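(* Over $\mathsf{RCA}_0^\omega$: (a) $(\exists^3)\to\mathsf{CLO}\to\mathsf{HBC}$; (b) $\mathsf{CLO}\leftrightarrow[\mathsf{ACA}+\mathsf{open}]$.
   Context: Framework: Kohlenbach's higher-order arithmetic. $\mathsf{RCA}_0^\omega$ is the base theory in the language with variables of all finite types over $\mathbb{N}$ (basic arithmetic, combinators, primitive recursor $\mathbf{R}_0$, extensionality, quantifier-free induction, $\mathsf{QF\text{-}AC}^{1,0}$). $(\exists^3)$: there is $E^3\le1$ with $E(Y)=0\leftrightarrow(\exists f^1)(Y(f)=0)$ for all $Y^2$. $\mathsf{ACA}$ is arithmetical comprehension. Reals are represented by fast-converging Cauchy sequences of rationals. A set of reals is given by $Y:\mathbb{R}\to\mathbb{R}$, where $x\in Y$ means $Y(x)>0$; $Y$ is open if for every $x\in Y$ there is a rational $r>0$ with $B(x,r)\subseteq Y$; $Y$ is closed if its complement is open. Fix an enumeration $(q_n,r_n)_{n\in\mathbb{N}}$ of pairs of rationals with $r_n>0$. $\mathsf{open}$: for every open set $Y\subseteq\mathbb{R}$ there is $X\subseteq\mathbb{N}$ with $(\forall n)(n\in X\leftrightarrow B(q_n,r_n)\subseteq Y)$. $\mathsf{CLO}$: every non-empty closed set $C\subseteq\mathbb{R}$ is located, i.e. the distance function $x\mapsto d(x,C)=\inf_{y\in C}|x-y|$ exists as a continuous function $\mathbb{R}\to\mathbb{R}$. $\mathsf{HBC}$: for every closed $C\subseteq[0,1]$ and sequences of reals $(a_n),(b_n)$ with $C\subseteq\bigcup_n(a_n,b_n)$,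 there is $n_0$ with $C\subseteq\bigcup_{n\le n_0}(a_n,b_n)$. *)

theory Defs
  imports Main
begin

section \<open>The language of all finite types\<close>

datatype ty = Nt | Fn ty ty (infixr "\<rightarrow>" 65)

abbreviation T1 :: ty where "T1 \<equiv> Nt \<rightarrow> Nt"
abbreviation T2 :: ty where "T2 \<equiv> T1 \<rightarrow> Nt"
abbreviation T3 :: ty where "T3 \<equiv> T2 \<rightarrow> Nt"

text \<open>Every type has its own countable supply of variables: a variable is an index together with
  its type, and variables with the same index but different types are different.\<close>

type_synonym var = "nat \<times> ty"

datatype tm =
    Var nat ty
  | Zero | One | Plus | Times
  | Kc ty ty
  | Sc ty ty ty
  | Rec
  | App tm tm (infixl "\<cdot>" 90)

fun type_of :: "tm \<Rightarrow> ty option" where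
  "type_of (Var i \<tau>) = Some \<tau>"
| "type_of Zero = Some Nt"
| "type_of One = Some Nt"
| "type_of Plus = Some (Nt \<rightarrow> Nt \<rightarrow> Nt)"
| "type_of Times = Some (Nt \<rightarrow> Nt \<rightarrow> Nt)"
| "type_of (Kc \<sigma> \<tau>) = Some (\<sigma> \<rightarrow> \<tau> \<rightarrow> \<sigma>)"
| "type_of (Sc \<rho> \<sigma> \<tau>) = Some ((\<rho> \<rightarrow> \<sigma> \<rightarrow> \<tau>) \<rightarrow> (\<rho> \<rightarrow> \<sigma>) \<rightarrow> \<rho> \<rightarrow> \<tau>)"
| "type_of Rec = Some ((Nt \<rightarrow> Nt \<rightarrow> Nt) \<rightarrow> Nt \<rightarrow> Nt \<rightarrow> Nt)"
| "type_of (s \<cdot> t) =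
     (case type_of s of
        Some (\<sigma> \<rightarrow> \<tau>) \<Rightarrow> if type_of t = Some \<sigma> then Some \<tau> else None
      | _ \<Rightarrow> None)"

fun fvt :: "tm \<Rightarrow> var set" where
  "fvt (Var i \<tau>) = {(i, \<tau>)}"
| "fvt (s \<cdot> t) = fvt s \<union> fvt t"
| "fvt _ = {}"

fun substt :: "var \<Rightarrow> tm \<Rightarrow> tm \<Rightarrow> tm" where
  "substt x r (Var i \<tau>) = (if x = (i, \<tau>) then r else Var i \<tau>)"
| "substt x r (s \<cdot> t) = substt x r s \<cdot> substt x r t"
| "substt x r t = t"

text \<open>The only primitive predicates are equality and order at type 0; equality at higher types is
  defined below.\<close>

datatype fm =
    Eq tm tm
  | Less tm tm
  | Fls
  | Imp fm fm
  | FAll var fm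

definition Neg :: "fm \<Rightarrow> fm" where "Neg A = Imp A Fls"
definition Conj :: "fm \<Rightarrow> fm \<Rightarrow> fm" where "Conj A B = Neg (Imp A (Neg B))"
definition Disj :: "fm \<Rightarrow> fm \<Rightarrow> fm" where "Disj A B = Imp (Neg A) B"
definition Iff :: "fm \<Rightarrow> fm \<Rightarrow> fm" where "Iff A B = Conj (Imp A B) (Imp B A)"
definition FEx :: "var \<Rightarrow> fm \<Rightarrow> fm" where "FEx x A = Neg (FAll x (Neg A))"

fun wff :: "fm \<Rightarrow> bool" where
  "wff (Eq s t) \<longleftrightarrow> type_of s = Some Nt \<and> type_of t = Some Nt"
| "wff (Less s t) \<longleftrightarrow> type_of s = Some Nt \<and> type_of t = Some Nt"
| "wff Fls \<longleftrightarrow> True"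
| "wff (Imp A B) \<longleftrightarrow> wff A \<and> wff B"
| "wff (FAll x A) \<longleftrightarrow> wff A"

fun fv :: "fm \<Rightarrow> var set" where
  "fv (Eq s t) = fvt s \<union> fvt t"
| "fv (Less s t) = fvt s \<union> fvt t"
| "fv Fls = {}"
| "fv (Imp A B) = fv A \<union> fv B"
| "fv (FAll x A) = fv A - {x}"

fun subst :: "var \<Rightarrow> tm \<Rightarrow> fm \<Rightarrow> fm" where
  "subst x r (Eq s t) = Eq (substt x r s) (substt x r t)"
| "subst x r (Less s t) = Less (substt x r s) (substt x r t)"
| "subst x r Fls = Fls"
| "subst x r (Imp A B) = Imp (subst x r A) (subst x r B)"
| "subst x r (FAll y A) = (if x = y then FAll y A else FAll y (subst x r A))"

fun free_for :: "tm \<Rightarrow> var \<Rightarrow> fm \<Rightarrow> bool" where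
  "free_for r x (Imp A B) \<longleftrightarrow> free_for r x A \<and> free_for r x B"
| "free_for r x (FAll y A) \<longleftrightarrow> x \<notin> fv (FAll y A) \<or> y \<notin> fvt r \<and> free_for r x A"
| "free_for r x _ \<longleftrightarrow> True"

fun quantifier_free :: "fm \<Rightarrow> bool" where
  "quantifier_free (Imp A B) \<longleftrightarrow> quantifier_free A \<and> quantifier_free B"
| "quantifier_free (FAll x A) \<longleftrightarrow> False"
| "quantifier_free _ \<longleftrightarrow> True"

fun number_quantifiers :: "fm \<Rightarrow> bool" where
  "number_quantifiers (Imp A B) \<longleftrightarrow> number_quantifiers A \<and> number_quantifiers B"
| "number_quantifiers (FAll x A) \<longleftrightarrow> snd x = Nt \<and> number_quantifiers A"
| "number_quantifiers _ \<longleftrightarrow> True"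

text \<open>Arithmetical formulas: quantifiers over numbers only, parameters of type 0 and 1 (numbers
  and, as usual in this language, functions in place of sets).\<close>

definition arithmetical :: "fm \<Rightarrow> bool" where
  "arithmetical A \<longleftrightarrow> number_quantifiers A \<and> (\<forall>(i, \<tau>) \<in> fv A. \<tau> = Nt \<or> \<tau> = T1)"

section \<open>Classical many-sorted provability\<close>

text \<open>Hilbert calculus. Since generalisation is unrestricted, a formula of \<open>T\<close> with free variables
  has the force of its universal closure.\<close>

inductive provable :: "fm set \<Rightarrow> fm \<Rightarrow> bool" (infix "\<turnstile>" 50) for T :: "fm set" where
  Ax: "A \<in> T \<Longrightarrow> wff A \<Longrightarrow> T \<turnstile> A"
| P1: "wff A \<Longrightarrow> wff B \<Longrightarrow> T \<turnstile> Imp A (Imp B A)"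
| P2: "wff A \<Longrightarrow> wff B \<Longrightarrow> wff C \<Longrightarrow>
       T \<turnstile> Imp (Imp A (Imp B C)) (Imp (Imp A B) (Imp A C))"
| P3: "wff A \<Longrightarrow> T \<turnstile> Imp (Neg (Neg A)) A"
| Q1: "wff A \<Longrightarrow> type_of t = Some \<tau> \<Longrightarrow> free_for t (i, \<tau>) A \<Longrightarrow>
       T \<turnstile> Imp (FAll (i, \<tau>) A) (subst (i, \<tau>) t A)"
| Q2: "wff A \<Longrightarrow> wff B \<Longrightarrow> x \<notin> fv A \<Longrightarrow>
       T \<turnstile> Imp (FAll x (Imp A B)) (Imp A (FAll x B))"
| MP: "T \<turnstile> Imp A B \<Longrightarrow> T \<turnstile> A \<Longrightarrow> T \<turnstile> B"
| Gen: "T \<turnstile> A \<Longrightarrow> T \<turnstile> FAll x A"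

section \<open>Writing concrete sentences\<close>

text \<open>Formulas with binders are written with HOL abstractions and read off as de Bruijn levels: an
  \<open>sfm\<close> maps the current depth \<open>n\<close> to a formula, and a quantifier at depth \<open>n\<close> binds the variable
  with index \<open>n\<close> and passes on the depth \<open>Suc n\<close>. A sentence is the value at depth 0, so that all
  variables in scope at depth \<open>n\<close> have index below \<open>n\<close> and no variable capture can occur.\<close>

type_synonym sfm = "nat \<Rightarrow> fm"

definition Forall :: "ty \<Rightarrow> (tm \<Rightarrow> sfm) \<Rightarrow> sfm" where
  "Forall \<tau> F = (\<lambda>n. FAll (n, \<tau>) (F (Var n \<tau>) (Suc n)))"

definition Exists :: "ty \<Rightarrow> (tm \<Rightarrow> sfm) \<Rightarrow> sfm" where
  "Exists \<tau> F = (\<lambda>n. FEx (n, \<tau>) (F (Var n \<tau>) (Suc n)))"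

definition s_eq :: "tm \<Rightarrow> tm \<Rightarrow> sfm" (infix "\<^bold>=" 60) where "(s \<^bold>= t) = (\<lambda>n. Eq s t)"
definition s_less :: "tm \<Rightarrow> tm \<Rightarrow> sfm" (infix "\<^bold><" 60) where "(s \<^bold>< t) = (\<lambda>n. Less s t)"
definition s_neg :: "sfm \<Rightarrow> sfm" ("\<^bold>\<not> _" [55] 55) where "(\<^bold>\<not> A) = (\<lambda>n. Neg (A n))"
definition s_conj :: "sfm \<Rightarrow> sfm \<Rightarrow> sfm" (infixr "\<^bold>\<and>" 45) where "(A \<^bold>\<and> B) = (\<lambda>n. Conj (A n) (B n))"
definition s_disj :: "sfm \<Rightarrow> sfm \<Rightarrow> sfm" (infixr "\<^bold>\<or>" 44) where "(A \<^bold>\<or> B) = (\<lambda>n. Disj (A n) (B n))"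
definition s_imp :: "sfm \<Rightarrow> sfm \<Rightarrow> sfm" (infixr "\<^bold>\<longrightarrow>" 43) where "(A \<^bold>\<longrightarrow> B) = (\<lambda>n. Imp (A n) (B n))"
definition s_iff :: "sfm \<Rightarrow> sfm \<Rightarrow> sfm" (infixr "\<^bold>\<longleftrightarrow>" 42) where "(A \<^bold>\<longleftrightarrow> B) = (\<lambda>n. Iff (A n) (B n))"

definition s_le :: "tm \<Rightarrow> tm \<Rightarrow> sfm" (infix "\<^bold>\<le>" 60) where
  "(s \<^bold>\<le> t) = (s \<^bold>< t \<^bold>\<or> s \<^bold>= t)"

abbreviation t_add :: "tm \<Rightarrow> tm \<Rightarrow> tm" (infixl "\<oplus>" 70) where "s \<oplus> t \<equiv> Plus \<cdot> s \<cdot> t"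
abbreviation t_mul :: "tm \<Rightarrow> tm \<Rightarrow> tm" (infixl "\<otimes>" 75) where "s \<otimes> t \<equiv> Times \<cdot> s \<cdot> t"

fun eq_at :: "ty \<Rightarrow> tm \<Rightarrow> tm \<Rightarrow> sfm" where
  "eq_at Nt s t = (s \<^bold>= t)"
| "eq_at (\<sigma> \<rightarrow> \<tau>) s t = Forall \<sigma> (\<lambda>z. eq_at \<tau> (s \<cdot> z) (t \<cdot> z))"

section \<open>The base theory\<close>

definition equality_axioms :: "fm set" where
  "equality_axioms = (\<lambda>A. A 0) `
    {Forall Nt (\<lambda>x. x \<^bold>= x),
     Forall Nt (\<lambda>x. Forall Nt (\<lambda>y. x \<^bold>= y \<^bold>\<longrightarrow> y \<^bold>= x)),
     Forall Nt (\<lambda>x. Forall Nt (\<lambda>y. Forall Nt (\<lambda>z. x \<^bold>= y \<^bold>\<longrightarrow> y \<^bold>= z \<^bold>\<longrightarrow> x \<^bold>= z))),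
     Forall Nt (\<lambda>x. Forall Nt (\<lambda>y. Forall Nt (\<lambda>u. Forall Nt (\<lambda>v.
       x \<^bold>= y \<^bold>\<longrightarrow> u \<^bold>= v \<^bold>\<longrightarrow> x \<^bold>< u \<^bold>\<longrightarrow> y \<^bold>< v))))}"

text \<open>The usual basic axioms of second-order arithmetic; together with quantifier-free induction
  they make the numbers a discretely ordered semiring.\<close>

definition arithmetic_axioms :: "fm set" where
  "arithmetic_axioms = (\<lambda>A. A 0) `
    {Forall Nt (\<lambda>m. \<^bold>\<not> (m \<oplus> One \<^bold>= Zero)),
     Forall Nt (\<lambda>m. Forall Nt (\<lambda>n. m \<oplus> One \<^bold>= n \<oplus> One \<^bold>\<longrightarrow> m \<^bold>= n)),
     Forall Nt (\<lambda>m. m \<oplus> Zero \<^bold>= m),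
     Forall Nt (\<lambda>m. Forall Nt (\<lambda>n. m \<oplus> (n \<oplus> One) \<^bold>= (m \<oplus> n) \<oplus> One)),
     Forall Nt (\<lambda>m. m \<otimes> Zero \<^bold>= Zero),
     Forall Nt (\<lambda>m. Forall Nt (\<lambda>n. m \<otimes> (n \<oplus> One) \<^bold>= (m \<otimes> n) \<oplus> m)),
     Forall Nt (\<lambda>m. \<^bold>\<not> (m \<^bold>< Zero)),
     Forall Nt (\<lambda>m. Forall Nt (\<lambda>n. m \<^bold>< n \<oplus> One \<^bold>\<longleftrightarrow> (m \<^bold>< n \<^bold>\<or> m \<^bold>= n)))}"

definition K_axiom :: "ty \<Rightarrow> ty \<Rightarrow> sfm" where
  "K_axiom \<sigma> \<tau> = Forall \<sigma> (\<lambda>x. Forall \<tau> (\<lambda>y. eq_at \<sigma> (Kc \<sigma> \<tau> \<cdot> x \<cdot> y) x))"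

definition S_axiom :: "ty \<Rightarrow> ty \<Rightarrow> ty \<Rightarrow> sfm" where
  "S_axiom \<rho> \<sigma> \<tau> =
     Forall (\<rho> \<rightarrow> \<sigma> \<rightarrow> \<tau>) (\<lambda>x. Forall (\<rho> \<rightarrow> \<sigma>) (\<lambda>y. Forall \<rho> (\<lambda>z.
       eq_at \<tau> (Sc \<rho> \<sigma> \<tau> \<cdot> x \<cdot> y \<cdot> z) (x \<cdot> z \<cdot> (y \<cdot> z)))))"

definition R_axioms :: "fm set" where
  "R_axioms = (\<lambda>A. A 0) `
    {Forall (Nt \<rightarrow> Nt \<rightarrow> Nt) (\<lambda>f. Forall Nt (\<lambda>m. Rec \<cdot> f \<cdot> m \<cdot> Zero \<^bold>= m)),
     Forall (Nt \<rightarrow> Nt \<rightarrow> Nt) (\<lambda>f. Forall Nt (\<lambda>m. Forall Nt (\<lambda>n.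
       Rec \<cdot> f \<cdot> m \<cdot> (n \<oplus> One) \<^bold>= f \<cdot> n \<cdot> (Rec \<cdot> f \<cdot> m \<cdot> n))))}"

definition extensionality_axiom :: "ty \<Rightarrow> ty \<Rightarrow> sfm" where
  "extensionality_axiom \<rho> \<tau> =
     Forall \<rho> (\<lambda>x. Forall \<rho> (\<lambda>y. Forall (\<rho> \<rightarrow> \<tau>) (\<lambda>f.
       eq_at \<rho> x y \<^bold>\<longrightarrow> eq_at \<tau> (f \<cdot> x) (f \<cdot> y))))"

definition induction_axiom :: "nat \<Rightarrow> fm \<Rightarrow> fm" where
  "induction_axiom i A =
     Imp (subst (i, Nt) Zero A)
      (Imp (FAll (i, Nt) (Imp A (subst (i, Nt) (Var i Nt \<oplus> One) A)))
        (FAll (i, Nt) A))"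

definition QF_induction :: "fm set" where
  "QF_induction = {induction_axiom i A | i A. wff A \<and> quantifier_free A}"

definition choice_axiom :: "nat \<Rightarrow> nat \<Rightarrow> nat \<Rightarrow> fm \<Rightarrow> fm" where
  "choice_axiom i j k A =
     Imp (FAll (i, T1) (FEx (j, Nt) A))
      (FEx (k, T2) (FAll (i, T1) (subst (j, Nt) (Var k T2 \<cdot> Var i T1) A)))"

definition QF_AC_10 :: "fm set" where
  "QF_AC_10 = {choice_axiom i j k A | i j k A. wff A \<and> quantifier_free A \<and> (k, T2) \<notin> fv A}"

definition RCA0\<omega> :: "fm set" where
  "RCA0\<omega> = equality_axioms \<union> arithmetic_axioms \<union> {K_axiom \<sigma> \<tau> 0 | \<sigma> \<tau>. True}
     \<union> {S_axiom \<rho> \<sigma> \<tau> 0 | \<rho> \<sigma> \<tau>. True} \<union> R_axioms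
     \<union> {extensionality_axiom \<rho> \<tau> 0 | \<rho> \<tau>. True} \<union> QF_induction \<union> QF_AC_10"

section \<open>Comprehension principles\<close>

text \<open>\<open>E \<le> 1\<close> at type 3 is the pointwise order.\<close>

definition E3 :: fm where
  "E3 = Exists T3 (\<lambda>E. Forall T2 (\<lambda>Y.
      E \<cdot> Y \<^bold>\<le> One \<^bold>\<and>
      (E \<cdot> Y \<^bold>= Zero \<^bold>\<longleftrightarrow> Exists T1 (\<lambda>f. Y \<cdot> f \<^bold>= Zero)))) 0"

text \<open>A set of numbers is given by a characteristic function of type 1.\<close>

definition comprehension_axiom :: "nat \<Rightarrow> nat \<Rightarrow> fm \<Rightarrow> fm" where
  "comprehension_axiom i k A =
     FEx (k, T1) (FAll (i, Nt) (Conj ((Var k T1 \<cdot> Var i Nt \<^bold>\<le> One) 0)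
       (Iff (Eq (Var k T1 \<cdot> Var i Nt) One) A)))"

definition ACA :: "fm set" where
  "ACA = {comprehension_axiom i k A | i k A. wff A \<and> arithmetical A \<and> (k, T1) \<notin> fv A}"

section \<open>Rational numbers\<close>

text \<open>\<open>n\<close> is the Cantor code of \<open>(x, y)\<close>, that is \<open>2 n = (x + y) (x + y + 1) + 2 y\<close>. Every number
  codes exactly one pair.\<close>

definition pair_code :: "tm \<Rightarrow> tm \<Rightarrow> tm \<Rightarrow> sfm" where
  "pair_code n x y = (n \<oplus> n \<^bold>= (x \<oplus> y) \<otimes> (x \<oplus> y \<oplus> One) \<oplus> (y \<oplus> y))"

text \<open>Every number \<open>q\<close> codes a rational: if \<open>q\<close> codes the triple \<open>(a, (b, c))\<close>, the rational is
  \<open>(a - b) / (c + 1)\<close>. In particular 0 and 1 code the rationals 0 and 1. Different numbers may code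
  the same rational.\<close>

definition rat_code :: "tm \<Rightarrow> tm \<Rightarrow> tm \<Rightarrow> tm \<Rightarrow> sfm" where
  "rat_code q a b c = Exists Nt (\<lambda>m. pair_code q a m \<^bold>\<and> pair_code m b c)"

text \<open>A triple \<open>(p, n, d)\<close> of terms of type 0 stands for the rational \<open>(p - n) / d\<close>.\<close>

type_synonym rat_tm = "tm \<times> tm \<times> tm"

definition with_rat :: "tm \<Rightarrow> (rat_tm \<Rightarrow> sfm) \<Rightarrow> sfm" where
  "with_rat q F = Exists Nt (\<lambda>a. Exists Nt (\<lambda>b. Exists Nt (\<lambda>c.
     rat_code q a b c \<^bold>\<and> F (a, b, c \<oplus> One))))"

definition q_zero :: rat_tm where "q_zero = (Zero, Zero, One)"

fun q_neg :: "rat_tm \<Rightarrow> rat_tm" where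
  "q_neg (p, n, d) = (n, p, d)"

fun q_add :: "rat_tm \<Rightarrow> rat_tm \<Rightarrow> rat_tm" where
  "q_add (p, n, d) (p', n', d') = (p \<otimes> d' \<oplus> p' \<otimes> d, n \<otimes> d' \<oplus> n' \<otimes> d, d \<otimes> d')"

definition q_diff :: "rat_tm \<Rightarrow> rat_tm \<Rightarrow> rat_tm" where
  "q_diff u v = q_add u (q_neg v)"

fun q_less :: "rat_tm \<Rightarrow> rat_tm \<Rightarrow> sfm" where
  "q_less (p, n, d) (p', n', d') = (p \<otimes> d' \<oplus> n' \<otimes> d \<^bold>< p' \<otimes> d \<oplus> n \<otimes> d')"

definition q_le :: "rat_tm \<Rightarrow> rat_tm \<Rightarrow> sfm" where
  "q_le u v = (\<^bold>\<not> q_less v u)"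

definition q_eq :: "rat_tm \<Rightarrow> rat_tm \<Rightarrow> sfm" where
  "q_eq u v = (q_le u v \<^bold>\<and> q_le v u)"

definition q_abs_less :: "rat_tm \<Rightarrow> rat_tm \<Rightarrow> sfm" where
  "q_abs_less u v = (q_less u v \<^bold>\<and> q_less (q_neg u) v)"

definition q_abs_le :: "rat_tm \<Rightarrow> rat_tm \<Rightarrow> sfm" where
  "q_abs_le u v = (q_le u v \<^bold>\<and> q_le (q_neg u) v)"

definition q_is_abs :: "rat_tm \<Rightarrow> rat_tm \<Rightarrow> sfm" where
  "q_is_abs w u = (q_le q_zero w \<^bold>\<and> (q_eq w u \<^bold>\<or> q_eq w (q_neg u)))"

text \<open>\<open>2\<^sup>n\<close>, by primitive recursion along \<open>\<lambda>i x. x + x\<close>.\<close>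

definition two_pow :: "tm \<Rightarrow> tm" where
  "two_pow n =
     Rec \<cdot> (Kc T1 Nt \<cdot> (Sc Nt Nt Nt \<cdot> Plus \<cdot> (Sc Nt T1 Nt \<cdot> Kc Nt T1 \<cdot> Kc Nt Nt))) \<cdot> One \<cdot> n"

text \<open>\<open>2\<^sup>-\<^sup>n\<close> and \<open>2\<^sup>-\<^sup>n\<^sup>+\<^sup>1\<close>.\<close>

definition q_eps :: "tm \<Rightarrow> rat_tm" where "q_eps n = (One, Zero, two_pow n)"
definition q_eps2 :: "tm \<Rightarrow> rat_tm" where "q_eps2 n = (One \<oplus> One, Zero, two_pow n)"

section \<open>Real numbers\<close>

definition is_real :: "tm \<Rightarrow> sfm" where
  "is_real x = Forall Nt (\<lambda>n. Forall Nt (\<lambda>i.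
     with_rat (x \<cdot> n) (\<lambda>u. with_rat (x \<cdot> (n \<oplus> i)) (\<lambda>v. q_abs_less (q_diff u v) (q_eps n)))))"

definition ForallR :: "(tm \<Rightarrow> sfm) \<Rightarrow> sfm" where
  "ForallR F = Forall T1 (\<lambda>x. is_real x \<^bold>\<longrightarrow> F x)"

definition ExistsR :: "(tm \<Rightarrow> sfm) \<Rightarrow> sfm" where
  "ExistsR F = Exists T1 (\<lambda>x. is_real x \<^bold>\<and> F x)"

definition r_eq :: "tm \<Rightarrow> tm \<Rightarrow> sfm" where
  "r_eq x y = Forall Nt (\<lambda>n. with_rat (x \<cdot> n) (\<lambda>u. with_rat (y \<cdot> n) (\<lambda>v.
     q_abs_le (q_diff u v) (q_eps2 n))))"

definition r_le :: "tm \<Rightarrow> tm \<Rightarrow> sfm" where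
  "r_le x y = Forall Nt (\<lambda>n. with_rat (x \<cdot> n) (\<lambda>u. with_rat (y \<cdot> n) (\<lambda>v.
     q_le u (q_add v (q_eps2 n)))))"

definition r_less :: "tm \<Rightarrow> tm \<Rightarrow> sfm" where
  "r_less x y = (\<^bold>\<not> r_le y x)"

text \<open>A rational as a real: the constant sequence.\<close>

definition r_of_rat :: "tm \<Rightarrow> tm" where
  "r_of_rat q = Kc Nt Nt \<cdot> q"

text \<open>\<open>z = \<bar>x - y\<bar>\<close>, computed on the sequences; the index shift keeps \<open>z\<close> fast converging.\<close>

definition r_is_dist :: "tm \<Rightarrow> tm \<Rightarrow> tm \<Rightarrow> sfm" where
  "r_is_dist z x y = Forall Nt (\<lambda>k.
     with_rat (z \<cdot> k) (\<lambda>w. with_rat (x \<cdot> (k \<oplus> One)) (\<lambda>u. with_rat (y \<cdot> (k \<oplus> One)) (\<lambda>v.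
       q_is_abs w (q_diff u v)))))"

definition with_dist :: "tm \<Rightarrow> tm \<Rightarrow> (tm \<Rightarrow> sfm) \<Rightarrow> sfm" where
  "with_dist x y F = ExistsR (\<lambda>z. r_is_dist z x y \<^bold>\<and> F z)"

text \<open>\<open>y \<in> B(x, r)\<close> for reals \<open>x\<close>, \<open>y\<close> and a rational \<open>r\<close>.\<close>

definition in_ball :: "tm \<Rightarrow> tm \<Rightarrow> tm \<Rightarrow> sfm" where
  "in_ball x r y = with_dist x y (\<lambda>z. r_less z (r_of_rat r))"

definition pos_rat :: "tm \<Rightarrow> sfm" where
  "pos_rat r = with_rat r (\<lambda>u. q_less q_zero u)"

section \<open>Functions and sets of reals\<close>

definition real_function :: "tm \<Rightarrow> sfm" where
  "real_function F =
     (ForallR (\<lambda>x. is_real (F \<cdot> x)) \<^bold>\<and>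
      ForallR (\<lambda>x. ForallR (\<lambda>y. r_eq x y \<^bold>\<longrightarrow> r_eq (F \<cdot> x) (F \<cdot> y))))"

definition continuous_function :: "tm \<Rightarrow> sfm" where
  "continuous_function F = ForallR (\<lambda>x. Forall Nt (\<lambda>\<epsilon>. pos_rat \<epsilon> \<^bold>\<longrightarrow>
     Exists Nt (\<lambda>\<delta>. pos_rat \<delta> \<^bold>\<and> ForallR (\<lambda>y. in_ball x \<delta> y \<^bold>\<longrightarrow> in_ball (F \<cdot> x) \<epsilon> (F \<cdot> y)))))"

definition mem :: "tm \<Rightarrow> tm \<Rightarrow> sfm" where
  "mem x Y = r_less (r_of_rat Zero) (Y \<cdot> x)"

definition open_pred :: "(tm \<Rightarrow> sfm) \<Rightarrow> sfm" where
  "open_pred P = ForallR (\<lambda>x. P x \<^bold>\<longrightarrow>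
     Exists Nt (\<lambda>r. pos_rat r \<^bold>\<and> ForallR (\<lambda>y. in_ball x r y \<^bold>\<longrightarrow> P y)))"

definition open_set :: "tm \<Rightarrow> sfm" where
  "open_set Y = (real_function Y \<^bold>\<and> open_pred (\<lambda>x. mem x Y))"

text \<open>A closed set is itself given by a function \<open>C\<close>; its complement, which need not be given by
  such a function, is open.\<close>

definition closed_set :: "tm \<Rightarrow> sfm" where
  "closed_set C = (real_function C \<^bold>\<and> open_pred (\<lambda>x. \<^bold>\<not> mem x C))"

text \<open>\<open>n\<close> enumerates \<open>(q, r)\<close>: \<open>n\<close> codes \<open>(q, (d, e))\<close> and \<open>r\<close> is the code of \<open>(d + 1) / (e + 1)\<close>.
  So each \<open>n\<close> has exactly one pair, \<open>r\<close> is positive, and each rational centre and positive rational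
  radius occurs.\<close>

definition ball_enum :: "tm \<Rightarrow> tm \<Rightarrow> tm \<Rightarrow> sfm" where
  "ball_enum n q r = Exists Nt (\<lambda>m. Exists Nt (\<lambda>d. Exists Nt (\<lambda>e.
     pair_code n q m \<^bold>\<and> pair_code m d e \<^bold>\<and> rat_code r (d \<oplus> One) Zero e)))"

definition OPEN :: fm where
  "OPEN = Forall (T1 \<rightarrow> T1) (\<lambda>Y. open_set Y \<^bold>\<longrightarrow>
     Exists T1 (\<lambda>X. Forall Nt (\<lambda>n. X \<cdot> n \<^bold>\<le> One \<^bold>\<and>
       (X \<cdot> n \<^bold>= One \<^bold>\<longleftrightarrow>
         Exists Nt (\<lambda>q. Exists Nt (\<lambda>r. ball_enum n q r \<^bold>\<and>
           ForallR (\<lambda>y. in_ball (r_of_rat q) r y \<^bold>\<longrightarrow> mem y Y))))))) 0"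

text \<open>\<open>d = inf {\<bar>x - y\<bar> | y \<in> C}\<close> as greatest lower bound.\<close>

definition is_distance :: "tm \<Rightarrow> tm \<Rightarrow> tm \<Rightarrow> sfm" where
  "is_distance d x C =
     (ForallR (\<lambda>y. mem y C \<^bold>\<longrightarrow> with_dist x y (\<lambda>z. r_le d z)) \<^bold>\<and>
      ForallR (\<lambda>e. ForallR (\<lambda>y. mem y C \<^bold>\<longrightarrow> with_dist x y (\<lambda>z. r_le e z)) \<^bold>\<longrightarrow> r_le e d))"

definition CLO :: fm where
  "CLO = Forall (T1 \<rightarrow> T1) (\<lambda>C. closed_set C \<^bold>\<and> ExistsR (\<lambda>x. mem x C) \<^bold>\<longrightarrow>
     Exists (T1 \<rightarrow> T1) (\<lambda>D. real_function D \<^bold>\<and> continuous_function D \<^bold>\<and>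
       ForallR (\<lambda>x. is_distance (D \<cdot> x) x C))) 0"

definition HBC :: fm where
  "HBC = Forall (T1 \<rightarrow> T1) (\<lambda>C.
     closed_set C \<^bold>\<and>
     ForallR (\<lambda>x. mem x C \<^bold>\<longrightarrow> r_le (r_of_rat Zero) x \<^bold>\<and> r_le x (r_of_rat One)) \<^bold>\<longrightarrow>
     Forall (Nt \<rightarrow> T1) (\<lambda>a. Forall (Nt \<rightarrow> T1) (\<lambda>b.
       Forall Nt (\<lambda>n. is_real (a \<cdot> n) \<^bold>\<and> is_real (b \<cdot> n)) \<^bold>\<and>
       ForallR (\<lambda>x. mem x C \<^bold>\<longrightarrow> Exists Nt (\<lambda>n. r_less (a \<cdot> n) x \<^bold>\<and> r_less x (b \<cdot> n))) \<^bold>\<longrightarrow>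
       Exists Nt (\<lambda>n0. ForallR (\<lambda>x. mem x C \<^bold>\<longrightarrow>
         Exists Nt (\<lambda>n. n \<^bold>\<le> n0 \<^bold>\<and> r_less (a \<cdot> n) x \<^bold>\<and> r_less x (b \<cdot> n))))))) 0"

end

theory Submission
  imports Defs "HOL-Computational_Algebra.Fraction_Field" "HOL-Library.Countable"
begin

text \<open>By a completeness theorem for the calculus it suffices to argue in models: a countermodel to
  one of the claims would be an extensional structure with possibly nonstandard numbers, in which the
  usual arguments can be carried out with its own functions and inductions. The case distinction on \<open>\<exists>\<^sup>2\<close> does
  the work. If \<open>\<exists>\<^sup>2\<close> holds, complements of sets of reals are again sets, so that closed sets, open
  sets, distances and enumerated balls are interchangeable. If it fails, Grilliot's trick makes every
  function on the reals continuous; then a closed set is also open, and compactness arguments by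
  bisection take over, based on the Turing jump. \<open>CLO\<close> yields the jump by way of suprema: if a bounded
  increasing sequence of rationals had no supremum, the reals below it would form a closed set, and the
  distance of this set from a number beyond it would be a supremum after all. Arithmetical comprehension
  is the closure of the jump under composition and number quantifiers.\<close>

text \<open>Neither the numbers nor the functions of the countermodel are those of HOL. An induction
  on its numbers requires a quantifier-free formula or, later, a predicate whose characteristic
  function lies in the model; the rules for \<open>I1\<close> to \<open>I4\<close> and
  \<open>R1\<close> to \<open>R4\<close> discharge this by resolution. An unbounded number
  quantifier may enter such a predicate only through \<open>jmp\<close> or \<open>e2\<close>. That
  is why estimates about reals are so often restated as a number quantifier before a decidable
  comparison of rationals.

  The case distinction has its reason in the gap between these two. \<open>jmp\<close> acts on
  predicates of numbers, whereas \<open>e2\<close> works uniformly in parameters of higher type,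
  such as reals. Only with \<open>e2\<close> is membership in a set of reals decidable; without it
  sets are accessible at rational points, and continuity has to carry the information to the others.

  Values in the ordered ring \<open>K\<close> turn equality and order of reals into those of HOL, so
  estimates become linear arithmetic. Limits, however, must be produced inside the model, from
  approximations given by one of its functions.\<close>

instance ty :: countable by countable_datatype
instance tm :: countable by countable_datatype
instance fm :: countable by countable_datatype

section \<open>Derivations from hypotheses\<close>

lemma type_of_substt: "type_of t = Some \<tau> \<Longrightarrow> type_of (substt (i, \<tau>) t s) = type_of s"
proof (induction s)
  case (App s1 s2)
  show ?case unfolding substt.simps type_of.simps App.IH(1)[OF App.prems] App.IH(2)[OF App.prems] ..
qed auto

lemma wff_subst: "type_of t = Some \<tau> \<Longrightarrow> wff (subst (i, \<tau>) t A) = wff A"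
  by (induction A) (auto simp: type_of_substt)

lemma provable_wff: "T \<turnstile> A \<Longrightarrow> wff A"
  by (induction rule: provable.induct) (auto simp: Neg_def wff_subst)

text \<open>\<open>provable\<close> generalises without restriction, so the deduction theorem fails
  for hypotheses with free variables. Here hypotheses are combined with theorems by modus ponens
  alone, and generalisation is recovered in \<open>ders_gen\<close> for variables that are not free
  in the hypotheses.\<close>

inductive ders :: "fm set \<Rightarrow> fm set \<Rightarrow> fm \<Rightarrow> bool" for T \<Gamma> where
  Hyp: "A \<in> \<Gamma> \<Longrightarrow> wff A \<Longrightarrow> ders T \<Gamma> A"
| Thm: "T \<turnstile> A \<Longrightarrow> ders T \<Gamma> A"
| DMP: "ders T \<Gamma> (Imp A B) \<Longrightarrow> ders T \<Gamma> A \<Longrightarrow> ders T \<Gamma> B"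

lemma ders_wff: "ders T \<Gamma> A \<Longrightarrow> wff A"
  by (induction rule: ders.induct) (auto dest: provable_wff)

lemma ders_mono: "ders T \<Gamma> A \<Longrightarrow> \<Gamma> \<subseteq> \<Delta> \<Longrightarrow> ders T \<Delta> A"
proof (induction rule: ders.induct)
  case (DMP A B) then show ?case by (intro ders.DMP[of T \<Delta> A B]) auto
qed (auto intro: Hyp Thm)

lemma ders_empty: "ders T {} A \<Longrightarrow> T \<turnstile> A"
proof (induction rule: ders.induct)
  case (DMP A B) then show ?case by (intro MP[of T A B])
qed auto

lemma ders_finite: "ders T \<Gamma> A \<Longrightarrow> \<exists>\<Delta>. finite \<Delta> \<and> \<Delta> \<subseteq> \<Gamma> \<and> ders T \<Delta> A"
proof (induction rule: ders.induct)
  case (Hyp A)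
  then show ?case by (intro exI[of _ "{A}"]) (simp add: ders.Hyp)
next
  case (Thm A)
  then show ?case by (intro exI[of _ "{}"]) (simp add: ders.Thm)
next
  case (DMP A B)
  then obtain \<Delta>1 \<Delta>2 where D: "finite \<Delta>1" "\<Delta>1 \<subseteq> \<Gamma>" "ders T \<Delta>1 (Imp A B)"
    "finite \<Delta>2" "\<Delta>2 \<subseteq> \<Gamma>" "ders T \<Delta>2 A" by blast
  have "ders T (\<Delta>1 \<union> \<Delta>2) B"
    by (rule ders.DMP[OF ders_mono[OF D(3)] ders_mono[OF D(6)]]) simp_all
  then show ?case using D by (intro exI[of _ "\<Delta>1 \<union> \<Delta>2"]) simp
qed

lemma provable_imp_refl: "wff A \<Longrightarrow> T \<turnstile> Imp A A"
  by (rule MP[OF MP[OF P2[of A "Imp A A" A T] P1[of A "Imp A A" T]] P1[of A A T]]) simp_all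

lemma ders_const: "ders T \<Gamma> B \<Longrightarrow> wff A \<Longrightarrow> ders T \<Gamma> (Imp A B)"
  by (rule DMP[OF Thm[OF P1]]) (simp_all add: ders_wff)

lemma deduction: "ders T (insert A \<Gamma>) B \<Longrightarrow> wff A \<Longrightarrow> ders T \<Gamma> (Imp A B)"
proof (induction rule: ders.induct)
  case (Hyp B)
  show ?case
  proof (cases "B = A")
    case True then show ?thesis using Hyp by (simp add: Thm provable_imp_refl)
  next
    case False
    then have "ders T \<Gamma> B" using Hyp by (simp add: ders.Hyp)
    then show ?thesis using Hyp by (simp add: ders_const)
  qed
next
  case (Thm B)
  then show ?case by (simp add: ders_const ders.Thm)
next
  case (DMP B C)
  have "wff (Imp B C)" using ders_wff[OF DMP(1)] .
  then have "T \<turnstile> Imp (Imp A (Imp B C)) (Imp (Imp A B) (Imp A C))"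
    using DMP by (intro P2) simp_all
  from ders.DMP[OF ders.DMP[OF ders.Thm[OF this]]] show ?case using DMP by simp
qed

lemma ders_cut: "ders T (insert A \<Gamma>) B \<Longrightarrow> ders T \<Gamma> A \<Longrightarrow> ders T \<Gamma> B"
  by (rule DMP[OF deduction]) (simp_all add: ders_wff)

lemma ders_classical: "ders T (insert (Neg A) \<Gamma>) Fls \<Longrightarrow> wff A \<Longrightarrow> ders T \<Gamma> A"
  using deduction[of T "Neg A" \<Gamma> Fls] DMP[OF Thm[OF P3[of A T]]] by (simp add: Neg_def)

lemma ders_Fls: "ders T \<Gamma> Fls \<Longrightarrow> wff A \<Longrightarrow> ders T \<Gamma> A"
  by (rule ders_classical) (simp_all add: ders_mono subset_insertI)

lemma substt_self: "substt (i, \<tau>) (Var i \<tau>) s = s"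
  by (induction s) simp_all

lemma subst_self: "subst (i, \<tau>) (Var i \<tau>) A = A"
  by (induction A) (simp_all add: substt_self)

lemma free_for_self: "free_for (Var i \<tau>) (i, \<tau>) A"
  by (induction A) auto

lemma ders_spec:
  assumes "ders T \<Gamma> (FAll (i, \<tau>) A)" "type_of t = Some \<tau>" "free_for t (i, \<tau>) A"
  shows "ders T \<Gamma> (subst (i, \<tau>) t A)"
  using assms ders_wff[OF assms(1)] by (intro DMP[OF Thm[OF Q1[of A t \<tau> i T]] assms(1)]) simp_all

lemma ders_spec_self: "ders T \<Gamma> (FAll (i, \<tau>) A) \<Longrightarrow> ders T \<Gamma> A"
  using ders_spec[of T \<Gamma> i \<tau> A "Var i \<tau>"] by (simp add: subst_self free_for_self)

text \<open>This pushes a quantifier through modus ponens in \<open>ders_gen\<close>. The calculus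
  only has \<open>Q2\<close>, so both universal formulas are instantiated and the result is
  generalised as a theorem; x is free in neither of them.\<close>

lemma provable_FAll_Imp:
  assumes "wff A" "wff B"
  shows "T \<turnstile> Imp (FAll x (Imp A B)) (Imp (FAll x A) (FAll x B))"
proof -
  obtain i \<tau> where x: "x = (i, \<tau>)" by force
  let ?P = "FAll x (Imp A B)" and ?Q = "FAll x A"
  have w: "wff ?P" "wff ?Q" using assms by simp_all
  have "ders T {?Q, ?P} (Imp A B)"
    by (rule ders_spec_self[of T _ i \<tau>], rule ders.Hyp) (use w in \<open>simp_all add: x\<close>)
  moreover have "ders T {?Q, ?P} A"
    by (rule ders_spec_self[of T _ i \<tau>], rule ders.Hyp) (use w in \<open>simp_all add: x\<close>)
  ultimately have "ders T {?Q, ?P} B" by (rule DMP)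
  then have "T \<turnstile> Imp ?P (Imp ?Q B)"
    by (intro ders_empty deduction w)
  then have 1: "T \<turnstile> Imp ?P (FAll x (Imp ?Q B))"
    by (intro MP[OF Q2[OF w(1)] Gen]) (use assms in simp_all)
  have 2: "T \<turnstile> Imp (FAll x (Imp ?Q B)) (Imp ?Q (FAll x B))"
    by (rule Q2) (use assms in simp_all)
  have "ders T {?P} (Imp ?Q (FAll x B))"
    by (rule DMP[OF Thm[OF 2] DMP[OF Thm[OF 1]]], rule Hyp) (use w in simp_all)
  then show ?thesis by (rule ders_empty[OF deduction[OF _ w(1)]])
qed

lemma ders_gen: "ders T \<Gamma> A \<Longrightarrow> (\<And>B. B \<in> \<Gamma> \<Longrightarrow> x \<notin> fv B) \<Longrightarrow> ders T \<Gamma> (FAll x A)"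
proof (induction rule: ders.induct)
  case (Hyp A)
  have "T \<turnstile> Imp A (FAll x A)"
    by (rule MP[OF Q2 Gen[OF provable_imp_refl]]) (use Hyp in simp_all)
  then show ?case by (rule DMP[OF Thm]) (use Hyp in \<open>simp add: ders.Hyp\<close>)
next
  case (Thm A)
  then show ?case by (simp add: ders.Thm Gen)
next
  case (DMP A B)
  have w: "wff A" "wff B" using ders_wff[OF DMP(1)] by simp_all
  show ?case
    by (rule ders.DMP[OF ders.DMP[OF ders.Thm[OF provable_FAll_Imp[OF w]]]])
      (use DMP in simp_all)
qed

section \<open>Renaming of variables\<close>

primrec rent :: "(nat \<Rightarrow> nat) \<Rightarrow> tm \<Rightarrow> tm" where
  "rent r (Var i \<tau>) = Var (r i) \<tau>"
| "rent r (s \<cdot> t) = rent r s \<cdot> rent r t"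
| "rent r Zero = Zero" | "rent r One = One" | "rent r Plus = Plus" | "rent r Times = Times"
| "rent r (Kc \<sigma> \<tau>) = Kc \<sigma> \<tau>" | "rent r (Sc \<rho> \<sigma> \<tau>) = Sc \<rho> \<sigma> \<tau>" | "rent r Rec = Rec"

primrec ren :: "(nat \<Rightarrow> nat) \<Rightarrow> fm \<Rightarrow> fm" where
  "ren r (Eq s t) = Eq (rent r s) (rent r t)"
| "ren r (Less s t) = Less (rent r s) (rent r t)"
| "ren r Fls = Fls"
| "ren r (Imp A B) = Imp (ren r A) (ren r B)"
| "ren r (FAll x A) = FAll (r (fst x), snd x) (ren r A)"

definition indt :: "tm \<Rightarrow> nat set" where "indt t = fst ` fvt t"

lemma indt_simps [simp]:
  "indt (Var i \<tau>) = {i}" "indt (s \<cdot> t) = indt s \<union> indt t"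
  "indt Zero = {}" "indt One = {}" "indt Plus = {}" "indt Times = {}" "indt (Kc \<sigma> \<tau>) = {}"
  "indt (Sc \<rho> \<sigma> \<tau>) = {}" "indt Rec = {}"
  by (auto simp: indt_def)

fun ind :: "fm \<Rightarrow> nat set" where
  "ind (Eq s t) = indt s \<union> indt t"
| "ind (Less s t) = indt s \<union> indt t"
| "ind Fls = {}"
| "ind (Imp A B) = ind A \<union> ind B"
| "ind (FAll x A) = insert (fst x) (ind A)"

lemma finite_fvt [simp]: "finite (fvt t)" by (induction t) auto
lemma finite_fv [simp]: "finite (fv A)" by (induction A) auto
lemma finite_indt [simp]: "finite (indt t)" by (simp add: indt_def)
lemma finite_ind [simp]: "finite (ind A)" by (induction A) auto

lemma fv_ind: "x \<in> fv A \<Longrightarrow> fst x \<in> ind A"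
  by (induction A) (auto simp: indt_def)

lemma rent_rent: "rent r (rent s t) = rent (\<lambda>i. r (s i)) t"
  by (induction t) auto

lemma ren_ren: "ren r (ren s A) = ren (\<lambda>i. r (s i)) A"
  by (induction A) (auto simp: rent_rent)

lemma rent_id: "(\<And>i. i \<in> indt t \<Longrightarrow> r i = i) \<Longrightarrow> rent r t = t"
  by (induction t) auto

lemma ren_id: "(\<And>i. i \<in> ind A \<Longrightarrow> r i = i) \<Longrightarrow> ren r A = A"
  by (induction A) (auto simp: rent_id)

lemma type_of_rent [simp]: "type_of (rent r t) = type_of t"
proof (induction t)
  case (App s1 s2)
  show ?case unfolding rent.simps type_of.simps App.IH ..
qed auto

lemma wff_ren [simp]: "wff (ren r A) = wff A"
  by (induction A) auto

lemma fvt_rent: "fvt (rent r t) = apfst r ` fvt t"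
  by (induction t) (auto simp: image_Un)

lemma rent_substt:
  "inj_on r (insert i (indt s)) \<Longrightarrow> rent r (substt (i, \<tau>) t s) = substt (r i, \<tau>) (rent r t) (rent r s)"
proof (induction s)
  case (App s1 s2)
  have "inj_on r (insert i (indt s1))" "inj_on r (insert i (indt s2))"
    by (rule inj_on_subset[OF App(3)], force)+
  then show ?case using App by simp
qed (simp_all add: inj_on_def)

lemma ren_subst:
  "inj_on r (insert i (ind A)) \<Longrightarrow> ren r (subst (i, \<tau>) t A) = subst (r i, \<tau>) (rent r t) (ren r A)"
proof (induction A)
  case (Eq s t)
  have "inj_on r (insert i (indt s))" "inj_on r (insert i (indt t))"
    by (rule inj_on_subset[OF Eq], force)+
  then show ?case by (simp add: rent_substt)
next
  case (Less s t)
  have "inj_on r (insert i (indt s))" "inj_on r (insert i (indt t))"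
    by (rule inj_on_subset[OF Less], force)+
  then show ?case by (simp add: rent_substt)
next
  case (Imp A B)
  have "inj_on r (insert i (ind A))" "inj_on r (insert i (ind B))"
    by (rule inj_on_subset[OF Imp(3)], force)+
  then show ?case using Imp by simp
next
  case (FAll x A)
  have "inj_on r (insert i (ind A))" by (rule inj_on_subset[OF FAll(2)], force)+
  then show ?case using FAll by (cases x) (auto simp: inj_on_def)
qed simp

lemma fv_ren: "inj_on r (ind A) \<Longrightarrow> fv (ren r A) = apfst r ` fv A"
proof (induction A)
  case (Imp A B)
  have "inj_on r (ind A)" "inj_on r (ind B)"
    by (rule inj_on_subset[OF Imp(3)], force)+
  then show ?case using Imp by (simp add: image_Un)
next
  case (FAll x A)
  have "inj_on r (ind A)" by (rule inj_on_subset[OF FAll(2)], force)+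
  then have *: "fv (ren r A) = apfst r ` fv A" by (rule FAll)
  have "\<And>y. y \<in> fv A \<Longrightarrow> r (fst y) = r (fst x) \<Longrightarrow> fst y = fst x"
    using FAll(2) fv_ind[of _ A] by (auto simp: inj_on_def)
  then show ?case unfolding fv.simps ren.simps *
    by (cases x) (fastforce simp: image_iff)
qed (auto simp: fvt_rent image_Un)

lemma free_for_ren:
  "inj_on r (insert i (indt t \<union> ind A)) \<Longrightarrow> free_for t (i, \<tau>) A \<Longrightarrow> free_for (rent r t) (r i, \<tau>) (ren r A)"
proof (induction A)
  case (Imp A B)
  have "inj_on r (insert i (indt t \<union> ind A))" "inj_on r (insert i (indt t \<union> ind B))"
    by (rule inj_on_subset[OF Imp(3)], force)+
  then show ?case using Imp by simp
next
  case (FAll x A)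
  have i: "inj_on r (insert i (indt t \<union> ind A))" "inj_on r (ind (FAll x A))"
    by (rule inj_on_subset[OF FAll(2)], force)+
  have "ren r (FAll x A) = FAll (r (fst x), snd x) (ren r A)" by simp
  have 1: "(r i, \<tau>) \<notin> fv (ren r (FAll x A))" if "(i, \<tau>) \<notin> fv (FAll x A)"
  proof
    assume "(r i, \<tau>) \<in> fv (ren r (FAll x A))"
    then obtain z where "z \<in> fv (FAll x A)" "(r i, \<tau>) = apfst r z"
      unfolding fv_ren[OF i(2)] by (rule imageE)
    then obtain j where j: "(j, \<tau>) \<in> fv (FAll x A)" "r j = r i" by (cases z) auto
    moreover have "j \<in> ind (FAll x A)" using fv_ind[OF j(1)] by simp
    ultimately show False using that FAll(2) by (auto simp: inj_on_def)
  qed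
  have 2: "(r (fst x), snd x) \<notin> fvt (rent r t)" if "x \<notin> fvt t"
  proof
    assume "(r (fst x), snd x) \<in> fvt (rent r t)"
    then obtain j where "(j, snd x) \<in> fvt t" "r j = r (fst x)" by (auto simp: fvt_rent)
    moreover then have "j \<in> indt t" by (force simp: indt_def)
    ultimately show False using that FAll(2) by (auto simp: inj_on_def)
  qed
  show ?case using FAll(3) 1 2 FAll(1)[OF i(1)] by auto
qed auto

abbreviation emb :: "fm \<Rightarrow> fm" where "emb \<equiv> ren (\<lambda>i. 2 * i)"

text \<open>Proofs over \<open>emb ` T\<close> may use odd variables, the witnesses of the Henkin construction. As a
  proof is finite, a renaming that undoes \<open>emb\<close> can be chosen to be injective on its variables.\<close>

definition unemb :: "nat \<Rightarrow> (nat \<Rightarrow> nat) \<Rightarrow> bool" where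
  "unemb N r \<longleftrightarrow> inj_on r {..<N} \<and> (\<forall>i. r (2 * i) = i)"

lemma unemb_mono: "unemb N r \<Longrightarrow> M \<le> N \<Longrightarrow> unemb M r"
  unfolding unemb_def by (meson inj_on_subset lessThan_subset_iff)

lemma unemb_inj_on: "unemb N r \<Longrightarrow> (\<forall>j\<in>S. j < N) \<Longrightarrow> inj_on r S"
  unfolding unemb_def by (rule inj_on_subset[of r "{..<N}"]) auto

lemma finite_bound: "finite (S :: nat set) \<Longrightarrow> \<exists>N. \<forall>i\<in>S. i < N"
  using finite_nat_set_iff_bounded by blast

text \<open>The order of quantifiers matters: the bound belongs to the proof, and any renaming that
  respects it works, so the premises of modus ponens can share one renaming. Injectivity prevents
  capture in \<open>Q1\<close> and keeps the variable of \<open>Q2\<close> out of A.\<close>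

lemma provable_unemb:
  "emb ` T \<turnstile> A \<Longrightarrow> \<exists>N. \<forall>r. unemb N r \<longrightarrow> T \<turnstile> ren r A"
proof (induction rule: provable.induct)
  case (Ax A)
  then obtain B where "B \<in> T" "A = emb B" by auto
  have "T \<turnstile> ren r A" if "unemb 0 r" for r
  proof -
    have "ren (\<lambda>i. r (2 * i)) B = B" by (rule ren_id) (use that in \<open>simp add: unemb_def\<close>)
    then have "ren r A = B" using \<open>A = emb B\<close> by (simp add: ren_ren)
    then show ?thesis using \<open>B \<in> T\<close> \<open>wff A\<close> \<open>A = emb B\<close> by (simp add: provable.Ax)
  qed
  then show ?case by blast
next
  case (Q1 A t \<tau> i)
  obtain N where N: "\<forall>j \<in> insert i (indt t \<union> ind A). j < N" using finite_bound[of "insert i (indt t \<union> ind A)"] by auto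
  have "T \<turnstile> ren r (Imp (FAll (i, \<tau>) A) (subst (i, \<tau>) t A))" if "unemb N r" for r
  proof -
    have i: "inj_on r (insert i (indt t \<union> ind A))"
      using that N by (rule unemb_inj_on)
    then have i': "inj_on r (insert i (ind A))" by (rule inj_on_subset) auto
    show ?thesis unfolding ren.simps ren_subst[OF i'] fst_conv snd_conv
      by (intro provable.Q1 free_for_ren[OF i]) (use Q1 in simp_all)
  qed
  then show ?case by blast
next
  case (Q2 A B x)
  obtain N where N: "\<forall>j \<in> insert (fst x) (ind A). j < N" using finite_bound[of "insert (fst x) (ind A)"] by auto
  have "T \<turnstile> ren r (Imp (FAll x (Imp A B)) (Imp A (FAll x B)))" if "unemb N r" for r
  proof -
    have i: "inj_on r (insert (fst x) (ind A))"
      using that N by (rule unemb_inj_on)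
    then have i': "inj_on r (ind A)" by (rule inj_on_subset) auto
    have "(r (fst x), snd x) \<notin> fv (ren r A)"
    proof
      assume "(r (fst x), snd x) \<in> fv (ren r A)"
      then obtain j where j: "(j, snd x) \<in> fv A" "r j = r (fst x)" unfolding fv_ren[OF i'] by auto
      then show False using fv_ind[OF j(1)] i Q2(3) by (auto simp: inj_on_def)
    qed
    then show ?thesis unfolding ren.simps by (intro provable.Q2) (use Q2 in simp_all)
  qed
  then show ?case by blast
next
  case (MP A B)
  then obtain N1 N2 where "\<forall>r. unemb N1 r \<longrightarrow> T \<turnstile> ren r (Imp A B)" "\<forall>r. unemb N2 r \<longrightarrow> T \<turnstile> ren r A"
    by blast
  then have "T \<turnstile> ren r B" if "unemb (max N1 N2) r" for r
    using unemb_mono[OF that, of N1] unemb_mono[OF that, of N2]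
    by (intro provable.MP[of T "ren r A" "ren r B"]) simp_all
  then show ?case by blast
next
  case (Gen A x)
  then obtain N where "\<forall>r. unemb N r \<longrightarrow> T \<turnstile> ren r A" by blast
  then show ?case by (intro exI[of _ N]) (simp add: provable.Gen)
qed (simp_all add: Neg_def P1 P2 P3[unfolded Neg_def])

lemma provable_emb_iff: "emb ` T \<turnstile> emb A \<Longrightarrow> T \<turnstile> A"
proof -
  assume "emb ` T \<turnstile> emb A"
  then obtain N where N: "\<And>r. unemb N r \<Longrightarrow> T \<turnstile> ren r (emb A)" using provable_unemb by blast
  \<comment> \<open>Even indices are halved, odd ones are moved beyond N. Halves of even indices
    below N stay below N, so the two kinds cannot collide.\<close>
  define r where "r i = (if even i then i div 2 else N + i)" for i
  have lt: "r x < N" if "x < N" "even x" for x using that by (simp add: r_def)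
  have ge: "r x = N + x" if "odd x" for x using that by (simp add: r_def)
  have "x = y" if "x < N" "y < N" "r x = r y" for x y
  proof (cases "even x")
    case True
    then have "even y" using lt[of x] ge[of y] that by fastforce
    with True show ?thesis using that(3) by (auto simp: r_def elim!: dvdE)
  next
    case False
    then have "odd y" using lt[of y] ge[of x] that by fastforce
    with False show ?thesis using that(3) ge by simp
  qed
  then have "unemb N r" by (simp add: unemb_def inj_on_def r_def)
  moreover have "ren (\<lambda>i. r (2 * i)) A = A" by (rule ren_id) (simp add: r_def)
  ultimately show ?thesis using N[of r] by (simp add: ren_ren)
qed

section \<open>Structures\<close>

text \<open>Elements are terms, because the countermodels will be term models and their quotients by
  chosen representatives. A single element type also lets the completeness theorem quantify over
  structures.\<close>

record str =
  carr :: "ty \<Rightarrow> tm set"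
  ap :: "tm \<Rightarrow> tm \<Rightarrow> tm"
  ct :: "tm \<Rightarrow> tm"
  req :: "tm \<Rightarrow> tm \<Rightarrow> bool"
  rls :: "tm \<Rightarrow> tm \<Rightarrow> bool"

type_synonym env = "var \<Rightarrow> tm"

fun eval :: "str \<Rightarrow> env \<Rightarrow> tm \<Rightarrow> tm" where
  "eval M e (Var i \<tau>) = e (i, \<tau>)"
| "eval M e (s \<cdot> t) = ap M (eval M e s) (eval M e t)"
| "eval M e t = ct M t"

fun sat :: "str \<Rightarrow> env \<Rightarrow> fm \<Rightarrow> bool" where
  "sat M e (Eq s t) = req M (eval M e s) (eval M e t)"
| "sat M e (Less s t) = rls M (eval M e s) (eval M e t)"
| "sat M e Fls = False"
| "sat M e (Imp A B) = (sat M e A \<longrightarrow> sat M e B)"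
| "sat M e (FAll x A) = (\<forall>a \<in> carr M (snd x). sat M (e(x := a)) A)"

definition penv :: "str \<Rightarrow> env \<Rightarrow> bool" where
  "penv M e \<longleftrightarrow> (\<forall>x. e x \<in> carr M (snd x))"

lemma penvD: "penv M e \<Longrightarrow> e (i, \<tau>) \<in> carr M \<tau>"
  by (auto simp: penv_def dest: spec[of _ "(i, \<tau>)"])

lemma penv_upd: "penv M e \<Longrightarrow> a \<in> carr M (snd x) \<Longrightarrow> penv M (e(x := a))"
  by (auto simp: penv_def)

lemma eval_cong: "(\<And>x. x \<in> fvt t \<Longrightarrow> e x = e' x) \<Longrightarrow> eval M e t = eval M e' t"
proof (induction t)
  case (App s t) then show ?case by (simp add: App.IH(1)[of] App.IH(2)[of])
qed auto

lemma sat_cong: "(\<And>x. x \<in> fv A \<Longrightarrow> e x = e' x) \<Longrightarrow> sat M e A = sat M e' A"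
proof (induction A arbitrary: e e')
  case (Eq s t)
  have "eval M e s = eval M e' s" "eval M e t = eval M e' t"
    by (rule eval_cong, simp add: Eq)+
  then show ?case by simp
next
  case (Less s t)
  have "eval M e s = eval M e' s" "eval M e t = eval M e' t"
    by (rule eval_cong, simp add: Less)+
  then show ?case by simp
next
  case (Imp A B)
  have "sat M e A = sat M e' A" "sat M e B = sat M e' B"
    by (rule Imp.IH, simp add: Imp.prems)+
  then show ?case by simp
next
  case (FAll x A)
  have "sat M (e(x := a)) A = sat M (e'(x := a)) A" for a
    by (rule FAll.IH) (simp add: FAll.prems)
  then show ?case by simp
qed simp

lemma eval_fresh: "x \<notin> fvt t \<Longrightarrow> eval M (e(x := a)) t = eval M e t"
  by (rule eval_cong) auto

section \<open>The completeness theorem\<close>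

primrec instt :: "env \<Rightarrow> tm \<Rightarrow> tm" where
  "instt e (Var i \<tau>) = e (i, \<tau>)"
| "instt e (s \<cdot> t) = instt e s \<cdot> instt e t"
| "instt e Zero = Zero" | "instt e One = One" | "instt e Plus = Plus" | "instt e Times = Times"
| "instt e (Kc \<sigma> \<tau>) = Kc \<sigma> \<tau>" | "instt e (Sc \<rho> \<sigma> \<tau>) = Sc \<rho> \<sigma> \<tau>" | "instt e Rec = Rec"

definition dvar :: "var \<Rightarrow> tm" where "dvar x = Var (2 * fst x) (snd x)"

text \<open>Bound variables of \<open>inst e A\<close> are even, so that terms all of whose variables are odd can be
  substituted without capture.\<close>

fun inst :: "env \<Rightarrow> fm \<Rightarrow> fm" where
  "inst e (Eq s t) = Eq (instt e s) (instt e t)"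
| "inst e (Less s t) = Less (instt e s) (instt e t)"
| "inst e Fls = Fls"
| "inst e (Imp A B) = Imp (inst e A) (inst e B)"
| "inst e (FAll x A) = FAll (2 * fst x, snd x) (inst (e(x := dvar x)) A)"

lemma instt_dvar: "instt dvar t = rent (\<lambda>i. 2 * i) t"
  by (induction t) (simp_all add: dvar_def)

lemma inst_dvar: "inst dvar A = emb A"
proof (induction A)
  case (FAll x A)
  have "dvar(x := dvar x) = dvar" by auto
  then show ?case using FAll by simp
qed (simp_all add: instt_dvar)

lemma instt_cong: "(\<And>x. x \<in> fvt t \<Longrightarrow> e x = e' x) \<Longrightarrow> instt e t = instt e' t"
  by (induction t) simp_all

lemma inst_cong: "(\<And>x. x \<in> fv A \<Longrightarrow> e x = e' x) \<Longrightarrow> inst e A = inst e' A"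
proof (induction A arbitrary: e e')
  case (Eq s t)
  have "instt e s = instt e' s" "instt e t = instt e' t" by (rule instt_cong, simp add: Eq)+
  then show ?case by simp
next
  case (Less s t)
  have "instt e s = instt e' s" "instt e t = instt e' t" by (rule instt_cong, simp add: Less)+
  then show ?case by simp
next
  case (Imp A B)
  have "inst e A = inst e' A" "inst e B = inst e' B" by (rule Imp.IH, simp add: Imp.prems)+
  then show ?case by simp
next
  case (FAll x A)
  have "inst (e(x := dvar x)) A = inst (e'(x := dvar x)) A"
    by (rule FAll.IH) (simp add: FAll.prems)
  then show ?case by simp
qed simp

definition tyenv :: "env \<Rightarrow> bool" where "tyenv e \<longleftrightarrow> (\<forall>x. type_of (e x) = Some (snd x))"

lemma tyenv_upd: "tyenv e \<Longrightarrow> type_of t = Some (snd x) \<Longrightarrow> tyenv (e(x := t))"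
  by (auto simp: tyenv_def)

lemma type_of_dvar [simp]: "type_of (dvar x) = Some (snd x)"
  by (simp add: dvar_def)

lemma type_of_instt [simp]: "tyenv e \<Longrightarrow> type_of (instt e t) = type_of t"
proof (induction t)
  case (App s1 s2)
  show ?case unfolding instt.simps type_of.simps App.IH[OF App.prems] ..
qed (simp_all add: tyenv_def)

lemma wff_inst [simp]: "tyenv e \<Longrightarrow> wff (inst e A) = wff A"
  by (induction A arbitrary: e) (simp_all add: tyenv_upd)

lemma subst_instt:
  "(\<And>z. z \<in> fvt s \<Longrightarrow> z \<noteq> x \<Longrightarrow> (2 * fst x, snd x) \<notin> fvt (e z)) \<Longrightarrow>
    substt (2 * fst x, snd x) t (instt (e(x := dvar x)) s) = instt (e(x := t)) s"
proof (induction s)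
  case (Var i \<tau>)
  have "substt y t s = s" if "y \<notin> fvt s" for y s using that by (induction s) auto
  then show ?case using Var by (auto simp: dvar_def)
qed auto

text \<open>This turns the instantiation of a quantifier into an update of the environment, the form
  in which satisfaction treats it. The hypothesis excludes that the value of another variable
  mentions the doubled variable of x.\<close>

lemma subst_inst:
  "(\<And>z. z \<in> fv A \<Longrightarrow> z \<noteq> x \<Longrightarrow> (2 * fst x, snd x) \<notin> fvt (e z)) \<Longrightarrow>
    subst (2 * fst x, snd x) t (inst (e(x := dvar x)) A) = inst (e(x := t)) A"
proof (induction A arbitrary: e)
  case (FAll y A)
  show ?case
  proof (cases "x = y")
    case True
    show ?thesis by (simp only: True inst.simps subst.simps fun_upd_upd if_True simp_thms)
  next
    case False
    then have ne: "(2 * fst x, snd x) \<noteq> (2 * fst y, snd y)" by (auto simp: prod_eq_iff)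
    have "subst (2 * fst x, snd x) t (inst ((e(y := dvar y))(x := dvar x)) A) =
        inst ((e(y := dvar y))(x := t)) A"
      by (rule FAll.IH) (use FAll.prems ne in \<open>auto simp: dvar_def prod_eq_iff\<close>)
    then show ?thesis
      using ne by (simp only: inst.simps subst.simps fun_upd_twist[OF False] if_False)
  qed
qed (simp_all add: subst_instt)

definition oddt :: "tm \<Rightarrow> bool" where "oddt t \<longleftrightarrow> (\<forall>i \<in> indt t. odd i)"

lemma oddt_fvt: "oddt t \<Longrightarrow> (2 * i, \<tau>) \<notin> fvt t"
  by (force simp: oddt_def indt_def)

lemma free_for_inst: "oddt t \<Longrightarrow> free_for t x (inst e A)"
  by (induction A arbitrary: e) (auto simp: oddt_fvt)

text \<open>Only finitely many variables are free in A, and they are replaced one after another by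
  \<open>Gen\<close> and \<open>Q1\<close>. Earlier replacements are not disturbed by later ones,
  for the inserted terms have odd variables and those still to be replaced are even.\<close>

lemma provable_inst:
  assumes "emb ` T \<turnstile> emb A" "\<And>x. oddt (e x)" "tyenv e"
  shows "emb ` T \<turnstile> inst e A"
proof -
  have *: "finite F \<Longrightarrow> emb ` T \<turnstile> inst (\<lambda>x. if x \<in> F then e x else dvar x) A" for F
  proof (induction F rule: finite_induct)
    case empty then show ?case using assms(1) by (simp add: inst_dvar)
  next
    case (insert x F)
    let ?e = "\<lambda>z. if z \<in> F then e z else dvar z"
    let ?x = "(2 * fst x, snd x)"
    have eq: "?e = ?e(x := dvar x)" using insert(2) by auto
    have "emb ` T \<turnstile> FAll ?x (inst ?e A)" by (rule Gen) (rule insert)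
    have "type_of (e x) = Some (snd x)" using assms(3) unfolding tyenv_def by blast
    then have "emb ` T \<turnstile> subst ?x (e x) (inst ?e A)"
      using assms(2) provable_wff[OF insert(3)]
      by (intro MP[OF Q1 \<open>emb ` T \<turnstile> FAll ?x (inst ?e A)\<close>] free_for_inst) (simp_all add: tyenv_def)
    also have "subst ?x (e x) (inst ?e A) = subst ?x (e x) (inst (?e(x := dvar x)) A)"
      using eq by simp
    also have "\<dots> = inst (?e(x := e x)) A"
      by (rule subst_inst) (use assms(2) in \<open>auto simp: oddt_fvt dvar_def prod_eq_iff\<close>)
    also have "?e(x := e x) = (\<lambda>z. if z \<in> insert x F then e z else dvar z)" by auto
    finally show ?case .
  qed
  have "inst (\<lambda>x. if x \<in> fv A then e x else dvar x) A = inst e A"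
    by (rule inst_cong) simp
  then show ?thesis using *[of "fv A"] by simp
qed

context
  fixes T :: "fm set"
begin

definition cons :: "fm set \<Rightarrow> bool" where "cons \<Gamma> \<longleftrightarrow> \<not> ders T \<Gamma> Fls"

lemma cons_insert:
  assumes "cons \<Gamma>" "wff A" shows "cons (insert A \<Gamma>) \<or> cons (insert (Neg A) \<Gamma>)"
proof (rule ccontr)
  assume "\<not> ?thesis"
  then have 1: "ders T (insert A \<Gamma>) Fls" and 2: "ders T (insert (Neg A) \<Gamma>) Fls"
    by (auto simp: cons_def)
  from ders_cut[OF 1 ders_classical[OF 2 assms(2)]] show False using assms(1) by (simp add: cons_def)
qed

lemma subst_subst_fresh:
  "y \<notin> ind A \<Longrightarrow> subst (y, \<tau>) (Var x \<tau>) (subst (x, \<tau>) (Var y \<tau>) A) = A"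
proof -
  have t: "y \<notin> indt s \<Longrightarrow> substt (y, \<tau>) (Var x \<tau>) (substt (x, \<tau>) (Var y \<tau>) s) = s" for s
    by (induction s) auto
  have n: "y \<notin> indt s \<Longrightarrow> substt (y, \<tau>) u s = s" for u s
    by (induction s) auto
  have m: "y \<notin> ind A \<Longrightarrow> subst (y, \<tau>) u A = A" for u A
    by (induction A) (auto simp: n)
  show "y \<notin> ind A \<Longrightarrow> ?thesis"
    by (induction A) (auto simp: t m)
qed

lemma free_for_fresh:
  assumes "y \<notin> ind A" shows "free_for (Var x \<tau>) (y, \<tau>) (subst (x, \<tau>) (Var y \<tau>) A)"
proof -
  have n: "y \<notin> ind B \<Longrightarrow> (y, \<tau>) \<notin> fv B" for B using fv_ind[of "(y, \<tau>)"] by auto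
  show ?thesis using assms by (induction A) (auto simp: n)
qed

lemma fv_subst_Var: "z \<in> fv (subst x (Var y \<tau>) A) \<Longrightarrow> z \<in> fv A - {x} \<or> z = (y, \<tau>)"
proof (induction A)
  have *: "z \<in> fvt (substt x (Var y \<tau>) s) \<Longrightarrow> z \<in> fvt s - {x} \<or> z = (y, \<tau>)" for s
    by (induction s) (auto split: if_splits)
  case (Eq s t) then show ?case using * by auto
next
  have *: "z \<in> fvt (substt x (Var y \<tau>) s) \<Longrightarrow> z \<in> fvt s - {x} \<or> z = (y, \<tau>)" for s
    by (induction s) (auto split: if_splits)
  case (Less s t) then show ?case using * by auto
qed (auto split: if_splits)

text \<open>If the negated instance were inconsistent, the instance would follow from hypotheses in
  which y does not occur. Generalising over y and substituting the old variable back gives the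
  universal formula that has just been denied.\<close>

lemma cons_henkin:
  assumes c: "cons (insert (Neg (FAll (i, \<tau>) A)) \<Gamma>)" and w: "wff A"
    and y: "y \<notin> ind A" "y \<noteq> i" "\<And>B. B \<in> \<Gamma> \<Longrightarrow> y \<notin> ind B"
  shows "cons (insert (Neg (subst (i, \<tau>) (Var y \<tau>) A)) (insert (Neg (FAll (i, \<tau>) A)) \<Gamma>))"
proof (rule ccontr)
  let ?G = "insert (Neg (FAll (i, \<tau>) A)) \<Gamma>" and ?A = "subst (i, \<tau>) (Var y \<tau>) A"
  assume "\<not> ?thesis"
  then have "ders T (insert (Neg ?A) ?G) Fls" by (simp add: cons_def)
  then have "ders T ?G ?A" by (rule ders_classical) (simp add: wff_subst w)
  then have 1: "ders T ?G (FAll (y, \<tau>) ?A)"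
  proof (rule ders_gen)
    fix B assume "B \<in> ?G"
    then have "y \<notin> ind B" using y by (auto simp: Neg_def)
    then show "(y, \<tau>) \<notin> fv B" using fv_ind[of "(y, \<tau>)" B] by auto
  qed
  have "ders T {FAll (y, \<tau>) ?A} (FAll (y, \<tau>) ?A)" by (rule Hyp) (simp_all add: wff_subst w)
  from ders_spec[OF this, of "Var i \<tau>"] have "ders T {FAll (y, \<tau>) ?A} A"
    using y(1) by (simp add: subst_subst_fresh free_for_fresh)
  then have "ders T {FAll (y, \<tau>) ?A} (FAll (i, \<tau>) A)"
    by (rule ders_gen) (use fv_subst_Var[of _ "(i, \<tau>)" y \<tau> A] y(2) in auto)
  then have 2: "ders T ?G (FAll (i, \<tau>) A)"
    by (intro ders_cut[OF _ 1]) (erule ders_mono, auto)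
  have "ders T ?G (Imp (FAll (i, \<tau>) A) Fls)" by (rule Hyp) (simp_all add: Neg_def w)
  from DMP[OF this 2] show False using c by (simp add: cons_def)
qed

text \<open>Odd, so that the witness is an element of the term model, whose terms contain odd
  variables only; beyond all indices in use, so that it is new. The stages of the construction are
  finite, hence such an index exists.\<close>

definition fresh :: "fm set \<Rightarrow> nat" where
  "fresh \<Gamma> = (SOME y. odd y \<and> (\<forall>B \<in> \<Gamma>. \<forall>i \<in> ind B. i < y))"

lemma fresh: "finite \<Gamma> \<Longrightarrow> odd (fresh \<Gamma>) \<and> (\<forall>B \<in> \<Gamma>. \<forall>i \<in> ind B. i < fresh \<Gamma>)"
  unfolding fresh_def
proof (rule someI_ex)
  assume "finite \<Gamma>"
  then have "finite (\<Union>(ind ` \<Gamma>))" by simp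
  then obtain N where "\<forall>i \<in> \<Union>(ind ` \<Gamma>). i < N" using finite_bound by blast
  then show "\<exists>y. odd y \<and> (\<forall>B \<in> \<Gamma>. \<forall>i \<in> ind B. i < y)"
    by (intro exI[of _ "2 * N + 1"]) fastforce
qed

definition wit :: "fm \<Rightarrow> nat \<Rightarrow> fm set" where
  "wit A y = (case A of FAll x B \<Rightarrow> {Neg (subst x (Var y (snd x)) B)} | _ \<Rightarrow> {})"

text \<open>A formula is decided at the stage given by its code. A rejected universal formula
  receives its counterexample at the same stage, where the set is still finite and a variable is
  available.\<close>

definition lstep :: "fm set \<Rightarrow> fm \<Rightarrow> fm set" where
  "lstep \<Gamma> A = (if \<not> wff A then \<Gamma> else if cons (insert A \<Gamma>) then insert A \<Gamma>
     else wit A (fresh (insert A \<Gamma>)) \<union> insert (Neg A) \<Gamma>)"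

primrec lchain :: "fm \<Rightarrow> nat \<Rightarrow> fm set" where
  "lchain G 0 = {G}"
| "lchain G (Suc n) = lstep (lchain G n) (from_nat n)"

definition lindenbaum :: "fm \<Rightarrow> fm set" where "lindenbaum G = (\<Union>n. lchain G n)"

lemma finite_wit [simp]: "finite (wit A y)"
  by (cases A) (simp_all add: wit_def)

lemma finite_lchain [simp]: "finite (lchain G n)"
  by (induction n) (auto simp: lstep_def)

lemma cons_lstep:
  assumes "finite \<Gamma>" "cons \<Gamma>" shows "cons (lstep \<Gamma> A)"
proof (cases "wff A \<and> \<not> cons (insert A \<Gamma>)")
  case True
  then have c: "cons (insert (Neg A) \<Gamma>)" using cons_insert assms by blast
  let ?y = "fresh (insert A \<Gamma>)"
  have y: "odd ?y \<and> (\<forall>B \<in> insert A \<Gamma>. \<forall>i \<in> ind B. i < ?y)"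
    by (rule fresh) (simp add: assms)
  show ?thesis
  proof (cases A)
    case (FAll x B)
    obtain i \<tau> where x: "x = (i, \<tau>)" by force
    have "cons (insert (Neg (subst (i, \<tau>) (Var ?y \<tau>) B)) (insert (Neg (FAll (i, \<tau>) B)) \<Gamma>))"
      by (rule cons_henkin) (use c True y in \<open>auto simp: FAll x\<close>)
    then show ?thesis using True FAll x by (simp add: lstep_def wit_def insert_commute)
  qed (use c True in \<open>simp_all add: lstep_def wit_def\<close>)
qed (use assms in \<open>auto simp: lstep_def\<close>)

context
  fixes G assumes cons_G: "cons {G}"
begin

lemma cons_lchain: "cons (lchain G n)"
  by (induction n) (simp_all add: cons_G cons_lstep)

lemma lchain_mono: "m \<le> n \<Longrightarrow> lchain G m \<subseteq> lchain G n"
proof (induction rule: dec_induct)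
  case (step n) then show ?case by (auto simp: lstep_def)
qed simp

lemma cons_lind: "cons (lindenbaum G)"
proof (rule ccontr)
  assume "\<not> cons (lindenbaum G)"
  then obtain \<Delta> where D: "finite \<Delta>" "\<Delta> \<subseteq> lindenbaum G" "ders T \<Delta> Fls"
    using ders_finite cons_def by metis
  have "\<exists>n. \<Delta> \<subseteq> lchain G n" using D(1,2)
  proof (induction \<Delta> rule: finite_induct)
    case (insert A \<Delta>)
    then obtain n m where "\<Delta> \<subseteq> lchain G n" "A \<in> lchain G m" by (auto simp: lindenbaum_def)
    then show ?case using lchain_mono[of n "max n m"] lchain_mono[of m "max n m"]
      by (intro exI[of _ "max n m"]) auto
  qed simp
  then show False using D(3) ders_mono cons_lchain cons_def by metis
qed

lemma lindenbaum_ders: "ders T (lindenbaum G) A \<Longrightarrow> A \<in> lindenbaum G"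
proof -
  assume d: "ders T (lindenbaum G) A"
  let ?n = "to_nat A"
  have w: "wff A" using d by (rule ders_wff)
  show "A \<in> lindenbaum G"
  proof (rule ccontr)
    assume n: "A \<notin> lindenbaum G"
    then have "\<not> cons (insert A (lchain G ?n))"
      using w by (auto simp: lindenbaum_def lstep_def dest!: spec[of _ "Suc ?n"])
    then have "Neg A \<in> lchain G (Suc ?n)" using w by (simp add: lstep_def)
    then have "Imp A Fls \<in> lindenbaum G" by (auto simp: lindenbaum_def Neg_def simp del: lchain.simps)
    then have "ders T (lindenbaum G) (Imp A Fls)" using w by (intro Hyp) auto
    then show False using DMP[OF _ d] cons_lind by (auto simp: cons_def)
  qed
qed

lemma lindenbaum_Imp:
  assumes "wff A" "wff B"
  shows "Imp A B \<in> lindenbaum G \<longleftrightarrow> (A \<in> lindenbaum G \<longrightarrow> B \<in> lindenbaum G)"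
proof
  assume "Imp A B \<in> lindenbaum G"
  then show "A \<in> lindenbaum G \<longrightarrow> B \<in> lindenbaum G"
    using DMP[OF Hyp Hyp, of A B "lindenbaum G" T] assms lindenbaum_ders[of B] by simp
next
  assume *: "A \<in> lindenbaum G \<longrightarrow> B \<in> lindenbaum G"
  show "Imp A B \<in> lindenbaum G"
  proof (cases "B \<in> lindenbaum G")
    case True
    then show ?thesis using assms by (intro lindenbaum_ders[OF ders_const] Hyp)
  next
    case False
    then have "A \<notin> lindenbaum G" using * by simp
    then have "\<not> ders T (lindenbaum G) A" using lindenbaum_ders by blast
    show ?thesis
    proof (cases "cons (insert A (lindenbaum G))")
      case True
      have "A \<in> lchain G (Suc (to_nat A))"
      proof -
        have "cons (insert A (lchain G (to_nat A)))"
          using True ders_mono[of T "insert A (lchain G (to_nat A))" Fls "insert A (lindenbaum G)"]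
          by (auto simp: cons_def lindenbaum_def)
        then show ?thesis using assms by (simp add: lstep_def)
      qed
      then show ?thesis using \<open>A \<notin> lindenbaum G\<close> by (auto simp: lindenbaum_def simp del: lchain.simps)
    next
      case False
      then have "ders T (insert A (lindenbaum G)) B"
        by (intro ders_Fls[OF _ assms(2)]) (simp add: cons_def)
      then show ?thesis by (intro lindenbaum_ders[OF deduction] assms)
    qed
  qed
qed

lemma lindenbaum_Fls: "Fls \<notin> lindenbaum G"
  using cons_lind Hyp[of Fls "lindenbaum G" T] by (auto simp: cons_def)

text \<open>For the converse, absence of the universal formula means that a negated instance at an
  odd variable was added at its stage.\<close>

lemma lindenbaum_FAll:
  assumes "wff A" "\<And>t. oddt t \<Longrightarrow> type_of t = Some \<tau> \<Longrightarrow> free_for t (i, \<tau>) A"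
  shows "FAll (i, \<tau>) A \<in> lindenbaum G \<longleftrightarrow>
    (\<forall>t. oddt t \<longrightarrow> type_of t = Some \<tau> \<longrightarrow> subst (i, \<tau>) t A \<in> lindenbaum G)"
proof
  assume "FAll (i, \<tau>) A \<in> lindenbaum G"
  then have "ders T (lindenbaum G) (FAll (i, \<tau>) A)" using assms by (intro Hyp) auto
  then show "\<forall>t. oddt t \<longrightarrow> type_of t = Some \<tau> \<longrightarrow> subst (i, \<tau>) t A \<in> lindenbaum G"
    using ders_spec assms lindenbaum_ders by blast
next
  assume *: "\<forall>t. oddt t \<longrightarrow> type_of t = Some \<tau> \<longrightarrow> subst (i, \<tau>) t A \<in> lindenbaum G"
  let ?B = "FAll (i, \<tau>) A"
  let ?n = "to_nat ?B"
  let ?y = "fresh (insert ?B (lchain G ?n))"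
  show "?B \<in> lindenbaum G"
  proof (rule ccontr)
    assume n: "?B \<notin> lindenbaum G"
    then have "\<not> cons (insert ?B (lchain G ?n))"
      using assms(1) by (auto simp: lindenbaum_def lstep_def dest!: spec[of _ "Suc ?n"])
    then have "Neg (subst (i, \<tau>) (Var ?y \<tau>) A) \<in> lchain G (Suc ?n)"
      using assms(1) by (simp add: lstep_def wit_def)
    then have "Imp (subst (i, \<tau>) (Var ?y \<tau>) A) Fls \<in> lindenbaum G"
      by (auto simp: lindenbaum_def Neg_def simp del: lchain.simps)
    then have "subst (i, \<tau>) (Var ?y \<tau>) A \<notin> lindenbaum G"
      using lindenbaum_Imp[of "subst (i, \<tau>) (Var ?y \<tau>) A" Fls] assms(1) lindenbaum_Fls by (simp add: wff_subst)
    moreover have "odd ?y" using fresh[of "insert ?B (lchain G ?n)"] by simp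
    ultimately show False using * by (auto simp: oddt_def)
  qed
qed

end

end

section \<open>Satisfaction of the defined connectives and of sentences in level notation\<close>

lemma sat_Neg [simp]: "sat M e (Neg A) = (\<not> sat M e A)" by (simp add: Neg_def)
lemma sat_Conj [simp]: "sat M e (Conj A B) = (sat M e A \<and> sat M e B)" by (simp add: Conj_def)
lemma sat_Disj [simp]: "sat M e (Disj A B) = (sat M e A \<or> sat M e B)" by (auto simp add: Disj_def)
lemma sat_Iff [simp]: "sat M e (Iff A B) = (sat M e A = sat M e B)" by (auto simp add: Iff_def)
lemma sat_FEx [simp]: "sat M e (FEx x A) = (\<exists>a \<in> carr M (snd x). sat M (e(x := a)) A)"
  by (simp add: FEx_def)

lemma sat_Forall [simp]:
  "sat M e (Forall \<tau> F n) = (\<forall>a \<in> carr M \<tau>. sat M (e((n, \<tau>) := a)) (F (Var n \<tau>) (Suc n)))"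
  by (simp add: Forall_def)

lemma sat_Exists [simp]:
  "sat M e (Exists \<tau> F n) = (\<exists>a \<in> carr M \<tau>. sat M (e((n, \<tau>) := a)) (F (Var n \<tau>) (Suc n)))"
  by (simp add: Exists_def)

lemma sat_sfm [simp]:
  "sat M e ((s \<^bold>= t) n) = req M (eval M e s) (eval M e t)"
  "sat M e ((s \<^bold>< t) n) = rls M (eval M e s) (eval M e t)"
  "sat M e ((\<^bold>\<not> A) n) = (\<not> sat M e (A n))"
  "sat M e ((A \<^bold>\<and> B) n) = (sat M e (A n) \<and> sat M e (B n))"
  "sat M e ((A \<^bold>\<or> B) n) = (sat M e (A n) \<or> sat M e (B n))"
  "sat M e ((A \<^bold>\<longrightarrow> B) n) = (sat M e (A n) \<longrightarrow> sat M e (B n))"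
  "sat M e ((A \<^bold>\<longleftrightarrow> B) n) = (sat M e (A n) = sat M e (B n))"
  by (simp_all add: s_eq_def s_less_def s_neg_def s_conj_def s_disj_def s_imp_def s_iff_def)

text \<open>A term in scope at depth n has indices below n only, so the variable bound at depth n
  does not disturb its value.\<close>

definition ltv :: "tm \<Rightarrow> nat \<Rightarrow> bool" where "ltv t n \<longleftrightarrow> (\<forall>i \<in> indt t. i < n)"

lemma ltv_simps [simp]:
  "ltv (Var i \<tau>) n = (i < n)" "ltv (s \<cdot> t) n = (ltv s n \<and> ltv t n)"
  "ltv Zero n" "ltv One n" "ltv Plus n" "ltv Times n" "ltv (Kc \<sigma> \<tau>) n" "ltv (Sc \<rho> \<sigma> \<tau>) n" "ltv Rec n"
  by (auto simp: ltv_def)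

lemma ltv_Suc [simp]: "ltv t n \<Longrightarrow> ltv t (Suc n)"
  by (auto simp: ltv_def less_Suc_eq)

lemma eval_ltv [simp]: "ltv t n \<Longrightarrow> eval M (e((n, \<tau>) := a)) t = eval M e t"
  by (rule eval_fresh) (force simp: ltv_def indt_def)

fun sim :: "str \<Rightarrow> ty \<Rightarrow> tm \<Rightarrow> tm \<Rightarrow> bool" where
  "sim M Nt a b = req M a b"
| "sim M (\<sigma> \<rightarrow> \<tau>) a b = (\<forall>z \<in> carr M \<sigma>. sim M \<tau> (ap M a z) (ap M b z))"

lemma sat_eq_at [simp]:
  "ltv s n \<Longrightarrow> ltv t n \<Longrightarrow> sat M e (eq_at \<tau> s t n) = sim M \<tau> (eval M e s) (eval M e t)"
  by (induction \<tau> arbitrary: s t n e) simp_all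

definition model :: "str \<Rightarrow> fm set \<Rightarrow> bool" where
  "model M T \<longleftrightarrow> (\<forall>A \<in> T. wff A \<longrightarrow> (\<forall>e. penv M e \<longrightarrow> sat M e A))"

text \<open>The conditions on t in the fourth clause describe the constants of the language: closed
  typed terms that are not applications.\<close>

definition normal :: "str \<Rightarrow> bool" where
  "normal M \<longleftrightarrow> req M = (=) \<and> (\<forall>\<tau>. carr M \<tau> \<noteq> {}) \<and>
    (\<forall>\<sigma> \<tau>. \<forall>f \<in> carr M (\<sigma> \<rightarrow> \<tau>). \<forall>a \<in> carr M \<sigma>. ap M f a \<in> carr M \<tau>) \<and>
    (\<forall>t \<tau>. type_of t = Some \<tau> \<longrightarrow> fvt t = {} \<longrightarrow> (\<forall>r s. t \<noteq> r \<cdot> s) \<longrightarrow> ct M t \<in> carr M \<tau>) \<and>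
    (\<forall>\<sigma> \<tau>. \<forall>f \<in> carr M (\<sigma> \<rightarrow> \<tau>). \<forall>g \<in> carr M (\<sigma> \<rightarrow> \<tau>).
      (\<forall>a \<in> carr M \<sigma>. ap M f a = ap M g a) \<longrightarrow> f = g)"

definition raw :: "str \<Rightarrow> bool" where
  "raw M \<longleftrightarrow> carr M = (\<lambda>\<tau>. {t. oddt t \<and> type_of t = Some \<tau>}) \<and> ap M = App \<and> ct M = (\<lambda>t. t)"

lemma eval_raw: "raw M \<Longrightarrow> eval M e t = instt e t"
  by (induction t) (simp_all add: raw_def)

lemma raw_tyenv: "raw M \<Longrightarrow> penv M e \<Longrightarrow> tyenv e"
  by (simp add: raw_def penv_def tyenv_def)

lemma raw_oddt: "raw M \<Longrightarrow> penv M e \<Longrightarrow> oddt (e x)"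
  by (cases x) (simp add: raw_def penv_def)

lemma oddt_simps [simp]:
  "oddt (s \<cdot> t) = (oddt s \<and> oddt t)" "oddt Zero" "oddt One" "oddt Plus" "oddt Times"
  "oddt (Kc \<sigma> \<tau>)" "oddt (Sc \<rho> \<sigma> \<tau>)" "oddt Rec" "oddt (Var i \<tau>) = odd i"
  by (auto simp: oddt_def)

lemma type_of_App:
  "type_of (s \<cdot> t) = Some \<tau> \<longleftrightarrow> (\<exists>\<sigma>. type_of s = Some (\<sigma> \<rightarrow> \<tau>) \<and> type_of t = Some \<sigma>)"
  by (auto split: option.split ty.split)

lemma eval_raw_carr: "raw M \<Longrightarrow> penv M e \<Longrightarrow> type_of t = Some \<tau> \<Longrightarrow> eval M e t \<in> carr M \<tau>"
proof (induction t arbitrary: \<tau>)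
  case (App s t)
  from App.prems(3) obtain \<sigma> where "type_of s = Some (\<sigma> \<rightarrow> \<tau>)" "type_of t = Some \<sigma>"
    unfolding type_of_App by blast
  with App.IH(1)[OF App.prems(1,2)] App.IH(2)[OF App.prems(1,2)] App.prems(1)
  show ?case by (simp add: raw_def type_of_App)
qed (auto simp: raw_def penv_def)

text \<open>Henkin's term model: theory and sentence are moved to even variables, the elements are
  the typed terms in odd variables, and atomic truth is membership in the maximal consistent set.
  Equality at type 0 is still only a relation here.\<close>

lemma raw_model:
  assumes "\<not> T \<turnstile> G" "wff G" "fv G = {}"
  shows "\<exists>M. raw M \<and> model M T \<and> (\<forall>e. penv M e \<longrightarrow> \<not> sat M e G)"
proof -
  let ?T = "emb ` T" and ?H = "Neg (emb G)"
  have "\<not> ?T \<turnstile> emb G" using assms(1) provable_emb_iff by blast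
  then have c: "cons ?T {?H}"
    using ders_empty[OF ders_classical[of ?T "emb G" "{}"]] assms(2) by (auto simp: cons_def)
  let ?L = "lindenbaum ?T ?H"
  define M where "M = \<lparr>carr = (\<lambda>\<tau>. {t. oddt t \<and> type_of t = Some \<tau>}), ap = App, ct = (\<lambda>t. t),
    req = (\<lambda>s t. Eq s t \<in> ?L), rls = (\<lambda>s t. Less s t \<in> ?L)\<rparr>"
  have raw: "raw M" by (simp add: raw_def M_def)
  have Mr: "req M s t \<longleftrightarrow> Eq s t \<in> ?L" "rls M s t \<longleftrightarrow> Less s t \<in> ?L" for s t
    by (simp_all add: M_def)
  have truth: "wff A \<Longrightarrow> penv M e \<Longrightarrow> inst e A \<in> ?L \<longleftrightarrow> sat M e A" for A e
  proof (induction A arbitrary: e)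
    case (Eq s t) then show ?case by (simp add: eval_raw[OF raw] Mr)
  next
    case (Less s t) then show ?case by (simp add: eval_raw[OF raw] Mr)
  next
    case Fls then show ?case by (simp add: lindenbaum_Fls[OF c])
  next
    case (Imp A B)
    have "wff (inst e A)" "wff (inst e B)" using Imp.prems raw_tyenv[OF raw Imp.prems(2)] by simp_all
    from lindenbaum_Imp[OF c this] show ?case using Imp by simp
  next
    case (FAll x A)
    have te: "tyenv (e(x := dvar x))" by (rule tyenv_upd[OF raw_tyenv[OF raw FAll.prems(2)]]) simp
    have w: "wff (inst (e(x := dvar x)) A)" using te FAll.prems by simp
    have "inst e (FAll x A) \<in> ?L \<longleftrightarrow> (\<forall>t. oddt t \<longrightarrow> type_of t = Some (snd x) \<longrightarrow>
        subst (2 * fst x, snd x) t (inst (e(x := dvar x)) A) \<in> ?L)"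
      unfolding inst.simps by (rule lindenbaum_FAll[OF c w]) (rule free_for_inst)
    also have "\<dots> \<longleftrightarrow> (\<forall>t. oddt t \<longrightarrow> type_of t = Some (snd x) \<longrightarrow> inst (e(x := t)) A \<in> ?L)"
      by (subst subst_inst) (simp_all add: oddt_fvt raw_oddt[OF raw FAll.prems(2)])
    also have "\<dots> \<longleftrightarrow> (\<forall>t \<in> carr M (snd x). inst (e(x := t)) A \<in> ?L)"
      using raw by (auto simp: raw_def)
    also have "\<dots> \<longleftrightarrow> (\<forall>t \<in> carr M (snd x). sat M (e(x := t)) A)"
    proof (rule ball_cong[OF refl])
      fix t assume "t \<in> carr M (snd x)"
      then show "inst (e(x := t)) A \<in> ?L \<longleftrightarrow> sat M (e(x := t)) A"
        using FAll.prems by (intro FAll.IH penv_upd) simp_all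
    qed
    finally show ?case by simp
  qed
  have "model M T"
    unfolding model_def
  proof (intro ballI impI allI)
    fix A e assume A: "A \<in> T" "wff A" and e: "penv M e"
    have "?T \<turnstile> inst e A"
      by (rule provable_inst[OF provable.Ax]) (use A raw_oddt[OF raw e] raw_tyenv[OF raw e] in simp_all)
    then have "inst e A \<in> ?L" by (intro lindenbaum_ders[OF c] Thm)
    then show "sat M e A" using truth A e by simp
  qed
  moreover have "\<not> sat M e G" if e: "penv M e" for e
  proof -
    have "inst e G = emb G" unfolding inst_dvar[symmetric] by (rule inst_cong) (simp add: assms(3))
    moreover have "?H \<in> lchain ?T ?H 0" by simp
    then have "Imp (emb G) Fls \<in> ?L" unfolding lindenbaum_def Neg_def by blast
    then have "emb G \<notin> ?L" using lindenbaum_Imp[OF c, of "emb G" Fls] lindenbaum_Fls[OF c] assms(2) by simp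
    ultimately show ?thesis using truth[of G e] assms(2) e by simp
  qed
  ultimately show ?thesis using raw by blast
qed

section \<open>Quotient of the term model by extensional equality\<close>

locale raw_eq =
  fixes M T
  assumes raw: "raw M" and mod: "model M T"
    and eqT: "equality_axioms \<subseteq> T" and extT: "\<And>\<rho> \<tau>. extensionality_axiom \<rho> \<tau> 0 \<in> T"
begin

lemma wff_eq_at: "type_of s = Some \<tau> \<Longrightarrow> type_of t = Some \<tau> \<Longrightarrow> wff (eq_at \<tau> s t n)"
  by (induction \<tau> arbitrary: s t n) (simp_all add: s_eq_def Forall_def)

lemma penv_ex: "\<exists>e. penv M e"
  using raw by (intro exI[of _ "\<lambda>x. Var 1 (snd x)"]) (simp add: penv_def raw_def)

lemma req_refl: "a \<in> carr M Nt \<Longrightarrow> req M a a"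
  and req_sym: "\<lbrakk>a \<in> carr M Nt; b \<in> carr M Nt; req M a b\<rbrakk> \<Longrightarrow> req M b a"
  and req_trans: "\<lbrakk>a \<in> carr M Nt; b \<in> carr M Nt; c \<in> carr M Nt; req M a b; req M b c\<rbrakk> \<Longrightarrow> req M a c"
  and rls_cong: "\<lbrakk>a \<in> carr M Nt; b \<in> carr M Nt; c \<in> carr M Nt; d \<in> carr M Nt; req M a b; req M c d;
      rls M a c\<rbrakk> \<Longrightarrow> rls M b d"
proof -
  obtain e where e: "penv M e" using penv_ex by blast
  have s: "sat M e A" if "A \<in> equality_axioms" "wff A" for A
    using mod eqT that e by (auto simp: model_def)
  have all: "\<forall>A \<in> equality_axioms. wff A \<longrightarrow> sat M e A" using s by blast
  note all' = all[unfolded equality_axioms_def, simplified,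
      simplified Forall_def s_eq_def s_imp_def s_less_def, simplified]
  show "a \<in> carr M Nt \<Longrightarrow> req M a a" using all' by blast
  show "\<lbrakk>a \<in> carr M Nt; b \<in> carr M Nt; req M a b\<rbrakk> \<Longrightarrow> req M b a" using all' by blast
  show "\<lbrakk>a \<in> carr M Nt; b \<in> carr M Nt; c \<in> carr M Nt; req M a b; req M b c\<rbrakk> \<Longrightarrow> req M a c"
    using all' by blast
  show "\<lbrakk>a \<in> carr M Nt; b \<in> carr M Nt; c \<in> carr M Nt; d \<in> carr M Nt; req M a b; req M c d;
      rls M a c\<rbrakk> \<Longrightarrow> rls M b d" using all' by blast
qed

lemma sim_ap: "\<lbrakk>x \<in> carr M \<rho>; y \<in> carr M \<rho>; f \<in> carr M (\<rho> \<rightarrow> \<tau>); sim M \<rho> x y\<rbrakk> \<Longrightarrow>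
    sim M \<tau> (ap M f x) (ap M f y)"
proof -
  obtain e where e: "penv M e" using penv_ex by blast
  have "wff (extensionality_axiom \<rho> \<tau> 0)"
    by (simp add: extensionality_axiom_def Forall_def s_imp_def wff_eq_at)
  then have "sat M e (extensionality_axiom \<rho> \<tau> 0)" using mod extT e by (simp add: model_def)
  then show "\<lbrakk>x \<in> carr M \<rho>; y \<in> carr M \<rho>; f \<in> carr M (\<rho> \<rightarrow> \<tau>); sim M \<rho> x y\<rbrakk> \<Longrightarrow> ?thesis"
    by (simp add: extensionality_axiom_def)
qed

lemma ap_carr: "f \<in> carr M (\<sigma> \<rightarrow> \<tau>) \<Longrightarrow> a \<in> carr M \<sigma> \<Longrightarrow> ap M f a \<in> carr M \<tau>"
  using raw by (simp add: raw_def type_of_App)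

lemma sim_refl: "a \<in> carr M \<tau> \<Longrightarrow> sim M \<tau> a a"
  by (induction \<tau> arbitrary: a) (simp_all add: req_refl ap_carr)

lemma sim_sym: "\<lbrakk>a \<in> carr M \<tau>; b \<in> carr M \<tau>; sim M \<tau> a b\<rbrakk> \<Longrightarrow> sim M \<tau> b a"
  by (induction \<tau> arbitrary: a b) (simp_all add: req_sym ap_carr)

lemma sim_trans: "\<lbrakk>a \<in> carr M \<tau>; b \<in> carr M \<tau>; c \<in> carr M \<tau>; sim M \<tau> a b; sim M \<tau> b c\<rbrakk> \<Longrightarrow> sim M \<tau> a c"
proof (induction \<tau> arbitrary: a b c)
  case Nt then show ?case using req_trans[of a b c] by simp
next
  case (Fn \<sigma> \<tau>)
  show ?case
  proof (simp, intro ballI)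
    fix z assume z: "z \<in> carr M \<sigma>"
    show "sim M \<tau> (ap M a z) (ap M c z)"
      by (rule Fn.IH(2)[of _ "ap M b z"]) (use Fn.prems z in \<open>simp_all add: ap_carr[of _ \<sigma>]\<close>)
  qed
qed

definition nrmt :: "ty \<Rightarrow> tm \<Rightarrow> tm" where
  "nrmt \<tau> a = (SOME b. b \<in> carr M \<tau> \<and> sim M \<tau> a b)"

text \<open>A chosen representative replaces the equivalence class, so that the quotient is again a
  structure of terms. Every element has one type, which determines the relation to be used.\<close>

definition nm :: "tm \<Rightarrow> tm" where "nm a = nrmt (the (type_of a)) a"

lemma nm: "a \<in> carr M \<tau> \<Longrightarrow> nm a \<in> carr M \<tau> \<and> sim M \<tau> a (nm a)"
proof -
  assume a: "a \<in> carr M \<tau>"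
  then have "the (type_of a) = \<tau>" using raw by (simp add: raw_def)
  moreover have "nrmt \<tau> a \<in> carr M \<tau> \<and> sim M \<tau> a (nrmt \<tau> a)"
    unfolding nrmt_def by (rule someI[of _ a]) (simp add: a sim_refl)
  ultimately show ?thesis by (simp add: nm_def)
qed

lemma nm_eq_iff: "\<lbrakk>a \<in> carr M \<tau>; b \<in> carr M \<tau>\<rbrakk> \<Longrightarrow> nm a = nm b \<longleftrightarrow> sim M \<tau> a b"
proof
  assume a: "a \<in> carr M \<tau>" and b: "b \<in> carr M \<tau>"
  show "sim M \<tau> a b" if "nm a = nm b"
    using nm[OF a] nm[OF b] that sim_trans[OF a _ b] sim_sym[OF b] by metis
  assume s: "sim M \<tau> a b"
  have t: "the (type_of a) = \<tau>" "the (type_of b) = \<tau>" using raw a b by (simp_all add: raw_def)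
  \<comment> \<open>Both representatives are chosen from the same set, hence equal.\<close>
  have "c \<in> carr M \<tau> \<and> sim M \<tau> a c \<longleftrightarrow> c \<in> carr M \<tau> \<and> sim M \<tau> b c" for c
    using s a b sim_trans[of a \<tau> b c] sim_trans[of b \<tau> a c] sim_sym[of a \<tau> b] by metis
  then show "nm a = nm b" by (simp add: nm_def t nrmt_def)
qed

lemma sim_ap2: "\<lbrakk>f \<in> carr M (\<sigma> \<rightarrow> \<tau>); g \<in> carr M (\<sigma> \<rightarrow> \<tau>); a \<in> carr M \<sigma>; b \<in> carr M \<sigma>;
    sim M (\<sigma> \<rightarrow> \<tau>) f g; sim M \<sigma> a b\<rbrakk> \<Longrightarrow> sim M \<tau> (ap M f a) (ap M g b)"
  by (rule sim_trans[of _ _ "ap M g a"]) (simp_all add: ap_carr[of _ \<sigma>] sim_ap[of a \<sigma> b])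

lemma nm_ap: "\<lbrakk>f \<in> carr M (\<sigma> \<rightarrow> \<tau>); a \<in> carr M \<sigma>\<rbrakk> \<Longrightarrow> nm (ap M (nm f) (nm a)) = nm (ap M f a)"
  using nm[of f] nm[of a] sim_sym
  by (subst nm_eq_iff[of _ \<tau>]) (auto intro!: ap_carr sim_ap2[of _ \<sigma>] simp del: sim.simps)

definition Q :: str where
  "Q = \<lparr>carr = (\<lambda>\<tau>. nm ` carr M \<tau>), ap = (\<lambda>a b. nm (ap M a b)), ct = nm, req = (=), rls = rls M\<rparr>"

lemma Q_simps [simp]:
  "carr Q \<tau> = nm ` carr M \<tau>" "ap Q a b = nm (ap M a b)" "ct Q t = nm t" "req Q = (=)" "rls Q = rls M"
  by (simp_all add: Q_def)

lemma eval_Q: "penv M e \<Longrightarrow> type_of t = Some \<tau> \<Longrightarrow> eval Q (\<lambda>x. nm (e x)) t = nm (eval M e t)"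
proof (induction t arbitrary: \<tau>)
  case (App s t)
  from App.prems(2) obtain \<sigma> where t: "type_of s = Some (\<sigma> \<rightarrow> \<tau>)" "type_of t = Some \<sigma>"
    unfolding type_of_App by blast
  have "nm (ap M (nm (eval M e s)) (nm (eval M e t))) = nm (ap M (eval M e s) (eval M e t))"
    by (rule nm_ap) (rule eval_raw_carr[OF raw App.prems(1)], rule t)+
  then show ?case using App.IH[OF App.prems(1)] t by simp
qed (use raw in \<open>simp_all add: raw_def\<close>)

lemma sat_Q: "penv M e \<Longrightarrow> wff A \<Longrightarrow> sat Q (\<lambda>x. nm (e x)) A = sat M e A"
proof (induction A arbitrary: e)
  case (Eq s t)
  have "eval M e s \<in> carr M Nt" "eval M e t \<in> carr M Nt"
    using Eq eval_raw_carr[OF raw] by simp_all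
  then show ?case using Eq by (simp add: eval_Q[of e _ Nt] nm_eq_iff[of _ Nt])
next
  case (Less s t)
  have c: "eval M e s \<in> carr M Nt" "eval M e t \<in> carr M Nt"
    using Less eval_raw_carr[OF raw] by simp_all
  have "rls M (nm (eval M e s)) (nm (eval M e t)) \<longleftrightarrow> rls M (eval M e s) (eval M e t)"
    using nm[OF c(1)] nm[OF c(2)] c rls_cong req_sym by (metis sim.simps(1))
  then show ?case using Less by (simp add: eval_Q[of e _ Nt])
next
  case (FAll x A)
  have "sat Q ((\<lambda>x. nm (e x))(x := nm a)) A = sat M (e(x := a)) A" if "a \<in> carr M (snd x)" for a
  proof -
    have eq: "(\<lambda>x. nm (e x))(x := nm a) = (\<lambda>z. nm ((e(x := a)) z))" by auto
    show ?thesis unfolding eq using FAll.IH[of "e(x := a)"] FAll.prems that by (simp only: penv_upd wff.simps)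
  qed
  then show ?case by simp
qed simp_all

lemma penv_Q: "penv Q e \<Longrightarrow> \<exists>e'. penv M e' \<and> e = (\<lambda>x. nm (e' x))"
proof -
  assume "penv Q e"
  then have "\<forall>x. \<exists>a. a \<in> carr M (snd x) \<and> e x = nm a" by (auto simp: penv_def)
  then obtain e' where "\<forall>x. e' x \<in> carr M (snd x) \<and> e x = nm (e' x)" by metis
  then show ?thesis by (intro exI[of _ e']) (auto simp: penv_def)
qed

lemma model_Q: "model Q T"
  unfolding model_def
proof (intro ballI impI allI)
  fix A e assume "A \<in> T" "wff A" "penv Q e"
  moreover then obtain e' where "penv M e'" "e = (\<lambda>x. nm (e' x))" using penv_Q by blast
  ultimately show "sat Q e A" using sat_Q mod by (simp add: model_def)
qed

lemma normal_Q: "normal Q"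
  unfolding normal_def
proof (intro conjI)
  show "\<forall>\<tau>. carr Q \<tau> \<noteq> {}"
  proof
    fix \<tau> have "Var 1 \<tau> \<in> carr M \<tau>" using raw by (simp add: raw_def)
    then show "carr Q \<tau> \<noteq> {}" by auto
  qed
  show "\<forall>\<sigma> \<tau>. \<forall>f\<in>carr Q (\<sigma> \<rightarrow> \<tau>). \<forall>a\<in>carr Q \<sigma>. ap Q f a \<in> carr Q \<tau>"
    using nm_ap ap_carr by (auto intro: imageI)
  show "\<forall>t \<tau>. type_of t = Some \<tau> \<longrightarrow> fvt t = {} \<longrightarrow> (\<forall>r s. t \<noteq> r \<cdot> s) \<longrightarrow> ct Q t \<in> carr Q \<tau>"
    using raw by (auto simp: raw_def oddt_def indt_def)
  show "\<forall>\<sigma> \<tau>. \<forall>f\<in>carr Q (\<sigma> \<rightarrow> \<tau>). \<forall>g\<in>carr Q (\<sigma> \<rightarrow> \<tau>).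
      (\<forall>a\<in>carr Q \<sigma>. ap Q f a = ap Q g a) \<longrightarrow> f = g"
  proof (intro allI ballI impI)
    fix \<sigma> \<tau> f g
    assume "f \<in> carr Q (\<sigma> \<rightarrow> \<tau>)" "g \<in> carr Q (\<sigma> \<rightarrow> \<tau>)" and eq: "\<forall>a\<in>carr Q \<sigma>. ap Q f a = ap Q g a"
    then obtain f' g' where f: "f' \<in> carr M (\<sigma> \<rightarrow> \<tau>)" "f = nm f'" and g: "g' \<in> carr M (\<sigma> \<rightarrow> \<tau>)" "g = nm g'"
      by auto
    have "sim M \<tau> (ap M f' z) (ap M g' z)" if "z \<in> carr M \<sigma>" for z
      using eq that nm_ap[OF f(1) that] nm_ap[OF g(1) that] nm_eq_iff[OF ap_carr[OF f(1) that] ap_carr[OF g(1) that]]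
      by (simp add: f g)
    then show "f = g" using nm_eq_iff[OF f(1) g(1)] by (simp add: f g)
  qed
qed simp

end

definition allcl :: "var list \<Rightarrow> fm \<Rightarrow> fm" where "allcl xs A = foldr FAll xs A"

lemma allcl_provable: "T \<turnstile> allcl xs A \<Longrightarrow> T \<turnstile> A"
proof (induction xs)
  case (Cons x xs)
  then have "ders T {} (FAll (fst x, snd x) (allcl xs A))" by (simp add: allcl_def Thm)
  then show ?case using Cons.IH ders_spec_self ders_empty by blast
qed (simp add: allcl_def)

lemma allcl_sat:
  "(\<And>e. penv M e \<Longrightarrow> sat M e A) \<Longrightarrow> penv M e \<Longrightarrow> sat M e (allcl xs A)"
  by (induction xs arbitrary: e) (simp_all add: allcl_def penv_upd)

text \<open>The term model refutes the universal closure of G, and the passage to representatives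
  makes equality the identity without changing truth. The equality and extensionality axioms are
  there to make extensional equality a congruence.\<close>

theorem completeness:
  assumes T: "equality_axioms \<subseteq> T" "\<And>\<rho> \<tau>. extensionality_axiom \<rho> \<tau> 0 \<in> T" and G: "wff G"
    and valid: "\<And>M e. normal M \<Longrightarrow> model M T \<Longrightarrow> penv M e \<Longrightarrow> sat M e G"
  shows "T \<turnstile> G"
proof (rule ccontr)
  assume n: "\<not> T \<turnstile> G"
  obtain xs where xs: "set xs = fv G" using finite_list[OF finite_fv[of G]] by blast
  let ?G = "allcl xs G"
  have "fv (allcl ys G) = fv G - set ys" for ys by (induction ys) (auto simp: allcl_def)
  then have "fv ?G = {}" using xs by simp
  moreover have "wff (allcl ys G)" for ys by (induction ys) (simp_all add: allcl_def G)
  ultimately obtain M where M: "raw M" "model M T" "\<And>e. penv M e \<Longrightarrow> \<not> sat M e ?G"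
    using raw_model[of T ?G] n allcl_provable by blast
  interpret raw_eq M T by unfold_locales (use M T in auto)
  obtain e where e: "penv M e" using penv_ex by blast
  have "penv Q (\<lambda>x. nm (e x))" using e by (auto simp: penv_def)
  then have "sat Q (\<lambda>x. nm (e x)) ?G" using valid[OF normal_Q model_Q] by (intro allcl_sat)
  then show False using sat_Q[OF e] \<open>\<And>ys. wff (allcl ys G)\<close> M(3)[OF e] by simp
qed

section \<open>The model under investigation\<close>

lemma wff_sfm [simp]:
  "wff (Forall \<tau> F n) = wff (F (Var n \<tau>) (Suc n))"
  "wff (Exists \<tau> F n) = wff (F (Var n \<tau>) (Suc n))"
  "wff ((s \<^bold>= t) n) = (type_of s = Some Nt \<and> type_of t = Some Nt)"
  "wff ((s \<^bold>< t) n) = (type_of s = Some Nt \<and> type_of t = Some Nt)"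
  "wff ((\<^bold>\<not> A) n) = wff (A n)" "wff ((A \<^bold>\<and> B) n) = (wff (A n) \<and> wff (B n))"
  "wff ((A \<^bold>\<or> B) n) = (wff (A n) \<and> wff (B n))"
  "wff ((A \<^bold>\<longrightarrow> B) n) = (wff (A n) \<and> wff (B n))"
  "wff ((A \<^bold>\<longleftrightarrow> B) n) = (wff (A n) \<and> wff (B n))"
  by (auto simp: Forall_def Exists_def FEx_def s_eq_def s_less_def s_neg_def s_conj_def s_disj_def
      s_imp_def s_iff_def Neg_def Conj_def Disj_def Iff_def)

lemma wff_eq_at: "type_of s = Some \<tau> \<Longrightarrow> type_of t = Some \<tau> \<Longrightarrow> wff (eq_at \<tau> s t n)"
  by (induction \<tau> arbitrary: s t n) simp_all

text \<open>One predicate covers the failure of each of the claims, so that a single model has to be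
  fixed. \<open>ACA\<close> is a schema: as a conclusion some instance fails, as a premise all
  instances hold in all environments.\<close>

definition countermodel :: "str \<Rightarrow> bool" where
  "countermodel M \<longleftrightarrow> normal M \<and> model M RCA0\<omega> \<and> (\<exists>e. penv M e \<and>
    (sat M e E3 \<and> \<not> sat M e CLO \<or> sat M e CLO \<and> \<not> sat M e HBC \<or>
     (\<exists>A \<in> ACA \<union> {OPEN}. wff A \<and> sat M e CLO \<and> \<not> sat M e A) \<or>
     model M ACA \<and> sat M e OPEN \<and> \<not> sat M e CLO))"

definition refuted :: bool where "refuted \<longleftrightarrow> (\<exists>M. countermodel M)"

text \<open>The theorem is refuted by some model if and only if \<open>refuted\<close> holds. In order to use type classes
  for the arithmetic of such a model, it is fixed globally; without \<open>refuted\<close>, which will turn out to be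
  the case, any structure whose numbers are those of \<open>nat\<close> will do.\<close>

definition fallback :: str where
  "fallback = \<lparr>carr = (\<lambda>\<tau>. if \<tau> = Nt then range (\<lambda>n. Var n Nt) else {Var 0 \<tau>}),
    ap = (\<lambda>f a. case type_of f of Some (\<sigma> \<rightarrow> \<tau>) \<Rightarrow> Var 0 \<tau> | _ \<Rightarrow> Zero),
    ct = (\<lambda>t. Var 0 (the (type_of t))), req = (=), rls = (\<lambda>_ _. False)\<rparr>"

definition M0 :: str where "M0 = (if refuted then SOME M. countermodel M else fallback)"

lemma normal_fallback: "normal fallback"
  by (auto simp: normal_def fallback_def)

lemma countermodel_M0: "refuted \<Longrightarrow> countermodel M0"
  unfolding M0_def refuted_def by (simp add: someI_ex[of countermodel])

lemma normal_M0: "normal M0"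
proof (cases refuted)
  case True
  from countermodel_M0[OF this] show ?thesis by (simp add: countermodel_def)
qed (simp add: M0_def normal_fallback)

lemma carr_M0_not_refuted: "\<not> refuted \<Longrightarrow> carr M0 Nt = range (\<lambda>n. Var n Nt)"
  by (simp add: M0_def fallback_def)

lemma req_M0 [simp]: "req M0 = (=)"
  using normal_M0 by (simp add: normal_def)

lemma carr_nonempty: "\<exists>x. x \<in> carr M0 \<tau>"
  using normal_M0 unfolding normal_def by blast

text \<open>Each HOL type in this class mirrors one carrier of \<open>M0\<close>. HOL type inference
  then takes over the typing conditions that would otherwise accompany every element.\<close>

class mty =
  fixes tyof :: "'a itself \<Rightarrow> ty" and rp :: "'a \<Rightarrow> tm" and ab :: "tm \<Rightarrow> 'a"
  assumes rp_mem: "rp x \<in> carr M0 (tyof TYPE('a))"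
    and ab_rp [simp]: "ab (rp x) = x"
    and rp_ab: "t \<in> carr M0 (tyof TYPE('a)) \<Longrightarrow> rp (ab t) = t"

lemma rp_inject [simp]: "rp x = rp y \<longleftrightarrow> x = y"
  using ab_rp by metis

lemma ball_rp: "(\<forall>a \<in> carr M0 (tyof TYPE('a::mty)). P a) \<longleftrightarrow> (\<forall>x::'a. P (rp x))"
  using rp_mem rp_ab by metis

lemma bex_rp: "(\<exists>a \<in> carr M0 (tyof TYPE('a::mty)). P a) \<longleftrightarrow> (\<exists>x::'a. P (rp x))"
  using rp_mem rp_ab by metis

typedef num = "carr M0 Nt" by (rule carr_nonempty)

instantiation num :: mty
begin
definition "tyof (_ :: num itself) = Nt"
definition "rp = Rep_num"
definition "ab = Abs_num"
instance
  by standard (simp_all add: tyof_num_def rp_num_def ab_num_def Rep_num[simplified] Rep_num_inverse Abs_num_inverse)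
end

typedef (overloaded) ('a::mty, 'b::mty) fn = "carr M0 (tyof TYPE('a) \<rightarrow> tyof TYPE('b))"
  by (rule carr_nonempty)

instantiation fn :: (mty, mty) mty
begin
definition "tyof (_ :: ('a, 'b) fn itself) = tyof TYPE('a) \<rightarrow> tyof TYPE('b)"
definition "rp = Rep_fn"
definition "ab = Abs_fn"
instance
  by standard (simp_all add: tyof_fn_def rp_fn_def ab_fn_def Rep_fn[simplified] Rep_fn_inverse Abs_fn_inverse)
end

lemmas tyof_simps [simp] = tyof_num_def tyof_fn_def

type_synonym t1 = "(num, num) fn"
type_synonym t2 = "(t1, num) fn"
type_synonym t3 = "(t2, num) fn"
type_synonym t11 = "(t1, t1) fn"
type_synonym t01 = "(num, t1) fn"

definition app :: "('a::mty, 'b::mty) fn \<Rightarrow> 'a \<Rightarrow> 'b" (infixl "\<bullet>" 100) where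
  "f \<bullet> x = ab (ap M0 (rp f) (rp x))"

lemma ap_rp [simp]: "ap M0 (rp f) (rp x) = rp (f \<bullet> x)"
proof -
  have "rp f \<in> carr M0 (tyof TYPE('a) \<rightarrow> tyof TYPE('b))" for f :: "('a, 'b) fn"
    using rp_mem[of f] by simp
  then have "ap M0 (rp f) (rp x) \<in> carr M0 (tyof TYPE('b))"
    using normal_M0 rp_mem[of x] unfolding normal_def by blast
  then show ?thesis by (simp add: app_def rp_ab)
qed

lemma fn_ext: "(\<And>x. f \<bullet> x = g \<bullet> x) \<Longrightarrow> f = g"
proof -
  assume *: "\<And>x. f \<bullet> x = g \<bullet> x"
  have "\<forall>a \<in> carr M0 (tyof TYPE('a)). ap M0 (rp f) a = ap M0 (rp g) a"
    unfolding ball_rp using * by simp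
  moreover have "rp f \<in> carr M0 (tyof TYPE('a) \<rightarrow> tyof TYPE('b))"
    "rp g \<in> carr M0 (tyof TYPE('a) \<rightarrow> tyof TYPE('b))"
    using rp_mem[of f] rp_mem[of g] by simp_all
  ultimately have "rp f = rp g" using normal_M0 unfolding normal_def by blast
  then show ?thesis by simp
qed

lemma fn_eq_iff: "f = g \<longleftrightarrow> (\<forall>x. f \<bullet> x = g \<bullet> x)"
  using fn_ext by blast

lemma sim_rp: "\<lbrakk>a \<in> carr M0 \<tau>; b \<in> carr M0 \<tau>\<rbrakk> \<Longrightarrow> sim M0 \<tau> a b \<longleftrightarrow> a = b"
proof (induction \<tau> arbitrary: a b)
  case (Fn \<sigma> \<tau>)
  have c: "ap M0 a z \<in> carr M0 \<tau>" "ap M0 b z \<in> carr M0 \<tau>" if "z \<in> carr M0 \<sigma>" for z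
    using normal_M0 Fn.prems that unfolding normal_def by blast+
  have "sim M0 (\<sigma> \<rightarrow> \<tau>) a b \<longleftrightarrow> (\<forall>z \<in> carr M0 \<sigma>. ap M0 a z = ap M0 b z)"
    using Fn.IH(2) c by simp
  also have "\<dots> \<longleftrightarrow> a = b" using normal_M0 Fn.prems unfolding normal_def by blast
  finally show ?case .
qed simp

lemma ct_rp: "type_of t = Some (tyof TYPE('a::mty)) \<Longrightarrow> fvt t = {} \<Longrightarrow> (\<And>r s. t \<noteq> r \<cdot> s) \<Longrightarrow>
    rp (ab (ct M0 t) :: 'a) = ct M0 t"
  using normal_M0 by (intro rp_ab) (auto simp: normal_def)

definition cK :: "('a::mty, ('b::mty, 'a) fn) fn" where
  "cK = ab (ct M0 (Kc (tyof TYPE('a)) (tyof TYPE('b))))"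
definition cS :: "(('a::mty, ('b::mty, 'c::mty) fn) fn, (('a, 'b) fn, ('a, 'c) fn) fn) fn" where
  "cS = ab (ct M0 (Sc (tyof TYPE('a)) (tyof TYPE('b)) (tyof TYPE('c))))"
definition cR :: "((num, (num, num) fn) fn, (num, (num, num) fn) fn) fn" where
  "cR = ab (ct M0 Rec)"
definition c0 :: num where "c0 = ab (ct M0 Zero)"
definition c1 :: num where "c1 = ab (ct M0 One)"
definition cadd :: "(num, (num, num) fn) fn" where "cadd = ab (ct M0 Plus)"
definition cmul :: "(num, (num, num) fn) fn" where "cmul = ab (ct M0 Times)"
definition cls :: "num \<Rightarrow> num \<Rightarrow> bool" where "cls x y = rls M0 (rp x) (rp y)"

lemma rp_cK: "ct M0 (Kc (tyof TYPE('a::mty)) (tyof TYPE('b::mty))) = rp (cK :: ('a::mty, ('b::mty, 'a) fn) fn)"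
  unfolding cK_def by (rule ct_rp[symmetric]) simp_all
lemma rp_cS: "ct M0 (Sc (tyof TYPE('a::mty)) (tyof TYPE('b::mty)) (tyof TYPE('c::mty))) =
    rp (cS :: (('a::mty, ('b::mty, 'c::mty) fn) fn, (('a, 'b) fn, ('a, 'c) fn) fn) fn)"
  unfolding cS_def by (rule ct_rp[symmetric]) simp_all
lemma rp_consts [simp]: "ct M0 Rec = rp cR" "ct M0 Zero = rp c0" "ct M0 One = rp c1"
  "ct M0 Plus = rp cadd" "ct M0 Times = rp cmul" "rls M0 (rp x) (rp y) = cls x y"
  unfolding cR_def c0_def c1_def cadd_def cmul_def cls_def
  by (rule ct_rp[symmetric], simp, simp, simp)+ (rule refl)

definition e0 :: env where "e0 x = (SOME a. a \<in> carr M0 (snd x))"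

lemma penv_e0 [simp]: "penv M0 e0"
  unfolding penv_def e0_def by (rule allI, rule someI_ex, rule carr_nonempty)

lemma penv_rp [simp]: "penv M0 e \<Longrightarrow> \<tau> = tyof TYPE('a) \<Longrightarrow> penv M0 (e((i, \<tau>) := rp (x::'a::mty)))"
  by (simp add: penv_upd rp_mem)

lemma eval_substt: "eval M e (substt x t s) = eval M (e(x := eval M e t)) s"
  by (induction s) simp_all

lemma sat_subst_qf:
  "quantifier_free A \<Longrightarrow> sat M e (subst x t A) = sat M (e(x := eval M e t)) A"
  by (induction A) (simp_all add: eval_substt)

lemma ball_num [simp]: "(\<forall>a \<in> carr M0 Nt. P a) \<longleftrightarrow> (\<forall>x::num. P (rp x))"
  and bex_num [simp]: "(\<exists>a \<in> carr M0 Nt. P a) \<longleftrightarrow> (\<exists>x::num. P (rp x))"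
  using ball_rp[where 'a = num] bex_rp[where 'a = num] by simp_all

lemma ball_t1 [simp]: "(\<forall>a \<in> carr M0 T1. P a) \<longleftrightarrow> (\<forall>x::t1. P (rp x))"
  and bex_t1 [simp]: "(\<exists>a \<in> carr M0 T1. P a) \<longleftrightarrow> (\<exists>x::t1. P (rp x))"
  using ball_rp[where 'a = t1] bex_rp[where 'a = t1] by simp_all

lemma ball_t2 [simp]: "(\<forall>a \<in> carr M0 T2. P a) \<longleftrightarrow> (\<forall>x::t2. P (rp x))"
  and bex_t2 [simp]: "(\<exists>a \<in> carr M0 T2. P a) \<longleftrightarrow> (\<exists>x::t2. P (rp x))"
  using ball_rp[where 'a = t2] bex_rp[where 'a = t2] by simp_all

lemma ball_t3 [simp]: "(\<forall>a \<in> carr M0 T3. P a) \<longleftrightarrow> (\<forall>x::t3. P (rp x))"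
  and bex_t3 [simp]: "(\<exists>a \<in> carr M0 T3. P a) \<longleftrightarrow> (\<exists>x::t3. P (rp x))"
  using ball_rp[where 'a = t3] bex_rp[where 'a = t3] by simp_all

lemma ball_t11 [simp]: "(\<forall>a \<in> carr M0 (T1 \<rightarrow> T1). P a) \<longleftrightarrow> (\<forall>x::t11. P (rp x))"
  and bex_t11 [simp]: "(\<exists>a \<in> carr M0 (T1 \<rightarrow> T1). P a) \<longleftrightarrow> (\<exists>x::t11. P (rp x))"
  using ball_rp[where 'a = t11] bex_rp[where 'a = t11] by simp_all

lemma ball_t01 [simp]: "(\<forall>a \<in> carr M0 (Nt \<rightarrow> T1). P a) \<longleftrightarrow> (\<forall>x::t01. P (rp x))"
  and bex_t01 [simp]: "(\<exists>a \<in> carr M0 (Nt \<rightarrow> T1). P a) \<longleftrightarrow> (\<exists>x::t01. P (rp x))"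
  using ball_rp[where 'a = t01] bex_rp[where 'a = t01] by simp_all

section \<open>The axioms of the base theory, read in the model\<close>

context
  assumes refuted: refuted
begin

lemma model_M0: "A \<in> RCA0\<omega> \<Longrightarrow> wff A \<Longrightarrow> penv M0 e \<Longrightarrow> sat M0 e A"
  using countermodel_M0[OF refuted] by (simp add: countermodel_def model_def)

lemma cK_app: "cK \<bullet> (x::'a::mty) \<bullet> (y::'b::mty) = x"
proof -
  let ?A = "K_axiom (tyof TYPE('a)) (tyof TYPE('b)) 0"
  have "wff ?A" by (simp add: K_axiom_def wff_eq_at)
  moreover have "?A \<in> RCA0\<omega>" unfolding RCA0\<omega>_def by blast
  ultimately have "sat M0 e0 ?A" by (intro model_M0) simp_all
  then have "sim M0 (tyof TYPE('a)) (rp (cK \<bullet> x \<bullet> y)) (rp x)"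
    by (simp add: K_axiom_def ball_rp rp_cK)
  then show ?thesis by (simp add: sim_rp rp_mem)
qed

lemma cS_app: "cS \<bullet> (f :: ('a::mty, ('b::mty, 'c::mty) fn) fn) \<bullet> g \<bullet> z = f \<bullet> z \<bullet> (g \<bullet> z)"
proof -
  let ?A = "S_axiom (tyof TYPE('a)) (tyof TYPE('b)) (tyof TYPE('c)) 0"
  have "wff ?A" by (simp add: S_axiom_def wff_eq_at)
  moreover have "?A \<in> RCA0\<omega>" unfolding RCA0\<omega>_def by blast
  ultimately have "sat M0 e0 ?A" by (intro model_M0) simp_all
  then have "\<forall>f \<in> carr M0 (tyof TYPE(('a, ('b, 'c) fn) fn)). \<forall>g \<in> carr M0 (tyof TYPE(('a, 'b) fn)).
      \<forall>z \<in> carr M0 (tyof TYPE('a)).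
      sim M0 (tyof TYPE('c)) (ap M0 (ap M0 (ap M0 (rp (cS :: (('a, ('b, 'c) fn) fn, (('a, 'b) fn, ('a, 'c) fn) fn) fn)) f) g) z)
        (ap M0 (ap M0 f z) (ap M0 g z))"
    by (simp add: S_axiom_def rp_cS)
  then have "sim M0 (tyof TYPE('c)) (rp (cS \<bullet> f \<bullet> g \<bullet> z)) (rp (f \<bullet> z \<bullet> (g \<bullet> z)))"
    unfolding ball_rp by simp
  then show ?thesis by (simp add: sim_rp rp_mem)
qed

lemma cR_app: "cR \<bullet> f \<bullet> m \<bullet> c0 = m" "cR \<bullet> f \<bullet> m \<bullet> (cadd \<bullet> n \<bullet> c1) = f \<bullet> n \<bullet> (cR \<bullet> f \<bullet> m \<bullet> n)"
proof -
  have R: "R_axioms \<subseteq> RCA0\<omega>" by (auto simp: RCA0\<omega>_def)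
  have *: "(\<forall>a \<in> carr M0 (Nt \<rightarrow> Nt \<rightarrow> Nt). P a) \<longleftrightarrow> (\<forall>x::(num, t1) fn. P (rp x))" for P
    using ball_rp[where 'a = "(num, t1) fn"] by simp
  have all: "\<forall>A \<in> R_axioms. wff A \<longrightarrow> sat M0 e0 A" using model_M0[of _ e0] R by auto
  note all[unfolded R_axioms_def, simplified, simplified *, simplified]
  then show "cR \<bullet> f \<bullet> m \<bullet> c0 = m" "cR \<bullet> f \<bullet> m \<bullet> (cadd \<bullet> n \<bullet> c1) = f \<bullet> n \<bullet> (cR \<bullet> f \<bullet> m \<bullet> n)"
    by blast+
qed

lemma arith:
  "cadd \<bullet> m \<bullet> c1 \<noteq> c0" "cadd \<bullet> m \<bullet> c1 = cadd \<bullet> n \<bullet> c1 \<longleftrightarrow> m = n" "cadd \<bullet> m \<bullet> c0 = m"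
  "cadd \<bullet> m \<bullet> (cadd \<bullet> n \<bullet> c1) = cadd \<bullet> (cadd \<bullet> m \<bullet> n) \<bullet> c1"
  "cmul \<bullet> m \<bullet> c0 = c0" "cmul \<bullet> m \<bullet> (cadd \<bullet> n \<bullet> c1) = cadd \<bullet> (cmul \<bullet> m \<bullet> n) \<bullet> m"
  "\<not> cls m c0" "cls m (cadd \<bullet> n \<bullet> c1) \<longleftrightarrow> cls m n \<or> m = n"
proof -
  have R: "arithmetic_axioms \<subseteq> RCA0\<omega>" by (auto simp: RCA0\<omega>_def)
  have all: "\<forall>A \<in> arithmetic_axioms. wff A \<longrightarrow> sat M0 e0 A" using model_M0[of _ e0] R by auto
  note a = all[unfolded arithmetic_axioms_def, simplified]
  show "cadd \<bullet> m \<bullet> c1 \<noteq> c0" "cadd \<bullet> m \<bullet> c1 = cadd \<bullet> n \<bullet> c1 \<longleftrightarrow> m = n" "cadd \<bullet> m \<bullet> c0 = m"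
    "cadd \<bullet> m \<bullet> (cadd \<bullet> n \<bullet> c1) = cadd \<bullet> (cadd \<bullet> m \<bullet> n) \<bullet> c1"
    "cmul \<bullet> m \<bullet> c0 = c0" "cmul \<bullet> m \<bullet> (cadd \<bullet> n \<bullet> c1) = cadd \<bullet> (cmul \<bullet> m \<bullet> n) \<bullet> m"
    "\<not> cls m c0" "cls m (cadd \<bullet> n \<bullet> c1) \<longleftrightarrow> cls m n \<or> m = n"
    using a by blast+
qed

text \<open>The numbers may be nonstandard, so this is the induction with which their arithmetic
  starts. Parameters are supplied by the environment.\<close>

lemma formula_induct:
  assumes A: "wff A" "quantifier_free A" and e: "penv M0 e"
    and 0: "sat M0 (e((0, Nt) := rp c0)) A"
    and S: "\<And>n. sat M0 (e((0, Nt) := rp n)) A \<Longrightarrow> sat M0 (e((0, Nt) := rp (cadd \<bullet> n \<bullet> c1))) A"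
  shows "sat M0 (e((0, Nt) := rp (n::num))) A"
proof -
  have "wff (induction_axiom 0 A)" using A by (simp add: induction_axiom_def wff_subst)
  moreover have "induction_axiom 0 A \<in> RCA0\<omega>"
    using A unfolding RCA0\<omega>_def QF_induction_def by blast
  ultimately have "sat M0 e (induction_axiom 0 A)" using e by (intro model_M0)
  then show ?thesis
    using 0 S by (simp add: induction_axiom_def sat_subst_qf[OF A(2)])
qed

lemma formula_choice:
  assumes A: "wff A" "quantifier_free A" and e: "penv M0 e" and k: "(2, T2) \<notin> fv A"
    and ex: "\<And>f::t1. \<exists>n::num. sat M0 (e((0, T1) := rp f, (1, Nt) := rp n)) A"
  shows "\<exists>Y::t2. \<forall>f::t1. sat M0 (e((2, T2) := rp Y, (0, T1) := rp f, (1, Nt) := rp (Y \<bullet> f))) A"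
proof -
  have "wff (choice_axiom 0 1 2 A)" using A by (simp add: choice_axiom_def wff_subst FEx_def Neg_def)
  moreover have "choice_axiom 0 1 2 A \<in> RCA0\<omega>"
    using A k unfolding RCA0\<omega>_def QF_AC_10_def by blast
  ultimately have "sat M0 e (choice_axiom 0 1 2 A)" using e by (intro model_M0)
  then show ?thesis
    using ex by (simp add: choice_axiom_def sat_subst_qf[OF A(2)])
qed

end

section \<open>Arithmetic of the model\<close>

lemma qf_simps [simp]:
  "wff (Neg A) = wff A" "wff (Disj A B) = (wff A \<and> wff B)" "wff (Conj A B) = (wff A \<and> wff B)"
  "quantifier_free (Neg A) = quantifier_free A"
  "quantifier_free (Disj A B) = (quantifier_free A \<and> quantifier_free B)"
  "quantifier_free (Conj A B) = (quantifier_free A \<and> quantifier_free B)"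
  by (simp_all add: Neg_def Disj_def Conj_def)

context
  assumes refuted: refuted
begin

abbreviation (input) "padd m n \<equiv> cadd \<bullet> m \<bullet> n"
abbreviation (input) "pmul m n \<equiv> cmul \<bullet> m \<bullet> n"

abbreviation (input) "vn \<equiv> Var 0 Nt"
abbreviation (input) "vm \<equiv> Var 1 Nt"
abbreviation (input) "vk \<equiv> Var 2 Nt"

abbreviation (input) env2 :: "num \<Rightarrow> num \<Rightarrow> env" where
  "env2 m k \<equiv> e0((1, Nt) := rp m, (2, Nt) := rp k)"

lemmas ind = formula_induct[OF refuted]
lemmas ar [simp] = arith[OF refuted]

lemma padd_c0: "padd c0 n = n"
  using ind[of "Eq (Zero \<oplus> vn) vn" e0 n] by simp

lemma padd_c1: "padd (padd m c1) n = padd (padd m n) c1"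
  using ind[of "Eq ((vm \<oplus> One) \<oplus> vn) ((vm \<oplus> vn) \<oplus> One)" "env2 m m" n] by simp

lemma padd_comm: "padd m n = padd n m"
  using ind[of "Eq (vm \<oplus> vn) (vn \<oplus> vm)" "env2 m m" n] by (simp add: padd_c0 padd_c1)

lemma padd_assoc: "padd (padd m k) n = padd m (padd k n)"
  using ind[of "Eq ((vm \<oplus> vk) \<oplus> vn) (vm \<oplus> (vk \<oplus> vn))" "env2 m k" n] by simp

lemma padd_lcomm: "padd m (padd k n) = padd k (padd m n)"
  by (metis padd_comm padd_assoc)

lemma pmul_c0: "pmul c0 n = c0"
  using ind[of "Eq (Zero \<otimes> vn) Zero" e0 n] by simp

lemma pmul_c1: "pmul (padd m c1) n = padd (pmul m n) n"
  using ind[of "Eq ((vm \<oplus> One) \<otimes> vn) ((vm \<otimes> vn) \<oplus> vn)" "env2 m m" n]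
  by (simp del: ar(4) add: padd_assoc padd_comm padd_lcomm)

lemma pmul_comm: "pmul m n = pmul n m"
  using ind[of "Eq (vm \<otimes> vn) (vn \<otimes> vm)" "env2 m m" n] by (simp add: pmul_c0 pmul_c1)

lemma pmul_distrib: "pmul (padd m k) n = padd (pmul m n) (pmul k n)"
  using ind[of "Eq ((vm \<oplus> vk) \<otimes> vn) ((vm \<otimes> vn) \<oplus> (vk \<otimes> vn))" "env2 m k" n]
  by (simp add: padd_assoc padd_lcomm)

lemma pmul_distrib2: "pmul n (padd m k) = padd (pmul n m) (pmul n k)"
  by (metis pmul_comm pmul_distrib)

lemma pmul_one: "pmul m c1 = m"
  using ar(6)[of m c0] by (simp add: padd_c0 del: ar(6))

lemma pmul_assoc: "pmul (pmul m k) n = pmul m (pmul k n)"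
  using ind[of "Eq ((vm \<otimes> vk) \<otimes> vn) (vm \<otimes> (vk \<otimes> vn))" "env2 m k" n]
  by (simp add: pmul_distrib2 pmul_one)

lemma padd_cancel: "padd m n = padd k n \<longleftrightarrow> m = k"
  using ind[of "Imp (Eq (vm \<oplus> vn) (vk \<oplus> vn)) (Eq vm vk)" "env2 m k" n] by auto

lemma c0_or_succ: "n = c0 \<or> (\<exists>k. n = padd k c1)"
proof -
  \<comment> \<open>The predecessor: with \<open>cK\<close> as step function the recursor returns
    the counter of its last step. It replaces the existential quantifier, so that the induction
    formula is quantifier-free.\<close>
  define pd where "pd = cR \<bullet> cK \<bullet> c0"
  have pd: "pd \<bullet> c0 = c0" "pd \<bullet> (padd n c1) = n" for n
    by (simp_all add: pd_def cR_app[OF refuted] cK_app[OF refuted])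
  have "n = c0 \<or> n = padd (pd \<bullet> n) c1"
    using ind[of "Disj (Eq vn Zero) (Eq vn (Var 3 T1 \<cdot> vn \<oplus> One))" "e0((3, T1) := rp pd)" n]
    by (simp add: pd)
  then show ?thesis by blast
qed

lemma cls_c0: "cls c0 n \<longleftrightarrow> n \<noteq> c0"
proof -
  have "n = c0 \<or> cls c0 n"
    using ind[of "Disj (Eq vn Zero) (Less Zero vn)" e0 n] by auto
  then show ?thesis by auto
qed

lemma cls_mono1: "cls n m \<Longrightarrow> cls (padd n c1) (padd m c1)"
  using ind[of "Imp (Less vm vn) (Less (vm \<oplus> One) (vn \<oplus> One))" "env2 n n" m] by auto

lemma cls_total: "cls m n \<or> m = n \<or> cls n m"
proof -
  have "cls m (padd k c1) \<or> m = padd k c1 \<or> cls (padd k c1) m" if "cls m k \<or> m = k \<or> cls k m" for k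
    using that cls_mono1[of k m] by auto
  then show ?thesis
    using ind[of "Disj (Less vm vn) (Disj (Eq vm vn) (Less vn vm))" "env2 m m" n] cls_c0[of m] by simp
qed

lemma cls_trans: "cls m k \<Longrightarrow> cls k n \<Longrightarrow> cls m n"
  using ind[of "Imp (Less vm vk) (Imp (Less vk vn) (Less vm vn))" "env2 m k" n] by auto

lemma cls_Suc_self: "cls m (padd m c1)" by simp

lemma cls_irrefl: "\<not> cls m m"
proof -
  have *: "\<not> cls (padd n c1) (padd n c1)" if "\<not> cls n n" for n
  proof
    assume "cls (padd n c1) (padd n c1)"
    then have "cls (padd n c1) n \<or> padd n c1 = n" by simp
    then show False using that cls_trans[OF cls_Suc_self] by (metis ar(8))
  qed
  show ?thesis using ind[of "Imp (Less vn vn) Fls" e0 m] * by (simp del: ar(8))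
qed

lemma cls_padd: "cls m k \<Longrightarrow> cls (padd m n) (padd k n)"
  using ind[of "Imp (Less vm vk) (Less (vm \<oplus> vn) (vk \<oplus> vn))" "env2 m k" n] cls_mono1 by auto

lemma cls_diff: "cls m n \<Longrightarrow> \<exists>k. k \<noteq> c0 \<and> n = padd m k"
proof -
  define pd where "pd = cR \<bullet> cK \<bullet> c0"
  have pd: "pd \<bullet> c0 = c0" "pd \<bullet> (padd n c1) = n" for n
    by (simp_all add: pd_def cR_app[OF refuted] cK_app[OF refuted])
  \<comment> \<open>Iterated predecessor, hence the truncated difference of n and the argument;
    again an explicit witness.\<close>
  define mo where "mo = cR \<bullet> (cK \<bullet> pd) \<bullet> n"
  have mo: "mo \<bullet> c0 = n" "mo \<bullet> (padd k c1) = pd \<bullet> (mo \<bullet> k)" for k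
    by (simp_all add: mo_def cR_app[OF refuted] cK_app[OF refuted])
  have st: "padd (pd \<bullet> (mo \<bullet> k)) (padd k c1) = n" if "padd (mo \<bullet> k) k = n" "cls k n" for k
  proof -
    have "mo \<bullet> k \<noteq> c0" using that cls_irrefl by (auto simp: padd_c0)
    then obtain l where "mo \<bullet> k = padd l c1" using c0_or_succ by blast
    then show ?thesis using that by (simp add: pd padd_c1)
  qed
  have "\<not> cls n m \<Longrightarrow> padd (mo \<bullet> m) m = n"
  proof -
    have s: "\<not> cls n (padd k c1) \<Longrightarrow> \<not> cls n k \<and> cls k n" for k using cls_total[of k n] by auto
    show "\<not> cls n m \<Longrightarrow> ?thesis"
      using ind[of "Imp (Neg (Less vm vn)) (Eq (Var 3 T1 \<cdot> vn \<oplus> vn) vm)" "(env2 n n)((3, T1) := rp mo)" m]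
        s st by (simp add: mo)
  qed
  moreover assume mn: "cls m n"
  moreover then have "\<not> cls n m" using cls_trans cls_irrefl by blast
  ultimately have "padd (mo \<bullet> m) m = n" by simp
  moreover then have "mo \<bullet> m \<noteq> c0" using mn cls_irrefl by (auto simp: padd_c0)
  ultimately show ?thesis using padd_comm by metis
qed

lemma pmul_nz: "m \<noteq> c0 \<Longrightarrow> n \<noteq> c0 \<Longrightarrow> pmul m n \<noteq> c0"
  using c0_or_succ[of m] c0_or_succ[of n] by (auto simp: padd_assoc[symmetric])

end

definition nidx :: "num \<Rightarrow> nat" where "nidx x = (THE n. rp x = Var n Nt)"
definition ofidx :: "nat \<Rightarrow> num" where "ofidx n = ab (Var n Nt)"

lemma ofidx: "\<not> refuted \<Longrightarrow> nidx (ofidx n) = n" "\<not> refuted \<Longrightarrow> ofidx (nidx x) = x"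
proof -
  assume o: "\<not> refuted"
  have r: "rp (ofidx n) = Var n Nt" for n
    unfolding ofidx_def by (rule rp_ab) (simp add: carr_M0_not_refuted[OF o])
  then show n: "nidx (ofidx n) = n" for n by (simp add: nidx_def)
  have "rp x \<in> carr M0 Nt" using rp_mem[of x] by simp
  then obtain n where "rp x = Var n Nt" using carr_M0_not_refuted[OF o] by blast
  then have "x = ofidx n" using r[of n] by (metis rp_inject)
  then show "ofidx (nidx x) = x" using n by simp
qed

lemma nidx_eq: "\<not> refuted \<Longrightarrow> x = y \<longleftrightarrow> nidx x = nidx y"
  using ofidx by metis

text \<open>A class instance cannot depend on the hypothesis \<open>refuted\<close>. In the other
  case the numbers are variables, and the operations are copied from \<open>nat\<close> through
  their indices.\<close>

instantiation num :: "{zero, one, plus, times, linorder, minus}"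
begin
definition "0 = (if refuted then c0 else ofidx 0)"
definition "1 = (if refuted then c1 else ofidx 1)"
definition "m + n = (if refuted then cadd \<bullet> m \<bullet> n else ofidx (nidx m + nidx n))" for m n :: num
definition "m * n = (if refuted then cmul \<bullet> m \<bullet> n else ofidx (nidx m * nidx n))" for m n :: num
definition "m < n = (if refuted then cls m n else nidx m < nidx n)" for m n :: num
definition "m \<le> n \<longleftrightarrow> m < n \<or> m = n" for m n :: num
definition "m - n = (if n < m then (THE k. n + k = m) else 0)" for m n :: num
instance
proof
  fix x y z :: num
  show "x < y \<longleftrightarrow> x \<le> y \<and> \<not> y \<le> x"
    using cls_trans cls_irrefl by (auto simp: less_eq_num_def less_num_def)
  show "x \<le> x" by (simp add: less_eq_num_def)
  show "x \<le> y \<Longrightarrow> y \<le> z \<Longrightarrow> x \<le> z"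
    using cls_trans by (auto simp: less_eq_num_def less_num_def split: if_splits)
  show "x \<le> y \<Longrightarrow> y \<le> x \<Longrightarrow> x = y"
    using cls_trans cls_irrefl by (auto simp: less_eq_num_def less_num_def split: if_splits)
  show "x \<le> y \<or> y \<le> x"
    using cls_total[of x y] nidx_eq[of x y] by (auto simp: less_eq_num_def less_num_def)
qed
end

instantiation num :: linordered_semidom
begin

lemma num_aux:
  fixes a b c :: num
  shows "a + b + c = a + (b + c)" "a + b = b + a" "0 + a = a" "a * b * c = a * (b * c)"
    "a * b = b * a" "1 * a = a" "(a + b) * c = a * c + b * c" "0 \<noteq> (1::num)" "0 * a = 0"
    "a + b = a + c \<longleftrightarrow> b = c" "a * b = 0 \<longleftrightarrow> a = 0 \<or> b = 0" "0 \<le> a"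
    "a < b \<Longrightarrow> c + a < c + b" "a < b \<Longrightarrow> \<exists>k. k \<noteq> 0 \<and> a + k = b" "0 < a \<longleftrightarrow> a \<noteq> 0"
proof -
  have z: "padd c0 c1 = c1" if refuted using padd_c0[OF that] .
  show "a + b + c = a + (b + c)" "a + b = b + a" "0 + a = a" "a * b * c = a * (b * c)"
    "a * b = b * a" "1 * a = a" "(a + b) * c = a * c + b * c" "0 * a = 0"
    by (cases refuted; simp add: plus_num_def times_num_def zero_num_def one_num_def ofidx padd_assoc
        pmul_assoc padd_c0 pmul_c0 pmul_distrib algebra_simps; metis padd_comm pmul_comm pmul_one)+
  show "0 \<noteq> (1::num)"
    using arith(1)[of c0] z by (cases refuted) (auto simp: zero_num_def one_num_def nidx_eq ofidx)
  show "a + b = a + c \<longleftrightarrow> b = c"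
    using padd_cancel[of b a c] padd_comm[of a]
    by (cases refuted) (auto simp: plus_num_def nidx_eq ofidx)
  show "a * b = 0 \<longleftrightarrow> a = 0 \<or> b = 0"
    using pmul_nz[of a b] pmul_c0[of b] arith(5)[of a]
    by (cases refuted) (auto simp: times_num_def zero_num_def nidx_eq ofidx)
  show l: "0 < a \<longleftrightarrow> a \<noteq> 0"
    using cls_c0[of a] by (cases refuted) (auto simp: less_num_def zero_num_def nidx_eq ofidx)
  then show "0 \<le> a" by (auto simp: less_eq_num_def)
  show "a < b \<Longrightarrow> c + a < c + b"
    using cls_padd[of a b c] padd_comm[of c] by (cases refuted) (auto simp: less_num_def plus_num_def ofidx)
  show "\<exists>k. k \<noteq> 0 \<and> a + k = b" if "a < b"
  proof (cases refuted)
    case True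
    then show ?thesis using cls_diff[OF True, of a b] that
      by (auto simp: less_num_def plus_num_def zero_num_def)
  next
    case False
    then show ?thesis using that
      by (intro exI[of _ "ofidx (nidx b - nidx a)"])
        (auto simp: less_num_def plus_num_def zero_num_def nidx_eq ofidx)
  qed
qed

lemma num_diff: "(a::num) + b - a = b"
proof (cases "b = 0")
  case True
  then have "a + b = a" using num_aux(2)[of a 0] num_aux(3)[of a] by simp
  then show ?thesis using True by (simp add: minus_num_def)
next
  case False
  then have "0 < b" using num_aux(15) by simp
  from num_aux(13)[OF this, of a] have "a < a + b" using num_aux(2,3) by simp
  then show ?thesis using num_aux(10) by (simp add: minus_num_def)
qed

lemma num_le_iff: "(a::num) \<le> b \<longleftrightarrow> (\<exists>k. b = a + k)"
proof
  assume "a \<le> b"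
  then show "\<exists>k. b = a + k"
    using num_aux(14)[of a b] num_aux(2,3) unfolding less_eq_num_def by metis
next
  assume "\<exists>k. b = a + k"
  then obtain k where "b = a + k" ..
  then show "a \<le> b" using num_aux(13)[of 0 k a] num_aux(2,3,15)[of a] num_aux(2,3,15) unfolding less_eq_num_def
    by metis
qed

lemma num_diff0: "(a::num) \<le> b \<Longrightarrow> a - b = 0"
  unfolding minus_num_def by auto

lemma num_mult_less: "(a::num) < b \<Longrightarrow> 0 < c \<Longrightarrow> c * a < c * b"
proof -
  assume "a < b" "0 < c"
  then obtain k where "k \<noteq> 0" "a + k = b" using num_aux(14) by blast
  then have "c * b = c * a + c * k" "c * k \<noteq> 0" using num_aux(5,7,11,15) \<open>0 < c\<close> by metis+
  then show ?thesis using num_aux(13)[of 0 "c * k" "c * a"] num_aux(2,3,15) by metis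
qed

instance
proof
  fix a b c :: num
  show "a + b + c = a + (b + c)" "a + b = b + a" "0 + a = a" "a * b * c = a * (b * c)"
    "a * b = b * a" "1 * a = a" "(a + b) * c = a * c + b * c" "0 \<noteq> (1::num)" "0 * a = 0" "a * 0 = 0"
    using num_aux by metis+
  show "a * (b + c) = a * b + a * c" using num_aux(5,7) by metis
  show "a + b - a = b" by (rule num_diff)
  show "a - b - c = a - (b + c)"
  proof (cases "b + c \<le> a")
    case True
    then obtain k where "a = b + c + k" using num_le_iff by blast
    then show ?thesis by (simp add: num_aux(1) num_diff) (simp add: num_aux(1)[symmetric] num_diff)
  next
    case False
    then have 1: "a - (b + c) = 0" using num_diff0 by simp
    show ?thesis
    proof (cases "b \<le> a")
      case True
      then obtain k where k: "a = b + k" using num_le_iff by blast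
      then have "\<not> c \<le> k" using False num_le_iff num_aux(1) by metis
      then show ?thesis using 1 by (simp add: k num_diff num_diff0)
    qed (use 1 num_diff0 num_aux(12) in simp)
  qed
  show "a * (b - c) = a * b - a * c"
  proof (cases "c \<le> b")
    case True
    then obtain k where "b = c + k" using num_le_iff by blast
    moreover then have "a * b = a * c + a * k" using num_aux(5,7) by metis
    ultimately show ?thesis by (simp add: num_diff)
  next
    case False
    then obtain k where "c = b + k" using num_le_iff by (metis linear)
    then have "a * c = a * b + a * k" using num_aux(5,7) by metis
    then have "a * b \<le> a * c" using num_le_iff by blast
    moreover have "a * 0 = 0" using num_aux(5)[of a 0] num_aux(9)[of a] by simp
    ultimately show ?thesis using False by (simp add: num_diff0)
  qed
  show "a \<noteq> 0 \<Longrightarrow> b \<noteq> 0 \<Longrightarrow> a * b \<noteq> 0" using num_aux(11) by blast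
  show "a \<le> b \<Longrightarrow> c + a \<le> c + b" unfolding num_le_iff using num_aux(1) by metis
  show "a < b \<Longrightarrow> 0 < c \<Longrightarrow> c * a < c * b" by (rule num_mult_less)
  show "0 < (1::num)" using num_aux(8,15) by metis
  show "b \<le> a \<Longrightarrow> a - b + b = a" using num_le_iff num_diff num_aux(2) by metis
qed
end

lemma num_ge0 [simp]: "0 \<le> (n::num)" by (rule num_aux(12))
lemma num_not_less0 [simp]: "\<not> (n::num) < 0" by (simp add: not_less)
lemma num_gt0 [simp]: "0 < n \<longleftrightarrow> n \<noteq> (0::num)" by (rule num_aux(15))

section \<open>Functions of the model\<close>

text \<open>\<open>I1 F\<close> makes F internal: it is the action of a function of the model. The
  variants treat curried functions, and fixed arities let closure under abstraction be used as a
  plain rule from one arity to the next.\<close>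

definition I1 :: "('a::mty \<Rightarrow> 'r::mty) \<Rightarrow> bool" where
  "I1 F \<longleftrightarrow> (\<exists>f. \<forall>x. f \<bullet> x = F x)"

definition I2 :: "('a::mty \<Rightarrow> 'b::mty \<Rightarrow> 'r::mty) \<Rightarrow> bool" where
  "I2 F \<longleftrightarrow> (\<exists>f. \<forall>x y. f \<bullet> x \<bullet> y = F x y)"

definition I3 :: "('a::mty \<Rightarrow> 'b::mty \<Rightarrow> 'c::mty \<Rightarrow> 'r::mty) \<Rightarrow> bool" where
  "I3 F \<longleftrightarrow> (\<exists>f. \<forall>x y z. f \<bullet> x \<bullet> y \<bullet> z = F x y z)"

definition I4 :: "('a::mty \<Rightarrow> 'b::mty \<Rightarrow> 'c::mty \<Rightarrow> 'd::mty \<Rightarrow> 'r::mty) \<Rightarrow> bool" where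
  "I4 F \<longleftrightarrow> (\<exists>f. \<forall>x y z w. f \<bullet> x \<bullet> y \<bullet> z \<bullet> w = F x y z w)"

definition lam :: "('a::mty \<Rightarrow> 'b::mty) \<Rightarrow> ('a, 'b) fn" where
  "lam F = (SOME f. \<forall>x. f \<bullet> x = F x)"

lemma lam [simp]: "I1 F \<Longrightarrow> lam F \<bullet> x = F x"
  unfolding I1_def lam_def by (rule spec[of _ x]) (rule someI_ex)

lemma lam_eq: "I1 F \<Longrightarrow> lam F = f \<longleftrightarrow> (\<forall>x. F x = f \<bullet> x)"
  by (simp add: fn_eq_iff)

locale counterexample =
  assumes refuted: refuted
begin

lemma I1_const: "I1 (\<lambda>x. c)"
  unfolding I1_def by (rule exI[of _ "cK \<bullet> c"]) (simp add: cK_app[OF refuted])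

lemma I1_var: "I1 (\<lambda>x. x)"
  unfolding I1_def
  by (rule exI[of _ "cS \<bullet> cK \<bullet> (cK :: ('a, ('a, 'a) fn) fn)"]) (simp add: cK_app[OF refuted] cS_app[OF refuted])

text \<open>The S combinator; with K for constants it makes every applicative term in x
  internal.\<close>

lemma I1_app: "I1 F \<Longrightarrow> I1 G \<Longrightarrow> I1 (\<lambda>x. F x \<bullet> G x)"
proof -
  assume "I1 F" "I1 G"
  then obtain f g where "\<And>x. f \<bullet> x = F x" "\<And>x. g \<bullet> x = G x" unfolding I1_def by blast
  then show ?thesis unfolding I1_def by (intro exI[of _ "cS \<bullet> f \<bullet> g"]) (simp add: cS_app[OF refuted])
qed

lemma I2_from: "I1 G \<Longrightarrow> (\<And>x y. G x \<bullet> y = F x y) \<Longrightarrow> I2 F"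
  unfolding I1_def I2_def by metis

lemma I2_const: "I2 (\<lambda>x y. c)"
  by (rule I2_from[of "\<lambda>x. cK \<bullet> c"]) (simp_all add: I1_const cK_app[OF refuted])

lemma I2_weak: "I1 F \<Longrightarrow> I2 (\<lambda>x y. F x)"
  by (rule I2_from[of "\<lambda>x. cK \<bullet> F x"]) (simp_all add: I1_app I1_const cK_app[OF refuted])

lemma I2_last: "I2 (\<lambda>x y. y)"
proof -
  obtain f :: "('b, 'b) fn" where "\<And>x. f \<bullet> x = x" using I1_var unfolding I1_def by blast
  then show ?thesis by (intro I2_from[of "\<lambda>x. f"] I1_const)
qed

lemma I2_app: "I2 F \<Longrightarrow> I2 G \<Longrightarrow> I2 (\<lambda>x y. F x y \<bullet> G x y)"
proof -
  assume "I2 F" "I2 G"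
  then obtain f g where "\<And>x y. f \<bullet> x \<bullet> y = F x y" "\<And>x y. g \<bullet> x \<bullet> y = G x y" unfolding I2_def by blast
  moreover have "I1 (\<lambda>x. cS \<bullet> (f \<bullet> x) \<bullet> (g \<bullet> x))"
    by (intro I1_app I1_const I1_var)
  ultimately show ?thesis by (elim I2_from) (simp add: cS_app[OF refuted])
qed

lemmas I2_vars = I2_weak[OF I1_var] I2_last

lemma I3_from: "I2 G \<Longrightarrow> (\<And>x y z. G x y \<bullet> z = F x y z) \<Longrightarrow> I3 F"
  unfolding I2_def I3_def by metis

lemma I3_const: "I3 (\<lambda>x y z. c)"
  by (rule I3_from[of "\<lambda>x y. cK \<bullet> c"]) (simp_all add: I2_const cK_app[OF refuted])

lemma I3_weak: "I2 F \<Longrightarrow> I3 (\<lambda>x y z. F x y)"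
  by (rule I3_from[of "\<lambda>x y. cK \<bullet> F x y"]) (simp_all add: I2_app I2_const cK_app[OF refuted])

lemma I3_last: "I3 (\<lambda>x y z. z)"
proof -
  obtain f :: "('c, 'c) fn" where "\<And>x. f \<bullet> x = x" using I1_var unfolding I1_def by blast
  then show ?thesis by (intro I3_from[of "\<lambda>x y. f"] I2_const)
qed

lemma I3_app: "I3 F \<Longrightarrow> I3 G \<Longrightarrow> I3 (\<lambda>x y z. F x y z \<bullet> G x y z)"
proof -
  assume "I3 F" "I3 G"
  then obtain f g where "\<And>x y z. f \<bullet> x \<bullet> y \<bullet> z = F x y z" "\<And>x y z. g \<bullet> x \<bullet> y \<bullet> z = G x y z" unfolding I3_def by blast
  moreover have "I2 (\<lambda>x y. cS \<bullet> (f \<bullet> x \<bullet> y) \<bullet> (g \<bullet> x \<bullet> y))"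
    by (intro I2_app I2_const I2_vars)
  ultimately show ?thesis by (elim I3_from) (simp add: cS_app[OF refuted])
qed

lemmas I3_vars = I2_vars[THEN I3_weak] I3_last

lemma I4_from: "I3 G \<Longrightarrow> (\<And>x y z w. G x y z \<bullet> w = F x y z w) \<Longrightarrow> I4 F"
  unfolding I3_def I4_def by metis

lemma I4_const: "I4 (\<lambda>x y z w. c)"
  by (rule I4_from[of "\<lambda>x y z. cK \<bullet> c"]) (simp_all add: I3_const cK_app[OF refuted])

lemma I4_weak: "I3 F \<Longrightarrow> I4 (\<lambda>x y z w. F x y z)"
  by (rule I4_from[of "\<lambda>x y z. cK \<bullet> F x y z"]) (simp_all add: I3_app I3_const cK_app[OF refuted])

lemma I4_last: "I4 (\<lambda>x y z w. w)"
proof -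
  obtain f :: "('d, 'd) fn" where "\<And>x. f \<bullet> x = x" using I1_var unfolding I1_def by blast
  then show ?thesis by (intro I4_from[of "\<lambda>x y z. f"] I3_const)
qed

lemma I4_app: "I4 F \<Longrightarrow> I4 G \<Longrightarrow> I4 (\<lambda>x y z w. F x y z w \<bullet> G x y z w)"
proof -
  assume "I4 F" "I4 G"
  then obtain f g where "\<And>x y z w. f \<bullet> x \<bullet> y \<bullet> z \<bullet> w = F x y z w" "\<And>x y z w. g \<bullet> x \<bullet> y \<bullet> z \<bullet> w = G x y z w" unfolding I4_def by blast
  moreover have "I3 (\<lambda>x y z. cS \<bullet> (f \<bullet> x \<bullet> y \<bullet> z) \<bullet> (g \<bullet> x \<bullet> y \<bullet> z))"
    by (intro I3_app I3_const I3_vars)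
  ultimately show ?thesis by (elim I4_from) (simp add: cS_app[OF refuted])
qed

lemmas I4_vars = I3_vars[THEN I4_weak] I4_last

text \<open>Extensionality identifies \<open>lam (F x)\<close> with the value at x of the function
  that represents F, so abstraction stays inside the model.\<close>

lemma I1_lam: "I2 F \<Longrightarrow> I1 (\<lambda>x. lam (F x))"
proof -
  assume F: "I2 F"
  then obtain f where f: "\<And>x y. f \<bullet> x \<bullet> y = F x y" unfolding I2_def by blast
  have "lam (F x) = f \<bullet> x" for x
    by (subst lam_eq) (auto simp: I1_def f[symmetric] intro: exI[of _ "f \<bullet> x"])
  then show ?thesis unfolding I1_def by metis
qed

lemma I2_lam: "I3 F \<Longrightarrow> I2 (\<lambda>x y. lam (F x y))"
proof -
  assume F: "I3 F"
  then obtain f where f: "\<And>x y z. f \<bullet> x \<bullet> y \<bullet> z = F x y z" unfolding I3_def by blast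
  have "lam (F x y) = f \<bullet> x \<bullet> y" for x y
    by (subst lam_eq) (auto simp: I1_def f[symmetric] intro: exI[of _ "f \<bullet> x \<bullet> y"])
  then show ?thesis unfolding I2_def by metis
qed

lemma I3_lam: "I4 F \<Longrightarrow> I3 (\<lambda>x y z. lam (F x y z))"
proof -
  assume F: "I4 F"
  then obtain f where f: "\<And>x y z w. f \<bullet> x \<bullet> y \<bullet> z \<bullet> w = F x y z w" unfolding I4_def by blast
  have "lam (F x y z) = f \<bullet> x \<bullet> y \<bullet> z" for x y z
    by (subst lam_eq) (auto simp: I1_def f[symmetric] intro: exI[of _ "f \<bullet> x \<bullet> y \<bullet> z"])
  then show ?thesis unfolding I3_def by metis
qed

lemma I1_c1: "I1 h \<Longrightarrow> I1 F \<Longrightarrow> I1 (\<lambda>x. h (F x))"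
proof -
  assume "I1 h" and *: "I1 F"
  then obtain g where "\<And>x. g \<bullet> x = h x" unfolding I1_def by blast
  then have h: "h = (\<lambda>x. g \<bullet> x)" by (intro ext) simp
  show ?thesis unfolding h by (intro I1_app I1_const *)
qed

lemma I1_c2: "I2 h \<Longrightarrow> I1 F \<Longrightarrow> I1 G \<Longrightarrow> I1 (\<lambda>x. h (F x) (G x))"
proof -
  assume "I2 h" and *: "I1 F" "I1 G"
  then obtain g where "\<And>x y. g \<bullet> x \<bullet> y = h x y" unfolding I2_def by blast
  then have h: "h = (\<lambda>x y. g \<bullet> x \<bullet> y)" by (intro ext) simp
  show ?thesis unfolding h by (intro I1_app I1_const *)
qed

lemma I1_c3: "I3 h \<Longrightarrow> I1 F \<Longrightarrow> I1 G \<Longrightarrow> I1 H \<Longrightarrow> I1 (\<lambda>x. h (F x) (G x) (H x))"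
proof -
  assume "I3 h" and *: "I1 F" "I1 G" "I1 H"
  then obtain g where "\<And>x y z. g \<bullet> x \<bullet> y \<bullet> z = h x y z" unfolding I3_def by blast
  then have h: "h = (\<lambda>x y z. g \<bullet> x \<bullet> y \<bullet> z)" by (intro ext) simp
  show ?thesis unfolding h by (intro I1_app I1_const *)
qed

lemma I2_c1: "I1 h \<Longrightarrow> I2 F \<Longrightarrow> I2 (\<lambda>x y. h (F x y))"
proof -
  assume "I1 h" and *: "I2 F"
  then obtain g where "\<And>x. g \<bullet> x = h x" unfolding I1_def by blast
  then have h: "h = (\<lambda>x. g \<bullet> x)" by (intro ext) simp
  show ?thesis unfolding h by (intro I2_app I2_const *)
qed

lemma I2_c2: "I2 h \<Longrightarrow> I2 F \<Longrightarrow> I2 G \<Longrightarrow> I2 (\<lambda>x y. h (F x y) (G x y))"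
proof -
  assume "I2 h" and *: "I2 F" "I2 G"
  then obtain g where "\<And>x y. g \<bullet> x \<bullet> y = h x y" unfolding I2_def by blast
  then have h: "h = (\<lambda>x y. g \<bullet> x \<bullet> y)" by (intro ext) simp
  show ?thesis unfolding h by (intro I2_app I2_const *)
qed

lemma I2_c3: "I3 h \<Longrightarrow> I2 F \<Longrightarrow> I2 G \<Longrightarrow> I2 H \<Longrightarrow> I2 (\<lambda>x y. h (F x y) (G x y) (H x y))"
proof -
  assume "I3 h" and *: "I2 F" "I2 G" "I2 H"
  then obtain g where "\<And>x y z. g \<bullet> x \<bullet> y \<bullet> z = h x y z" unfolding I3_def by blast
  then have h: "h = (\<lambda>x y z. g \<bullet> x \<bullet> y \<bullet> z)" by (intro ext) simp
  show ?thesis unfolding h by (intro I2_app I2_const *)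
qed

lemma I3_c1: "I1 h \<Longrightarrow> I3 F \<Longrightarrow> I3 (\<lambda>x y z. h (F x y z))"
proof -
  assume "I1 h" and *: "I3 F"
  then obtain g where "\<And>x. g \<bullet> x = h x" unfolding I1_def by blast
  then have h: "h = (\<lambda>x. g \<bullet> x)" by (intro ext) simp
  show ?thesis unfolding h by (intro I3_app I3_const *)
qed

lemma I3_c2: "I2 h \<Longrightarrow> I3 F \<Longrightarrow> I3 G \<Longrightarrow> I3 (\<lambda>x y z. h (F x y z) (G x y z))"
proof -
  assume "I2 h" and *: "I3 F" "I3 G"
  then obtain g where "\<And>x y. g \<bullet> x \<bullet> y = h x y" unfolding I2_def by blast
  then have h: "h = (\<lambda>x y. g \<bullet> x \<bullet> y)" by (intro ext) simp
  show ?thesis unfolding h by (intro I3_app I3_const *)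
qed

lemma I4_c1: "I1 h \<Longrightarrow> I4 F \<Longrightarrow> I4 (\<lambda>x y z w. h (F x y z w))"
proof -
  assume "I1 h" and *: "I4 F"
  then obtain g where "\<And>x. g \<bullet> x = h x" unfolding I1_def by blast
  then have h: "h = (\<lambda>x. g \<bullet> x)" by (intro ext) simp
  show ?thesis unfolding h by (intro I4_app I4_const *)
qed

lemma I4_c2: "I2 h \<Longrightarrow> I4 F \<Longrightarrow> I4 G \<Longrightarrow> I4 (\<lambda>x y z w. h (F x y z w) (G x y z w))"
proof -
  assume "I2 h" and *: "I4 F" "I4 G"
  then obtain g where "\<And>x y. g \<bullet> x \<bullet> y = h x y" unfolding I2_def by blast
  then have h: "h = (\<lambda>x y. g \<bullet> x \<bullet> y)" by (intro ext) simp
  show ?thesis unfolding h by (intro I4_app I4_const *)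
qed

lemma I4_c3: "I3 h \<Longrightarrow> I4 F \<Longrightarrow> I4 G \<Longrightarrow> I4 H \<Longrightarrow> I4 (\<lambda>x y z w. h (F x y z w) (G x y z w) (H x y z w))"
proof -
  assume "I3 h" and *: "I4 F" "I4 G" "I4 H"
  then obtain g where "\<And>x y z. g \<bullet> x \<bullet> y \<bullet> z = h x y z" unfolding I3_def by blast
  then have h: "h = (\<lambda>x y z. g \<bullet> x \<bullet> y \<bullet> z)" by (intro ext) simp
  show ?thesis unfolding h by (intro I4_app I4_const *)
qed

end

section \<open>Primitive recursion, induction for internal predicates, and truth values as
  numbers\<close>

lemma num_Suc_nz [simp]: "n + 1 \<noteq> (0::num)"
  using add_nonneg_pos[of n "1::num"] by auto

definition prec :: "(num \<Rightarrow> num \<Rightarrow> num) \<Rightarrow> num \<Rightarrow> num \<Rightarrow> num" where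
  "prec G m n = cR \<bullet> (lam (\<lambda>i. lam (G i))) \<bullet> m \<bullet> n"

context counterexample
begin

lemma zero_c0: "(0::num) = c0" and one_c1: "(1::num) = c1"
  and plus_cadd: "(m::num) + n = cadd \<bullet> m \<bullet> n" and times_cmul: "(m::num) * n = cmul \<bullet> m \<bullet> n"
  and less_cls: "(m::num) < n \<longleftrightarrow> cls m n"
  using refuted by (simp_all add: zero_num_def one_num_def plus_num_def times_num_def less_num_def)

lemma num_cases: obtains "n = (0::num)" | k where "n = k + 1"
  using c0_or_succ[OF refuted, of n] by (auto simp: zero_c0 one_c1 plus_cadd)

lemma less_Suc_num: "(m::num) < n + 1 \<longleftrightarrow> m \<le> n"
  using arith(8)[OF refuted, of m n] by (auto simp: less_eq_num_def less_cls plus_cadd one_c1)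

lemma Suc_le_num: "(m::num) + 1 \<le> n \<longleftrightarrow> m < n"
  using less_Suc_num[of n m] by (simp add: not_less[symmetric])

lemma less_one_num: "(n::num) < 1 \<longleftrightarrow> n = 0"
  using less_Suc_num[of n 0] by (auto simp: antisym)

lemma I2_plus: "I2 ((+) :: num \<Rightarrow> num \<Rightarrow> num)" and I2_times: "I2 ((*) :: num \<Rightarrow> num \<Rightarrow> num)"
  unfolding I2_def by (simp_all add: plus_cadd times_cmul) blast+

lemma I2D: "I2 F \<Longrightarrow> I1 (F x)"
  unfolding I1_def I2_def by blast

lemma prec: "I2 G \<Longrightarrow> prec G m 0 = m" "I2 G \<Longrightarrow> prec G m (n + 1) = G n (prec G m n)"
proof -
  show "I2 G \<Longrightarrow> prec G m 0 = m" by (simp add: prec_def zero_c0 cR_app[OF refuted])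
  assume G: "I2 G"
  have "lam (\<lambda>i. lam (G i)) \<bullet> n \<bullet> a = G n a" for a
    using I1_lam[OF G] I2D[OF G] by simp
  then show "prec G m (n + 1) = G n (prec G m n)"
    by (simp add: prec_def plus_cadd one_c1 cR_app[OF refuted])
qed

lemma num_induct_eq:
  assumes "I1 (F :: num \<Rightarrow> num)" "I1 G" "F 0 = G 0" "\<And>n. F n = G n \<Longrightarrow> F (n + 1) = G (n + 1)"
  shows "F n = G n"
proof -
  obtain f g where f: "\<And>x. f \<bullet> x = F x" and g: "\<And>x. g \<bullet> x = G x"
    using assms(1,2) unfolding I1_def by blast
  show ?thesis
    using formula_induct[OF refuted, of "Eq (Var 1 T1 \<cdot> Var 0 Nt) (Var 2 T1 \<cdot> Var 0 Nt)"
        "e0((1, T1) := rp f, (2, T1) := rp g)" n] assms(3,4)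
    by (simp add: f g zero_c0[symmetric] one_c1[symmetric] plus_cadd[symmetric])
qed

text \<open>An internal characteristic function turns P into an equation between values of two
  functions of the model, and for equations quantifier-free induction is enough.\<close>

lemma num_induct:
  assumes "I1 (\<lambda>n. of_bool (P n) :: num)" "P 0" "\<And>n. P n \<Longrightarrow> P (n + 1)"
  shows "P (n::num)"
proof -
  have "of_bool (P n) = (1::num)"
    by (rule num_induct_eq[OF assms(1) I1_const]) (use assms(2,3) in \<open>auto simp: of_bool_def split: if_splits\<close>)
  then show ?thesis by (simp split: if_splits)
qed

lemma I2_minus: "I2 ((-) :: num \<Rightarrow> num \<Rightarrow> num)"
proof -
  define pd where "pd = cR \<bullet> cK \<bullet> c0"
  have "pd \<bullet> 0 = 0" "pd \<bullet> (n + 1) = n" for n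
    by (simp_all add: pd_def cR_app[OF refuted] cK_app[OF refuted] zero_c0 one_c1 plus_cadd)
  note pd = this
  define mo where "mo m = cR \<bullet> (cK \<bullet> pd) \<bullet> m" for m
  have mo: "mo m \<bullet> 0 = m" "mo m \<bullet> (k + 1) = pd \<bullet> (mo m \<bullet> k)" for m k
    by (simp_all add: mo_def cR_app[OF refuted] cK_app[OF refuted] zero_c0 one_c1 plus_cadd)
  \<comment> \<open>Truncated difference expressed by addition and order, since the language has no
    subtraction.\<close>
  let ?A = "Disj (Eq (Var 2 T1 \<cdot> Var 0 Nt \<oplus> Var 0 Nt) (Var 1 Nt))
      (Conj (Less (Var 1 Nt) (Var 0 Nt)) (Eq (Var 2 T1 \<cdot> Var 0 Nt) Zero))"
  have st: "mo m \<bullet> (k + 1) + (k + 1) = m \<or> m < k + 1 \<and> mo m \<bullet> (k + 1) = 0"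
    if "mo m \<bullet> k + k = m \<or> m < k \<and> mo m \<bullet> k = 0" for m k
  proof (cases "mo m \<bullet> k" rule: num_cases)
    case 1
    then show ?thesis using that by (auto simp: mo pd less_Suc_num)
  next
    case (2 l)
    have "l + 1 \<noteq> 0" by (simp add: zero_c0 one_c1 plus_cadd arith(1)[OF refuted])
    then show ?thesis using that 2 pd(2)[of l] mo(2)[of m k] by (auto simp: add.assoc add.commute[of k 1])
  qed
  have "mo m \<bullet> n + n = m \<or> m < n \<and> mo m \<bullet> n = 0" for m n
    using formula_induct[OF refuted, of ?A "e0((1, Nt) := rp m, (2, T1) := rp (mo m))" n] st[of m]
    by (simp add: zero_c0[symmetric] one_c1[symmetric] plus_cadd[symmetric] less_cls[symmetric] mo)
  then have "mo m \<bullet> n = m - n" for m n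
    by (metis add_diff_cancel_right' num_diff0 order_less_imp_le)
  moreover have "I1 mo" unfolding mo_def by (intro I1_app I1_const I1_var)
  ultimately show ?thesis by (intro I2_from) auto
qed

end

text \<open>With truncated subtraction for negation, closure under the connectives follows from
  closure under arithmetic.\<close>

lemma of_bool_num:
  "of_bool (\<not> P) = 1 - (of_bool P :: num)"
  "of_bool (P \<and> Q) = of_bool P * (of_bool Q :: num)"
  "of_bool (P \<or> Q) = 1 - (1 - of_bool P) * (1 - of_bool Q :: num)"
  "of_bool (P \<longrightarrow> Q) = 1 - of_bool P * (1 - of_bool Q :: num)"
  "of_bool (P \<longleftrightarrow> Q) = of_bool P * of_bool Q + (1 - of_bool P) * (1 - of_bool Q :: num)"
  by (cases P; cases Q; simp)+

lemma num_le_diff0: "m - n = 0 \<longleftrightarrow> m \<le> (n::num)"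
  using num_diff0[of m n] le_add_diff_inverse2[of n m] by (metis add_0 linear order_refl)

lemma (in counterexample) of_bool_le_num: "of_bool (m \<le> n) = 1 - (m - (n::num))"
proof -
  have "1 \<le> m - n" if "\<not> m \<le> n"
    using that num_le_diff0[of m n] less_one_num[of "m - n"] by (simp add: not_less[symmetric])
  then show ?thesis using num_le_diff0[of m n] by (cases "m \<le> n") (simp_all add: num_diff0)
qed

lemma if_num: "(if P then a else b) = of_bool P * a + (1 - of_bool P) * (b::num)"
  by simp

context counterexample
begin

lemma I1_arith:
  fixes F G :: "'a::mty \<Rightarrow> num"
  shows "I1 F \<Longrightarrow> I1 G \<Longrightarrow> I1 (\<lambda>x. F x + G x)"
    and "I1 F \<Longrightarrow> I1 G \<Longrightarrow> I1 (\<lambda>x. F x * G x)"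
    and "I1 F \<Longrightarrow> I1 G \<Longrightarrow> I1 (\<lambda>x. F x - G x)"
  by (erule I1_c2[OF I2_plus] I1_c2[OF I2_times] I1_c2[OF I2_minus], assumption)+

lemma I1_bool:
  shows "I1 (\<lambda>x. of_bool (P x) :: num) \<Longrightarrow> I1 (\<lambda>x. of_bool (\<not> P x) :: num)"
  and "I1 (\<lambda>x. of_bool (P x) :: num) \<Longrightarrow> I1 (\<lambda>x. of_bool (Q x) :: num) \<Longrightarrow> I1 (\<lambda>x. of_bool (P x \<and> Q x) :: num)"
  and "I1 (\<lambda>x. of_bool (P x) :: num) \<Longrightarrow> I1 (\<lambda>x. of_bool (Q x) :: num) \<Longrightarrow> I1 (\<lambda>x. of_bool (P x \<or> Q x) :: num)"
  and "I1 (\<lambda>x. of_bool (P x) :: num) \<Longrightarrow> I1 (\<lambda>x. of_bool (Q x) :: num) \<Longrightarrow> I1 (\<lambda>x. of_bool (P x \<longrightarrow> Q x) :: num)"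
  and "I1 (\<lambda>x. of_bool (P x) :: num) \<Longrightarrow> I1 (\<lambda>x. of_bool (Q x) :: num) \<Longrightarrow> I1 (\<lambda>x. of_bool (P x \<longleftrightarrow> Q x) :: num)"
  unfolding of_bool_num by (intro I1_arith I1_const; assumption)+

lemma I1_if: "I1 (\<lambda>x. of_bool (P x) :: num) \<Longrightarrow> I1 (\<lambda>x. F x :: num) \<Longrightarrow> I1 (\<lambda>x. G x :: num) \<Longrightarrow> I1 (\<lambda>x. if P x then F x else G x :: num)"
  unfolding if_num by (intro I1_arith I1_const; assumption)

lemma I1_le: "I1 (\<lambda>x. F x :: num) \<Longrightarrow> I1 (\<lambda>x. G x :: num) \<Longrightarrow> I1 (\<lambda>x. of_bool (F x \<le> G x) :: num)"
  unfolding of_bool_le_num by (intro I1_arith I1_const)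

lemma I1_cmp:
  assumes "I1 (\<lambda>x. F x :: num)" "I1 (\<lambda>x. G x :: num)"
  shows "I1 (\<lambda>x. of_bool (F x < G x) :: num)" and "I1 (\<lambda>x. of_bool (F x = G x) :: num)"
  unfolding not_le[symmetric] eq_iff by (intro I1_bool I1_le assms)+

lemma I2_arith:
  fixes F G :: "'a::mty \<Rightarrow> 'b::mty \<Rightarrow> num"
  shows "I2 F \<Longrightarrow> I2 G \<Longrightarrow> I2 (\<lambda>x y. F x y + G x y)"
    and "I2 F \<Longrightarrow> I2 G \<Longrightarrow> I2 (\<lambda>x y. F x y * G x y)"
    and "I2 F \<Longrightarrow> I2 G \<Longrightarrow> I2 (\<lambda>x y. F x y - G x y)"
  by (erule I2_c2[OF I2_plus] I2_c2[OF I2_times] I2_c2[OF I2_minus], assumption)+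

lemma I2_bool:
  shows "I2 (\<lambda>x y. of_bool (P x y) :: num) \<Longrightarrow> I2 (\<lambda>x y. of_bool (\<not> P x y) :: num)"
  and "I2 (\<lambda>x y. of_bool (P x y) :: num) \<Longrightarrow> I2 (\<lambda>x y. of_bool (Q x y) :: num) \<Longrightarrow> I2 (\<lambda>x y. of_bool (P x y \<and> Q x y) :: num)"
  and "I2 (\<lambda>x y. of_bool (P x y) :: num) \<Longrightarrow> I2 (\<lambda>x y. of_bool (Q x y) :: num) \<Longrightarrow> I2 (\<lambda>x y. of_bool (P x y \<or> Q x y) :: num)"
  and "I2 (\<lambda>x y. of_bool (P x y) :: num) \<Longrightarrow> I2 (\<lambda>x y. of_bool (Q x y) :: num) \<Longrightarrow> I2 (\<lambda>x y. of_bool (P x y \<longrightarrow> Q x y) :: num)"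
  and "I2 (\<lambda>x y. of_bool (P x y) :: num) \<Longrightarrow> I2 (\<lambda>x y. of_bool (Q x y) :: num) \<Longrightarrow> I2 (\<lambda>x y. of_bool (P x y \<longleftrightarrow> Q x y) :: num)"
  unfolding of_bool_num by (intro I2_arith I2_const; assumption)+

lemma I2_if: "I2 (\<lambda>x y. of_bool (P x y) :: num) \<Longrightarrow> I2 (\<lambda>x y. F x y :: num) \<Longrightarrow> I2 (\<lambda>x y. G x y :: num) \<Longrightarrow> I2 (\<lambda>x y. if P x y then F x y else G x y :: num)"
  unfolding if_num by (intro I2_arith I2_const; assumption)

lemma I2_le: "I2 (\<lambda>x y. F x y :: num) \<Longrightarrow> I2 (\<lambda>x y. G x y :: num) \<Longrightarrow> I2 (\<lambda>x y. of_bool (F x y \<le> G x y) :: num)"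
  unfolding of_bool_le_num by (intro I2_arith I2_const)

lemma I2_cmp:
  assumes "I2 (\<lambda>x y. F x y :: num)" "I2 (\<lambda>x y. G x y :: num)"
  shows "I2 (\<lambda>x y. of_bool (F x y < G x y) :: num)" and "I2 (\<lambda>x y. of_bool (F x y = G x y) :: num)"
  unfolding not_le[symmetric] eq_iff by (intro I2_bool I2_le assms)+

lemma I3_arith:
  fixes F G :: "'a::mty \<Rightarrow> 'b::mty \<Rightarrow> 'c::mty \<Rightarrow> num"
  shows "I3 F \<Longrightarrow> I3 G \<Longrightarrow> I3 (\<lambda>x y z. F x y z + G x y z)"
    and "I3 F \<Longrightarrow> I3 G \<Longrightarrow> I3 (\<lambda>x y z. F x y z * G x y z)"
    and "I3 F \<Longrightarrow> I3 G \<Longrightarrow> I3 (\<lambda>x y z. F x y z - G x y z)"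
  by (erule I3_c2[OF I2_plus] I3_c2[OF I2_times] I3_c2[OF I2_minus], assumption)+

lemma I3_bool:
  shows "I3 (\<lambda>x y z. of_bool (P x y z) :: num) \<Longrightarrow> I3 (\<lambda>x y z. of_bool (\<not> P x y z) :: num)"
  and "I3 (\<lambda>x y z. of_bool (P x y z) :: num) \<Longrightarrow> I3 (\<lambda>x y z. of_bool (Q x y z) :: num) \<Longrightarrow> I3 (\<lambda>x y z. of_bool (P x y z \<and> Q x y z) :: num)"
  and "I3 (\<lambda>x y z. of_bool (P x y z) :: num) \<Longrightarrow> I3 (\<lambda>x y z. of_bool (Q x y z) :: num) \<Longrightarrow> I3 (\<lambda>x y z. of_bool (P x y z \<or> Q x y z) :: num)"
  and "I3 (\<lambda>x y z. of_bool (P x y z) :: num) \<Longrightarrow> I3 (\<lambda>x y z. of_bool (Q x y z) :: num) \<Longrightarrow> I3 (\<lambda>x y z. of_bool (P x y z \<longrightarrow> Q x y z) :: num)"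
  and "I3 (\<lambda>x y z. of_bool (P x y z) :: num) \<Longrightarrow> I3 (\<lambda>x y z. of_bool (Q x y z) :: num) \<Longrightarrow> I3 (\<lambda>x y z. of_bool (P x y z \<longleftrightarrow> Q x y z) :: num)"
  unfolding of_bool_num by (intro I3_arith I3_const; assumption)+

lemma I3_if: "I3 (\<lambda>x y z. of_bool (P x y z) :: num) \<Longrightarrow> I3 (\<lambda>x y z. F x y z :: num) \<Longrightarrow> I3 (\<lambda>x y z. G x y z :: num) \<Longrightarrow> I3 (\<lambda>x y z. if P x y z then F x y z else G x y z :: num)"
  unfolding if_num by (intro I3_arith I3_const; assumption)

lemma I3_le: "I3 (\<lambda>x y z. F x y z :: num) \<Longrightarrow> I3 (\<lambda>x y z. G x y z :: num) \<Longrightarrow> I3 (\<lambda>x y z. of_bool (F x y z \<le> G x y z) :: num)"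
  unfolding of_bool_le_num by (intro I3_arith I3_const)

lemma I3_cmp:
  assumes "I3 (\<lambda>x y z. F x y z :: num)" "I3 (\<lambda>x y z. G x y z :: num)"
  shows "I3 (\<lambda>x y z. of_bool (F x y z < G x y z) :: num)" and "I3 (\<lambda>x y z. of_bool (F x y z = G x y z) :: num)"
  unfolding not_le[symmetric] eq_iff by (intro I3_bool I3_le assms)+

lemma I4_arith:
  fixes F G :: "'a::mty \<Rightarrow> 'b::mty \<Rightarrow> 'c::mty \<Rightarrow> 'd::mty \<Rightarrow> num"
  shows "I4 F \<Longrightarrow> I4 G \<Longrightarrow> I4 (\<lambda>x y z w. F x y z w + G x y z w)"
    and "I4 F \<Longrightarrow> I4 G \<Longrightarrow> I4 (\<lambda>x y z w. F x y z w * G x y z w)"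
    and "I4 F \<Longrightarrow> I4 G \<Longrightarrow> I4 (\<lambda>x y z w. F x y z w - G x y z w)"
  by (erule I4_c2[OF I2_plus] I4_c2[OF I2_times] I4_c2[OF I2_minus], assumption)+

lemma I4_bool:
  shows "I4 (\<lambda>x y z w. of_bool (P x y z w) :: num) \<Longrightarrow> I4 (\<lambda>x y z w. of_bool (\<not> P x y z w) :: num)"
  and "I4 (\<lambda>x y z w. of_bool (P x y z w) :: num) \<Longrightarrow> I4 (\<lambda>x y z w. of_bool (Q x y z w) :: num) \<Longrightarrow> I4 (\<lambda>x y z w. of_bool (P x y z w \<and> Q x y z w) :: num)"
  and "I4 (\<lambda>x y z w. of_bool (P x y z w) :: num) \<Longrightarrow> I4 (\<lambda>x y z w. of_bool (Q x y z w) :: num) \<Longrightarrow> I4 (\<lambda>x y z w. of_bool (P x y z w \<or> Q x y z w) :: num)"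
  and "I4 (\<lambda>x y z w. of_bool (P x y z w) :: num) \<Longrightarrow> I4 (\<lambda>x y z w. of_bool (Q x y z w) :: num) \<Longrightarrow> I4 (\<lambda>x y z w. of_bool (P x y z w \<longrightarrow> Q x y z w) :: num)"
  and "I4 (\<lambda>x y z w. of_bool (P x y z w) :: num) \<Longrightarrow> I4 (\<lambda>x y z w. of_bool (Q x y z w) :: num) \<Longrightarrow> I4 (\<lambda>x y z w. of_bool (P x y z w \<longleftrightarrow> Q x y z w) :: num)"
  unfolding of_bool_num by (intro I4_arith I4_const; assumption)+

lemma I4_if: "I4 (\<lambda>x y z w. of_bool (P x y z w) :: num) \<Longrightarrow> I4 (\<lambda>x y z w. F x y z w :: num) \<Longrightarrow> I4 (\<lambda>x y z w. G x y z w :: num) \<Longrightarrow> I4 (\<lambda>x y z w. if P x y z w then F x y z w else G x y z w :: num)"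
  unfolding if_num by (intro I4_arith I4_const; assumption)

lemma I4_le: "I4 (\<lambda>x y z w. F x y z w :: num) \<Longrightarrow> I4 (\<lambda>x y z w. G x y z w :: num) \<Longrightarrow> I4 (\<lambda>x y z w. of_bool (F x y z w \<le> G x y z w) :: num)"
  unfolding of_bool_le_num by (intro I4_arith I4_const)

lemma I4_cmp:
  assumes "I4 (\<lambda>x y z w. F x y z w :: num)" "I4 (\<lambda>x y z w. G x y z w :: num)"
  shows "I4 (\<lambda>x y z w. of_bool (F x y z w < G x y z w) :: num)" and "I4 (\<lambda>x y z w. of_bool (F x y z w = G x y z w) :: num)"
  unfolding not_le[symmetric] eq_iff by (intro I4_bool I4_le assms)+

lemma I1_prec: "I3 G \<Longrightarrow> I1 F \<Longrightarrow> I1 H \<Longrightarrow> I1 (\<lambda>x. prec (G x) (F x) (H x))"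
  unfolding prec_def by (intro I1_app I1_const I1_lam I2_lam)

lemmas I1_rules = I1_const I1_var I1_arith I1_bool I1_if I1_le I1_cmp I1_lam I1_app

lemma I2_prec: "I4 G \<Longrightarrow> I2 F \<Longrightarrow> I2 H \<Longrightarrow> I2 (\<lambda>x y. prec (G x y) (F x y) (H x y))"
  unfolding prec_def by (intro I2_app I2_const I2_lam I3_lam)

lemmas I2_rules = I2_const I2_vars I2_arith I2_bool I2_if I2_le I2_cmp I2_lam I2_app

lemmas I3_rules = I3_const I3_vars I3_arith I3_bool I3_if I3_le I3_cmp I3_lam I3_app

lemmas I4_rules = I4_const I4_vars I4_arith I4_bool I4_if I4_le I4_cmp I4_app

end

context counterexample
begin

lemmas I_rules = I1_rules I2_rules I3_rules I4_rules I1_prec I2_prec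
lemmas nind = num_induct
lemmas prec_eqs [simp] = prec
lemmas less_Suc = less_Suc_num Suc_le_num

lemma I2_fst: "I1 F \<Longrightarrow> I2 (\<lambda>x y. F x)" by (rule I2_weak)
lemma I2_snd: "I1 F \<Longrightarrow> I2 (\<lambda>x y. F y)" by (rule I2_c1[OF _ I2_last])

text \<open>A bounded universal quantifier is a product of truth values. The two directions are
  separate inductions on the partial products, so that the quantifier itself stays out of the
  induction formula.\<close>

lemma prec_all:
  assumes P: "I1 (\<lambda>i. of_bool (P i) :: num)"
  shows "prec (\<lambda>i a. a * of_bool (P i)) 1 n = of_bool (\<forall>i<n. P i)"
proof -
  let ?G = "\<lambda>i a. a * of_bool (P i) :: num"
  let ?b = "prec ?G 1"
  have G: "I2 ?G" by (intro I_rules I2_fst P)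
  have 1: "?b n = 0 \<or> ?b n = 1" for n
    by (rule nind[where P = "\<lambda>n. ?b n = 0 \<or> ?b n = 1"])
      (intro I_rules I3_c1[OF P], use prec_eqs[OF G] in auto)
  have 2: "?b j = 1" if "\<forall>i<n. P i" "j \<le> n" for j n
  proof -
    have "j \<le> n \<longrightarrow> ?b j = 1"
      by (rule nind[where P = "\<lambda>j. j \<le> n \<longrightarrow> ?b j = 1"])
        (intro I_rules I3_c1[OF P], use prec_eqs[OF G] that in \<open>auto simp: less_Suc\<close>)
    then show ?thesis using that by blast
  qed
  have 3: "P i" if "i < n" "?b n = 1" for i n
  proof -
    have "i < j \<and> ?b j = 1 \<longrightarrow> P i" for j
      by (rule nind[where P = "\<lambda>j. i < j \<and> ?b j = 1 \<longrightarrow> P i"])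
        (intro I_rules I3_c1[OF P] P, use prec_eqs[OF G] 1 in \<open>auto simp: less_Suc order_le_less of_bool_def split: if_splits\<close>)
    then show ?thesis using that by blast
  qed
  show ?thesis using 1[of n] 2[of n n] 3[of _ n] by (auto simp: of_bool_def)
qed

lemma I2_ball:
  assumes P: "I3 (\<lambda>x y (i::num). of_bool (P x y i) :: num)" and N: "I2 N"
  shows "I2 (\<lambda>x y. of_bool (\<forall>i<N x y. P x y i) :: num)"
proof -
  have "I2 (\<lambda>x y. prec (\<lambda>i a. a * of_bool (P x y i)) 1 (N x y))"
    by (intro I_rules I4_c3[OF P] N)
  moreover have "I1 (\<lambda>i. of_bool (P x y i) :: num)" for x y
    using P unfolding I3_def I1_def by blast
  ultimately show ?thesis by (simp add: prec_all)
qed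

lemma choice10:
  assumes P: "I2 (\<lambda>f n. of_bool (P f n) :: num)" and ex: "\<And>f::t1. \<exists>n::num. P f n"
  shows "\<exists>Y::t2. \<forall>f. P f (Y \<bullet> f)"
proof -
  obtain c :: "(t1, t1) fn" where c: "\<And>f n. c \<bullet> f \<bullet> n = of_bool (P f n)"
    using P unfolding I2_def by blast
  let ?A = "Eq (Var 3 (T1 \<rightarrow> T1) \<cdot> Var 0 T1 \<cdot> Var 1 Nt) One"
  have "\<exists>Y::t2. \<forall>f::t1. sat M0 (e0((3, T1 \<rightarrow> T1) := rp c, (2, T2) := rp Y, (0, T1) := rp f, (1, Nt) := rp (Y \<bullet> f))) ?A"
    by (rule formula_choice[OF refuted]) (use ex in \<open>simp_all add: c one_c1[symmetric]\<close>)
  then show ?thesis by (simp add: c one_c1[symmetric])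
qed

text \<open>Choice in the base theory assigns numbers to functions; m is coded as the constant
  function with value m and read off at 0.\<close>

lemma choice00:
  assumes P: "I2 (\<lambda>m n. of_bool (P m n) :: num)" and ex: "\<And>m::num. \<exists>n::num. P m n"
  shows "\<exists>g. I1 g \<and> (\<forall>m. P m (g m))"
proof -
  have "I2 (\<lambda>f n. of_bool (P (f \<bullet> 0) n) :: num)" by (intro I2_c2[OF P] I_rules)
  then obtain Y :: t2 where "\<forall>f. P (f \<bullet> 0) (Y \<bullet> f)" using choice10[of "\<lambda>f. P (f \<bullet> 0)"] ex by blast
  then have "P m (Y \<bullet> (cK \<bullet> m))" for m by (metis cK_app[OF refuted])
  moreover have "I1 (\<lambda>m. Y \<bullet> (cK \<bullet> m))" by (intro I_rules)
  ultimately show ?thesis by blast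
qed

end

section \<open>Cantor pairing and its projections\<close>

definition tri :: "num \<Rightarrow> num" where "tri = prec (\<lambda>i a. a + (i + 1)) 0"
definition pair :: "num \<Rightarrow> num \<Rightarrow> num" where "pair x y = tri (x + y) + y"
text \<open>The largest t with \<open>tri t \<le> n\<close>. It grows by at most one when n does, so
  recursion on n computes it.\<close>

definition troot :: "num \<Rightarrow> num" where
  "troot = prec (\<lambda>i a. if tri (a + 1) \<le> i + 1 then a + 1 else a) 0"
definition pi2 :: "num \<Rightarrow> num" where "pi2 n = n - tri (troot n)"
definition pi1 :: "num \<Rightarrow> num" where "pi1 n = troot n - pi2 n"

context counterexample
begin

lemma I1_tri: "I1 tri"
  unfolding tri_def by (rule I1_prec[where H = "\<lambda>x. x" and F = "\<lambda>_. 0"]) (intro I_rules)+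

lemma tri: "tri 0 = 0" "tri (n + 1) = tri n + (n + 1)"
  unfolding tri_def by (rule prec, intro I_rules)+

lemma I1_troot: "I1 troot"
  unfolding troot_def
  by (rule I1_prec[where H = "\<lambda>x. x" and F = "\<lambda>_. 0"])
    (intro I_rules I3_c1[OF I1_tri])+

lemma troot: "troot 0 = 0" "troot (n + 1) = (if tri (troot n + 1) \<le> n + 1 then troot n + 1 else troot n)"
  unfolding troot_def by (rule prec, intro I_rules I2_c1[OF I1_tri])+

lemma tri_double: "tri n + tri n = n * (n + 1)"
  by (rule nind[where P = "\<lambda>n. tri n + tri n = n * (n + 1)"])
    (intro I_rules I1_c1[OF I1_tri], auto simp: tri algebra_simps simp del: one_add_one)

lemma tri_mono: "m \<le> n \<Longrightarrow> tri m \<le> tri n"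
proof -
  have "m \<le> n \<longrightarrow> tri m \<le> tri n"
    by (rule nind[where P = "\<lambda>n. m \<le> n \<longrightarrow> tri m \<le> tri n"])
      (intro I_rules I1_c1[OF I1_tri],
        auto simp: tri le_less[of m] less_Suc_num intro: order_trans)
  then show "m \<le> n \<Longrightarrow> ?thesis" by blast
qed

lemma troot_bounds: "tri (troot n) \<le> n \<and> n < tri (troot n + 1)"
proof (rule nind[where P = "\<lambda>n. tri (troot n) \<le> n \<and> n < tri (troot n + 1)"])
  fix n assume *: "tri (troot n) \<le> n \<and> n < tri (troot n + 1)"
  show "tri (troot (n + 1)) \<le> n + 1 \<and> n + 1 < tri (troot (n + 1) + 1)"
  proof (cases "tri (troot n + 1) \<le> n + 1")
    case True
    have "n + 1 \<le> tri (troot n + 1)" using * by (simp add: Suc_le_num)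
    also have "\<dots> < tri (troot n + 1 + 1)" unfolding tri(2)[of "troot n + 1"] by simp
    finally show ?thesis using True by (simp add: troot)
  next
    case False
    then show ?thesis using * by (auto simp: troot intro: order_trans)
  qed
qed (intro I_rules I1_c1[OF I1_tri] I1_c1[OF I1_troot], use tri(2)[of 0] in \<open>simp add: tri troot\<close>)

lemma troot_pair: "troot (pair x y) = x + y"
proof -
  let ?s = "x + y" and ?n = "pair x y" and ?t = "troot (pair x y)"
  have 1: "tri ?s \<le> ?n" by (simp add: pair_def)
  have 2: "?n < tri (?s + 1)" unfolding pair_def tri using less_Suc_num[of y "x + y"] by simp
  have "\<not> ?t < ?s" using 1 tri_mono[of "?t + 1" ?s] troot_bounds[of ?n] by (auto simp: Suc_le_num)
  moreover have "\<not> ?s < ?t" using 2 tri_mono[of "?s + 1" ?t] troot_bounds[of ?n] by (auto simp: Suc_le_num)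
  ultimately show ?thesis by simp
qed

lemma pi_pair [simp]: "pi1 (pair x y) = x" "pi2 (pair x y) = y"
proof -
  show "pi2 (pair x y) = y" by (simp add: pi2_def troot_pair) (simp add: pair_def)
  then show "pi1 (pair x y) = x" by (simp add: pi1_def troot_pair)
qed

lemma pair_pi [simp]: "pair (pi1 n) (pi2 n) = n"
proof -
  have 1: "tri (troot n) + pi2 n = n" using troot_bounds[of n] by (simp add: pi2_def le_add_diff_inverse)
  have "tri (troot n) + pi2 n < tri (troot n) + (troot n + 1)"
    unfolding 1 using troot_bounds[of n] by (simp add: tri)
  then have "pi2 n \<le> troot n" by (simp add: less_Suc_num)
  then have "pi1 n + pi2 n = troot n" by (simp add: pi1_def le_add_diff_inverse2)
  then show ?thesis using 1 by (simp add: pair_def)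
qed

text \<open>The formula of the language avoids division by doubling; \<open>tri_double\<close>
  translates it, and doubling is injective.\<close>

lemma pair_code_num: "n + n = (x + y) * (x + y + 1) + (y + y) \<longleftrightarrow> n = pair x y"
proof -
  have d: "m + m = k + k \<longleftrightarrow> m = k" for m k :: num
    by (metis add_strict_mono less_irrefl linorder_less_linear)
  have "(x + y) * (x + y + 1) + (y + y) = pair x y + pair x y"
    unfolding tri_double[symmetric] by (simp add: pair_def ac_simps)
  then show ?thesis using d by metis
qed

lemma pair_eq_iff: "n = pair x y \<longleftrightarrow> x = pi1 n \<and> y = pi2 n"
  using pi_pair pair_pi by metis

lemma I2_pair: "I2 pair" and I1_pi2: "I1 pi2" and I1_pi1: "I1 pi1"
proof -
  show "I2 pair" unfolding pair_def by (intro I_rules I2_c1[OF I1_tri])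
  show 2: "I1 pi2" unfolding pi2_def by (intro I_rules I1_c1[OF I1_tri] I1_c1[OF I1_troot])
  show "I1 pi1" unfolding pi1_def
    by (intro I_rules I1_c1[OF 2] I1_c1[OF I1_troot])
qed

lemmas I_pair = I1_c2[OF I2_pair] I2_c2[OF I2_pair] I3_c2[OF I2_pair] I4_c2[OF I2_pair]
  I1_c1[OF I1_pi1] I2_c1[OF I1_pi1] I3_c1[OF I1_pi1] I4_c1[OF I1_pi1]
  I1_c1[OF I1_pi2] I2_c1[OF I1_pi2] I3_c1[OF I1_pi2] I4_c1[OF I1_pi2]

end

section \<open>Differences, fractions and Cauchy completion\<close>

definition grel :: "'a::linordered_semidom \<times> 'a \<Rightarrow> 'a \<times> 'a \<Rightarrow> bool" where
  "grel = (\<lambda>(a, b) (c, d). a + d = c + b)"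

\<comment> \<open>Pairs stand for differences. These are the integers over the numbers of the model,
  and their fraction field will be its rationals.\<close>
quotient_type (overloaded) 'a gint = "'a::linordered_semidom \<times> 'a" / grel morphisms rep_gi abs_gi
proof (rule equivpI)
  show "reflp (grel :: 'a \<times> 'a \<Rightarrow> _)" by (auto simp: reflp_def grel_def)
  show "symp (grel :: 'a \<times> 'a \<Rightarrow> _)" by (auto simp: symp_def grel_def ac_simps)
  show "transp (grel :: 'a \<times> 'a \<Rightarrow> _)"
  proof (rule transpI, clarsimp simp: grel_def)
    fix a b c d e f :: 'a
    assume "a + d = c + b" "c + f = e + d"
    then have "(a + f) + (c + d) = (e + b) + (c + d)" by (simp add: ac_simps) (metis add.assoc add.commute)
    then show "a + f = e + b" by simp
  qed
qed

instantiation gint :: (linordered_semidom) comm_ring_1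
begin

lift_definition zero_gint :: "'a gint" is "(0, 0)" .
lift_definition one_gint :: "'a gint" is "(1, 0)" .
lift_definition plus_gint :: "'a gint \<Rightarrow> 'a gint \<Rightarrow> 'a gint" is "\<lambda>(a, b) (c, d). (a + c, b + d)"
proof (clarsimp simp: grel_def)
  fix a b c d e f g h :: 'a
  assume "a + d = c + b" "e + h = g + f"
  then have "(a + d) + (e + h) = (c + b) + (g + f)" by simp
  then show "a + e + (d + h) = c + g + (b + f)" by (simp add: ac_simps)
qed
lift_definition uminus_gint :: "'a gint \<Rightarrow> 'a gint" is "\<lambda>(a, b). (b, a)"
  by (auto simp: grel_def ac_simps)
definition minus_gint :: "'a gint \<Rightarrow> 'a gint \<Rightarrow> 'a gint" where "minus_gint x y = x + - y"
lift_definition times_gint :: "'a gint \<Rightarrow> 'a gint \<Rightarrow> 'a gint"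
  is "\<lambda>(a, b) (c, d). (a * c + b * d, a * d + b * c)"
proof (clarsimp simp: grel_def)
  fix a b c d e f g h :: 'a
  assume 1: "a + d = c + b" and 2: "e + h = g + f"
  \<comment> \<open>The sum is arranged so that both sides of the goal appear with the same four
    additional products, which then cancel.\<close>
  have "(a + d) * e + (c + b) * f + c * (e + h) + d * (g + f) = (c + b) * e + (a + d) * f + c * (g + f) + d * (e + h)"
    unfolding 1 2 by (simp add: algebra_simps)
  then have "(a * e + b * f + (c * h + d * g)) + (d * e + c * f + c * e + d * f) =
      (c * g + d * h + (a * f + b * e)) + (d * e + c * f + c * e + d * f)"
    by (simp add: algebra_simps)
  then show "a * e + b * f + (c * h + d * g) = c * g + d * h + (a * f + b * e)"
    unfolding add_right_cancel .
qed
instance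
proof
  fix x y z :: "'a gint"
  show "x + y + z = x + (y + z)" by transfer (auto simp: grel_def ac_simps)
  show "x + y = y + x" by transfer (auto simp: grel_def ac_simps)
  show "0 + x = x" by transfer (auto simp: grel_def)
  show "- x + x = 0" by transfer (auto simp: grel_def ac_simps)
  show "x - y = x + - y" by (rule minus_gint_def)
  show "x * y * z = x * (y * z)" by transfer (auto simp: grel_def algebra_simps)
  show "x * y = y * x" by transfer (auto simp: grel_def algebra_simps)
  show "1 * x = x" by transfer (auto simp: grel_def)
  show "(x + y) * z = x * z + y * z" by transfer (auto simp: grel_def algebra_simps)
  show "0 \<noteq> (1 :: 'a gint)" by transfer (auto simp: grel_def)
qed

end

lemma gint_mult_less_aux:
  fixes a b c d e f :: "'a::linordered_semidom"
  assumes 1: "a + d < c + b" and 2: "f < e"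
  shows "e * a + f * b + (e * d + f * c) < e * c + f * d + (e * b + f * a)"
proof -
  from 2 obtain k where k: "e = f + k" "k > 0"
    by (metis add.commute le_add_diff_inverse2 less_imp_le less_add_same_cancel1)
  have "k * (a + d) < k * (c + b)" by (rule mult_strict_left_mono[OF 1 k(2)])
  then have "k * (a + d) + f * (a + b + c + d) < k * (c + b) + f * (a + b + c + d)" by simp
  then show ?thesis unfolding k(1) by (simp add: algebra_simps)
qed

instantiation gint :: (linordered_semidom) linordered_idom
begin

lift_definition less_eq_gint :: "'a gint \<Rightarrow> 'a gint \<Rightarrow> bool" is "\<lambda>(a, b) (c, d). a + d \<le> c + b"
proof (clarsimp simp: grel_def)
  fix a b c d e f g h :: 'a
  assume 1: "a + d = c + b" and 2: "e + h = g + f"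
  have "a + f \<le> e + b \<longleftrightarrow> (a + f) + (d + h) \<le> (e + b) + (d + h)" by simp
  also have "(a + f) + (d + h) = (a + d) + (f + h)" by (simp add: ac_simps)
  also have "\<dots> = (c + h) + (b + f)" unfolding 1 by (simp add: ac_simps)
  also have "(e + b) + (d + h) = (e + h) + (b + d)" by (simp add: ac_simps)
  also have "\<dots> = (g + d) + (b + f)" unfolding 2 by (simp add: ac_simps)
  finally show "(a + f \<le> e + b) = (c + h \<le> g + d)" by simp
qed
definition less_gint :: "'a gint \<Rightarrow> 'a gint \<Rightarrow> bool" where "less_gint x y \<longleftrightarrow> x \<le> y \<and> \<not> y \<le> x"
definition abs_gint :: "'a gint \<Rightarrow> 'a gint" where "abs_gint x = (if x < 0 then - x else x)"
definition sgn_gint :: "'a gint \<Rightarrow> 'a gint" where "sgn_gint x = (if x = 0 then 0 else if 0 < x then 1 else - 1)"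

instance
proof
  fix x y z :: "'a gint"
  show "x < y \<longleftrightarrow> x \<le> y \<and> \<not> y \<le> x" by (rule less_gint_def)
  show "x \<le> x" by transfer auto
  show "x \<le> y \<Longrightarrow> y \<le> z \<Longrightarrow> x \<le> z"
  proof (transfer, clarsimp)
    fix a b c d e f :: 'a
    assume "a + d \<le> c + b" "c + f \<le> e + d"
    then have "(a + d) + (c + f) \<le> (c + b) + (e + d)" by (rule add_mono)
    then have "(a + f) + (c + d) \<le> (e + b) + (c + d)" by (simp add: ac_simps)
    then show "a + f \<le> e + b" by simp
  qed
  show "x \<le> y \<Longrightarrow> y \<le> x \<Longrightarrow> x = y" by transfer (auto simp: grel_def)
  show "x \<le> y \<or> y \<le> x" by transfer auto
  show "x \<le> y \<Longrightarrow> z + x \<le> z + y"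
  proof (transfer, clarsimp)
    fix a b c d e f :: 'a
    assume "a + d \<le> c + b"
    then have "(e + f) + (a + d) \<le> (e + f) + (c + b)" by simp
    then show "e + a + (f + d) \<le> e + c + (f + b)" by (simp add: ac_simps)
  qed
  show "x < y \<Longrightarrow> 0 < z \<Longrightarrow> z * x < z * y"
  proof -
    have *: "x \<le> y \<longrightarrow> \<not> y \<le> x \<longrightarrow> \<not> z \<le> 0 \<longrightarrow> \<not> z * y \<le> z * x"
      apply transfer
      apply clarsimp
      subgoal premises prems for a b c d e f
        using gint_mult_less_aux[of a d c b f e] prems by (metis less_le not_le)
      done
    have "z * x \<le> z * y \<or> z * y \<le> z * x" by transfer auto
    then show "x < y \<Longrightarrow> 0 < z \<Longrightarrow> z * x < z * y" using * unfolding less_gint_def by blast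
  qed
  show "\<bar>x\<bar> = (if x < 0 then - x else x)" by (rule abs_gint_def)
  show "sgn x = (if x = 0 then 0 else if 0 < x then 1 else - 1)" by (rule sgn_gint_def)
qed

end

lift_definition gof :: "'a::linordered_semidom \<Rightarrow> 'a gint" is "\<lambda>a. (a, 0)" .

lemma gof_simps [simp]: "gof 0 = 0" "gof 1 = 1" "gof (a + b) = gof a + gof b" "gof (a * b) = gof a * gof b"
  "gof a \<le> gof b \<longleftrightarrow> a \<le> b" "gof a = gof b \<longleftrightarrow> a = b"
  by (transfer, simp add: grel_def)+

lemma gof_less [simp]: "gof a < gof b \<longleftrightarrow> a < b"
  by (simp add: less_le)

lemma gof_diff: "\<exists>a b. x = gof a - gof b"
  unfolding minus_gint_def by transfer (auto simp: grel_def)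

type_synonym rt = "num gint fract"

definition ofn :: "num \<Rightarrow> rt" where "ofn n = Fraction_Field.Fract (gof n) 1"

lemma ofn_simps [simp]: "ofn 0 = 0" "ofn 1 = 1" "ofn (a + b) = ofn a + ofn b" "ofn (a * b) = ofn a * ofn b"
  "ofn a \<le> ofn b \<longleftrightarrow> a \<le> b" "ofn a < ofn b \<longleftrightarrow> a < b" "ofn a = ofn b \<longleftrightarrow> a = b"
  by (simp_all add: ofn_def Zero_fract_def One_fract_def eq_fract)

lemma ofn_ge0 [simp]: "0 \<le> ofn n" using ofn_simps(5)[of 0 n] by simp

text \<open>Brings every fraction into the shape of the codes of the language, whose third component
  is one less than the denominator.\<close>

lemma (in counterexample) ofn_frac: "\<exists>a b c. x = (ofn a - ofn b) / (ofn c + 1)"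
proof -
  have "\<exists>p q. 0 < q \<and> x = Fraction_Field.Fract p q"
    by (induction x rule: fract_induct_pos) blast
  then obtain p q where x: "0 < q" "x = Fraction_Field.Fract p q" by blast
  obtain a b where p: "p = gof a - gof b" using gof_diff by blast
  obtain c d where q: "q = gof c - gof d" using gof_diff by blast
  then have "d < c" using x(1) by simp
  then have "c = d + (c - d)" "c - d \<noteq> 0" by (simp_all add: le_add_diff_inverse num_le_diff0)
  then obtain k where k: "c = d + (k + 1)" using num_cases[of "c - d"] by metis
  have "x = (ofn a - ofn b) / ofn (k + 1)"
    unfolding ofn_def x(2) p q k by (simp del: ofn_simps)
  then show ?thesis by auto
qed

lifting_forget fract.lifting
lifting_forget gint.lifting

text \<open>The sequences need not belong to the model: the completion only serves as an ordered ring
  in which the reals of the model have values.\<close>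

definition Cau :: "(num \<Rightarrow> rt) \<Rightarrow> bool" where
  "Cau X \<longleftrightarrow> (\<forall>r>0. \<exists>c. \<forall>\<^sub>F n in at_top. \<bar>X n - c\<bar> < r)"

definition Van :: "(num \<Rightarrow> rt) \<Rightarrow> bool" where
  "Van X \<longleftrightarrow> (\<forall>r>0. \<forall>\<^sub>F n in at_top. \<bar>X n\<bar> < r)"

lemma Cau_const: "Cau (\<lambda>_. c)"
  unfolding Cau_def by (intro allI impI exI[of _ c]) simp

lemma Van_0: "Van (\<lambda>_. 0)" by (simp add: Van_def)

lemma Cau_add: assumes "Cau X" "Cau Y" shows "Cau (\<lambda>n. X n + Y n)"
  unfolding Cau_def
proof (intro allI impI)
  fix r :: rt assume "0 < r"
  then have "0 < r / 2" by simp
  then obtain c d where 1: "\<forall>\<^sub>F n in at_top. \<bar>X n - c\<bar> < r / 2" and 2: "\<forall>\<^sub>F n in at_top. \<bar>Y n - d\<bar> < r / 2"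
    using assms unfolding Cau_def by blast
  show "\<exists>c. \<forall>\<^sub>F n in at_top. \<bar>X n + Y n - c\<bar> < r"
  proof
    show "\<forall>\<^sub>F n in at_top. \<bar>X n + Y n - (c + d)\<bar> < r"
      using 1 2 by eventually_elim linarith
  qed
qed

lemma Cau_minus: assumes "Cau X" shows "Cau (\<lambda>n. - X n)"
  unfolding Cau_def
proof (intro allI impI)
  fix r :: rt assume "0 < r"
  then obtain c where 1: "\<forall>\<^sub>F n in at_top. \<bar>X n - c\<bar> < r" using assms unfolding Cau_def by blast
  show "\<exists>c. \<forall>\<^sub>F n in at_top. \<bar>- X n - c\<bar> < r"
    by (rule exI[of _ "- c"]) (use 1 in eventually_elim, linarith)
qed

lemma Cau_bounded: assumes "Cau X" shows "\<exists>b>0. \<forall>\<^sub>F n in at_top. \<bar>X n\<bar> < b"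
proof -
  have "(0::rt) < 1" by simp
  then obtain c where 1: "\<forall>\<^sub>F n in at_top. \<bar>X n - c\<bar> < 1" using assms unfolding Cau_def by blast
  show ?thesis
    by (rule exI[of _ "\<bar>c\<bar> + 1"]) (use 1 in \<open>auto elim!: eventually_mono\<close>)
qed

text \<open>The split into x * (y - d) and d * (x - c) leaves e / 2 for each part;
  \<open>\<bar>d\<bar> + 1\<close> keeps the divisor positive.\<close>

lemma mult_close:
  fixes x y c d e B :: rt
  assumes "\<bar>x\<bar> < B" "\<bar>y - d\<bar> < e / (2 * B)" "\<bar>x - c\<bar> < e / (2 * (\<bar>d\<bar> + 1))" "0 < B"
  shows "\<bar>x * y - c * d\<bar> < e"
proof -
  have "x * y - c * d = x * (y - d) + d * (x - c)" by (simp add: algebra_simps)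
  then have "\<bar>x * y - c * d\<bar> \<le> \<bar>x\<bar> * \<bar>y - d\<bar> + \<bar>d\<bar> * \<bar>x - c\<bar>"
    by (metis abs_mult abs_triangle_ineq)
  also have "\<bar>x\<bar> * \<bar>y - d\<bar> \<le> B * \<bar>y - d\<bar>" using assms(1) by (intro mult_right_mono) auto
  also have "B * \<bar>y - d\<bar> < B * (e / (2 * B))" by (rule mult_strict_left_mono[OF assms(2,4)])
  also have "\<dots> = e / 2" using assms(4) by simp
  also have "\<bar>d\<bar> * \<bar>x - c\<bar> \<le> (\<bar>d\<bar> + 1) * \<bar>x - c\<bar>" by (intro mult_right_mono) auto
  also have "\<dots> \<le> (\<bar>d\<bar> + 1) * (e / (2 * (\<bar>d\<bar> + 1)))" using assms(3) by (intro mult_left_mono) auto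
  also have "\<dots> = e / 2"
  proof -
    have "D \<noteq> 0 \<Longrightarrow> D * (e / (2 * D)) = e / 2" for D by simp
    moreover have "\<bar>d\<bar> + 1 \<noteq> 0" using abs_ge_zero[of d] by linarith
    ultimately show ?thesis by blast
  qed
  finally show ?thesis by simp
qed

lemma Cau_mult: assumes "Cau X" "Cau Y" shows "Cau (\<lambda>n. X n * Y n)"
  unfolding Cau_def
proof (intro allI impI)
  fix r :: rt assume r: "0 < r"
  obtain B where B: "B > 0" "\<forall>\<^sub>F n in at_top. \<bar>X n\<bar> < B" using Cau_bounded[OF assms(1)] by blast
  have "0 < r / (2 * B)" using r B by simp
  then obtain d where d: "\<forall>\<^sub>F n in at_top. \<bar>Y n - d\<bar> < r / (2 * B)" using assms(2) unfolding Cau_def by blast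
  have "0 < \<bar>d\<bar> + 1" using abs_ge_zero[of d] by linarith
  then have "0 < r / (2 * (\<bar>d\<bar> + 1))" using r by simp
  then obtain c where c: "\<forall>\<^sub>F n in at_top. \<bar>X n - c\<bar> < r / (2 * (\<bar>d\<bar> + 1))"
    using assms(1) unfolding Cau_def by blast
  show "\<exists>c. \<forall>\<^sub>F n in at_top. \<bar>X n * Y n - c\<bar> < r"
    by (rule exI[of _ "c * d"]) (use B(2) d c in eventually_elim, rule mult_close[OF _ _ _ B(1)])
qed

lemma Van_add: assumes "Van X" "Van Y" shows "Van (\<lambda>n. X n + Y n)"
  unfolding Van_def
proof (intro allI impI)
  fix r :: rt assume "0 < r"
  then have "0 < r / 2" by simp
  then have 1: "\<forall>\<^sub>F n in at_top. \<bar>X n\<bar> < r / 2" and 2: "\<forall>\<^sub>F n in at_top. \<bar>Y n\<bar> < r / 2"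
    using assms unfolding Van_def by blast+
  show "\<forall>\<^sub>F n in at_top. \<bar>X n + Y n\<bar> < r"
    using 1 2 by eventually_elim linarith
qed

lemma Van_minus: "Van X \<Longrightarrow> Van (\<lambda>n. - X n)" by (simp add: Van_def)

lemma Van_mult: assumes "Cau X" "Van Y" shows "Van (\<lambda>n. X n * Y n)"
  unfolding Van_def
proof (intro allI impI)
  fix r :: rt assume r: "0 < r"
  obtain B where B: "B > 0" "\<forall>\<^sub>F n in at_top. \<bar>X n\<bar> < B" using Cau_bounded[OF assms(1)] by blast
  then have "\<forall>\<^sub>F n in at_top. \<bar>Y n\<bar> < r / B" using r assms(2) by (simp add: Van_def)
  with B(2) show "\<forall>\<^sub>F n in at_top. \<bar>X n * Y n\<bar> < r"
  proof eventually_elim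
    case (elim n)
    have "\<bar>X n\<bar> * \<bar>Y n\<bar> \<le> B * \<bar>Y n\<bar>" using elim by (intro mult_right_mono) auto
    also have "\<dots> < B * (r / B)" by (rule mult_strict_left_mono[OF elim(2) B(1)])
    also have "\<dots> = r" using B(1) by simp
    finally show ?case by (simp add: abs_mult)
  qed
qed

definition Pos :: "(num \<Rightarrow> rt) \<Rightarrow> bool" where
  "Pos X \<longleftrightarrow> (\<exists>r>0. \<forall>\<^sub>F n in at_top. r < X n)"

text \<open>Trichotomy for the completion. X is at least r in absolute value at arbitrarily late
  indices and eventually within r / 4 of some c, so from then on it keeps the sign it has at one
  such index.\<close>

lemma Cau_cases: assumes "Cau X" "\<not> Van X" shows "Pos X \<or> Pos (\<lambda>n. - X n)"
proof -
  obtain r where r': "0 < r" "\<not> (\<forall>\<^sub>F n in at_top. \<bar>X n\<bar> < r)"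
    using assms(2) unfolding Van_def by blast
  then have r: "0 < r" "\<exists>\<^sub>F n in at_top. \<not> \<bar>X n\<bar> < r"
    unfolding frequently_def not_not by blast+
  then have "0 < r / 4" by simp
  then obtain c where c: "\<forall>\<^sub>F n in at_top. \<bar>X n - c\<bar> < r / 4" using assms(1) unfolding Cau_def by blast
  have "\<exists>\<^sub>F n in at_top. \<not> \<bar>X n\<bar> < r \<and> \<bar>X n - c\<bar> < r / 4"
    using frequently_eventually_frequently[OF r(2) c] .
  then obtain n where n: "\<not> \<bar>X n\<bar> < r" "\<bar>X n - c\<bar> < r / 4" using frequently_ex[of "\<lambda>n. \<not> \<bar>X n\<bar> < r \<and> \<bar>X n - c\<bar> < r / 4" at_top] by blast
  show ?thesis
  proof (cases "0 < X n")
    case True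
    have "\<forall>\<^sub>F m in at_top. r / 4 < X m"
      using c by eventually_elim (use n True r(1) in linarith)
    then show ?thesis unfolding Pos_def using \<open>0 < r / 4\<close> by blast
  next
    case False
    have "\<forall>\<^sub>F m in at_top. r / 4 < - X m"
      using c by eventually_elim (use n False r(1) in linarith)
    then show ?thesis unfolding Pos_def using \<open>0 < r / 4\<close> by blast
  qed
qed

lemma Pos_not_Van: "Pos X \<Longrightarrow> \<not> Van X"
proof
  assume "Pos X" and V: "Van X"
  then obtain r where "r > 0" "\<forall>\<^sub>F n in at_top. r < X n" unfolding Pos_def by blast
  moreover then have "\<forall>\<^sub>F n in at_top. \<bar>X n\<bar> < r" using V by (simp add: Van_def)
  ultimately have "\<forall>\<^sub>F n in at_top. r < X n \<and> \<bar>X n\<bar> < r" by (intro eventually_conj)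
  then have "\<exists>n. r < X n \<and> \<bar>X n\<bar> < r" by (intro eventually_happens'[of at_top]) simp_all
  then show False by auto
qed

lemma Pos_add: "Pos X \<Longrightarrow> Pos Y \<Longrightarrow> Pos (\<lambda>n. X n + Y n)"
proof -
  assume "Pos X" "Pos Y"
  then obtain r s where rs: "r > 0" "s > 0" and 1: "\<forall>\<^sub>F n in at_top. r < X n" and 2: "\<forall>\<^sub>F n in at_top. s < Y n"
    unfolding Pos_def by blast
  have "\<forall>\<^sub>F n in at_top. r + s < X n + Y n" using 1 2 by eventually_elim simp
  then show ?thesis unfolding Pos_def using rs by (intro exI[of _ "r + s"]) simp
qed

lemma Pos_mult: "Pos X \<Longrightarrow> Pos Y \<Longrightarrow> Pos (\<lambda>n. X n * Y n)"
proof -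
  assume "Pos X" "Pos Y"
  then obtain r s where rs: "r > 0" "s > 0" and 1: "\<forall>\<^sub>F n in at_top. r < X n" and 2: "\<forall>\<^sub>F n in at_top. s < Y n"
    unfolding Pos_def by blast
  have "\<forall>\<^sub>F n in at_top. r * s < X n * Y n"
    using 1 2 by eventually_elim (use rs in \<open>auto intro: mult_strict_mono'\<close>)
  then show ?thesis unfolding Pos_def using rs by (intro exI[of _ "r * s"]) simp
qed

lemma Pos_Van: "Pos X \<Longrightarrow> Van (\<lambda>n. Y n - X n) \<Longrightarrow> Pos Y"
proof -
  assume "Pos X" and V: "Van (\<lambda>n. Y n - X n)"
  then obtain r where r: "r > 0" and 1: "\<forall>\<^sub>F n in at_top. r < X n" unfolding Pos_def by blast
  have "0 < r / 2" using r by simp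
  then have 2: "\<forall>\<^sub>F n in at_top. \<bar>Y n - X n\<bar> < r / 2" using V unfolding Van_def by blast
  have "\<forall>\<^sub>F n in at_top. r / 2 < Y n" using 1 2 by eventually_elim linarith
  then show ?thesis unfolding Pos_def using r by (intro exI[of _ "r / 2"]) simp
qed

definition krel :: "(num \<Rightarrow> rt) \<Rightarrow> (num \<Rightarrow> rt) \<Rightarrow> bool" where
  "krel X Y \<longleftrightarrow> Cau X \<and> Cau Y \<and> Van (\<lambda>n. X n - Y n)"

lemma krel_refl: "krel X X \<longleftrightarrow> Cau X" by (simp add: krel_def Van_0)

lemma krel_sym: "krel X Y \<Longrightarrow> krel Y X"
  using Van_minus[of "\<lambda>n. X n - Y n"] by (simp add: krel_def)

quotient_type K = "num \<Rightarrow> rt" / partial: krel morphisms rep_k abs_k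
proof (rule part_equivpI)
  show "\<exists>X. krel X X" using Cau_const krel_refl by blast
  show "symp krel" by (rule sympI) (rule krel_sym)
  show "transp krel"
  proof (rule transpI)
    fix X Y Z assume "krel X Y" "krel Y Z"
    then show "krel X Z" using Van_add[of "\<lambda>n. X n - Y n" "\<lambda>n. Y n - Z n"] by (simp add: krel_def)
  qed
qed

instantiation K :: comm_ring_1
begin

lift_definition zero_K :: K is "\<lambda>_. 0" by (simp add: krel_refl Cau_const)
lift_definition one_K :: K is "\<lambda>_. 1" by (simp add: krel_refl Cau_const)
lift_definition plus_K :: "K \<Rightarrow> K \<Rightarrow> K" is "\<lambda>X Y n. X n + Y n"
proof -
  fix X X' Y Y' assume "krel X X'" "krel Y Y'"
  then show "krel (\<lambda>n. X n + Y n) (\<lambda>n. X' n + Y' n)"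
    using Van_add[of "\<lambda>n. X n - X' n" "\<lambda>n. Y n - Y' n"] by (simp add: krel_def Cau_add algebra_simps)
qed
lift_definition uminus_K :: "K \<Rightarrow> K" is "\<lambda>X n. - X n"
proof -
  fix X X' assume "krel X X'"
  then show "krel (\<lambda>n. - X n) (\<lambda>n. - X' n)"
    using Van_minus[of "\<lambda>n. X n - X' n"] by (simp add: krel_def Cau_minus algebra_simps)
qed
lift_definition times_K :: "K \<Rightarrow> K \<Rightarrow> K" is "\<lambda>X Y n. X n * Y n"
proof -
  fix X X' Y Y' assume a: "krel X X'" "krel Y Y'"
  then have "Van (\<lambda>n. X n * (Y n - Y' n) + Y' n * (X n - X' n))"
    by (intro Van_add Van_mult) (simp_all add: krel_def)
  then show "krel (\<lambda>n. X n * Y n) (\<lambda>n. X' n * Y' n)"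
    using a by (simp add: krel_def Cau_mult algebra_simps)
qed
lift_definition kpos :: "K \<Rightarrow> bool" is Pos
proof -
  fix X Y assume "krel X Y"
  then show "Pos X = Pos Y" using krel_sym[of X Y] Pos_Van[of X Y] Pos_Van[of Y X] by (auto simp: krel_def)
qed
definition minus_K :: "K \<Rightarrow> K \<Rightarrow> K" where "minus_K x y = x + - y"
lemma K_ring:
  fixes x y z :: K
  shows "x + y + z = x + (y + z)" "x + y = y + x" "0 + x = x" "- x + x = 0" "x * y * z = x * (y * z)"
    "x * y = y * x" "1 * x = x" "(x + y) * z = x * z + y * z"
  by (transfer, simp add: krel_def Cau_add Cau_mult Cau_const Cau_minus Van_0 algebra_simps)+

lemma kpos: "\<not> kpos 0" "x \<noteq> 0 \<Longrightarrow> kpos x \<or> kpos (- x)" "kpos x \<Longrightarrow> kpos y \<Longrightarrow> kpos (x + y)"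
  "kpos x \<Longrightarrow> kpos y \<Longrightarrow> kpos (x * y)"
proof -
  show "\<not> kpos 0" by transfer (auto dest: Pos_not_Van simp: Van_0)
  show "x \<noteq> 0 \<Longrightarrow> kpos x \<or> kpos (- x)"
    by transfer (auto simp: krel_def Cau_const dest: Cau_cases)
  show "kpos x \<Longrightarrow> kpos y \<Longrightarrow> kpos (x + y)" by transfer (rule Pos_add)
  show "kpos x \<Longrightarrow> kpos y \<Longrightarrow> kpos (x * y)" by transfer (rule Pos_mult)
qed

lemma K_one: "kpos 1"
  by transfer (auto simp: Pos_def intro!: exI[of _ "1 / 2"])

instance
proof
  fix x y z :: K
  show "x + y + z = x + (y + z)" "x + y = y + x" "0 + x = x" "- x + x = 0" "x * y * z = x * (y * z)"
    "x * y = y * x" "1 * x = x" "(x + y) * z = x * z + y * z" by (rule K_ring)+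
  show "x - y = x + - y" by (rule minus_K_def)
  show "0 \<noteq> (1::K)" using kpos(1) K_one by metis
qed

end

instantiation K :: linordered_idom
begin

definition less_K :: "K \<Rightarrow> K \<Rightarrow> bool" where "less_K x y \<longleftrightarrow> kpos (y - x)"
definition less_eq_K :: "K \<Rightarrow> K \<Rightarrow> bool" where "less_eq_K x y \<longleftrightarrow> x < y \<or> x = y"
definition abs_K :: "K \<Rightarrow> K" where "abs_K x = (if x < 0 then - x else x)"
definition sgn_K :: "K \<Rightarrow> K" where "sgn_K x = (if x = 0 then 0 else if 0 < x then 1 else - 1)"

instance
proof
  fix x y z :: K
  have tr: "x < y \<Longrightarrow> y < z \<Longrightarrow> x < z" for x y z :: K
    unfolding less_K_def using kpos(3)[of "y - x" "z - y"] by simp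
  have ir: "\<not> x < x" for x :: K unfolding less_K_def using kpos(1) by simp
  have tot: "x < y \<or> x = y \<or> y < x" for x y :: K
    unfolding less_K_def using kpos(2)[of "y - x"] by auto
  show "x < y \<longleftrightarrow> x \<le> y \<and> \<not> y \<le> x" using tr[of x y x] ir[of x] unfolding less_eq_K_def by auto
  show "x \<le> x" by (simp add: less_eq_K_def)
  show "x \<le> y \<Longrightarrow> y \<le> z \<Longrightarrow> x \<le> z" using tr[of x y z] unfolding less_eq_K_def by auto
  show "x \<le> y \<Longrightarrow> y \<le> x \<Longrightarrow> x = y" using tr[of x y x] ir[of x] unfolding less_eq_K_def by auto
  show "x \<le> y \<or> y \<le> x" using tot[of x y] unfolding less_eq_K_def by auto
  show "x \<le> y \<Longrightarrow> z + x \<le> z + y" unfolding less_eq_K_def less_K_def by auto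
  show "x < y \<Longrightarrow> 0 < z \<Longrightarrow> z * x < z * y"
    unfolding less_K_def using kpos(4)[of z "y - x"] by (simp add: right_diff_distrib)
  show "\<bar>x\<bar> = (if x < 0 then - x else x)" by (rule abs_K_def)
  show "sgn x = (if x = 0 then 0 else if 0 < x then 1 else - 1)" by (rule sgn_K_def)
qed

end

lift_definition kq :: "rt \<Rightarrow> K" is "\<lambda>c _. c" by (simp add: krel_refl Cau_const)

lemma kq_ring [simp]: "kq 0 = 0" "kq 1 = 1" "kq (a + b) = kq a + kq b" "kq (- a) = - kq a" "kq (a * b) = kq a * kq b"
  by (transfer, simp add: krel_def Cau_const Van_0)+

lemma kq_diff [simp]: "kq (a - b) = kq a - kq b"
  using kq_ring(3)[of a "- b"] by simp

lemma kpos_kq: "kpos (kq a) \<longleftrightarrow> 0 < a"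
  by transfer (auto simp: Pos_def intro: dest: order_less_trans, meson dense)

lemma kq_less [simp]: "kq a < kq b \<longleftrightarrow> a < b"
  by (simp add: less_K_def kq_diff[symmetric] kpos_kq del: kq_diff)

lemma kq_le [simp]: "kq a \<le> kq b \<longleftrightarrow> a \<le> b"
  by (simp add: not_less[symmetric])

lemma kq_numeral [simp]: "kq (numeral w) = numeral w"
proof -
  have "kq (of_nat n) = of_nat n" for n by (induction n) simp_all
  from this[of "numeral w"] show ?thesis by simp
qed

lemma kq_abs [simp]: "kq \<bar>a\<bar> = \<bar>kq a\<bar>"
proof -
  have "kq a < 0 \<longleftrightarrow> a < 0" using kq_less[of a 0] by simp
  then show ?thesis by (simp add: abs_if)
qed

text \<open>Positivity means being eventually above some positive rational, and half of that
  rational stays strictly below the value.\<close>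

lemma kq_between: "0 < x \<Longrightarrow> \<exists>r>0. kq r < x"
proof -
  assume "0 < x"
  then have "kpos x" by (simp add: less_K_def)
  then have "\<exists>r>0. kpos (x - kq r)"
    unfolding minus_K_def
  proof transfer
    fix X assume "Pos X"
    then obtain r where r: "r > 0" and 1: "\<forall>\<^sub>F n in at_top. r < X n" unfolding Pos_def by blast
    have "\<forall>\<^sub>F n in at_top. r / 2 < X n + - (r / 2)" using 1 by eventually_elim simp
    then show "\<exists>r>0. Pos (\<lambda>n. X n + - r)" using r unfolding Pos_def by (meson half_gt_zero)
  qed
  then show ?thesis by (simp add: less_K_def)
qed

section \<open>Rational and real numbers of the model\<close>

definition pw :: "num \<Rightarrow> num" where "pw = prec (\<lambda>i a. a + a) 1"
definition eps :: "num \<Rightarrow> rt" where "eps n = 1 / ofn (pw n)"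

definition rv :: "num \<Rightarrow> rt" where
  "rv q = (ofn (pi1 q) - ofn (pi1 (pi2 q))) / (ofn (pi2 (pi2 q)) + 1)"
definition qcode :: "num \<Rightarrow> num \<Rightarrow> num \<Rightarrow> num" where "qcode a b c = pair a (pair b c)"

abbreviation (input) "qn \<equiv> \<lambda>q. pi1 q"
abbreviation (input) "qm \<equiv> \<lambda>q. pi1 (pi2 q)"
abbreviation (input) "qd \<equiv> \<lambda>q. pi2 (pi2 q) + 1"

text \<open>Codes store the denominator minus one, hence the final \<open>- 1\<close>. Fractions are
  not reduced; results are compared through \<open>rv\<close>.\<close>

definition qadd :: "num \<Rightarrow> num \<Rightarrow> num" where
  "qadd p q = qcode (qn p * qd q + qn q * qd p) (qm p * qd q + qm q * qd p) (qd p * qd q - 1)"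
definition qneg :: "num \<Rightarrow> num" where "qneg p = qcode (qm p) (qn p) (pi2 (pi2 p))"
definition qmul :: "num \<Rightarrow> num \<Rightarrow> num" where
  "qmul p q = qcode (qn p * qn q + qm p * qm q) (qn p * qm q + qm p * qn q) (qd p * qd q - 1)"
definition qle :: "num \<Rightarrow> num \<Rightarrow> bool" where
  "qle p q \<longleftrightarrow> qn p * qd q + qm q * qd p \<le> qn q * qd p + qm p * qd q"
definition qmax :: "num \<Rightarrow> num \<Rightarrow> num" where "qmax p q = (if qle p q then q else p)"
definition qmin :: "num \<Rightarrow> num \<Rightarrow> num" where "qmin p q = (if qle p q then p else q)"

lemma ofn_pos [simp]: "0 < ofn n + 1" using ofn_ge0[of n] by linarith
lemma ofn_nz [simp]: "ofn n + 1 \<noteq> 0" using ofn_pos[of n] by linarith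

context counterexample
begin

lemma pw: "pw 0 = 1" "pw (n + 1) = pw n + pw n"
  unfolding pw_def by (rule prec, intro I_rules)+

lemma I1_pw: "I1 pw"
  unfolding pw_def by (rule I1_prec[where H = "\<lambda>x. x" and F = "\<lambda>_. 1"]) (intro I_rules)+

lemma less_pw: "n < pw n"
proof (rule nind[where P = "\<lambda>n. n < pw n"])
  fix n assume *: "n < pw n"
  then have "n + 1 \<le> pw n" "1 \<le> pw n" using less_Suc[of n] less_Suc(2)[of 0 "pw n"] by auto
  then show "n + 1 < pw (n + 1)" using * by (auto simp: pw less_Suc intro: add_less_le_mono)
qed (intro I_rules I1_c1[OF I1_pw], simp add: pw)

lemma eps_pos [simp]: "0 < eps n"
proof -
  have "0 < ofn (pw n)" using le_less_trans[OF num_ge0 less_pw[of n]] ofn_simps(6)[of 0 "pw n"] by simp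
  then show ?thesis by (simp add: eps_def)
qed

lemma eps_ge0 [simp]: "0 \<le> eps n" by (rule less_imp_le) (rule eps_pos)

lemma eps_0 [simp]: "eps 0 = 1" by (simp add: eps_def pw)
lemma eps_Suc: "eps n = 2 * eps (n + 1)" by (simp add: eps_def pw)

lemma eps_add_le: "eps (n + i) \<le> eps n"
proof -
  have "pw n \<le> pw (n + i)"
  proof (rule nind[where P = "\<lambda>i. pw n \<le> pw (n + i)"])
    fix i assume *: "pw n \<le> pw (n + i)"
    show "pw n \<le> pw (n + (i + 1))" unfolding add.assoc[symmetric] pw by (rule add_increasing2[OF num_ge0 *])
  qed (intro I_rules I1_c1[OF I1_pw], simp)
  moreover have "0 < ofn (pw n)" for n using eps_pos[of n] by (simp add: eps_def)
  ultimately show ?thesis by (simp add: eps_def frac_le)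
qed

lemma eps_mono: "m \<le> n \<Longrightarrow> eps n \<le> eps m"
  using eps_add_le[of m "n - m"] by (simp add: le_add_diff_inverse)

lemma rv_qcode: "rv (qcode a b c) = (ofn a - ofn b) / (ofn c + 1)"
  by (simp add: rv_def qcode_def pi_pair)

lemma rv_surj: "\<exists>q. rv q = x"
  using ofn_frac[of x] rv_qcode by metis

text \<open>1 / x is at most the first component a of one of its codes, and a is below 2^a. The
  index found may itself be nonstandard.\<close>

lemma eps_arch: "0 < x \<Longrightarrow> \<exists>n. eps n < x"
proof -
  assume x: "0 < x"
  obtain a b c where abc: "1 / x = (ofn a - ofn b) / (ofn c + 1)" using ofn_frac by blast
  have "(ofn a - ofn b) / (ofn c + 1) \<le> ofn a / (ofn c + 1)"
    by (intro divide_right_mono) (auto intro: less_imp_le)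
  also have "\<dots> \<le> ofn a / 1" by (intro divide_left_mono) auto
  also have "\<dots> < ofn (pw a)" using less_pw[of a] by simp
  finally have "1 / x < ofn (pw a)" using abc by simp
  then have "eps a < x" using x eps_pos[of a] by (simp add: eps_def field_simps)
  then show ?thesis by blast
qed

lemma qd_mult: "ofn (qd p * qd q - 1) + 1 = (ofn (pi2 (pi2 p)) + 1) * (ofn (pi2 (pi2 q)) + 1)"
proof -
  have "qd p * qd q \<noteq> 0" by simp
  then obtain k where "qd p * qd q = k + 1" using num_cases by metis
  then have "qd p * qd q - 1 + 1 = qd p * qd q" by simp
  then have "ofn (qd p * qd q - 1 + 1) = ofn (qd p * qd q)" by simp
  then show ?thesis by simp
qed

lemma rv_qle: "rv p \<le> rv q \<longleftrightarrow> qle p q"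
proof -
  have "rv p \<le> rv q \<longleftrightarrow> (ofn (qn p) - ofn (qm p)) * ofn (qd q) \<le> (ofn (qn q) - ofn (qm q)) * ofn (qd p)"
    by (simp add: rv_def divide_le_eq pos_le_divide_eq)
  also have "\<dots> \<longleftrightarrow> ofn (qn p * qd q + qm q * qd p) \<le> ofn (qn q * qd p + qm p * qd q)"
    by (simp add: algebra_simps)
  finally show ?thesis unfolding qle_def ofn_simps(5) .
qed

lemma rv_ops:
  "rv (qadd p q) = rv p + rv q" "rv (qneg p) = - rv p" "rv (qmul p q) = rv p * rv q"
  "rv (qmax p q) = max (rv p) (rv q)" "rv (qmin p q) = min (rv p) (rv q)"
  "rv (qmax p (qneg p)) = \<bar>rv p\<bar>" "rv (qadd p (qneg q)) = rv p - rv q"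
proof -
  show 1: "rv (qadd p q) = rv p + rv q" for p q
    unfolding qadd_def rv_qcode qd_mult by (simp add: rv_def add_frac_eq) (simp add: algebra_simps)
  show 2: "rv (qneg p) = - rv p" for p
    unfolding qneg_def rv_qcode by (simp add: rv_def) (metis minus_diff_eq minus_divide_left)
  show "rv (qmul p q) = rv p * rv q"
    unfolding qmul_def rv_qcode qd_mult by (simp add: rv_def) (simp add: algebra_simps)
  show 3: "rv (qmax p q) = max (rv p) (rv q)" for p q by (simp add: qmax_def max_def rv_qle)
  show "rv (qmin p q) = min (rv p) (rv q)" by (simp add: qmin_def min_def rv_qle)
  show "rv (qmax p (qneg p)) = \<bar>rv p\<bar>" by (simp add: 2 3 abs_if max_def)
  show "rv (qadd p (qneg q)) = rv p - rv q" by (simp add: 1 2)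
qed

lemma rv_qn: "rv (qcode n 0 0) = ofn n" "rv (qcode 1 0 (pw n - 1)) = eps n"
proof -
  show "rv (qcode n 0 0) = ofn n" by (simp add: rv_qcode)
  have "pw n \<noteq> 0" using less_pw[of n] by auto
  then obtain k where "pw n = k + 1" using num_cases by metis
  then have "pw n - 1 + 1 = pw n" by simp
  then have "ofn (pw n - 1) + 1 = ofn (pw n)" by (metis ofn_simps(2,3))
  then show "rv (qcode 1 0 (pw n - 1)) = eps n" by (simp add: rv_qcode eps_def)
qed

lemma I3_qcode: "I3 qcode"
  unfolding qcode_def by (intro I_pair I_rules)

lemmas I_qcode = I1_c3[OF I3_qcode] I2_c3[OF I3_qcode]

lemma I_qn: "I1 (\<lambda>n. qcode n 0 0)" "I1 (\<lambda>n. qcode 1 0 (pw n - 1))"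
  by (intro I_qcode I_rules I1_c1[OF I1_pw])+

lemma I2_qle: "I2 (\<lambda>p q. of_bool (qle p q) :: num)"
  unfolding qle_def by (intro I_pair I_rules)

lemma I1_qneg: "I1 qneg"
  unfolding qneg_def by (intro I_qcode I_pair I_rules)

lemma I2_qops: "I2 qadd" "I2 qmul" "I2 qmax" "I2 qmin"
  unfolding qadd_def qmul_def qmax_def qmin_def
  by (intro I_qcode I_pair I_rules I2_qle)+

lemma I_qops:
  "I1 qneg" "I2 qadd" "I2 qmul" "I2 qmax" "I2 qmin" "I1 (\<lambda>p. qmax p (qneg p))" "I2 (\<lambda>p q. qadd p (qneg q))"
  "I2 (\<lambda>p q. of_bool (rv p \<le> rv q) :: num)" "I2 (\<lambda>p q. of_bool (rv p < rv q) :: num)"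
  "I2 (\<lambda>p q. of_bool (rv p = rv q) :: num)"
proof -
  have s: "I2 (\<lambda>p q. of_bool (qle q p) :: num)"
    by (rule I2_c2[OF I2_qle I2_vars(2) I2_vars(1)])
  show "I2 (\<lambda>p q. of_bool (rv p \<le> rv q) :: num)" unfolding rv_qle by (rule I2_qle)
  show "I2 (\<lambda>p q. of_bool (rv p < rv q) :: num)" unfolding not_le[symmetric] rv_qle by (intro I_rules s)
  show "I2 (\<lambda>p q. of_bool (rv p = rv q) :: num)" unfolding eq_iff rv_qle by (intro I_rules s I2_qle)
  show "I1 (\<lambda>p. qmax p (qneg p))" by (intro I1_c2[OF I2_qops(3)] I1_c1[OF I1_qneg] I_rules)
  show "I2 (\<lambda>p q. qadd p (qneg q))" by (intro I2_c2[OF I2_qops(1)] I2_c1[OF I1_qneg] I_rules)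
qed (rule I1_qneg I2_qops)+

end

section \<open>Internal functions with rational values\<close>

lemma if_ofn: "(if P then a else b) = ofn (of_bool P) * a + (1 - ofn (of_bool P)) * b"
  by simp

text \<open>The type \<open>rt\<close> mirrors no carrier of the model, so a function into it counts
  as internal if some internal function yields codes of its values.\<close>

definition R1 :: "('a::mty \<Rightarrow> rt) \<Rightarrow> bool" where
  "R1 F \<longleftrightarrow> (\<exists>G. I1 G \<and> (\<forall>x. rv (G x) = F x))"

definition R2 :: "('a::mty \<Rightarrow> 'b::mty \<Rightarrow> rt) \<Rightarrow> bool" where
  "R2 F \<longleftrightarrow> (\<exists>G. I2 G \<and> (\<forall>x y. rv (G x y) = F x y))"

definition R3 :: "('a::mty \<Rightarrow> 'b::mty \<Rightarrow> 'c::mty \<Rightarrow> rt) \<Rightarrow> bool" where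
  "R3 F \<longleftrightarrow> (\<exists>G. I3 G \<and> (\<forall>x y z. rv (G x y z) = F x y z))"

definition R4 :: "('a::mty \<Rightarrow> 'b::mty \<Rightarrow> 'c::mty \<Rightarrow> 'd::mty \<Rightarrow> rt) \<Rightarrow> bool" where
  "R4 F \<longleftrightarrow> (\<exists>G. I4 G \<and> (\<forall>x y z w. rv (G x y z w) = F x y z w))"

context counterexample
begin

lemma R1_rv: "I1 G \<Longrightarrow> R1 (\<lambda>x. rv (G x))"
  unfolding R1_def by blast

lemma R1_const: "R1 (\<lambda>x. c)"
proof -
  obtain q where "rv q = c" using rv_surj by blast
  then show ?thesis unfolding R1_def by (intro exI[of _ "\<lambda>x. q"] conjI I1_const) simp
qed

lemma R1_arith:
  assumes "R1 F" "R1 G"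
  shows "R1 (\<lambda>x. F x + G x)" "R1 (\<lambda>x. F x - G x)" "R1 (\<lambda>x. F x * G x)" "R1 (\<lambda>x. max (F x) (G x))"
    "R1 (\<lambda>x. min (F x) (G x))" "R1 (\<lambda>x. \<bar>F x\<bar>)" "R1 (\<lambda>x. - F x)"
    "I1 (\<lambda>x. of_bool (F x \<le> G x) :: num)" "I1 (\<lambda>x. of_bool (F x < G x) :: num)" "I1 (\<lambda>x. of_bool (F x = G x) :: num)"
proof -
  obtain f g where f: "I1 f" "\<And>x. F x = rv (f x)" and g: "I1 g" "\<And>x. G x = rv (g x)"
    using assms unfolding R1_def by metis
  note c = I1_c1[OF I_qops(6)] I1_c2[OF I_qops(7)] I1_c2[OF I_qops(8)] I1_c2[OF I_qops(9)] I1_c2[OF I_qops(10)] I1_c1[OF I_qops(1)] I1_c2[OF I_qops(2)] I1_c2[OF I_qops(3)] I1_c2[OF I_qops(4)] I1_c2[OF I_qops(5)] f(1) g(1)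
  show "R1 (\<lambda>x. F x + G x)" "R1 (\<lambda>x. F x - G x)" "R1 (\<lambda>x. F x * G x)" "R1 (\<lambda>x. max (F x) (G x))"
    "R1 (\<lambda>x. min (F x) (G x))" "R1 (\<lambda>x. \<bar>F x\<bar>)" "R1 (\<lambda>x. - F x)"
    unfolding f(2) g(2) rv_ops[symmetric] by (intro R1_rv c)+
  show "I1 (\<lambda>x. of_bool (F x \<le> G x) :: num)" "I1 (\<lambda>x. of_bool (F x < G x) :: num)" "I1 (\<lambda>x. of_bool (F x = G x) :: num)"
    unfolding f(2) g(2) by (intro c)+
qed

lemma R1_ofn: "I1 F \<Longrightarrow> R1 (\<lambda>x. ofn (F x))" "I1 F \<Longrightarrow> R1 (\<lambda>x. eps (F x))"
  unfolding rv_qn[symmetric]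
  by (erule R1_rv[OF I1_c1[OF I_qn(1)]] R1_rv[OF I1_c1[OF I_qn(2)]])+

lemma R1_if: "I1 (\<lambda>x. of_bool (P x) :: num) \<Longrightarrow> R1 F \<Longrightarrow> R1 G \<Longrightarrow> R1 (\<lambda>x. if P x then F x else G x)"
  unfolding if_ofn by (intro R1_arith(1-3) R1_const R1_ofn(1))

text \<open>Absolute value and negation concern one function; the constant 0 fills the place of the
  second one in \<open>R1_arith\<close>.\<close>

lemmas R1_rules = R1_const R1_ofn R1_rv R1_if R1_arith(1-5,8-10)
  R1_arith(6,7)[OF _ R1_const[of 0]]

lemma R2_rv: "I2 G \<Longrightarrow> R2 (\<lambda>x y. rv (G x y))"
  unfolding R2_def by blast

lemma R2_const: "R2 (\<lambda>x y. c)"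
proof -
  obtain q where "rv q = c" using rv_surj by blast
  then show ?thesis unfolding R2_def by (intro exI[of _ "\<lambda>x y. q"] conjI I2_const) simp
qed

lemma R2_arith:
  assumes "R2 F" "R2 G"
  shows "R2 (\<lambda>x y. F x y + G x y)" "R2 (\<lambda>x y. F x y - G x y)" "R2 (\<lambda>x y. F x y * G x y)" "R2 (\<lambda>x y. max (F x y) (G x y))"
    "R2 (\<lambda>x y. min (F x y) (G x y))" "R2 (\<lambda>x y. \<bar>F x y\<bar>)" "R2 (\<lambda>x y. - F x y)"
    "I2 (\<lambda>x y. of_bool (F x y \<le> G x y) :: num)" "I2 (\<lambda>x y. of_bool (F x y < G x y) :: num)" "I2 (\<lambda>x y. of_bool (F x y = G x y) :: num)"
proof -
  obtain f g where f: "I2 f" "\<And>x y. F x y = rv (f x y)" and g: "I2 g" "\<And>x y. G x y = rv (g x y)"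
    using assms unfolding R2_def by metis
  note c = I2_c1[OF I_qops(6)] I2_c2[OF I_qops(7)] I2_c2[OF I_qops(8)] I2_c2[OF I_qops(9)] I2_c2[OF I_qops(10)] I2_c1[OF I_qops(1)] I2_c2[OF I_qops(2)] I2_c2[OF I_qops(3)] I2_c2[OF I_qops(4)] I2_c2[OF I_qops(5)] f(1) g(1)
  show "R2 (\<lambda>x y. F x y + G x y)" "R2 (\<lambda>x y. F x y - G x y)" "R2 (\<lambda>x y. F x y * G x y)" "R2 (\<lambda>x y. max (F x y) (G x y))"
    "R2 (\<lambda>x y. min (F x y) (G x y))" "R2 (\<lambda>x y. \<bar>F x y\<bar>)" "R2 (\<lambda>x y. - F x y)"
    unfolding f(2) g(2) rv_ops[symmetric] by (intro R2_rv c)+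
  show "I2 (\<lambda>x y. of_bool (F x y \<le> G x y) :: num)" "I2 (\<lambda>x y. of_bool (F x y < G x y) :: num)" "I2 (\<lambda>x y. of_bool (F x y = G x y) :: num)"
    unfolding f(2) g(2) by (intro c)+
qed

lemma R2_ofn: "I2 F \<Longrightarrow> R2 (\<lambda>x y. ofn (F x y))" "I2 F \<Longrightarrow> R2 (\<lambda>x y. eps (F x y))"
  unfolding rv_qn[symmetric]
  by (erule R2_rv[OF I2_c1[OF I_qn(1)]] R2_rv[OF I2_c1[OF I_qn(2)]])+

lemma R2_if: "I2 (\<lambda>x y. of_bool (P x y) :: num) \<Longrightarrow> R2 F \<Longrightarrow> R2 G \<Longrightarrow> R2 (\<lambda>x y. if P x y then F x y else G x y)"
  unfolding if_ofn by (intro R2_arith(1-3) R2_const R2_ofn(1))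

lemmas R2_rules = R2_const R2_ofn R2_rv R2_if R2_arith(1-5,8-10)
  R2_arith(6,7)[OF _ R2_const[of 0]]

lemma R3_rv: "I3 G \<Longrightarrow> R3 (\<lambda>x y z. rv (G x y z))"
  unfolding R3_def by blast

lemma R3_const: "R3 (\<lambda>x y z. c)"
proof -
  obtain q where "rv q = c" using rv_surj by blast
  then show ?thesis unfolding R3_def by (intro exI[of _ "\<lambda>x y z. q"] conjI I3_const) simp
qed

lemma R3_arith:
  assumes "R3 F" "R3 G"
  shows "R3 (\<lambda>x y z. F x y z + G x y z)" "R3 (\<lambda>x y z. F x y z - G x y z)" "R3 (\<lambda>x y z. F x y z * G x y z)" "R3 (\<lambda>x y z. max (F x y z) (G x y z))"
    "R3 (\<lambda>x y z. min (F x y z) (G x y z))" "R3 (\<lambda>x y z. \<bar>F x y z\<bar>)" "R3 (\<lambda>x y z. - F x y z)"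
    "I3 (\<lambda>x y z. of_bool (F x y z \<le> G x y z) :: num)" "I3 (\<lambda>x y z. of_bool (F x y z < G x y z) :: num)" "I3 (\<lambda>x y z. of_bool (F x y z = G x y z) :: num)"
proof -
  obtain f g where f: "I3 f" "\<And>x y z. F x y z = rv (f x y z)" and g: "I3 g" "\<And>x y z. G x y z = rv (g x y z)"
    using assms unfolding R3_def by metis
  note c = I3_c1[OF I_qops(6)] I3_c2[OF I_qops(7)] I3_c2[OF I_qops(8)] I3_c2[OF I_qops(9)] I3_c2[OF I_qops(10)] I3_c1[OF I_qops(1)] I3_c2[OF I_qops(2)] I3_c2[OF I_qops(3)] I3_c2[OF I_qops(4)] I3_c2[OF I_qops(5)] f(1) g(1)
  show "R3 (\<lambda>x y z. F x y z + G x y z)" "R3 (\<lambda>x y z. F x y z - G x y z)" "R3 (\<lambda>x y z. F x y z * G x y z)" "R3 (\<lambda>x y z. max (F x y z) (G x y z))"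
    "R3 (\<lambda>x y z. min (F x y z) (G x y z))" "R3 (\<lambda>x y z. \<bar>F x y z\<bar>)" "R3 (\<lambda>x y z. - F x y z)"
    unfolding f(2) g(2) rv_ops[symmetric] by (intro R3_rv c)+
  show "I3 (\<lambda>x y z. of_bool (F x y z \<le> G x y z) :: num)" "I3 (\<lambda>x y z. of_bool (F x y z < G x y z) :: num)" "I3 (\<lambda>x y z. of_bool (F x y z = G x y z) :: num)"
    unfolding f(2) g(2) by (intro c)+
qed

lemma R3_ofn: "I3 F \<Longrightarrow> R3 (\<lambda>x y z. ofn (F x y z))" "I3 F \<Longrightarrow> R3 (\<lambda>x y z. eps (F x y z))"
  unfolding rv_qn[symmetric]
  by (erule R3_rv[OF I3_c1[OF I_qn(1)]] R3_rv[OF I3_c1[OF I_qn(2)]])+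

lemma R3_if: "I3 (\<lambda>x y z. of_bool (P x y z) :: num) \<Longrightarrow> R3 F \<Longrightarrow> R3 G \<Longrightarrow> R3 (\<lambda>x y z. if P x y z then F x y z else G x y z)"
  unfolding if_ofn by (intro R3_arith(1-3) R3_const R3_ofn(1))

lemmas R3_rules = R3_const R3_ofn R3_rv R3_if R3_arith(1-5,8-10)
  R3_arith(6,7)[OF _ R3_const[of 0]]

lemma R4_rv: "I4 G \<Longrightarrow> R4 (\<lambda>x y z w. rv (G x y z w))"
  unfolding R4_def by blast

lemma R4_const: "R4 (\<lambda>x y z w. c)"
proof -
  obtain q where "rv q = c" using rv_surj by blast
  then show ?thesis unfolding R4_def by (intro exI[of _ "\<lambda>x y z w. q"] conjI I4_const) simp
qed

lemma R4_arith:
  assumes "R4 F" "R4 G"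
  shows "R4 (\<lambda>x y z w. F x y z w + G x y z w)" "R4 (\<lambda>x y z w. F x y z w - G x y z w)" "R4 (\<lambda>x y z w. F x y z w * G x y z w)" "R4 (\<lambda>x y z w. max (F x y z w) (G x y z w))"
    "R4 (\<lambda>x y z w. min (F x y z w) (G x y z w))" "R4 (\<lambda>x y z w. \<bar>F x y z w\<bar>)" "R4 (\<lambda>x y z w. - F x y z w)"
    "I4 (\<lambda>x y z w. of_bool (F x y z w \<le> G x y z w) :: num)" "I4 (\<lambda>x y z w. of_bool (F x y z w < G x y z w) :: num)" "I4 (\<lambda>x y z w. of_bool (F x y z w = G x y z w) :: num)"
proof -
  obtain f g where f: "I4 f" "\<And>x y z w. F x y z w = rv (f x y z w)" and g: "I4 g" "\<And>x y z w. G x y z w = rv (g x y z w)"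
    using assms unfolding R4_def by metis
  note c = I4_c1[OF I_qops(6)] I4_c2[OF I_qops(7)] I4_c2[OF I_qops(8)] I4_c2[OF I_qops(9)] I4_c2[OF I_qops(10)] I4_c1[OF I_qops(1)] I4_c2[OF I_qops(2)] I4_c2[OF I_qops(3)] I4_c2[OF I_qops(4)] I4_c2[OF I_qops(5)] f(1) g(1)
  show "R4 (\<lambda>x y z w. F x y z w + G x y z w)" "R4 (\<lambda>x y z w. F x y z w - G x y z w)" "R4 (\<lambda>x y z w. F x y z w * G x y z w)" "R4 (\<lambda>x y z w. max (F x y z w) (G x y z w))"
    "R4 (\<lambda>x y z w. min (F x y z w) (G x y z w))" "R4 (\<lambda>x y z w. \<bar>F x y z w\<bar>)" "R4 (\<lambda>x y z w. - F x y z w)"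
    unfolding f(2) g(2) rv_ops[symmetric] by (intro R4_rv c)+
  show "I4 (\<lambda>x y z w. of_bool (F x y z w \<le> G x y z w) :: num)" "I4 (\<lambda>x y z w. of_bool (F x y z w < G x y z w) :: num)" "I4 (\<lambda>x y z w. of_bool (F x y z w = G x y z w) :: num)"
    unfolding f(2) g(2) by (intro c)+
qed

lemma R4_ofn: "I4 F \<Longrightarrow> R4 (\<lambda>x y z w. ofn (F x y z w))" "I4 F \<Longrightarrow> R4 (\<lambda>x y z w. eps (F x y z w))"
  unfolding rv_qn[symmetric]
  by (erule R4_rv[OF I4_c1[OF I_qn(1)]] R4_rv[OF I4_c1[OF I_qn(2)]])+

lemma R4_if: "I4 (\<lambda>x y z w. of_bool (P x y z w) :: num) \<Longrightarrow> R4 F \<Longrightarrow> R4 G \<Longrightarrow> R4 (\<lambda>x y z w. if P x y z w then F x y z w else G x y z w)"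
  unfolding if_ofn by (intro R4_arith(1-3) R4_const R4_ofn(1))

lemmas R4_rules = R4_const R4_ofn R4_rv R4_if R4_arith(1-5,8-10)
  R4_arith(6,7)[OF _ R4_const[of 0]]

lemmas R_rules = R1_rules R2_rules R3_rules R4_rules

end

section \<open>Real numbers of the model and their values\<close>

definition isr :: "t1 \<Rightarrow> bool" where
  "isr x \<longleftrightarrow> (\<forall>n i. \<bar>rv (x \<bullet> n) - rv (x \<bullet> (n + i))\<bar> < eps n)"
definition val :: "t1 \<Rightarrow> K" where "val x = abs_k (\<lambda>n. rv (x \<bullet> n))"
definition rat :: "num \<Rightarrow> t1" where "rat q = cK \<bullet> q"

lemma abs_k_le: assumes "Cau X" "\<forall>\<^sub>F n in at_top. X n \<le> c" shows "abs_k X \<le> kq c"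
proof (rule ccontr)
  assume "\<not> ?thesis"
  then have "kpos (abs_k X - kq c)" by (simp add: less_K_def not_le)
  also have "abs_k X - kq c = abs_k (\<lambda>n. X n + - c)"
    using assms(1) unfolding minus_K_def kq.abs_eq
    by (simp add: uminus_K.abs_eq plus_K.abs_eq krel_refl Cau_const Cau_minus)
  finally have "Pos (\<lambda>n. X n + - c)"
    using assms(1) Cau_add[OF assms(1) Cau_const[of "- c"]] by (simp add: kpos.abs_eq krel_refl)
  then obtain r where "r > 0" "\<forall>\<^sub>F n in at_top. r < X n + - c" unfolding Pos_def by blast
  then have "\<forall>\<^sub>F n in at_top. r < X n + - c \<and> X n \<le> c" using assms(2) by (intro eventually_conj)
  from eventually_happens'[OF _ this] obtain n where "r < X n + - c \<and> X n \<le> c" by auto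
  then show False using \<open>r > 0\<close> by linarith
qed

lemma abs_k_minus: "Cau X \<Longrightarrow> abs_k (\<lambda>n. - X n) = - abs_k X"
  by (simp add: uminus_K.abs_eq krel_refl)

context counterexample
begin

lemma rat_app [simp]: "rat q \<bullet> n = q" by (simp add: rat_def cK_app[OF refuted])

lemma isr_rat [simp]: "isr (rat q)" by (simp add: isr_def eps_pos)

lemma val_rat [simp]: "val (rat q) = kq (rv q)"
  by (simp add: val_def kq.abs_eq)

lemma isr_Cau: assumes "isr x" shows "Cau (\<lambda>n. rv (x \<bullet> n))"
  unfolding Cau_def
proof (intro allI impI)
  fix r :: rt assume "0 < r"
  then obtain n where n: "eps n < r" using eps_arch by blast
  have "\<forall>m\<ge>n. \<bar>rv (x \<bullet> m) - rv (x \<bullet> n)\<bar> < r"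
  proof (intro allI impI)
    fix m assume "n \<le> m"
    then have "m = n + (m - n)" by (simp add: le_add_diff_inverse)
    then show "\<bar>rv (x \<bullet> m) - rv (x \<bullet> n)\<bar> < r"
      using assms n unfolding isr_def by (metis abs_minus_commute order.strict_trans)
  qed
  then show "\<exists>c. \<forall>\<^sub>F m in at_top. \<bar>rv (x \<bullet> m) - c\<bar> < r"
    unfolding eventually_at_top_linorder by blast
qed

text \<open>From index n on all terms lie within \<open>eps n\<close> of the n-th one, and this
  survives the limit with \<open>\<le>\<close> in place of the strict bound.\<close>

lemma val_approx: assumes "isr x" shows "\<bar>val x - kq (rv (x \<bullet> n))\<bar> \<le> kq (eps n)"
proof -
  have *: "\<bar>rv (x \<bullet> m) - rv (x \<bullet> n)\<bar> < eps n" if "n \<le> m" for m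
  proof -
    have "m = n + (m - n)" using that by (simp add: le_add_diff_inverse)
    then show ?thesis using assms unfolding isr_def by (metis abs_minus_commute)
  qed
  have "\<forall>\<^sub>F m in at_top. rv (x \<bullet> m) \<le> rv (x \<bullet> n) + eps n"
    unfolding eventually_at_top_linorder using * by (intro exI[of _ n]) (force simp: abs_less_iff)
  from abs_k_le[OF isr_Cau[OF assms] this] have 1: "val x \<le> kq (rv (x \<bullet> n)) + kq (eps n)" by (simp add: val_def)
  have "\<forall>\<^sub>F m in at_top. - rv (x \<bullet> m) \<le> - rv (x \<bullet> n) + eps n"
    unfolding eventually_at_top_linorder using * by (intro exI[of _ n]) (force simp: abs_less_iff)
  from abs_k_le[OF Cau_minus[OF isr_Cau[OF assms]] this] have 2: "- val x \<le> - kq (rv (x \<bullet> n)) + kq (eps n)"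
    unfolding abs_k_minus[OF isr_Cau[OF assms]] by (simp add: val_def)
  show ?thesis using 1 2 by linarith
qed

lemma keps_pos [simp]: "0 < kq (eps n)" using kq_less[of 0 "eps n"] eps_pos by simp

lemma keps_Suc: "kq (eps n) = 2 * kq (eps (n + 1))"
  by (subst eps_Suc) simp

lemma keps_mono: "m \<le> n \<Longrightarrow> kq (eps n) \<le> kq (eps m)"
  using eps_mono by simp

lemma keps_arch: "0 < x \<Longrightarrow> \<exists>n. kq (eps n) < x"
proof -
  assume "0 < x"
  then obtain r where "r > 0" "kq r < x" using kq_between by blast
  then show ?thesis using eps_arch[of r] by (meson kq_less order.strict_trans)
qed

lemma keps_arch4: "0 < x \<Longrightarrow> \<exists>n. 4 * kq (eps n) < x"
proof -
  assume "0 < x"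
  then obtain n where "kq (eps n) < x" using keps_arch by blast
  then show ?thesis using keps_Suc[of n] keps_Suc[of "n + 1"] by (intro exI[of _ "n + 1 + 1"]) simp
qed

text \<open>Comparison up to every power of two. The factor 4 leaves room for the sums of errors to
  which this is applied.\<close>

lemma k_le_eps: "(\<And>n. x \<le> y + 4 * kq (eps n)) \<Longrightarrow> x \<le> y"
proof (rule ccontr)
  assume *: "\<And>n. x \<le> y + 4 * kq (eps n)" and "\<not> x \<le> y"
  then obtain n where "4 * kq (eps n) < x - y" using keps_arch4[of "x - y"] by auto
  then show False using *[of n] by linarith
qed

lemma k_eq_eps: assumes "\<And>n. \<bar>x - y\<bar> \<le> 4 * kq (eps n)" shows "x = (y::K)"
proof (rule antisym)
  show "x \<le> y" by (rule k_le_eps) (use assms in \<open>metis abs_le_iff add.commute diff_le_eq\<close>)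
  show "y \<le> x" by (rule k_le_eps) (use assms in \<open>metis abs_le_iff abs_minus_commute add.commute diff_le_eq\<close>)
qed

text \<open>The slack \<open>2 * eps n\<close> in the order of the language is the sum of the errors
  of x and y at n, and it disappears in the limit.\<close>

lemma le_val_iff:
  assumes "isr x" "isr y"
  shows "(\<forall>n. rv (x \<bullet> n) \<le> rv (y \<bullet> n) + 2 * eps n) \<longleftrightarrow> val x \<le> val y"
proof
  assume *: "\<forall>n. rv (x \<bullet> n) \<le> rv (y \<bullet> n) + 2 * eps n"
  show "val x \<le> val y"
  proof (rule k_le_eps)
    fix n
    have "kq (rv (x \<bullet> n)) \<le> kq (rv (y \<bullet> n) + 2 * eps n)" using * by (simp only: kq_le)
    then have "kq (rv (x \<bullet> n)) \<le> kq (rv (y \<bullet> n)) + 2 * kq (eps n)" by simp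
    then show "val x \<le> val y + 4 * kq (eps n)"
      using val_approx[OF assms(1), of n] val_approx[OF assms(2), of n] by linarith
  qed
next
  assume le: "val x \<le> val y"
  show "\<forall>n. rv (x \<bullet> n) \<le> rv (y \<bullet> n) + 2 * eps n"
  proof
    fix n
    have "kq (rv (x \<bullet> n)) \<le> kq (rv (y \<bullet> n)) + 2 * kq (eps n)"
      using val_approx[OF assms(1), of n] val_approx[OF assms(2), of n] le by linarith
    then have "kq (rv (x \<bullet> n)) \<le> kq (rv (y \<bullet> n) + 2 * eps n)" by simp
    then show "rv (x \<bullet> n) \<le> rv (y \<bullet> n) + 2 * eps n" by (simp only: kq_le)
  qed
qed

lemma eq_val_iff:
  assumes "isr x" "isr y"
  shows "(\<forall>n. \<bar>rv (x \<bullet> n) - rv (y \<bullet> n)\<bar> \<le> 2 * eps n) \<longleftrightarrow> val x = val y"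
proof -
  have "(\<forall>n. \<bar>rv (x \<bullet> n) - rv (y \<bullet> n)\<bar> \<le> 2 * eps n) \<longleftrightarrow>
      (\<forall>n. rv (x \<bullet> n) \<le> rv (y \<bullet> n) + 2 * eps n) \<and> (\<forall>n. rv (y \<bullet> n) \<le> rv (x \<bullet> n) + 2 * eps n)"
    by (auto simp: abs_le_iff algebra_simps)
  then show ?thesis unfolding le_val_iff[OF assms] le_val_iff[OF assms(2,1)] by auto
qed

lemma real_of_approx:
  assumes F: "R1 F" and ap: "\<And>n. \<bar>v - kq (F n)\<bar> \<le> kq (eps n)"
  shows "\<exists>x. isr x \<and> val x = v \<and> (\<forall>n. rv (x \<bullet> n) = F (n + 1 + 1))"
proof -
  obtain G where G: "I1 G" "\<And>n. rv (G n) = F n" using F unfolding R1_def by blast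
  then obtain g where g: "\<And>n. g \<bullet> n = G n" unfolding I1_def by blast
  \<comment> \<open>Approximations from n + 2 on differ by at most \<open>2 * eps (n + 2)\<close>,
    which is strictly below \<open>eps n\<close> as fast convergence demands.\<close>
  have "I1 (\<lambda>n. g \<bullet> (n + 1 + 1))" by (intro I_rules)
  then obtain x where x: "\<And>n. x \<bullet> n = g \<bullet> (n + 1 + 1)" unfolding I1_def by blast
  have r: "rv (x \<bullet> n) = F (n + 1 + 1)" for n by (simp add: x g G)
  have "isr x"
    unfolding isr_def r
  proof (intro allI)
    fix n i
    have "kq (eps (n + i + 1 + 1)) \<le> kq (eps (n + 1 + 1))" by (intro keps_mono) simp
    then have "\<bar>kq (F (n + 1 + 1)) - kq (F (n + i + 1 + 1))\<bar> \<le> 2 * kq (eps (n + 1 + 1))"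
      using ap[of "n + 1 + 1"] ap[of "n + i + 1 + 1"] by linarith
    also have "\<dots> < kq (eps n)" using keps_Suc[of n] keps_Suc[of "n + 1"] keps_pos[of "n + 1 + 1"] by linarith
    finally have "kq \<bar>F (n + 1 + 1) - F (n + i + 1 + 1)\<bar> < kq (eps n)" by simp
    then show "\<bar>F (n + 1 + 1) - F (n + i + 1 + 1)\<bar> < eps n" by (simp only: kq_less)
  qed
  moreover have "val x = v"
  proof (rule k_eq_eps)
    fix n
    have "kq (eps (n + 1 + 1)) \<le> kq (eps n)" by (intro keps_mono) (simp add: add.assoc)
    then show "\<bar>val x - v\<bar> \<le> 4 * kq (eps n)"
      using ap[of "n + 1 + 1"] val_approx[OF \<open>isr x\<close>, of n] keps_pos[of n] unfolding r by linarith
  qed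
  ultimately show ?thesis using r by blast
qed

lemma real_diff:
  assumes "isr x" "isr y" shows "\<exists>z. isr z \<and> val z = val x - val y"
proof -
  have "R1 (\<lambda>n. rv (x \<bullet> (n + 1)) - rv (y \<bullet> (n + 1)))"
    by (intro R_rules I_rules)
  moreover have "\<bar>val x - val y - kq (rv (x \<bullet> (n + 1)) - rv (y \<bullet> (n + 1)))\<bar> \<le> kq (eps n)" for n
    using val_approx[OF assms(1), of "n + 1"] val_approx[OF assms(2), of "n + 1"] keps_Suc[of n]
    unfolding kq_diff by linarith
  ultimately show ?thesis using real_of_approx by blast
qed

lemma dist_val:
  assumes "isr x" "isr y" "\<And>k. rv (z \<bullet> k) = \<bar>rv (x \<bullet> (k + 1)) - rv (y \<bullet> (k + 1))\<bar>"
  shows "isr z" "val z = \<bar>val x - val y\<bar>"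
proof -
  show "isr z"
    unfolding isr_def assms(3)
  proof (intro allI)
    fix n i
    have "\<bar>rv (x \<bullet> (n + 1)) - rv (x \<bullet> (n + 1 + i))\<bar> < eps (n + 1)" "\<bar>rv (y \<bullet> (n + 1)) - rv (y \<bullet> (n + 1 + i))\<bar> < eps (n + 1)"
      using assms(1,2) unfolding isr_def by blast+
    then show "\<bar>\<bar>rv (x \<bullet> (n + 1)) - rv (y \<bullet> (n + 1))\<bar> - \<bar>rv (x \<bullet> (n + i + 1)) - rv (y \<bullet> (n + i + 1))\<bar>\<bar> < eps n"
      using eps_Suc[of n] unfolding add.assoc add.commute[of i 1] by linarith
  qed
  show "val z = \<bar>val x - val y\<bar>"
  proof (rule k_eq_eps)
    fix n
    have "val z - kq \<bar>rv (x \<bullet> (n + 1)) - rv (y \<bullet> (n + 1))\<bar> \<le> kq (eps n)"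
      "kq \<bar>rv (x \<bullet> (n + 1)) - rv (y \<bullet> (n + 1))\<bar> - val z \<le> kq (eps n)"
      using val_approx[OF \<open>isr z\<close>, of n] unfolding assms(3) by linarith+
    then show "\<bar>val z - \<bar>val x - val y\<bar>\<bar> \<le> 4 * kq (eps n)"
      using val_approx[OF assms(1), of "n + 1"] val_approx[OF assms(2), of "n + 1"] keps_Suc[of n] keps_pos[of n]
      unfolding kq_abs kq_diff by linarith
  qed
qed

lemma dist_ex:
  "\<exists>z::t1. \<forall>k. rv (z \<bullet> k) = \<bar>rv (x \<bullet> (k + 1)) - rv (y \<bullet> (k + 1))\<bar>"
proof -
  have "R1 (\<lambda>k. \<bar>rv (x \<bullet> (k + 1)) - rv (y \<bullet> (k + 1))\<bar>)" by (intro R_rules I_rules)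
  then show ?thesis unfolding R1_def I1_def by metis
qed

end

section \<open>The sentences in the model\<close>

definition rle :: "t1 \<Rightarrow> t1 \<Rightarrow> bool" where
  "rle x y \<longleftrightarrow> (\<forall>n. rv (x \<bullet> n) \<le> rv (y \<bullet> n) + 2 * eps n)"
definition req1 :: "t1 \<Rightarrow> t1 \<Rightarrow> bool" where
  "req1 x y \<longleftrightarrow> (\<forall>n. \<bar>rv (x \<bullet> n) - rv (y \<bullet> n)\<bar> \<le> 2 * eps n)"
definition isd :: "t1 \<Rightarrow> t1 \<Rightarrow> t1 \<Rightarrow> bool" where
  "isd z x y \<longleftrightarrow> (\<forall>k. rv (z \<bullet> k) = \<bar>rv (x \<bullet> (k + 1)) - rv (y \<bullet> (k + 1))\<bar>)"
definition inball :: "t1 \<Rightarrow> num \<Rightarrow> t1 \<Rightarrow> bool" where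
  "inball x r y \<longleftrightarrow> (\<exists>z. isr z \<and> isd z x y \<and> \<not> rle (rat r) z)"
definition rfun :: "t11 \<Rightarrow> bool" where
  "rfun F \<longleftrightarrow> (\<forall>x. isr x \<longrightarrow> isr (F \<bullet> x)) \<and> (\<forall>x. isr x \<longrightarrow> (\<forall>y. isr y \<longrightarrow> req1 x y \<longrightarrow> req1 (F \<bullet> x) (F \<bullet> y)))"
definition contf :: "t11 \<Rightarrow> bool" where
  "contf F \<longleftrightarrow> (\<forall>x. isr x \<longrightarrow> (\<forall>q. 0 < rv q \<longrightarrow> (\<exists>d. 0 < rv d \<and>
    (\<forall>y. isr y \<longrightarrow> inball x d y \<longrightarrow> inball (F \<bullet> x) q (F \<bullet> y)))))"
definition memb :: "t1 \<Rightarrow> t11 \<Rightarrow> bool" where "memb x Y \<longleftrightarrow> \<not> rle (Y \<bullet> x) (rat 0)"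
definition openp :: "(t1 \<Rightarrow> bool) \<Rightarrow> bool" where
  "openp P \<longleftrightarrow> (\<forall>x. isr x \<longrightarrow> P x \<longrightarrow> (\<exists>r. 0 < rv r \<and> (\<forall>y. isr y \<longrightarrow> inball x r y \<longrightarrow> P y)))"
definition dist_of :: "t1 \<Rightarrow> t1 \<Rightarrow> t11 \<Rightarrow> bool" where
  "dist_of d x C \<longleftrightarrow> (\<forall>y. isr y \<longrightarrow> memb y C \<longrightarrow> (\<exists>z. isr z \<and> isd z x y \<and> rle d z)) \<and>
    (\<forall>e. isr e \<longrightarrow> (\<forall>y. isr y \<longrightarrow> memb y C \<longrightarrow> (\<exists>z. isr z \<and> isd z x y \<and> rle e z)) \<longrightarrow> rle e d)"

definition e3 :: bool where
  "e3 \<longleftrightarrow> (\<exists>E::t3. \<forall>Y. E \<bullet> Y \<le> 1 \<and> (E \<bullet> Y = 0 \<longleftrightarrow> (\<exists>f. Y \<bullet> f = 0)))"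
definition clo :: bool where
  "clo \<longleftrightarrow> (\<forall>C. rfun C \<and> openp (\<lambda>x. \<not> memb x C) \<and> (\<exists>x. isr x \<and> memb x C) \<longrightarrow>
    (\<exists>D. rfun D \<and> contf D \<and> (\<forall>x. isr x \<longrightarrow> dist_of (D \<bullet> x) x C)))"
definition opn :: bool where
  "opn \<longleftrightarrow> (\<forall>Y. rfun Y \<and> openp (\<lambda>x. memb x Y) \<longrightarrow> (\<exists>X::t1. \<forall>n. X \<bullet> n \<le> 1 \<and>
    (X \<bullet> n = 1 \<longleftrightarrow> (\<exists>q r. (\<exists>d e. n = pair q (pair d e) \<and> r = qcode (d + 1) 0 e) \<and>
      (\<forall>y. isr y \<longrightarrow> inball (rat q) r y \<longrightarrow> memb y Y)))))"
definition hbc :: bool where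
  "hbc \<longleftrightarrow> (\<forall>C. rfun C \<and> openp (\<lambda>x. \<not> memb x C) \<and>
    (\<forall>x. isr x \<longrightarrow> memb x C \<longrightarrow> rle (rat 0) x \<and> rle x (rat 1)) \<longrightarrow>
    (\<forall>(a::t01) (b::t01). (\<forall>n. isr (a \<bullet> n) \<and> isr (b \<bullet> n)) \<and>
      (\<forall>x. isr x \<longrightarrow> memb x C \<longrightarrow> (\<exists>n. \<not> rle x (a \<bullet> n) \<and> \<not> rle (b \<bullet> n) x)) \<longrightarrow>
      (\<exists>n0. \<forall>x. isr x \<longrightarrow> memb x C \<longrightarrow> (\<exists>n. n \<le> n0 \<and> \<not> rle x (a \<bullet> n) \<and> \<not> rle (b \<bullet> n) x))))"

text \<open>\<open>gd\<close> says that the components of a symbolic rational denote numbers and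
  that its denominator is not zero; \<open>tv\<close> is then its value.\<close>

definition gd :: "env \<Rightarrow> rat_tm \<Rightarrow> bool" where
  "gd e u = (case u of (p, n, d) \<Rightarrow> (\<exists>P N D. eval M0 e p = rp (P::num) \<and> eval M0 e n = rp (N::num) \<and>
    eval M0 e d = rp (D::num) \<and> D \<noteq> 0))"
definition tv :: "env \<Rightarrow> rat_tm \<Rightarrow> rt" where
  "tv e u = (case u of (p, n, d) \<Rightarrow>
    (ofn (ab (eval M0 e p)) - ofn (ab (eval M0 e n))) / ofn (ab (eval M0 e d)))"

context counterexample
begin

lemma rp_arith [simp]: "rp (cadd \<bullet> m \<bullet> n) = rp (m + n)" "rp (cmul \<bullet> m \<bullet> n) = rp (m * n)"
  "rp c0 = rp (0::num)" "rp c1 = rp (1::num)" "cls m n \<longleftrightarrow> m < n"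
  using plus_cadd times_cmul zero_c0 one_c1 less_cls by simp_all

lemma sat_le [simp]:
  "eval M0 e s = rp (m::num) \<Longrightarrow> eval M0 e t = rp n \<Longrightarrow> sat M0 e ((s \<^bold>\<le> t) k) \<longleftrightarrow> m \<le> n"
  by (auto simp: s_le_def le_less)

lemma sat_pair_code [simp]:
  "eval M0 e n = rp N \<Longrightarrow> eval M0 e x = rp X \<Longrightarrow> eval M0 e y = rp Y \<Longrightarrow>
    sat M0 e (pair_code n x y k) \<longleftrightarrow> N = pair X Y"
  using pair_code_num by (simp add: pair_code_def)

lemma sat_rat_code [simp]:
  "eval M0 e q = rp Q \<Longrightarrow> eval M0 e a = rp A \<Longrightarrow> eval M0 e b = rp B \<Longrightarrow> eval M0 e c = rp C \<Longrightarrow>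
    ltv q k \<Longrightarrow> ltv a k \<Longrightarrow> ltv b k \<Longrightarrow> ltv c k \<Longrightarrow> sat M0 e (rat_code q a b c k) \<longleftrightarrow> Q = qcode A B C"
  by (simp add: rat_code_def qcode_def)

lemma qcode_iff: "Q = qcode A B C \<longleftrightarrow> A = pi1 Q \<and> B = pi1 (pi2 Q) \<and> C = pi2 (pi2 Q)"
  unfolding qcode_def using pair_eq_iff pi_pair by metis

lemma sat_with_rat [simp]:
  "eval M0 e q = rp Q \<Longrightarrow> ltv q k \<Longrightarrow> sat M0 e (with_rat q F k) \<longleftrightarrow>
    sat M0 (e((k, Nt) := rp (pi1 Q), (Suc k, Nt) := rp (pi1 (pi2 Q)), (Suc (Suc k), Nt) := rp (pi2 (pi2 Q))))
      (F (Var k Nt, Var (Suc k) Nt, Var (Suc (Suc k)) Nt \<oplus> One) (Suc (Suc (Suc k))))"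
  by (simp add: with_rat_def qcode_iff)

lemma gd_simp [simp]: "gd e (p, n, d) \<longleftrightarrow> (\<exists>P. eval M0 e p = rp (P::num)) \<and> (\<exists>N. eval M0 e n = rp (N::num)) \<and>
    (\<exists>D. eval M0 e d = rp (D::num) \<and> D \<noteq> 0)"
  by (auto simp: gd_def)

lemma tv_simp [simp]: "tv e (p, n, d) = (ofn (ab (eval M0 e p)) - ofn (ab (eval M0 e n))) / ofn (ab (eval M0 e d))"
  by (simp add: tv_def)

lemma ofn_nz_iff [simp]: "ofn n = 0 \<longleftrightarrow> n = 0" using ofn_simps(7)[of n 0] by simp
lemma ofn_pos_iff: "n \<noteq> 0 \<Longrightarrow> 0 < ofn n" using ofn_simps(6)[of 0 n] by simp

lemma sat_q_less [simp]: "gd e u \<Longrightarrow> gd e v \<Longrightarrow> sat M0 e (q_less u v k) \<longleftrightarrow> tv e u < tv e v"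
proof -
  assume "gd e u" "gd e v"
  moreover obtain p n d where u: "u = (p, n, d)" by (cases u)
  moreover obtain p' n' d' where v: "v = (p', n', d')" by (cases v)
  ultimately obtain P N D P' N' D' where *: "eval M0 e p = rp (P::num)" "eval M0 e n = rp (N::num)"
    "eval M0 e d = rp (D::num)" "D \<noteq> 0" "eval M0 e p' = rp (P'::num)" "eval M0 e n' = rp (N'::num)"
    "eval M0 e d' = rp (D'::num)" "D' \<noteq> 0" by auto
  have "sat M0 e (q_less u v k) \<longleftrightarrow> P * D' + N' * D < P' * D + N * D'"
    by (simp add: u v *)
  also have "\<dots> \<longleftrightarrow> ofn (P * D' + N' * D) < ofn (P' * D + N * D')" unfolding ofn_simps(6) ..
  also have "\<dots> \<longleftrightarrow> (ofn P - ofn N) * ofn D' < (ofn P' - ofn N') * ofn D" by (simp add: algebra_simps)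
  also have "\<dots> \<longleftrightarrow> (ofn P - ofn N) / ofn D < (ofn P' - ofn N') / ofn D'"
    using ofn_pos_iff[OF *(4)] ofn_pos_iff[OF *(8)] by (simp add: divide_less_eq pos_less_divide_eq)
  finally show ?thesis by (simp add: u v *)
qed

lemma gd_neg [simp]: "gd e (q_neg u) \<longleftrightarrow> gd e u" by (cases u) auto
lemma tv_neg [simp]: "tv e (q_neg u) = - tv e u"
  by (cases u) (simp add: minus_divide_left[symmetric] del: minus_divide_left, simp add: diff_divide_distrib)
lemma gd_add [simp]: "gd e u \<Longrightarrow> gd e v \<Longrightarrow> gd e (q_add u v)"
  by (cases u; cases v) auto
lemma tv_add [simp]: "gd e u \<Longrightarrow> gd e v \<Longrightarrow> tv e (q_add u v) = tv e u + tv e v"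
  by (cases u; cases v) (auto simp: add_frac_eq algebra_simps)
lemma tv_diff [simp]: "gd e u \<Longrightarrow> gd e v \<Longrightarrow> gd e (q_diff u v)"
  "gd e u \<Longrightarrow> gd e v \<Longrightarrow> tv e (q_diff u v) = tv e u - tv e v"
  by (simp_all add: q_diff_def)
lemma tv_zero [simp]: "gd e q_zero" "tv e q_zero = 0"
  by (simp_all add: q_zero_def)

lemma sat_q_rels [simp]:
  assumes "gd e u" "gd e v"
  shows "sat M0 e (q_le u v k) \<longleftrightarrow> tv e u \<le> tv e v" "sat M0 e (q_eq u v k) \<longleftrightarrow> tv e u = tv e v"
    "sat M0 e (q_abs_less u v k) \<longleftrightarrow> \<bar>tv e u\<bar> < tv e v" "sat M0 e (q_abs_le u v k) \<longleftrightarrow> \<bar>tv e u\<bar> \<le> tv e v"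
    "sat M0 e (q_is_abs u v k) \<longleftrightarrow> tv e u = \<bar>tv e v\<bar>"
  using assms
  by (auto simp: q_le_def q_eq_def q_abs_less_def q_abs_le_def q_is_abs_def not_less abs_less_iff abs_le_iff abs_if)

lemma ct_inst [simp]:
  "ct M0 (Kc Nt Nt) = rp (cK :: (num, t1) fn)" "ct M0 (Kc T1 Nt) = rp (cK :: (t1, (num, t1) fn) fn)"
  "ct M0 (Kc Nt T1) = rp (cK :: (num, (t1, num) fn) fn)"
  "ct M0 (Sc Nt Nt Nt) = rp (cS :: ((num, t1) fn, (t1, t1) fn) fn)"
  "ct M0 (Sc Nt T1 Nt) = rp (cS :: ((num, t2) fn, ((num, t1) fn, t1) fn) fn)"
  using rp_cK[where 'a = num and 'b = num] rp_cK[where 'a = t1 and 'b = num]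
    rp_cK[where 'a = num and 'b = t1] rp_cS[where 'a = num and 'b = num and 'c = num]
    rp_cS[where 'a = num and 'b = t1 and 'c = num] by simp_all

text \<open>The combinator term of the language computes doubling, and extensionality identifies it
  with the abstraction used in \<open>pw\<close>.\<close>

lemma eval_two_pow [simp]: "eval M0 e n = rp N \<Longrightarrow> eval M0 e (two_pow n) = rp (pw N)"
proof -
  let ?f = "cK \<bullet> (cS \<bullet> cadd \<bullet> (cS \<bullet> cK \<bullet> (cK :: (num, t1) fn))) :: (num, t1) fn"
  have 1: "I1 (\<lambda>i::num. lam (\<lambda>a::num. a + a))" by (intro I_rules)
  have 2: "I1 (\<lambda>a::num. a + a)" by (intro I_rules)
  have l: "lam (\<lambda>i. lam (\<lambda>a. a + a)) \<bullet> i \<bullet> a = a + a" for i a :: num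
    by (simp only: lam[OF 1] lam[OF 2])
  have "?f \<bullet> i \<bullet> a = a + a" for i a
    by (simp add: cK_app[OF refuted] cS_app[OF refuted] plus_cadd)
  then have f: "?f = lam (\<lambda>i. lam (\<lambda>a. a + a))"
    using l by (simp add: fn_eq_iff)
  assume "eval M0 e n = rp N"
  then have "eval M0 e (two_pow n) = rp (cR \<bullet> ?f \<bullet> c1 \<bullet> N)" by (simp add: two_pow_def del: rp_arith)
  then show ?thesis unfolding f pw_def prec_def one_c1 .
qed

lemma pw_nz [simp]: "pw n \<noteq> 0" using less_pw[of n] by auto

lemma ofn_2 [simp]: "ofn 2 = 2"
  by (metis one_add_one ofn_simps(2,3))

lemma tv_eps [simp]:
  "eval M0 e n = rp N \<Longrightarrow> gd e (q_eps n)" "eval M0 e n = rp N \<Longrightarrow> tv e (q_eps n) = eps N"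
  "eval M0 e n = rp N \<Longrightarrow> gd e (q_eps2 n)" "eval M0 e n = rp N \<Longrightarrow> tv e (q_eps2 n) = 2 * eps N"
  by (simp_all add: q_eps_def q_eps2_def eps_def)

lemma tv_code [simp]:
  "(ofn (pi1 q) - ofn (pi1 (pi2 q))) / (ofn (pi2 (pi2 q)) + 1) = rv q" by (simp add: rv_def)

lemma sat_is_real [simp]: "eval M0 e x = rp X \<Longrightarrow> ltv x n \<Longrightarrow> sat M0 e (is_real x n) \<longleftrightarrow> isr X"
  by (simp add: is_real_def isr_def)

lemma sat_r_le [simp]: "eval M0 e x = rp X \<Longrightarrow> eval M0 e y = rp Y \<Longrightarrow> ltv x n \<Longrightarrow> ltv y n \<Longrightarrow>
    sat M0 e (r_le x y n) \<longleftrightarrow> rle X Y"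
  by (simp add: r_le_def rle_def)

lemma sat_r_eq [simp]: "eval M0 e x = rp X \<Longrightarrow> eval M0 e y = rp Y \<Longrightarrow> ltv x n \<Longrightarrow> ltv y n \<Longrightarrow>
    sat M0 e (r_eq x y n) \<longleftrightarrow> req1 X Y"
  by (simp add: r_eq_def req1_def)

lemma sat_r_less [simp]: "eval M0 e x = rp X \<Longrightarrow> eval M0 e y = rp Y \<Longrightarrow> ltv x n \<Longrightarrow> ltv y n \<Longrightarrow>
    sat M0 e (r_less x y n) \<longleftrightarrow> \<not> rle Y X"
  by (simp add: r_less_def)

lemma eval_r_of_rat [simp]: "eval M0 e q = rp Q \<Longrightarrow> eval M0 e (r_of_rat q) = rp (rat Q)"
  by (simp add: r_of_rat_def rat_def)

lemma ltv_r_of_rat [simp]: "ltv (r_of_rat q) n = ltv q n" by (simp add: r_of_rat_def)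

lemma sat_r_is_dist [simp]: "eval M0 e z = rp Z \<Longrightarrow> eval M0 e x = rp X \<Longrightarrow> eval M0 e y = rp Y \<Longrightarrow>
    ltv z n \<Longrightarrow> ltv x n \<Longrightarrow> ltv y n \<Longrightarrow> sat M0 e (r_is_dist z x y n) \<longleftrightarrow> isd Z X Y"
  by (simp add: r_is_dist_def isd_def)

lemma sat_in_ball [simp]: "eval M0 e x = rp X \<Longrightarrow> eval M0 e y = rp Y \<Longrightarrow> eval M0 e r = rp R \<Longrightarrow>
    ltv r n \<Longrightarrow> ltv x n \<Longrightarrow> ltv y n \<Longrightarrow> sat M0 e (in_ball x r y n) \<longleftrightarrow> inball X R Y"
  by (simp add: in_ball_def with_dist_def ExistsR_def inball_def)

lemma sat_pos_rat [simp]: "eval M0 e r = rp R \<Longrightarrow> ltv r n \<Longrightarrow> sat M0 e (pos_rat r n) \<longleftrightarrow> 0 < rv R"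
  by (simp add: pos_rat_def)

lemma sat_real_function [simp]: "eval M0 e F = rp F' \<Longrightarrow> ltv F n \<Longrightarrow> sat M0 e (real_function F n) \<longleftrightarrow> rfun F'"
  by (simp add: real_function_def ForallR_def rfun_def)

lemma sat_continuous [simp]: "eval M0 e F = rp F' \<Longrightarrow> ltv F n \<Longrightarrow> sat M0 e (continuous_function F n) \<longleftrightarrow> contf F'"
  by (simp add: continuous_function_def ForallR_def contf_def)

lemma sat_mem [simp]: "eval M0 e Y = rp Y' \<Longrightarrow> eval M0 e x = rp X \<Longrightarrow> ltv Y n \<Longrightarrow> ltv x n \<Longrightarrow>
    sat M0 e (mem x Y n) \<longleftrightarrow> memb X Y'"
  by (simp add: mem_def memb_def)

lemma sat_is_distance [simp]: "eval M0 e d = rp D \<Longrightarrow> eval M0 e x = rp X \<Longrightarrow> eval M0 e C = rp C' \<Longrightarrow>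
    ltv d n \<Longrightarrow> ltv x n \<Longrightarrow> ltv C n \<Longrightarrow> sat M0 e (is_distance d x C n) \<longleftrightarrow> dist_of D X C'"
  by (simp add: is_distance_def ForallR_def with_dist_def ExistsR_def dist_of_def)

lemma sat_E3: "sat M0 e E3 \<longleftrightarrow> e3"
  by (simp add: E3_def e3_def)

lemma sat_CLO: "sat M0 e CLO \<longleftrightarrow> clo"
  by (simp add: CLO_def clo_def closed_set_def open_pred_def openp_def ForallR_def ExistsR_def conj_assoc)

lemma sat_OPEN: "sat M0 e OPEN \<longleftrightarrow> opn"
  by (simp add: OPEN_def opn_def open_set_def open_pred_def openp_def ForallR_def ball_enum_def)

lemma sat_HBC: "sat M0 e HBC \<longleftrightarrow> hbc"
  by (simp add: HBC_def hbc_def closed_set_def open_pred_def openp_def ForallR_def conj_assoc)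

end

section \<open>Number quantifiers and the functional \<open>\<exists>\<^sup>2\<close>\<close>

definition e2 :: bool where "e2 \<longleftrightarrow> (\<exists>E::t2. \<forall>f. E \<bullet> f = 0 \<longleftrightarrow> (\<exists>n. f \<bullet> n = 0))"

text \<open>Arithmetical comprehension in semantic form: the sets of numbers of the model are closed
  under a number quantifier. Other parameters may be hidden in P, but nothing is uniform in them,
  unlike in \<open>e2\<close>.\<close>

definition jmp :: bool where
  "jmp \<longleftrightarrow> (\<forall>P. I2 (\<lambda>s a. of_bool (P s a) :: num) \<longrightarrow> I1 (\<lambda>s::num. of_bool (\<exists>a::num. P s a) :: num))"

context counterexample
begin

lemmas Ir = I_rules I_pair

text \<open>Here x may have any type, because the functional is applied to the abstraction over n
  for all x at once.\<close>

lemma e2_I1: "e2 \<Longrightarrow> I2 (\<lambda>x n. of_bool (P x n) :: num) \<Longrightarrow> I1 (\<lambda>x. of_bool (\<exists>n::num. P x n) :: num)"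
proof -
  assume "e2" and P: "I2 (\<lambda>x n. of_bool (P x n) :: num)"
  then obtain E :: t2 where E: "\<And>f. E \<bullet> f = 0 \<longleftrightarrow> (\<exists>n. f \<bullet> n = 0)" unfolding e2_def by blast
  have "I2 (\<lambda>x n. 1 - of_bool (P x n) :: num)" by (intro Ir P)
  from I2D[OF this] have f: "lam (\<lambda>n. 1 - of_bool (P x n) :: num) \<bullet> n = 1 - of_bool (P x n)" for x n
    by (rule lam)
  have "(\<exists>n. P x n) \<longleftrightarrow> E \<bullet> lam (\<lambda>n. 1 - of_bool (P x n)) = 0" for x
    unfolding E f by (auto simp: of_bool_def split: if_splits)
  then show ?thesis by (simp only:) (intro Ir P)
qed

lemma e2_I2: "e2 \<Longrightarrow> I3 (\<lambda>x y n. of_bool (P x y n) :: num) \<Longrightarrow> I2 (\<lambda>x y. of_bool (\<exists>n::num. P x y n) :: num)"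
proof -
  assume "e2" and P: "I3 (\<lambda>x y n. of_bool (P x y n) :: num)"
  then obtain E :: t2 where E: "\<And>f. E \<bullet> f = 0 \<longleftrightarrow> (\<exists>n. f \<bullet> n = 0)" unfolding e2_def by blast
  have "I1 (\<lambda>n. of_bool (P x y n) :: num)" for x y using P unfolding I3_def I1_def by blast
  then have "I1 (\<lambda>n. 1 - of_bool (P x y n) :: num)" for x y by (intro Ir)
  then have f: "lam (\<lambda>n. 1 - of_bool (P x y n) :: num) \<bullet> n = 1 - of_bool (P x y n)" for x y n
    by (rule lam)
  have "(\<exists>n. P x y n) \<longleftrightarrow> E \<bullet> lam (\<lambda>n. 1 - of_bool (P x y n)) = 0" for x y
    unfolding E f by (auto simp: of_bool_def split: if_splits)
  then show ?thesis by (simp only:) (intro Ir P)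
qed

lemma e2_all: assumes e2 shows
  "I2 (\<lambda>x n. of_bool (P x n) :: num) \<Longrightarrow> I1 (\<lambda>x. of_bool (\<forall>n::num. P x n) :: num)"
  "I3 (\<lambda>x y n. of_bool (Q x y n) :: num) \<Longrightarrow> I2 (\<lambda>x y. of_bool (\<forall>n::num. Q x y n) :: num)"
proof -
  assume "I2 (\<lambda>x n. of_bool (P x n) :: num)"
  then have "I1 (\<lambda>x. of_bool (\<not> (\<exists>n. \<not> P x n)) :: num)" by (intro Ir e2_I1[OF assms])
  then show "I1 (\<lambda>x. of_bool (\<forall>n. P x n) :: num)" by simp
next
  assume "I3 (\<lambda>x y n. of_bool (Q x y n) :: num)"
  then have "I2 (\<lambda>x y. of_bool (\<not> (\<exists>n. \<not> Q x y n)) :: num)" by (intro Ir e2_I2[OF assms])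
  then show "I2 (\<lambda>x y. of_bool (\<forall>n. Q x y n) :: num)" by simp
qed

lemma jmp_I1: "jmp \<Longrightarrow> I2 (\<lambda>s a. of_bool (P s a) :: num) \<Longrightarrow> I1 (\<lambda>s::num. of_bool (\<exists>a::num. P s a) :: num)"
  unfolding jmp_def by blast

text \<open>Two number parameters are packed into one by pairing.\<close>

lemma jmp_I2:
  assumes jmp and P: "I3 (\<lambda>s t a. of_bool (P s t a) :: num)"
  shows "I2 (\<lambda>(s::num) (t::num). of_bool (\<exists>a::num. P s t a) :: num)"
proof -
  have "I1 (\<lambda>u::num. of_bool (\<exists>a. P (pi1 u) (pi2 u) a) :: num)"
    by (intro jmp_I1[OF assms(1)] I2_c3[OF P] Ir)
  from I2_c1[OF this I2_pair] show ?thesis by (simp add: pi_pair)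
qed

lemma jmp_I3:
  assumes jmp and P: "I4 (\<lambda>s t u a. of_bool (P s t u a) :: num)"
  shows "I3 (\<lambda>(s::num) (t::num) (u::num). of_bool (\<exists>a::num. P s t u a) :: num)"
proof -
  obtain p where p: "\<And>s t u a. p \<bullet> s \<bullet> t \<bullet> u \<bullet> a = (of_bool (P s t u a) :: num)" using P unfolding I4_def by blast
  have "I3 (\<lambda>(v::num) (u::num) (a::num). p \<bullet> pi1 v \<bullet> pi2 v \<bullet> u \<bullet> a)" by (intro Ir)
  then have "I2 (\<lambda>(v::num) (u::num). of_bool (\<exists>a. P (pi1 v) (pi2 v) u a) :: num)"
    unfolding p by (rule jmp_I2[OF assms(1)])
  moreover have "I3 (\<lambda>(s::num) (t::num) (u::num). pair s t)" by (intro Ir)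
  ultimately have "I3 (\<lambda>(s::num) (t::num) (u::num). of_bool (\<exists>a. P (pi1 (pair s t)) (pi2 (pair s t)) u a) :: num)"
    by (rule I3_c2) (intro Ir)
  then show ?thesis by (simp add: pi_pair)
qed

lemma jmp_all: assumes jmp shows
  "I2 (\<lambda>x n. of_bool (P x n) :: num) \<Longrightarrow> I1 (\<lambda>x::num. of_bool (\<forall>n::num. P x n) :: num)"
  "I3 (\<lambda>x y n. of_bool (Q x y n) :: num) \<Longrightarrow> I2 (\<lambda>(x::num) (y::num). of_bool (\<forall>n::num. Q x y n) :: num)"
  "I4 (\<lambda>x y z n. of_bool (R x y z n) :: num) \<Longrightarrow>
    I3 (\<lambda>(x::num) (y::num) (z::num). of_bool (\<forall>n::num. R x y z n) :: num)"
proof -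
  assume "I2 (\<lambda>x n. of_bool (P x n) :: num)"
  then have "I1 (\<lambda>x. of_bool (\<not> (\<exists>n. \<not> P x n)) :: num)" by (intro Ir jmp_I1[OF assms])
  then show "I1 (\<lambda>x. of_bool (\<forall>n. P x n) :: num)" by simp
next
  assume "I3 (\<lambda>x y n. of_bool (Q x y n) :: num)"
  then have "I2 (\<lambda>x y. of_bool (\<not> (\<exists>n. \<not> Q x y n)) :: num)" by (intro Ir jmp_I2[OF assms])
  then show "I2 (\<lambda>x y. of_bool (\<forall>n. Q x y n) :: num)" by simp
next
  assume "I4 (\<lambda>x y z n. of_bool (R x y z n) :: num)"
  then have "I3 (\<lambda>x y z. of_bool (\<not> (\<exists>n. \<not> R x y z n)) :: num)" by (intro Ir jmp_I3[OF assms])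
  then show "I3 (\<lambda>x y z. of_bool (\<forall>n. R x y z n) :: num)" by simp
qed

section \<open>Reals, functions and sets in terms of values\<close>

lemma rle_val [simp]: "isr x \<Longrightarrow> isr y \<Longrightarrow> rle x y \<longleftrightarrow> val x \<le> val y"
  unfolding rle_def by (rule le_val_iff)

lemma req1_val [simp]: "isr x \<Longrightarrow> isr y \<Longrightarrow> req1 x y \<longleftrightarrow> val x = val y"
  unfolding req1_def by (rule eq_val_iff)

lemma isd_val: "isr x \<Longrightarrow> isr y \<Longrightarrow> isd z x y \<Longrightarrow> isr z \<and> val z = \<bar>val x - val y\<bar>"
  unfolding isd_def using dist_val[of x y z] by blast

lemma isd_ex: "\<exists>z. isd z x y" unfolding isd_def by (rule dist_ex)

lemmas [simp] = isr_rat val_rat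

lemma ex_isd: "isr x \<Longrightarrow> isr y \<Longrightarrow> (\<And>z. isr z \<Longrightarrow> R z \<longleftrightarrow> Q (val z)) \<Longrightarrow>
    (\<exists>z. isr z \<and> isd z x y \<and> R z) \<longleftrightarrow> Q \<bar>val x - val y\<bar>"
proof -
  assume x: "isr x" and y: "isr y" and RQ: "\<And>z. isr z \<Longrightarrow> R z \<longleftrightarrow> Q (val z)"
  obtain z where z: "isd z x y" using isd_ex by blast
  show ?thesis using isd_val[OF x y] RQ z by metis
qed

lemma inball_val [simp]: "isr x \<Longrightarrow> isr y \<Longrightarrow> inball x r y \<longleftrightarrow> \<bar>val x - val y\<bar> < kq (rv r)"
  unfolding inball_def by (rule ex_isd) (simp_all add: not_le)

lemma dist_le_val: "isr d \<Longrightarrow> isr x \<Longrightarrow> isr y \<Longrightarrow> (\<exists>z. isr z \<and> isd z x y \<and> rle d z) \<longleftrightarrow> val d \<le> \<bar>val x - val y\<bar>"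
  by (rule ex_isd) simp_all

lemma rv_0 [simp]: "rv 0 = 0"
proof -
  have "qcode 0 0 0 = 0" by (simp add: qcode_def pair_def tri)
  then show ?thesis using rv_qcode[of 0 0 0] by simp
qed

lemma rv_1 [simp]: "rv 1 = 1"
proof -
  have "tri 1 = 1" using tri(2)[of 0] by (simp add: tri)
  then have "qcode 1 0 0 = 1" by (simp add: qcode_def pair_def tri)
  then show ?thesis using rv_qcode[of 1 0 0] by simp
qed

lemma rfunD: "rfun F \<Longrightarrow> isr x \<Longrightarrow> isr (F \<bullet> x)"
  "rfun F \<Longrightarrow> isr x \<Longrightarrow> isr y \<Longrightarrow> val x = val y \<Longrightarrow> val (F \<bullet> x) = val (F \<bullet> y)"
proof -
  show 1: "rfun F \<Longrightarrow> isr x \<Longrightarrow> isr (F \<bullet> x)" for x unfolding rfun_def by blast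
  assume F: "rfun F" and x: "isr x" and y: "isr y" and "val x = val y"
  then have "req1 x y" by simp
  then have "req1 (F \<bullet> x) (F \<bullet> y)" using F x y unfolding rfun_def by blast
  then show "val (F \<bullet> x) = val (F \<bullet> y)" using 1[OF F x] 1[OF F y] by simp
qed

lemma rfunI: assumes "\<And>x. isr x \<Longrightarrow> isr (F \<bullet> x)"
    "\<And>x y. isr x \<Longrightarrow> isr y \<Longrightarrow> val x = val y \<Longrightarrow> val (F \<bullet> x) = val (F \<bullet> y)"
  shows "rfun F"
  unfolding rfun_def
proof (intro conjI allI impI)
  fix x y assume "isr x" "isr y" "req1 x y"
  then show "req1 (F \<bullet> x) (F \<bullet> y)" using assms(1)[of x] assms(1)[of y] assms(2)[of x y] by simp
qed (rule assms(1))

lemma memb_val: "rfun Y \<Longrightarrow> isr x \<Longrightarrow> memb x Y \<longleftrightarrow> 0 < val (Y \<bullet> x)"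
  unfolding memb_def by (simp add: rfunD(1) not_le)

lemma memb_cong: "rfun Y \<Longrightarrow> isr x \<Longrightarrow> isr y \<Longrightarrow> val x = val y \<Longrightarrow> memb x Y \<longleftrightarrow> memb y Y"
  using rfunD(2)[of Y x y] memb_val[of Y x] memb_val[of Y y] by simp

lemma openp_val: "openp P \<longleftrightarrow> (\<forall>x. isr x \<longrightarrow> P x \<longrightarrow> (\<exists>r>0. \<forall>y. isr y \<longrightarrow> \<bar>val x - val y\<bar> < kq r \<longrightarrow> P y))"
proof -
  have *: "(\<exists>r::rt. Q r) \<longleftrightarrow> (\<exists>r. Q (rv r))" for Q by (metis rv_surj)
  show ?thesis unfolding openp_def * by (simp cong: imp_cong conj_cong)
qed

lemma contf_lip:
  assumes F: "rfun F" and lip: "\<And>x y. isr x \<Longrightarrow> isr y \<Longrightarrow> val (F \<bullet> x) \<le> val (F \<bullet> y) + \<bar>val x - val y\<bar>"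
  shows "contf F"
  unfolding contf_def
proof (intro allI impI)
  fix x q assume x: "isr x" and q: "0 < rv q"
  have "\<bar>val (F \<bullet> x) - val (F \<bullet> y)\<bar> \<le> \<bar>val x - val y\<bar>" if "isr y" for y
    using lip[OF x that] lip[OF that x] by linarith
  then show "\<exists>d. 0 < rv d \<and> (\<forall>y. isr y \<longrightarrow> inball x d y \<longrightarrow> inball (F \<bullet> x) q (F \<bullet> y))"
    using q x rfunD(1)[OF F] by (intro exI[of _ q]) (auto intro: le_less_trans)
qed

lemma dist_of_val:
  assumes "rfun C" "isr d" "isr x"
  shows "dist_of d x C \<longleftrightarrow> (\<forall>y. isr y \<longrightarrow> memb y C \<longrightarrow> val d \<le> \<bar>val x - val y\<bar>) \<and>
    (\<forall>e. isr e \<longrightarrow> (\<forall>y. isr y \<longrightarrow> memb y C \<longrightarrow> val e \<le> \<bar>val x - val y\<bar>) \<longrightarrow> val e \<le> val d)"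
  unfolding dist_of_def using assms by (simp add: dist_le_val cong: imp_cong)

lemma kq_arch: "\<exists>n. x < kq (ofn n)"
proof (cases "0 < x")
  case True
  obtain r where r: "x < kq r"
  proof -
    have "\<exists>r. x < kq r"
    proof (rule ccontr)
      assume *: "\<not> ?thesis"
      obtain X where X: "Cau X" "x = abs_k X"
        by (induction x rule: K.abs_induct) (auto simp: krel_refl)
      obtain b where "\<forall>\<^sub>F n in at_top. \<bar>X n\<bar> < b" using Cau_bounded[OF X(1)] by blast
      then have "\<forall>\<^sub>F n in at_top. X n \<le> b" by eventually_elim auto
      from abs_k_le[OF X(1) this] have "x \<le> kq b" using X(2) by simp
      then have "x < kq (b + 1)" by (simp add: add_strict_increasing2)
      then show False using * by blast
    qed
    then show ?thesis using that by blast
  qed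
  obtain a b c where r': "r = (ofn a - ofn b) / (ofn c + 1)" using ofn_frac by blast
  have "r \<le> ofn a / (ofn c + 1)" unfolding r' by (intro divide_right_mono) (auto intro: less_imp_le)
  also have "\<dots> \<le> ofn a / 1" by (intro divide_left_mono) auto
  finally have "kq r \<le> kq (ofn a)" by simp
  then show ?thesis using r by (meson less_le_trans)
next
  case False
  then show ?thesis by (intro exI[of _ 1]) (simp add: not_less order.strict_trans1)
qed

lemma real_of_fast:
  assumes "R1 F" "\<And>n i. \<bar>F n - F (n + i)\<bar> < eps n"
  shows "\<exists>x. isr x \<and> (\<forall>n. rv (x \<bullet> n) = F n)"
proof -
  obtain x :: t1 where x: "\<And>n. rv (x \<bullet> n) = F n" using assms(1) unfolding R1_def I1_def by metis
  then show ?thesis using assms(2) unfolding isr_def by (intro exI[of _ x]) simp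
qed

lemma approx: "isr x \<Longrightarrow> \<bar>val x - kq (rv (x \<bullet> n))\<bar> \<le> kq (eps n)" by (rule val_approx)

lemma keps3: "kq (eps n) = 8 * kq (eps (n + 1 + 1 + 1))"
  using keps_Suc[of n] keps_Suc[of "n + 1"] keps_Suc[of "n + 1 + 1"] by simp

section \<open>Distance functions from rational distances\<close>

text \<open>If the lower bounds of distances from rational points are decidable, number choice finds
  for q and k a lower bound w such that w + 2^-k is none. For a real x, q is taken from the sequence
  of x; the 1-Lipschitz property makes the result fast converging, extensional and
  continuous.\<close>

lemma rat_dist:
  assumes C: "rfun C" and x0: "isr x0" "memb x0 C"
    and L: "I2 (\<lambda>q w. of_bool (L q w) :: num)"
    and LC: "\<And>q w. L q w \<longleftrightarrow> (\<forall>y. isr y \<longrightarrow> memb y C \<longrightarrow> kq (rv w) \<le> \<bar>kq (rv q) - val y\<bar>)"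
  shows "\<exists>D. rfun D \<and> contf D \<and> (\<forall>x. isr x \<longrightarrow> dist_of (D \<bullet> x) x C)"
proof -
  define qe where "qe k = qcode 1 0 (pw k - 1)" for k
  have qe: "rv (qe k) = eps k" for k unfolding qe_def by (rule rv_qn)
  have Iqe: "I1 qe" unfolding qe_def by (rule I_qn)
  let ?P = "\<lambda>m w. L (pi1 m) w \<and> \<not> L (pi1 m) (qadd w (qe (pi2 m)))"
  have IP: "I2 (\<lambda>m w. of_bool (?P m w) :: num)"
    by (intro Ir I2_c2[OF L] I2_c2[OF I2_qops(1)] I2_c1[OF Iqe])
  have "\<exists>w. ?P m w" for m
  proof (rule ccontr)
    assume "\<not> ?thesis"
    \<comment> \<open>Lower bounds could be raised by 2^-k forever; starting from 0 they would
      exceed the distance to the given point x0 of C.\<close>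
    then have st: "L (pi1 m) w \<Longrightarrow> L (pi1 m) (qadd w (qe (pi2 m)))" for w by blast
    let ?k = "pi2 m" and ?q = "pi1 m"
    define cd where "cd j = qmul (qcode j 0 0) (qe ?k)" for j
    have cd: "rv (cd j) = ofn j * eps ?k" for j
      unfolding cd_def rv_ops qe rv_qn by simp
    have Icd: "I1 cd" unfolding cd_def
      by (intro I1_c2[OF I2_qops(2)] I1_c1[OF I_qn(1)] Ir)
    have "L ?q (cd j)" for j
    proof (rule nind[where P = "\<lambda>j. L ?q (cd j)"])
      show "I1 (\<lambda>n. of_bool (L ?q (cd n)) :: num)" by (intro I1_c2[OF L] I1_c1[OF Icd] Ir)
      show "L ?q (cd 0)" unfolding LC cd by simp
      fix j assume "L ?q (cd j)"
      from st[OF this] show "L ?q (cd (j + 1))" unfolding LC rv_ops cd qe by (simp add: algebra_simps)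
    qed
    then have all: "kq (ofn j * eps ?k) \<le> \<bar>kq (rv ?q) - val x0\<bar>" for j using LC cd x0 by metis
    obtain N where N: "\<bar>kq (rv ?q) - val x0\<bar> < kq (ofn N)" using kq_arch by blast
    \<comment> \<open>2^k steps add up to 1, so N * 2^k steps reach N.\<close>
    have "ofn (pw ?k) * eps ?k = 1" by (simp add: eps_def ofn_nz_iff pw_nz)
    then have eq: "ofn (N * pw ?k) * eps ?k = ofn N" by (simp add: mult.assoc)
    show False using all[of "N * pw ?k"] N unfolding eq by simp
  qed
  then obtain W where W: "I1 W" "\<And>m. ?P m (W m)" using choice00[OF IP] by blast
  define d0 where "d0 q k = rv (W (pair q k))" for q k
  have lo: "kq (d0 q k) \<le> \<bar>kq (rv q) - val y\<bar>" if "isr y" "memb y C" for q k y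
    using W(2)[of "pair q k"] that unfolding LC d0_def by (simp add: pi_pair)
  have hi: "\<exists>y. isr y \<and> memb y C \<and> \<bar>kq (rv q) - val y\<bar> < kq (d0 q k) + kq (eps k)" for q k
    using W(2)[of "pair q k"] unfolding LC d0_def rv_ops qe by (simp add: pi_pair not_le)
  \<comment> \<open>At k + 3 the unit of error is an eighth of \<open>eps k\<close>, so that three
    such errors stay below it.\<close>
  have "I2 (\<lambda>(x::t1) k. W (pair (x \<bullet> (k + 1 + 1 + 1)) (k + 1 + 1 + 1)))"
    by (intro I2_c1[OF W(1)] Ir)
  then obtain D :: t11 where D': "\<And>x k. D \<bullet> x \<bullet> k = W (pair (x \<bullet> (k + 1 + 1 + 1)) (k + 1 + 1 + 1))"
    unfolding I2_def by blast
  define v where "v x n = d0 (x \<bullet> n) n" for x :: t1 and n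
  have D: "rv (D \<bullet> x \<bullet> k) = v x (k + 1 + 1 + 1)" for x k by (simp add: D' v_def d0_def)
  \<comment> \<open>The near-minimiser c for one rational point bounds the distance from the
    other.\<close>
  have cmp: "kq (v x m) \<le> kq (v y n) + \<bar>kq (rv (x \<bullet> m)) - kq (rv (y \<bullet> n))\<bar> + kq (eps n)" for x y m n
  proof -
    obtain c where c: "isr c" "memb c C" "\<bar>kq (rv (y \<bullet> n)) - val c\<bar> < kq (v y n) + kq (eps n)"
      unfolding v_def using hi by blast
    then show ?thesis using lo[OF c(1,2), of "x \<bullet> m" m] unfolding v_def by linarith
  qed
  have isrD: "isr (D \<bullet> x)" if x: "isr x" for x
    unfolding isr_def D
  proof (intro allI)
    fix n i :: num
    let ?m = "n + 1 + 1 + 1" and ?m' = "n + i + 1 + 1 + 1"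
    have "kq (eps ?m') \<le> kq (eps ?m)" by (intro keps_mono) simp
    then have "\<bar>kq (v x ?m) - kq (v x ?m')\<bar> \<le> 3 * kq (eps ?m)"
      using cmp[of x ?m x ?m'] cmp[of x ?m' x ?m] approx[OF x, of ?m] approx[OF x, of ?m'] by linarith
    also have "\<dots> < kq (eps n)" using keps3[of n] keps_pos[of ?m] by linarith
    finally have "kq \<bar>v x ?m - v x ?m'\<bar> < kq (eps n)" by simp
    then show "\<bar>v x ?m - v x ?m'\<bar> < eps n" by (simp only: kq_less)
  qed
  have apD: "\<bar>val (D \<bullet> x) - kq (v x (k + 1 + 1 + 1))\<bar> \<le> kq (eps k)" if "isr x" for x k
    using approx[OF isrD[OF that], of k] unfolding D .
  have lip: "val (D \<bullet> x) \<le> val (D \<bullet> y) + \<bar>val x - val y\<bar>" if x: "isr x" and y: "isr y" for x y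
  proof (rule k_le_eps)
    fix k :: num let ?n = "k + 1 + 1 + 1"
    show "val (D \<bullet> x) \<le> val (D \<bullet> y) + \<bar>val x - val y\<bar> + 4 * kq (eps k)"
      using apD[OF x, of k] apD[OF y, of k] cmp[of x ?n y ?n] approx[OF x, of ?n] approx[OF y, of ?n]
        keps3[of k] keps_pos[of ?n] by linarith
  qed
  have rD: "rfun D"
  proof (rule rfunI[OF isrD])
    fix x y assume "isr x" "isr y" "val x = val y"
    then show "val (D \<bullet> x) = val (D \<bullet> y)" using lip[of x y] lip[of y x] by simp
  qed
  have "dist_of (D \<bullet> x) x C" if x: "isr x" for x
    unfolding dist_of_val[OF C isrD[OF x] x]
  proof (intro conjI allI impI)
    fix y assume y: "isr y" "memb y C"
    show "val (D \<bullet> x) \<le> \<bar>val x - val y\<bar>"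
    proof (rule k_le_eps)
      fix k :: num let ?n = "k + 1 + 1 + 1"
      show "val (D \<bullet> x) \<le> \<bar>val x - val y\<bar> + 4 * kq (eps k)"
        using apD[OF x, of k] lo[OF y, of "x \<bullet> ?n" ?n] approx[OF x, of ?n] keps3[of k] keps_pos[of ?n]
        unfolding v_def by linarith
    qed
  next
    fix e assume e: "isr e" "\<forall>y. isr y \<longrightarrow> memb y C \<longrightarrow> val e \<le> \<bar>val x - val y\<bar>"
    show "val e \<le> val (D \<bullet> x)"
    proof (rule k_le_eps)
      fix k :: num let ?n = "k + 1 + 1 + 1"
      obtain c where c: "isr c" "memb c C" "\<bar>kq (rv (x \<bullet> ?n)) - val c\<bar> < kq (v x ?n) + kq (eps ?n)"
        unfolding v_def using hi by blast
      then have "val e \<le> \<bar>val x - val c\<bar>" using e(2) by blast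
      then show "val e \<le> val (D \<bullet> x) + 4 * kq (eps k)"
        using c(3) apD[OF x, of k] approx[OF x, of ?n] keps3[of k] keps_pos[of ?n] by linarith
    qed
  qed
  then show ?thesis using rD contf_lip[OF rD lip] by blast
qed

section \<open>Bisection\<close>

lemma eps_add: "eps (m + n) = eps m * eps n"
proof -
  have "pw (m + n) = pw m * pw n"
    by (rule nind[where P = "\<lambda>n. pw (m + n) = pw m * pw n"])
      (intro Ir I1_c1[OF I1_pw], auto simp: pw add.assoc[symmetric] distrib_left)
  then show ?thesis by (simp add: eps_def)
qed

text \<open>\<open>B n j\<close> is to be thought of as marking the j-th of 2^n equal parts of the
  segment from a to a + w, where w may be negative. As B is decidable, a branch of marked parts is
  computed by recursion, and its limit is a real of the model.\<close>

lemma bisection: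
  assumes B: "I2 (\<lambda>n j. of_bool (B n j) :: num)" and B0: "B 0 0"
    and st: "\<And>n j. B n j \<Longrightarrow> B (n + 1) (j + j) \<or> B (n + 1) (j + j + 1)"
  shows "\<exists>z. isr z \<and> (\<forall>n. \<exists>j. B n j \<and> \<bar>val z - kq (a + w * (ofn j * eps n))\<bar> \<le> kq (\<bar>w\<bar> * eps n))"
proof -
  let ?G = "\<lambda>n j. if B (n + 1) (j + j) then j + j else j + j + 1"
  define J where "J = prec ?G 0"
  have G: "I2 ?G" by (intro Ir I2_c2[OF B])
  have J: "J 0 = 0" "J (n + 1) = ?G n (J n)" for n unfolding J_def by (rule prec[OF G])+
  have IJ: "I1 J" unfolding J_def
    by (rule I1_prec[where H = "\<lambda>x. x" and F = "\<lambda>_. 0"]) (intro Ir I3_c2[OF B])+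
  have BJ: "B n (J n)" for n
  proof (rule nind[where P = "\<lambda>n. B n (J n)"])
    show "I1 (\<lambda>n. of_bool (B n (J n)) :: num)" by (intro I1_c2[OF B] Ir I1_c1[OF IJ])
  qed (use B0 st in \<open>auto simp: J\<close>)
  define t where "t n = ofn (J n) * eps n" for n
  have t1: "t (n + 1) = t n \<or> t (n + 1) = t n + eps (n + 1)" for n
  proof -
    have "ofn (j + j) * eps (n + 1) = ofn j * eps n" "ofn (j + j + 1) * eps (n + 1) = ofn j * eps n + eps (n + 1)" for j
      unfolding eps_Suc[of n] ofn_simps by (simp_all add: algebra_simps)
    then show ?thesis unfolding t_def J by (cases "B (n + 1) (J n + J n)") simp_all
  qed
  have tR: "R1 t" unfolding t_def by (intro R_rules I1_c1[OF IJ] Ir)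
  have tRn: "R1 (\<lambda>i. t (n + i))" for n unfolding t_def by (intro R_rules I1_c1[OF IJ] Ir)
  \<comment> \<open>The term \<open>- eps (n + i)\<close> makes the bound inductive: each step
    spends at most half of what is left.\<close>
  have tt: "t n \<le> t (n + i) \<and> t (n + i) \<le> t n + eps n - eps (n + i)" for n i
  proof (rule nind[where P = "\<lambda>i. t n \<le> t (n + i) \<and> t (n + i) \<le> t n + eps n - eps (n + i)"])
    show "I1 (\<lambda>i. of_bool (t n \<le> t (n + i) \<and> t (n + i) \<le> t n + eps n - eps (n + i)) :: num)"
      by (intro Ir R_rules tRn)
    fix i assume "t n \<le> t (n + i) \<and> t (n + i) \<le> t n + eps n - eps (n + i)"
    then show "t n \<le> t (n + (i + 1)) \<and> t (n + (i + 1)) \<le> t n + eps n - eps (n + (i + 1))"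
      using t1[of "n + i"] eps_Suc[of "n + i"] eps_pos[of "n + i + 1"]
      unfolding add.assoc[symmetric] by linarith
  qed simp
  have tc: "\<bar>t n - t (n + i)\<bar> \<le> eps n" for n i
    using tt[of n i] eps_pos[of n] eps_pos[of "n + i"] by linarith
  \<comment> \<open>The factor w may slow convergence down; starting c places later compensates for
    it.\<close>
  obtain c where c: "\<bar>w\<bar> * eps c < 1"
  proof -
    have "0 < 1 / (\<bar>w\<bar> + 1)" using abs_ge_zero[of w] by (simp add: add_nonneg_pos)
    then obtain c where "eps c < 1 / (\<bar>w\<bar> + 1)" using eps_arch by blast
    then have "eps c * (\<bar>w\<bar> + 1) < 1" using abs_ge_zero[of w] by (simp add: pos_less_divide_eq add_nonneg_pos)
    then have "\<bar>w\<bar> * eps c + eps c < 1" by (simp add: algebra_simps)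
    then have "\<bar>w\<bar> * eps c < 1" using eps_pos[of c] by linarith
    then show ?thesis using that by blast
  qed
  define F where "F n = a + w * t (n + c)" for n
  have FR: "R1 F" unfolding F_def t_def by (intro R_rules I1_c1[OF IJ] Ir)
  have wt: "\<bar>w * t n - w * t (n + i)\<bar> \<le> \<bar>w\<bar> * eps n" for n i
    unfolding right_diff_distrib[symmetric] abs_mult by (rule mult_left_mono[OF tc]) simp
  have "\<bar>F n - F (n + i)\<bar> < eps n" for n i
  proof -
    have "\<bar>F n - F (n + i)\<bar> \<le> \<bar>w\<bar> * eps (n + c)"
      using wt[of "n + c" i] unfolding F_def by (simp add: add.assoc add.commute[of i c])
    also have "\<dots> = (\<bar>w\<bar> * eps c) * eps n" by (simp add: eps_add)
    also have "\<dots> < 1 * eps n" using c eps_pos by (rule mult_strict_right_mono)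
    finally show ?thesis by simp
  qed
  from real_of_fast[OF FR this] obtain z where z: "isr z" "\<And>n. rv (z \<bullet> n) = F n" by blast
  have "\<bar>val z - kq (a + w * t n)\<bar> \<le> kq (\<bar>w\<bar> * eps n)" for n
  proof (rule k_le_eps)
    fix m
    have "\<bar>val z - kq (a + w * t (n + m + c))\<bar> \<le> kq (eps (n + m))"
      using approx[OF z(1), of "n + m"] unfolding z(2) F_def .
    moreover have "kq (eps (n + m)) \<le> kq (eps m)" by (intro keps_mono) simp
    moreover have "kq \<bar>w * t n - w * t (n + (m + c))\<bar> \<le> kq (\<bar>w\<bar> * eps n)" using wt by (simp only: kq_le)
    ultimately show "\<bar>val z - kq (a + w * t n)\<bar> \<le> kq (\<bar>w\<bar> * eps n) + 4 * kq (eps m)"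
      using keps_pos[of m] unfolding kq_abs kq_diff kq_ring(3) add.assoc by linarith
  qed
  then show ?thesis using z(1) BJ unfolding t_def by blast
qed

section \<open>Grilliot's trick\<close>

text \<open>Given \<open>f\<close>, follow \<open>u\<close> until a zero of \<open>f\<close> turns up and stay there: this is a real \<open>y\<close>, computed
  from \<open>f\<close>, with \<open>y = x\<close> if \<open>f\<close> has no zero and \<open>y = u n\<close> for some \<open>n\<close> otherwise. So \<open>F y\<close> decides
  between the two.\<close>

lemma grilliot:
  assumes F: "rfun F" and x: "isr x" and u: "I1 u"
    and ux: "\<And>n. \<bar>val x - kq (rv (u n))\<bar> \<le> kq (eps n)"
    and jump: "\<And>n. kq (eps k) \<le> \<bar>val (F \<bullet> rat (u n)) - val (F \<bullet> x)\<bar>"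
  shows e2
proof -
  \<comment> \<open>Bounded search: the least zero of f below n, and n itself as long as there is
    none.\<close>
  define s where "s f n = prec (\<lambda>i a. if f \<bullet> a = 0 then a else i + 1) 0 n" for f :: t1 and n
  have sG: "I2 (\<lambda>i a. if f \<bullet> a = 0 then a else i + 1)" for f :: t1 by (intro Ir)
  have s: "s f 0 = 0" "s f (n + 1) = (if f \<bullet> s f n = 0 then s f n else n + 1)" for f n
    unfolding s_def by (rule prec[OF sG])+
  have Is: "I2 s" unfolding s_def by (intro Ir)
  have Is1: "I1 (s f)" for f by (rule I2D[OF Is])
  have sinv: "s f n = n \<or> f \<bullet> s f n = 0" for f n
    by (rule nind[where P = "\<lambda>n. s f n = n \<or> f \<bullet> s f n = 0"])
      (intro Ir I1_c1[OF Is1], auto simp: s)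
  have sst: "f \<bullet> s f n = 0 \<longrightarrow> s f (n + i) = s f n" for f n i
    by (rule nind[where P = "\<lambda>i. f \<bullet> s f n = 0 \<longrightarrow> s f (n + i) = s f n"])
      (intro Ir I1_c1[OF Is1], auto simp: s add.assoc[symmetric])
  have sle: "s f n \<le> n" for f n
    by (rule nind[where P = "\<lambda>n. s f n \<le> n"])
      (intro Ir I1_c1[OF Is1], auto simp: s intro: order_trans)
  have sge: "s f n = n \<longrightarrow> n \<le> s f (n + i)" for f n i
    by (rule nind[where P = "\<lambda>i. s f n = n \<longrightarrow> n \<le> s f (n + i)"])
      (intro Ir I1_c1[OF Is1], auto simp: s add.assoc[symmetric] add_increasing2)
  \<comment> \<open>Reading u two places later makes the sequence converge fast while the search
    goes on; once a zero is found it is constant.\<close>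
  have "I2 (\<lambda>f n. u (s f (n + 1 + 1)))" by (intro I2_c1[OF u] I2_c2[OF Is] Ir)
  then obtain Y :: t11 where Y: "\<And>f n. Y \<bullet> f \<bullet> n = u (s f (n + 1 + 1))" unfolding I2_def by blast
  have isY: "isr (Y \<bullet> f)" for f
    unfolding isr_def Y
  proof (intro allI)
    fix n i :: num let ?n = "n + 1 + 1"
    have eq: "n + i + 1 + 1 = ?n + i" by (simp add: ac_simps)
    show "\<bar>rv (u (s f ?n)) - rv (u (s f (n + i + 1 + 1)))\<bar> < eps n"
    proof (cases "f \<bullet> s f ?n = 0")
      case True
      then show ?thesis unfolding eq using sst[of f ?n i] eps_pos by simp
    next
      case False
      then have sn: "s f ?n = ?n" using sinv by blast
      then have "kq (eps (s f (?n + i))) \<le> kq (eps ?n)" using sge by (intro keps_mono) blast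
      then have "\<bar>kq (rv (u (s f ?n))) - kq (rv (u (s f (?n + i))))\<bar> \<le> 2 * kq (eps ?n)"
        using ux[of "s f ?n"] ux[of "s f (?n + i)"] unfolding sn by linarith
      also have "\<dots> < kq (eps n)"
        using keps_Suc[of n] keps_Suc[of "n + 1"] keps_pos[of ?n] by linarith
      finally have "kq \<bar>rv (u (s f ?n)) - rv (u (s f (?n + i)))\<bar> < kq (eps n)" by simp
      then show ?thesis unfolding eq by (simp only: kq_less)
    qed
  qed
  have yes: "kq (eps k) \<le> \<bar>val (F \<bullet> (Y \<bullet> f)) - val (F \<bullet> x)\<bar>" if "f \<bullet> n = 0" for f n
  proof -
    let ?M = "s f n"
    have z: "f \<bullet> ?M = 0" using sinv[of f n] that by auto
    have "val (Y \<bullet> f) = val (rat (u ?M))"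
    proof (rule k_eq_eps)
      fix m
      have "Y \<bullet> f \<bullet> (n + m) = u ?M" unfolding Y using sst[of f n "m + 1 + 1"] z by (simp add: add.assoc)
      then have "\<bar>val (Y \<bullet> f) - kq (rv (u ?M))\<bar> \<le> kq (eps (n + m))"
        using approx[OF isY[of f], of "n + m"] by simp
      moreover have "kq (eps (n + m)) \<le> kq (eps m)" by (intro keps_mono) simp
      ultimately show "\<bar>val (Y \<bullet> f) - val (rat (u ?M))\<bar> \<le> 4 * kq (eps m)"
        using keps_pos[of m] unfolding val_rat by linarith
    qed
    then show ?thesis using rfunD(2)[OF F isY[of f], of "rat (u ?M)"] jump[of ?M] by simp
  qed
  have no: "val (F \<bullet> (Y \<bullet> f)) = val (F \<bullet> x)" if "\<forall>n. f \<bullet> n \<noteq> 0" for f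
  proof -
    have sn: "s f n = n" for n using sinv that by blast
    have "val (Y \<bullet> f) = val x"
    proof (rule k_eq_eps)
      fix m
      have "kq (eps (m + 1 + 1)) \<le> kq (eps m)" by (intro keps_mono) (simp add: add.assoc)
      then show "\<bar>val (Y \<bullet> f) - val x\<bar> \<le> 4 * kq (eps m)"
        using approx[OF isY[of f], of m] ux[of "m + 1 + 1"] keps_pos[of m] unfolding Y sn by linarith
    qed
    then show ?thesis using rfunD(2)[OF F isY[of f] x] by simp
  qed
  let ?n = "k + 1 + 1 + 1"
  \<comment> \<open>In units of \<open>eps (k + 3)\<close> the two values either differ by at least
    8 or agree. Each approximation errs by at most 1, so the threshold 4 separates 6 from 2.\<close>
  let ?T = "\<lambda>f. eps (k + 1) < \<bar>rv (F \<bullet> (Y \<bullet> f) \<bullet> ?n) - rv (F \<bullet> x \<bullet> ?n)\<bar>"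
  have "I1 (\<lambda>f. of_bool (\<not> ?T f) :: num)" by (intro Ir R_rules)
  then obtain E :: t2 where E: "\<And>f. E \<bullet> f = of_bool (\<not> ?T f)" unfolding I1_def by blast
  have "?T f \<longleftrightarrow> (\<exists>n. f \<bullet> n = 0)" for f
  proof -
    have a: "\<bar>val (F \<bullet> (Y \<bullet> f)) - kq (rv (F \<bullet> (Y \<bullet> f) \<bullet> ?n))\<bar> \<le> kq (eps ?n)"
      "\<bar>val (F \<bullet> x) - kq (rv (F \<bullet> x \<bullet> ?n))\<bar> \<le> kq (eps ?n)"
      using approx rfunD(1)[OF F] isY x by blast+
    have k: "?T f \<longleftrightarrow> kq (eps (k + 1)) < \<bar>kq (rv (F \<bullet> (Y \<bullet> f) \<bullet> ?n)) - kq (rv (F \<bullet> x \<bullet> ?n))\<bar>"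
      unfolding kq_diff[symmetric] kq_abs[symmetric] kq_less ..
    have e: "kq (eps k) = 8 * kq (eps ?n)" "kq (eps (k + 1)) = 4 * kq (eps ?n)" "0 < kq (eps ?n)"
      using keps3[of k] keps_Suc[of k] keps_pos[of ?n] by simp_all
    show ?thesis
    proof (cases "\<exists>n. f \<bullet> n = 0")
      case True
      then have "kq (eps k) \<le> \<bar>val (F \<bullet> (Y \<bullet> f)) - val (F \<bullet> x)\<bar>" using yes by blast
      then have "?T f" unfolding k using a e by linarith
      then show ?thesis using True by blast
    next
      case False
      then have "val (F \<bullet> (Y \<bullet> f)) = val (F \<bullet> x)" using no by blast
      then have "\<not> ?T f" unfolding k using a e by linarith
      then show ?thesis using False by blast
    qed
  qed
  then show ?thesis unfolding e2_def by (intro exI[of _ E]) (simp add: E)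
qed

text \<open>A discontinuity at x along rational points yields, by number choice, a sequence as in
  \<open>grilliot\<close>. Choice delivers numbers, and these can code rational points but not
  arbitrary reals.\<close>

lemma rational_continuity:
  assumes ne: "\<not> e2" and F: "rfun F" and x: "isr x"
  shows "\<exists>n. \<forall>u. \<bar>val x - kq (rv u)\<bar> < kq (eps n) \<longrightarrow> \<bar>val (F \<bullet> rat u) - val (F \<bullet> x)\<bar> < kq (eps k)"
proof (rule ccontr)
  assume "\<not> ?thesis"
  then have *: "\<exists>u. \<bar>val x - kq (rv u)\<bar> < kq (eps n) \<and> kq (eps k) \<le> \<bar>val (F \<bullet> rat u) - val (F \<bullet> x)\<bar>" for n
    by (auto simp: not_less)
  let ?k = "k + 1 + 1 + 1"
  have e: "kq (eps k) = 8 * kq (eps ?k)" "kq (eps (k + 1)) = 4 * kq (eps ?k)" "0 < kq (eps ?k)"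
    using keps3[of k] keps_Suc[of k] keps_pos[of ?k] by simp_all
  \<comment> \<open>A decidable substitute for the discontinuity: in units of
    \<open>eps (k + 3)\<close>, a jump of 8 shows up as at least 6 in the approximations, and from
    these 6 a true jump of 4, that is \<open>eps (k + 1)\<close>, is recovered.\<close>
  let ?P = "\<lambda>n u. \<bar>rv (x \<bullet> (n + 1 + 1)) - rv u\<bar> \<le> eps (n + 1) \<and>
      6 * eps ?k \<le> \<bar>rv (F \<bullet> rat u \<bullet> ?k) - rv (F \<bullet> x \<bullet> ?k)\<bar>"
  have aF: "\<bar>val (F \<bullet> y) - kq (rv (F \<bullet> y \<bullet> ?k))\<bar> \<le> kq (eps ?k)" if "isr y" for y
    using approx rfunD(1)[OF F that] by blast
  have P: "?P n u \<longleftrightarrow> \<bar>kq (rv (x \<bullet> (n + 1 + 1))) - kq (rv u)\<bar> \<le> kq (eps (n + 1)) \<and>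
      6 * kq (eps ?k) \<le> \<bar>kq (rv (F \<bullet> rat u \<bullet> ?k)) - kq (rv (F \<bullet> x \<bullet> ?k))\<bar>" for n u
  proof -
    have "6 * kq (eps ?k) = kq (6 * eps ?k)" by simp
    then show ?thesis by (simp only: kq_diff[symmetric] kq_abs[symmetric] kq_le)
  qed
  have "I2 (\<lambda>n u. of_bool (?P n u) :: num)" unfolding rat_def by (intro Ir R_rules)
  moreover have "\<exists>u. ?P n u" for n
  proof -
    obtain u where u: "\<bar>val x - kq (rv u)\<bar> < kq (eps (n + 1 + 1))"
        "kq (eps k) \<le> \<bar>val (F \<bullet> rat u) - val (F \<bullet> x)\<bar>" using * by blast
    have "?P n u" unfolding P
      using u approx[OF x, of "n + 1 + 1"] keps_Suc[of "n + 1"] aF[OF x] aF[OF isr_rat[of u]] e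
      by (intro conjI) linarith+
    then show ?thesis by blast
  qed
  ultimately obtain u where u: "I1 u" "\<And>n. ?P n (u n)"
    using choice00[of ?P] by blast
  have e2
  proof (rule grilliot[OF F x u(1), of "k + 1"])
    fix n
    show "\<bar>val x - kq (rv (u n))\<bar> \<le> kq (eps n)"
      using u(2)[of n] approx[OF x, of "n + 1 + 1"] keps_Suc[of n] keps_Suc[of "n + 1"]
        keps_pos[of "n + 1 + 1"] unfolding P by linarith
    show "kq (eps (k + 1)) \<le> \<bar>val (F \<bullet> rat (u n)) - val (F \<bullet> x)\<bar>"
      using u(2)[of n] aF[OF x] aF[OF isr_rat[of "u n"]] e unfolding P by linarith
  qed
  with ne show False ..
qed

end

context counterexample
begin

lemma scaled_eps: "0 < x \<Longrightarrow> \<exists>n. kq (W * eps n) < x"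
proof -
  assume "0 < x"
  then obtain r where r: "r > 0" "kq r < x" using kq_between by blast
  have W: "0 < \<bar>W\<bar> + 1" by (simp add: add_nonneg_pos)
  then have "0 < r / (\<bar>W\<bar> + 1)" using r by simp
  then obtain n where "eps n < r / (\<bar>W\<bar> + 1)" using eps_arch by blast
  then have "eps n * (\<bar>W\<bar> + 1) < r" using W by (simp add: pos_less_divide_eq)
  moreover have "W * eps n \<le> eps n * (\<bar>W\<bar> + 1)"
    unfolding mult.commute[of W] by (rule mult_left_mono) (simp_all add: eps_ge0 add_increasing2)
  ultimately have "W * eps n < r" by linarith
  then have "kq (W * eps n) < kq r" by (simp only: kq_less)
  then show ?thesis using r(2) by (meson order.strict_trans)
qed

text \<open>Rewrites a comparison with a rational as a number quantifier over a decidable condition,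
  the form to which \<open>jmp\<close> applies.\<close>

lemma ge_val_rat: "isr x \<Longrightarrow> kq c \<le> val x \<longleftrightarrow> (\<forall>m. c \<le> rv (x \<bullet> m) + eps m)"
proof -
  assume x: "isr x"
  have "c \<le> rv (x \<bullet> m) + eps m \<longleftrightarrow> kq c \<le> kq (rv (x \<bullet> m)) + kq (eps m)" for m
    unfolding kq_ring(3)[symmetric] kq_le ..
  moreover have "kq c \<le> val x" if "\<forall>m. kq c \<le> kq (rv (x \<bullet> m)) + kq (eps m)"
  proof (rule k_le_eps)
    fix n show "kq c \<le> val x + 4 * kq (eps n)" using that[rule_format, of n] approx[OF x, of n] keps_pos[of n] by linarith
  qed
  moreover have "kq c \<le> kq (rv (x \<bullet> m)) + kq (eps m)" if "kq c \<le> val x" for m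
    using that approx[OF x, of m] by linarith
  ultimately show ?thesis by metis
qed

lemma le_val_rat: "isr x \<Longrightarrow> val x \<le> kq c \<longleftrightarrow> (\<forall>m. rv (x \<bullet> m) \<le> c + eps m)"
proof -
  assume x: "isr x"
  have "rv (x \<bullet> m) \<le> c + eps m \<longleftrightarrow> kq (rv (x \<bullet> m)) \<le> kq c + kq (eps m)" for m
    unfolding kq_ring(3)[symmetric] kq_le ..
  moreover have "val x \<le> kq c" if "\<forall>m. kq (rv (x \<bullet> m)) \<le> kq c + kq (eps m)"
  proof (rule k_le_eps)
    fix n show "val x \<le> kq c + 4 * kq (eps n)" using that[rule_format, of n] approx[OF x, of n] keps_pos[of n] by linarith
  qed
  moreover have "kq (rv (x \<bullet> m)) \<le> kq c + kq (eps m)" if "val x \<le> kq c" for m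
    using that approx[OF x, of m] by linarith
  ultimately show ?thesis by metis
qed

text \<open>A distance is the greatest lower bound among the reals of the model only, so the
  competitor d - |x - y| must first be found there.\<close>

lemma dist_lip:
  assumes C: "rfun C" and d: "isr d" "dist_of d x C" and d': "isr d'" "dist_of d' y C" and x: "isr x" and y: "isr y"
  shows "val d \<le> val d' + \<bar>val x - val y\<bar>"
proof -
  obtain z where z: "isr z" "val z = \<bar>val x - val y\<bar>" using isd_ex[of x y] isd_val[OF x y] by blast
  obtain e where e: "isr e" "val e = val d - val z" using real_diff[OF d(1) z(1)] by blast
  have "val e \<le> \<bar>val y - val c\<bar>" if "isr c" "memb c C" for c
  proof -
    have "val d \<le> \<bar>val x - val c\<bar>" using d(2) that unfolding dist_of_val[OF C d(1) x] by blast
    then show ?thesis unfolding e z by linarith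
  qed
  then have "val e \<le> val d'" using d'(2) e(1) unfolding dist_of_val[OF C d'(1) y] by blast
  then show ?thesis unfolding e z by linarith
qed

section \<open>From \<open>\<exists>\<^sup>3\<close> to distance functions\<close>

text \<open>A number is the value at 0 of a function, so a quantifier over functions covers one over
  numbers.\<close>

lemma e3_e2: "e3 \<Longrightarrow> e2"
proof -
  assume e3
  then obtain E :: t3 where E: "\<And>Y. E \<bullet> Y = 0 \<longleftrightarrow> (\<exists>f. Y \<bullet> f = 0)" unfolding e3_def by blast
  have "I1 (\<lambda>f::t1. E \<bullet> lam (\<lambda>g::t1. f \<bullet> (g \<bullet> 0)))" by (intro Ir)
  then obtain E' :: t2 where E': "\<And>f. E' \<bullet> f = E \<bullet> lam (\<lambda>g::t1. f \<bullet> (g \<bullet> 0))" unfolding I1_def by blast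
  have "E' \<bullet> f = 0 \<longleftrightarrow> (\<exists>n. f \<bullet> n = 0)" for f
  proof -
    have "I1 (\<lambda>g::t1. f \<bullet> (g \<bullet> 0))" by (intro Ir)
    then have "E' \<bullet> f = 0 \<longleftrightarrow> (\<exists>g::t1. f \<bullet> (g \<bullet> 0) = 0)" unfolding E' E by simp
    also have "\<dots> \<longleftrightarrow> (\<exists>n. f \<bullet> n = 0)" by (metis rat_app)
    finally show ?thesis .
  qed
  then show e2 unfolding e2_def by blast
qed

lemma memb_iff: "memb x Y \<longleftrightarrow> \<not> (\<forall>n. rv (Y \<bullet> x \<bullet> n) \<le> 2 * eps n)"
  unfolding memb_def rle_def by (simp add: rat_app)

lemma e2_isr: "e2 \<Longrightarrow> I1 (\<lambda>x. of_bool (isr x) :: num)"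
  unfolding isr_def by (intro e2_all Ir R_rules)

lemma e2_memb: "e2 \<Longrightarrow> I1 (\<lambda>x. of_bool (memb x Y) :: num)"
  unfolding memb_iff by (intro e2_all Ir R_rules)

text \<open>The type 3 functional decides whether a rational w is a lower bound for the distances
  from a rational q to all points of C, which is what \<open>rat_dist\<close> asks for. The derived
  type 2 functional first makes being a real and lying in C decidable.\<close>

theorem e3_clo: "e3 \<Longrightarrow> clo"
proof -
  assume e3: e3
  then obtain E :: t3 where E: "\<And>Y. E \<bullet> Y = 0 \<longleftrightarrow> (\<exists>f. Y \<bullet> f = 0)" unfolding e3_def by blast
  note e2 = e3_e2[OF e3]
  show clo
    unfolding clo_def
  proof (intro allI impI, elim conjE exE)
    fix C x0 assume C: "rfun C" and x0: "isr x0" "memb x0 C"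
    \<comment> \<open>y is a point of C closer than w to q, where s codes the pair of q and
      w.\<close>
    let ?R = "\<lambda>s y. isr y \<and> memb y C \<and> \<not> (\<forall>n. rv (pi2 s) \<le> \<bar>rv (pi1 s) - rv (y \<bullet> n)\<bar> + eps n)"
    have R: "I2 (\<lambda>s y. of_bool (?R s y) :: num)"
      by (intro e2_all(2)[OF e2] I2_snd e2_isr[OF e2] e2_memb[OF e2] Ir R_rules)
    have Rl: "I1 (\<lambda>y. 1 - of_bool (?R s y) :: num)" for s
      by (intro Ir I2D[OF R])
    have "I1 (\<lambda>s. of_bool (E \<bullet> lam (\<lambda>y. 1 - of_bool (?R s y)) \<noteq> 0) :: num)" by (intro Ir R)
    moreover have "E \<bullet> lam (\<lambda>y. 1 - of_bool (?R s y)) \<noteq> 0 \<longleftrightarrow> (\<forall>y. \<not> ?R s y)" for s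
      unfolding E lam[OF Rl] by (auto simp: of_bool_def split: if_splits)
    ultimately have "I1 (\<lambda>s. of_bool (\<forall>y. \<not> ?R s y) :: num)" by (simp only:)
    from I2_c1[OF this I2_pair]
    have L: "I2 (\<lambda>q w. of_bool (\<forall>y. \<not> ?R (pair q w) y) :: num)" .
    show "\<exists>D. rfun D \<and> contf D \<and> (\<forall>x. isr x \<longrightarrow> dist_of (D \<bullet> x) x C)"
    proof (rule rat_dist[OF C x0 L])
      fix q w
      have "(\<forall>n. rv w \<le> \<bar>rv q - rv (y \<bullet> n)\<bar> + eps n) \<longleftrightarrow> kq (rv w) \<le> \<bar>kq (rv q) - val y\<bar>" if y: "isr y" for y
      proof -
        have k: "rv w \<le> \<bar>rv q - rv (y \<bullet> n)\<bar> + eps n \<longleftrightarrow> kq (rv w) \<le> \<bar>kq (rv q) - kq (rv (y \<bullet> n))\<bar> + kq (eps n)" for n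
          unfolding kq_diff[symmetric] kq_abs[symmetric] kq_ring(3)[symmetric] kq_le ..
        show ?thesis
          unfolding k
        proof
          assume *: "\<forall>n. kq (rv w) \<le> \<bar>kq (rv q) - kq (rv (y \<bullet> n))\<bar> + kq (eps n)"
          show "kq (rv w) \<le> \<bar>kq (rv q) - val y\<bar>"
          proof (rule k_le_eps)
            fix n show "kq (rv w) \<le> \<bar>kq (rv q) - val y\<bar> + 4 * kq (eps n)"
              using *[rule_format, of n] approx[OF y, of n] keps_pos[of n] by linarith
          qed
        next
          assume *: "kq (rv w) \<le> \<bar>kq (rv q) - val y\<bar>"
          show "\<forall>n. kq (rv w) \<le> \<bar>kq (rv q) - kq (rv (y \<bullet> n))\<bar> + kq (eps n)"
          proof
            fix n show "kq (rv w) \<le> \<bar>kq (rv q) - kq (rv (y \<bullet> n))\<bar> + kq (eps n)"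
              using * approx[OF y, of n] by linarith
          qed
        qed
      qed
      then show "(\<forall>y. \<not> ?R (pair q w) y) \<longleftrightarrow> (\<forall>y. isr y \<longrightarrow> memb y C \<longrightarrow> kq (rv w) \<le> \<bar>kq (rv q) - val y\<bar>)"
        by (auto simp: pi_pair)
    qed
  qed
qed

section \<open>From distance functions to arithmetical comprehension\<close>

definition qeps :: "num \<Rightarrow> num" where "qeps k = qcode 1 0 (pw k - 1)"

lemma rv_qeps: "rv (qeps k) = eps k" unfolding qeps_def by (rule rv_qn)
lemma I1_qeps: "I1 qeps" unfolding qeps_def by (rule I_qn)

text \<open>The characteristic function of the reals below some \<open>c n\<close> is
  \<open>x \<mapsto> sup\<^sub>n min (2\<^sup>-\<^sup>n) (c n - x)\<^sup>+\<close>.\<close>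

lemma clo_sup:
  assumes clo: clo and cR: "R1 (c :: num \<Rightarrow> rt)" and c1: "\<And>n. c n \<le> 1"
  shows "\<exists>b. isr b \<and> (\<forall>n. kq (c n) \<le> val b) \<and> (\<forall>r>0. \<exists>n. val b < kq (c n) + kq r)"
proof (rule ccontr)
  assume nosup: "\<not> ?thesis"
  obtain cc where cc: "I1 cc" "\<And>n. rv (cc n) = c n" using cR unfolding R1_def by blast
  \<comment> \<open>Codes the maximum of 0 and the first k terms
    \<open>min (eps i) (c i - rv r)\<close>. The cap \<open>eps i\<close> bounds what later terms
    can add and so gives a rate of convergence.\<close>
  define H where "H r k = prec (\<lambda>i a. qmax a (qmin (qeps i) (qadd (cc i) (qneg r)))) 0 k" for r k
  note q = I1_c2[OF I2_qops(1)] I1_c2[OF I2_qops(3)] I1_c2[OF I2_qops(4)] I1_c1[OF I1_qneg]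
    I2_c2[OF I2_qops(1)] I2_c2[OF I2_qops(3)] I2_c2[OF I2_qops(4)] I2_c1[OF I1_qneg]
    I4_c2[OF I2_qops(1)] I4_c2[OF I2_qops(3)] I4_c2[OF I2_qops(4)] I4_c1[OF I1_qneg]
    I2_c1[OF cc(1)] I4_c1[OF cc(1)] I2_c1[OF I1_qeps] I4_c1[OF I1_qeps]
  have IG: "I2 (\<lambda>i a. qmax a (qmin (qeps i) (qadd (cc i) (qneg r))))" for r by (intro q Ir)
  have IH: "I2 H" unfolding H_def by (intro q Ir)
  define G where "G r k = rv (H r k)" for r k
  have G: "G r 0 = 0" "G r (k + 1) = max (G r k) (min (eps k) (c k - rv r))" for r k
    unfolding G_def H_def prec[OF IG] by (simp_all add: rv_ops rv_qeps cc)
  have GR: "I1 K \<Longrightarrow> R1 (\<lambda>n. G r (K n))" for r and K :: "num \<Rightarrow> num"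
    unfolding G_def by (rule R1_rv) (intro I1_c2[OF IH] Ir)
  have G0: "0 \<le> G r k" for r k
    by (rule nind[where P = "\<lambda>k. 0 \<le> G r k"]) (intro R_rules GR Ir, auto simp: G)
  have Gm: "G r k \<le> G r (k + i)" for r k i
    by (rule nind[where P = "\<lambda>i. G r k \<le> G r (k + i)"])
      (intro R_rules GR Ir, auto simp: G add.assoc[symmetric])
  have Ge: "G r (k + i) \<le> G r k + eps k" for r k i
  proof (rule nind[where P = "\<lambda>i. G r (k + i) \<le> G r k + eps k"])
    fix i assume *: "G r (k + i) \<le> G r k + eps k"
    have "eps (k + i) \<le> eps k" by (rule eps_add_le)
    then show "G r (k + (i + 1)) \<le> G r k + eps k"
      using * G0[of r k] unfolding add.assoc[symmetric] G by linarith
  qed (intro R_rules GR Ir, simp add: eps_ge0)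
  have Gl: "G r k \<le> G r' k + \<bar>rv r - rv r'\<bar>" for r r' k
  proof (rule nind[where P = "\<lambda>k. G r k \<le> G r' k + \<bar>rv r - rv r'\<bar>"])
    fix k assume "G r k \<le> G r' k + \<bar>rv r - rv r'\<bar>"
    then show "G r (k + 1) \<le> G r' (k + 1) + \<bar>rv r - rv r'\<bar>" unfolding G by linarith
  qed (intro R_rules GR Ir, simp add: G)
  have Gu: "min (eps n) (c n - rv r) \<le> G r k" if "n < k" for n r k
  proof -
    have "n < k \<longrightarrow> min (eps n) (c n - rv r) \<le> G r k"
      by (rule nind[where P = "\<lambda>k. n < k \<longrightarrow> min (eps n) (c n - rv r) \<le> G r k"])
        (intro R_rules GR Ir, auto simp: G less_Suc le_less)
    then show ?thesis using that by blast
  qed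
  have Gz: "G r k \<le> t" if "\<forall>i. c i - rv r \<le> t" "0 \<le> t" for r k t
    by (rule nind[where P = "\<lambda>k. G r k \<le> t"]) (intro R_rules GR Ir, use that in \<open>auto simp: G min_le_iff_disj\<close>)
  have "I2 (\<lambda>(x::t1) k. H (x \<bullet> (k + 1 + 1)) (k + 1 + 1))" by (intro I2_c2[OF IH] Ir)
  then obtain F :: t11 where F': "\<And>x k. F \<bullet> x \<bullet> k = H (x \<bullet> (k + 1 + 1)) (k + 1 + 1)" unfolding I2_def by blast
  then have F: "rv (F \<bullet> x \<bullet> k) = G (x \<bullet> (k + 1 + 1)) (k + 1 + 1)" for x k by (simp add: G_def)
  have Gd: "\<bar>G r k - G r' k\<bar> \<le> \<bar>rv r - rv r'\<bar>" for r r' k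
    using Gl[of r k r'] Gl[of r' k r] by linarith
  have isF: "isr (F \<bullet> x)" if x: "isr x" for x
    unfolding isr_def F
  proof (intro allI)
    fix n i :: num let ?n = "n + 1 + 1"
    have eq: "n + i + 1 + 1 = ?n + i" by (simp add: ac_simps)
    have "\<bar>rv (x \<bullet> ?n) - rv (x \<bullet> (?n + i))\<bar> < eps ?n" using x unfolding isr_def by blast
    then show "\<bar>G (x \<bullet> ?n) ?n - G (x \<bullet> (n + i + 1 + 1)) (n + i + 1 + 1)\<bar> < eps n"
      using Gd[of "x \<bullet> ?n" ?n "x \<bullet> (?n + i)"] Gm[of "x \<bullet> (?n + i)" ?n i] Ge[of "x \<bullet> (?n + i)" ?n i]
        eps_Suc[of n] eps_Suc[of "n + 1"] eps_pos[of ?n] unfolding eq by linarith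
  qed
  have rF: "rfun F"
  proof (rule rfunI[OF isF])
    fix x y assume x: "isr x" and y: "isr y" and xy: "val x = val y"
    show "val (F \<bullet> x) = val (F \<bullet> y)"
    proof (rule k_eq_eps)
      fix n :: num let ?n = "n + 1 + 1"
      have "kq \<bar>G (x \<bullet> ?n) ?n - G (y \<bullet> ?n) ?n\<bar> \<le> kq \<bar>rv (x \<bullet> ?n) - rv (y \<bullet> ?n)\<bar>"
        unfolding kq_le by (rule Gd)
      then show "\<bar>val (F \<bullet> x) - val (F \<bullet> y)\<bar> \<le> 4 * kq (eps n)"
        using approx[OF isF[OF x], of n] approx[OF isF[OF y], of n] approx[OF x, of ?n] approx[OF y, of ?n] xy
          keps_Suc[of n] keps_Suc[of "n + 1"] keps_pos[of ?n]
        unfolding F kq_abs kq_diff by linarith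
    qed
  qed
  have mF: "memb x F \<longleftrightarrow> (\<exists>n. val x < kq (c n))" if x: "isr x" for x
  proof
    assume "memb x F"
    then have pos: "0 < val (F \<bullet> x)" using memb_val[OF rF x] by simp
    show "\<exists>n. val x < kq (c n)"
    proof (rule ccontr)
      assume "\<not> ?thesis"
      then have *: "kq (c n) \<le> val x" for n by (simp add: not_less)
      have "val (F \<bullet> x) \<le> 0"
      proof (rule k_le_eps)
        fix k :: num let ?k = "k + 1 + 1"
        have "c i - rv (x \<bullet> ?k) \<le> eps ?k" for i
        proof -
          have "kq (c i - rv (x \<bullet> ?k)) \<le> kq (eps ?k)" unfolding kq_diff using *[of i] approx[OF x, of ?k] by linarith
          then show ?thesis by (simp only: kq_le)
        qed
        then have "kq (G (x \<bullet> ?k) ?k) \<le> kq (eps ?k)" unfolding kq_le by (intro Gz) (simp_all add: eps_ge0)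
        then show "val (F \<bullet> x) \<le> 0 + 4 * kq (eps k)"
          using approx[OF isF[OF x], of k] keps_Suc[of k] keps_Suc[of "k + 1"] keps_pos[of ?k] unfolding F by linarith
      qed
      then show False using pos by simp
    qed
  next
    assume "\<exists>n. val x < kq (c n)"
    then obtain n where n: "val x < kq (c n)" by blast
    then obtain m where m: "4 * kq (eps m) < kq (c n) - val x" using keps_arch4[of "kq (c n) - val x"] by auto
    let ?k = "m + n + 1" let ?k2 = "m + n + 1 + 1 + 1"
    have a: "kq (eps (m + n)) \<le> kq (eps m)" "kq (eps (m + n)) \<le> kq (eps n)" "kq (eps ?k2) \<le> kq (eps m)"
      by (intro keps_mono; simp add: add.assoc)+
    have "n \<le> m + n" by simp
    also have "m + n < ?k2" by (simp add: add.assoc)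
    finally have "n < ?k2" .
    from Gu[OF this, of "x \<bullet> ?k2"] have "kq (min (eps n) (c n - rv (x \<bullet> ?k2))) \<le> kq (G (x \<bullet> ?k2) ?k2)" unfolding kq_le .
    moreover have "kq (min (eps n) (c n - rv (x \<bullet> ?k2))) = min (kq (eps n)) (kq (c n) - kq (rv (x \<bullet> ?k2)))"
      unfolding min_def kq_diff[symmetric] kq_le by (simp only: if_distrib[of kq])
    moreover have "kq (eps (m + n)) \<le> kq (c n) - kq (rv (x \<bullet> ?k2))"
      using m approx[OF x, of ?k2] a keps_pos[of m] by linarith
    then have "kq (eps (m + n)) \<le> min (kq (eps n)) (kq (c n) - kq (rv (x \<bullet> ?k2)))"
      using a(2) by (intro min.boundedI)
    ultimately have "kq (eps (m + n)) \<le> kq (G (x \<bullet> ?k2) ?k2)" by linarith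
    then have "0 < val (F \<bullet> x)"
      using approx[OF isF[OF x], of ?k] keps_Suc[of "m + n"] keps_pos[of "m + n + 1"] unfolding F by linarith
    then show "memb x F" using memb_val[OF rF x] by simp
  qed
  have op: "openp (\<lambda>x. \<not> memb x F)"
    unfolding openp_val
  proof (intro allI impI)
    fix x assume x: "isr x" and "\<not> memb x F"
    then have ub: "kq (c n) \<le> val x" for n using mF[OF x] by (auto simp: not_less)
    \<comment> \<open>An upper bound that is not a supremum leaves a gap r above the whole sequence.
      This is where the failure of suprema makes the set closed.\<close>
    then obtain r where r: "r > 0" "\<And>n. kq (c n) + kq r \<le> val x" using nosup x by (auto simp: not_less)
    have "\<not> memb y F" if "isr y" "\<bar>val x - val y\<bar> < kq r" for y
    proof -
      have "kq (c n) \<le> val y" for n using r(2)[of n] that(2) by linarith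
      then show ?thesis unfolding mF[OF that(1)] by (simp add: not_less)
    qed
    then show "\<exists>r>0. \<forall>y. isr y \<longrightarrow> \<bar>val x - val y\<bar> < kq r \<longrightarrow> \<not> memb y F" using r(1) by blast
  qed
  have memr: "memb (rat q) F \<longleftrightarrow> (\<exists>n. rv q < c n)" for q by (simp add: mF)
  obtain q0 where q0: "rv q0 = c 0 - 1" using rv_surj by blast
  have ne: "\<exists>x. isr x \<and> memb x F" by (rule exI[of _ "rat q0"]) (auto simp: memr q0 intro: exI[of _ 0])
  obtain D where D: "rfun D" "\<And>x. isr x \<Longrightarrow> dist_of (D \<bullet> x) x F"
    using clo[unfolded clo_def, rule_format, of F] rF op ne by blast
  \<comment> \<open>The point 2 lies beyond the sequence, which is bounded by 1; 2 minus its
    distance from the set will be the supremum.\<close>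
  obtain q2 where q2: "rv q2 = 2" using rv_surj by blast
  let ?d = "D \<bullet> rat q2"
  have isd: "isr ?d" using rfunD(1)[OF D(1)] by simp
  have dist: "\<And>y. isr y \<Longrightarrow> memb y F \<Longrightarrow> val ?d \<le> \<bar>2 - val y\<bar>"
    "\<And>e. isr e \<Longrightarrow> (\<And>y. isr y \<Longrightarrow> memb y F \<Longrightarrow> val e \<le> \<bar>2 - val y\<bar>) \<Longrightarrow> val e \<le> val ?d"
    using D(2)[of "rat q2"] unfolding dist_of_val[OF rF isd isr_rat] by (simp_all add: q2)
  have kc1: "kq (c n) \<le> 1" for n using c1[of n] kq_le[of "c n" 1] by simp
  obtain b where b: "isr b" "val b = 2 - val ?d"
    using real_diff[OF isr_rat[of q2] isd] by (auto simp: q2)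
  have ub: "kq (c n) \<le> val b" for n
  proof (rule ccontr)
    assume "\<not> ?thesis"
    then obtain r where r: "r > 0" "kq r < kq (c n) - val b" using kq_between[of "kq (c n) - val b"] by auto
    obtain qy where qy: "rv qy = c n - r" using rv_surj by blast
    have "memb (rat qy) F" unfolding memr qy using r(1) by (intro exI[of _ n]) simp
    from dist(1)[OF _ this] have "val ?d \<le> \<bar>2 - (kq (c n) - kq r)\<bar>" by (simp add: qy)
    moreover have "0 < kq r" using r(1) kq_less[of 0 r] by simp
    ultimately show False using r(2) kc1[of n] b(2) by linarith
  qed
  have "\<exists>n. val b < kq (c n) + kq r" if r: "r > 0" for r
  proof (rule ccontr)
    assume "\<not> ?thesis"
    then have *: "kq (c n) + kq r \<le> val b" for n by (simp add: not_less)
    obtain qr where qr: "rv qr = - r" using rv_surj by blast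
    obtain e where e: "isr e" "val e = val ?d + kq r" using real_diff[OF isd isr_rat[of qr]] by (auto simp: qr)
    have "val e \<le> \<bar>2 - val y\<bar>" if y: "isr y" "memb y F" for y
    proof -
      obtain n where "val y < kq (c n)" using mF[OF y(1)] y(2) by blast
      then show ?thesis using *[of n] b(2) unfolding e(2) by linarith
    qed
    then have "val e \<le> val ?d" using dist(2)[OF e(1)] by blast
    moreover have "0 < kq r" using r kq_less[of 0 r] by simp
    ultimately show False unfolding e(2) by linarith
  qed
  then show False using nosup b(1) ub by blast
qed

text \<open>\<open>c n\<close> is the sum of \<open>eps (s + 1)\<close> over those s < n for which P
  s a holds for some a < n. Once n > s and the supremum exceeds \<open>c n\<close> by less than
  \<open>eps (s + 1)\<close>, the index s can no longer enter, so the search for a is bounded by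
  n.\<close>

theorem clo_jmp: "clo \<Longrightarrow> jmp"
  unfolding jmp_def
proof (intro allI impI)
  fix P :: "num \<Rightarrow> num \<Rightarrow> bool"
  assume clo: clo and P: "I2 (\<lambda>s a. of_bool (P s a) :: num)"
  define p where "p s n \<longleftrightarrow> \<not> (\<forall>a<n. \<not> P s a)" for s n
  have Ip: "I2 (\<lambda>s n. of_bool (p s n) :: num)"
    unfolding p_def by (intro Ir I2_ball I3_c2[OF P])
  have pm: "p s n \<Longrightarrow> n \<le> n' \<Longrightarrow> p s n'" for s n n' unfolding p_def by (meson less_le_trans)
  \<comment> \<open>The first j binary digits of the sum, read as a whole number.\<close>
  define M where "M n j = prec (\<lambda>j a. a + a + of_bool (p j n)) 0 j" for n j
  have G: "I2 (\<lambda>j a. a + a + of_bool (p j n) :: num)" for n by (intro Ir I2_c2[OF Ip])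
  have M: "M n 0 = 0" "M n (j + 1) = M n j + M n j + of_bool (p j n)" for n j
    unfolding M_def by (rule prec[OF G])+
  have IM: "I2 M" unfolding M_def by (intro Ir I4_c2[OF Ip])
  define t where "t n j = ofn (M n j) * eps j" for n j
  have ofb: "ofn (of_bool b) = of_bool b" for b by simp
  have t: "t n 0 = 0" "t n (j + 1) = t n j + of_bool (p j n) * eps (j + 1)" for n j
    unfolding t_def M ofn_simps ofb using eps_Suc[of j] by (simp_all add: algebra_simps)
  have tR: "I1 K \<Longrightarrow> I1 L \<Longrightarrow> R1 (\<lambda>n. t (K n) (L n))" for K L :: "num \<Rightarrow> num"
    unfolding t_def by (intro R_rules I1_c2[OF IM] Ir; assumption)
  define c where "c n = t n n" for n
  have cR: "R1 c" unfolding c_def by (intro tR Ir)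
  have t1: "t n j \<le> 1 - eps j" for n j
  proof (rule nind[where P = "\<lambda>j. t n j \<le> 1 - eps j"])
    fix j assume "t n j \<le> 1 - eps j"
    moreover have "of_bool (p j n) * eps (j + 1) \<le> eps (j + 1)"
      using eps_ge0[of "j + 1"] by (cases "p j n") simp_all
    ultimately show "t n (j + 1) \<le> 1 - eps (j + 1)" unfolding t using eps_Suc[of j] by linarith
  qed (intro R_rules tR Ir, simp add: t eps_0)
  have c1: "c n \<le> 1" for n using t1[of n n] eps_pos[of n] unfolding c_def by linarith
  have tn: "t n j \<le> t n' j" if n: "n \<le> n'" for n n' j
  proof (rule nind[where P = "\<lambda>j. t n j \<le> t n' j"])
    fix j assume *: "t n j \<le> t n' j"
    have "of_bool (p j n) * eps (j + 1) \<le> of_bool (p j n') * eps (j + 1)"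
      using pm[OF _ n, of j] eps_ge0[of "j + 1"] by (cases "p j n") simp_all
    then show "t n (j + 1) \<le> t n' (j + 1)" unfolding t using * by linarith
  qed (intro R_rules tR Ir, simp add: t)
  have tj: "t n j \<le> t n (j + i)" for n j i
    by (rule nind[where P = "\<lambda>i. t n j \<le> t n (j + i)"])
      (intro R_rules tR Ir, use eps_ge0 in \<open>auto simp: t add.assoc[symmetric] of_bool_def intro: add_increasing2\<close>)
  have cm: "c n \<le> c n'" if "n \<le> n'" for n n'
    using tn[OF that, of n] tj[of n' n "n' - n"] that unfolding c_def by (simp add: le_add_diff_inverse)
  \<comment> \<open>If s enters after stage n, the sum grows by at least its weight
    \<open>eps (s + 1)\<close>.\<close>
  have cj: "c n + eps (s + 1) \<le> c n'" if n: "n \<le> n'" "s < n" "p s n'" "\<not> p s n" for n n' s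
  proof -
    have "s < j \<longrightarrow> t n j + eps (s + 1) \<le> t n' j" for j
    proof (rule nind[where P = "\<lambda>j. s < j \<longrightarrow> t n j + eps (s + 1) \<le> t n' j"])
      fix j assume *: "s < j \<longrightarrow> t n j + eps (s + 1) \<le> t n' j"
      show "s < j + 1 \<longrightarrow> t n (j + 1) + eps (s + 1) \<le> t n' (j + 1)"
      proof
        assume "s < j + 1"
        then consider "s < j" | "s = j" unfolding less_Suc by fastforce
        then show "t n (j + 1) + eps (s + 1) \<le> t n' (j + 1)"
        proof cases
          case 1
          then show ?thesis using * pm[OF _ n(1), of j] by (auto simp: t of_bool_def intro: add_increasing2)
        next
          case 2
          then show ?thesis using tn[OF n(1), of j] n(3,4) by (simp add: t)
        qed
      qed
    qed (intro R_rules tR Ir, simp)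
    then show ?thesis using tj[of n' n "n' - n"] n(1,2) unfolding c_def by (fastforce simp: le_add_diff_inverse)
  qed
  obtain b where b: "isr b" "\<And>n. kq (c n) \<le> val b" "\<And>r. r > 0 \<Longrightarrow> \<exists>n. val b < kq (c n) + kq r"
    using clo_sup[OF clo cR c1] by blast
  \<comment> \<open>Decidable and sufficient for the supremum to lie below
    \<open>c n + eps (s + 1)\<close>. The condition s < n ensures that the sum already takes index s
    into account.\<close>
  let ?Q = "\<lambda>s n. s < n \<and> rv (b \<bullet> n) + eps n < c n + eps (s + 1)"
  have IQ: "I2 (\<lambda>s n. of_bool (?Q s n) :: num)"
    unfolding c_def t_def by (intro Ir R_rules I2_c2[OF IM])
  have kQ: "rv (b \<bullet> n) + eps n < c n + eps (s + 1) \<longleftrightarrow> kq (rv (b \<bullet> n)) + kq (eps n) < kq (c n) + kq (eps (s + 1))" for s n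
    unfolding kq_ring(3)[symmetric] kq_less ..
  have "\<exists>n. ?Q s n" for s
  proof -
    obtain m where m: "val b < kq (c m) + kq (eps (s + 1))" using b(3)[OF eps_pos] by blast
    then obtain l where l: "4 * kq (eps l) < kq (c m) + kq (eps (s + 1)) - val b"
      using keps_arch4[of "kq (c m) + kq (eps (s + 1)) - val b"] by auto
    let ?n = "m + l + (s + 1)"
    have "kq (c m) \<le> kq (c ?n)" unfolding kq_le by (rule cm) (simp add: add.assoc)
    moreover have "kq (eps ?n) \<le> kq (eps l)" by (intro keps_mono) (simp add: add.assoc add_increasing)
    ultimately have "rv (b \<bullet> ?n) + eps ?n < c ?n + eps (s + 1)"
      unfolding kQ using l approx[OF b(1), of ?n] keps_pos[of l] by linarith
    moreover have "s < ?n" using Suc_le_num[of s ?n] by (simp add: add.assoc add_increasing)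
    ultimately show ?thesis by blast
  qed
  then obtain N where N: "I1 N" "\<And>s. ?Q s (N s)" using choice00[OF IQ] by blast
  have "(\<exists>a. P s a) \<longleftrightarrow> p s (N s)" for s
  proof
    assume "\<exists>a. P s a"
    then obtain a where a: "P s a" by blast
    show "p s (N s)"
    proof (rule ccontr)
      assume np: "\<not> p s (N s)"
      let ?n = "N s + (a + 1)"
      have "p s ?n" unfolding p_def using a Suc_le_num[of a ?n] by (auto simp: add_increasing)
      then have "c (N s) + eps (s + 1) \<le> c ?n" using cj[of "N s" ?n s] N(2)[of s] np by simp
      then have "kq (c (N s)) + kq (eps (s + 1)) \<le> kq (c ?n)" unfolding kq_ring(3)[symmetric] kq_le .
      then show False using N(2)[of s] b(2)[of ?n] approx[OF b(1), of "N s"] unfolding kQ by linarith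
    qed
  qed (auto simp: p_def)
  then show "I1 (\<lambda>s. of_bool (\<exists>a. P s a) :: num)"
    by (simp only:) (intro I1_c2[OF Ip] N Ir)
qed

end

context counterexample
begin

lemma clo_ex:
  "clo \<Longrightarrow> rfun C \<Longrightarrow> openp (\<lambda>x. \<not> memb x C) \<Longrightarrow> isr x0 \<Longrightarrow> memb x0 C \<Longrightarrow>
    \<exists>D. rfun D \<and> (\<forall>x. isr x \<longrightarrow> dist_of (D \<bullet> x) x C)"
  unfolding clo_def by blast

section \<open>The Heine-Borel theorem for closed sets\<close>

text \<open>The points of C cannot be quantified over arithmetically. The distance function replaces
  them by rational points at small distance, and \<open>jmp\<close> makes failure of the cover on a
  dyadic interval decidable. If no finite subcover existed, bisection would lead to a point at
  distance 0 from C, thus in C, yet outside every interval of the cover.\<close>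

theorem clo_hbc: "clo \<Longrightarrow> hbc"
  unfolding hbc_def
proof (intro allI impI, elim conjE)
  fix C :: t11 and a b :: t01
  assume clo: clo and C: "rfun C" and op: "openp (\<lambda>x. \<not> memb x C)"
    and C01: "\<forall>x. isr x \<longrightarrow> memb x C \<longrightarrow> rle (rat 0) x \<and> rle x (rat 1)"
    and ab: "\<forall>n. isr (a \<bullet> n) \<and> isr (b \<bullet> n)"
    and cov: "\<forall>x. isr x \<longrightarrow> memb x C \<longrightarrow> (\<exists>n. \<not> rle x (a \<bullet> n) \<and> \<not> rle (b \<bullet> n) x)"
  note jmp = clo_jmp[OF clo]
  have isab: "isr (a \<bullet> n)" "isr (b \<bullet> n)" for n using ab by blast+
  show "\<exists>n0. \<forall>x. isr x \<longrightarrow> memb x C \<longrightarrow> (\<exists>n\<le>n0. \<not> rle x (a \<bullet> n) \<and> \<not> rle (b \<bullet> n) x)"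
  proof (rule ccontr)
    assume no: "\<not> ?thesis"
    have bad: "\<exists>x. isr x \<and> memb x C \<and> (\<forall>n\<le>k. val x \<le> val (a \<bullet> n) \<or> val (b \<bullet> n) \<le> val x)" for k
    proof -
      obtain x where x: "isr x" "memb x C" "\<And>n. n \<le> k \<Longrightarrow> rle x (a \<bullet> n) \<or> rle (b \<bullet> n) x" using no by blast
      then show ?thesis using rle_val[OF x(1) isab(1)] rle_val[OF isab(2) x(1)] by blast
    qed
    obtain x0 where "isr x0" "memb x0 C" using bad[of 0] by (elim exE conjE)
    from clo_ex[OF clo C op this] obtain D where D: "rfun D" "\<And>x. isr x \<Longrightarrow> dist_of (D \<bullet> x) x C"
      by (elim exE conjE) simp
    have isD: "isr (D \<bullet> x)" if "isr x" for x using rfunD(1)[OF D(1) that] .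
    have Dlow: "val (D \<bullet> x) \<le> \<bar>val x - val y\<bar>" if "isr x" "isr y" "memb y C" for x y
      using D(2)[OF that(1)] that unfolding dist_of_val[OF C isD[OF that(1)] that(1)] by blast
    have Dlip: "val (D \<bullet> x) \<le> val (D \<bullet> y) + \<bar>val x - val y\<bar>" if "isr x" "isr y" for x y
      using dist_lip[OF C isD[OF that(1)] D(2)[OF that(1)] isD[OF that(2)] D(2)[OF that(2)] that] .
    \<comment> \<open>Up to precision k, u is a point of C outside the intervals with index at most
      k. The condition becomes stronger as k grows.\<close>
    define S where "S u k \<longleftrightarrow> val (D \<bullet> rat u) \<le> kq (eps k) \<and>
      (\<forall>i. i \<le> k \<longrightarrow> kq (rv u - eps k) \<le> val (a \<bullet> i) \<or> val (b \<bullet> i) \<le> kq (rv u + eps k))" for u k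
    have IS: "I2 (\<lambda>u k. of_bool (S u k) :: num)"
      unfolding S_def ge_val_rat[OF isab(1)] le_val_rat[OF isab(2)] le_val_rat[OF isD[OF isr_rat]]
      unfolding rat_def
      by (intro Ir R_rules jmp_all[OF jmp])
    have Smono: "S u k" if "S u k'" "k \<le> k'" for u k k'
    proof -
      have e: "kq (eps k') \<le> kq (eps k)" using that(2) by (rule keps_mono)
      show ?thesis unfolding S_def kq_diff kq_ring(3)
      proof (intro conjI allI impI)
        show "val (D \<bullet> rat u) \<le> kq (eps k)" using that(1) e unfolding S_def by linarith
        fix i assume "i \<le> k"
        then have "i \<le> k'" using that(2) by (rule order_trans)
        then show "kq (rv u) - kq (eps k) \<le> val (a \<bullet> i) \<or> val (b \<bullet> i) \<le> kq (rv u) + kq (eps k)"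
          using that(1) e unfolding S_def kq_diff kq_ring(3) by (meson add_left_mono diff_left_mono order_trans)
      qed
    qed
    \<comment> \<open>The tolerance \<open>eps k\<close> at both ends admits rational approximations
      of points of C near the boundary of the interval.\<close>
    let ?B = "\<lambda>n j. \<forall>k. \<exists>u. ofn j * eps n - eps k \<le> rv u \<and> rv u \<le> (ofn j + 1) * eps n + eps k \<and> S u k"
    have IB: "I2 (\<lambda>n j. of_bool (?B n j) :: num)"
      by (intro Ir R_rules jmp_all[OF jmp] jmp_I3[OF jmp] I4_c2[OF IS])
    have B0: "?B 0 0"
    proof
      fix k
      obtain x where x: "isr x" "memb x C" "\<forall>n\<le>k. val x \<le> val (a \<bullet> n) \<or> val (b \<bullet> n) \<le> val x" using bad by blast
      have x01: "0 \<le> val x" "val x \<le> 1" 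
        using C01[rule_format, OF x(1,2)] rle_val[OF isr_rat[of 0] x(1)] rle_val[OF x(1) isr_rat[of 1]] by simp_all
      let ?u = "x \<bullet> k"
      have u: "\<bar>val x - kq (rv ?u)\<bar> \<le> kq (eps k)" by (rule approx[OF x(1)])
      have "kq (- eps k) \<le> kq (rv ?u)" "kq (rv ?u) \<le> kq (1 + eps k)"
        unfolding kq_ring using u x01 by linarith+
      moreover have "S ?u k"
        unfolding S_def kq_diff kq_ring(3)
      proof (intro conjI allI impI)
        show "val (D \<bullet> rat ?u) \<le> kq (eps k)" using Dlow[OF isr_rat[of ?u] x(1,2)] u by simp
        fix i assume "i \<le> k"
        then have "val x \<le> val (a \<bullet> i) \<or> val (b \<bullet> i) \<le> val x" using x(3) by blast
        then show "kq (rv ?u) - kq (eps k) \<le> val (a \<bullet> i) \<or> val (b \<bullet> i) \<le> kq (rv ?u) + kq (eps k)"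
          using u by linarith
      qed
      ultimately show "\<exists>u. ofn 0 * eps 0 - eps k \<le> rv u \<and> rv u \<le> (ofn 0 + 1) * eps 0 + eps k \<and> S u k"
        unfolding kq_le by (intro exI[of _ ?u]) (simp add: eps_0)
    qed
    have st: "?B (n + 1) (j + j) \<or> ?B (n + 1) (j + j + 1)" if B: "?B n j" for n j
    proof (rule ccontr)
      assume "\<not> ?thesis"
      then obtain k1 k2 where
        1: "\<And>u. \<not> (ofn (j + j) * eps (n + 1) - eps k1 \<le> rv u \<and> rv u \<le> (ofn (j + j) + 1) * eps (n + 1) + eps k1 \<and> S u k1)" and
        2: "\<And>u. \<not> (ofn (j + j + 1) * eps (n + 1) - eps k2 \<le> rv u \<and> rv u \<le> (ofn (j + j + 1) + 1) * eps (n + 1) + eps k2 \<and> S u k2)"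
        by blast
      \<comment> \<open>A witness at the larger precision lies in one of the halves and, by
        monotonicity of S, contradicts the choice made for that half.\<close>
      let ?k = "max k1 k2"
      obtain u where u: "ofn j * eps n - eps ?k \<le> rv u" "rv u \<le> (ofn j + 1) * eps n + eps ?k" "S u ?k" using B by blast
      have S: "S u k1" "S u k2" using Smono[OF u(3)] by simp_all
      have e: "eps ?k \<le> eps k1" "eps ?k \<le> eps k2" by (intro eps_mono; simp)+
      have j: "ofn (j + j) * eps (n + 1) = ofn j * eps n" "(ofn (j + j) + 1) * eps (n + 1) = ofn (j + j + 1) * eps (n + 1)"
        "(ofn (j + j + 1) + 1) * eps (n + 1) = (ofn j + 1) * eps n"
        unfolding eps_Suc[of n] ofn_simps by (simp_all add: algebra_simps)
      show False using 1[of u] 2[of u] S u(1,2) e eps_pos[of k1] eps_pos[of k2] unfolding j by linarith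
    qed
    obtain z where z: "isr z"
      "\<And>n. \<exists>j. ?B n j \<and> \<bar>val z - kq (0 + 1 * (ofn j * eps n))\<bar> \<le> kq (\<bar>1\<bar> * eps n)"
      using bisection[OF IB B0 st, of 0 1] by blast
    have near: "\<exists>u. \<bar>val z - kq (rv u)\<bar> \<le> 3 * kq (eps n) \<and> S u n" for n
    proof -
      obtain j where j: "?B n j" "\<bar>val z - kq (0 + 1 * (ofn j * eps n))\<bar> \<le> kq (\<bar>1\<bar> * eps n)" using z(2) by blast
      then obtain u where u: "ofn j * eps n - eps n \<le> rv u" "rv u \<le> (ofn j + 1) * eps n + eps n" "S u n" by blast
      have "kq (ofn j * eps n - eps n) \<le> kq (rv u)" "kq (rv u) \<le> kq ((ofn j + 1) * eps n + eps n)"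
        using u(1,2) by (simp_all only: kq_le)
      then have "\<bar>kq (ofn j * eps n) - kq (rv u)\<bar> \<le> 2 * kq (eps n)"
        using keps_pos[of n] unfolding distrib_right kq_ring(3) kq_diff mult_1 by linarith
      then show ?thesis using j(2) u(3) unfolding mult_1 add_0 abs_one by (intro exI[of _ u]) linarith
    qed
    have zD: "val (D \<bullet> z) \<le> 0"
    proof (rule k_le_eps)
      fix n
      obtain u where u: "\<bar>val z - kq (rv u)\<bar> \<le> 3 * kq (eps n)" "S u n" using near by blast
      then show "val (D \<bullet> z) \<le> 0 + 4 * kq (eps n)"
        using Dlip[OF z(1) isr_rat[of u]] unfolding S_def val_rat by linarith
    qed
    \<comment> \<open>Otherwise the radius of a ball around z that misses C would be a positive
      lower bound of the distances, against distance 0.\<close>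
    have zC: "memb z C"
    proof (rule ccontr)
      assume "\<not> memb z C"
      then obtain r where r: "r > 0" "\<And>y. isr y \<Longrightarrow> \<bar>val z - val y\<bar> < kq r \<Longrightarrow> \<not> memb y C"
        using op z(1) unfolding openp_val by blast
      obtain q where q: "rv q = r" using rv_surj by blast
      have "val (rat q) \<le> \<bar>val z - val y\<bar>" if "isr y" "memb y C" for y
        using r(2)[OF that(1)] that(2) by (force simp: q not_less)
      then have "val (rat q) \<le> val (D \<bullet> z)"
        using D(2)[OF z(1)] isr_rat[of q] unfolding dist_of_val[OF C isD[OF z(1)] z(1)] by blast
      then show False using zD r(1) kq_less[of 0 r] by (simp add: q)
    qed
    then obtain n where "\<not> rle z (a \<bullet> n)" "\<not> rle (b \<bullet> n) z" using cov z(1) by blast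
    then have n: "val (a \<bullet> n) < val z" "val z < val (b \<bullet> n)"
      using rle_val[OF z(1) isab(1)] rle_val[OF isab(2) z(1)] by (auto simp: not_le)
    obtain m1 where m1: "4 * kq (eps m1) < val z - val (a \<bullet> n)" using keps_arch4 n(1) by (meson diff_gt_0_iff_gt)
    obtain m2 where m2: "4 * kq (eps m2) < val (b \<bullet> n) - val z" using keps_arch4 n(2) by (meson diff_gt_0_iff_gt)
    \<comment> \<open>Precise enough for both gaps and at least n, so that the interval n is among
      those that S excludes.\<close>
    let ?k = "m1 + m2 + n"
    have e: "kq (eps ?k) \<le> kq (eps m1)" "kq (eps ?k) \<le> kq (eps m2)"
      by (intro keps_mono; simp add: add.assoc add_increasing)+
    obtain u where u: "\<bar>val z - kq (rv u)\<bar> \<le> 3 * kq (eps ?k)" "S u ?k" using near by blast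
    have "n \<le> ?k" by (simp add: add_increasing)
    then have "kq (rv u - eps ?k) \<le> val (a \<bullet> n) \<or> val (b \<bullet> n) \<le> kq (rv u + eps ?k)" using u(2) unfolding S_def by blast
    then show False using u(1) m1 m2 e unfolding kq_diff kq_ring(3) by linarith
  qed
qed

section \<open>Enumerated balls inside open sets\<close>

abbreviation (input) "brad n \<equiv> qcode (pi1 (pi2 n) + 1) 0 (pi2 (pi2 n))"

definition ballin :: "t11 \<Rightarrow> num \<Rightarrow> num \<Rightarrow> bool" where
  "ballin Y q r \<longleftrightarrow> (\<forall>y. isr y \<longrightarrow> \<bar>kq (rv q) - val y\<bar> < kq (rv r) \<longrightarrow> memb y Y)"

lemma opn_iff: "opn \<longleftrightarrow> (\<forall>Y. rfun Y \<and> openp (\<lambda>x. memb x Y) \<longrightarrow>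
    (\<exists>X::t1. \<forall>n. X \<bullet> n \<le> 1 \<and> (X \<bullet> n = 1 \<longleftrightarrow> ballin Y (pi1 n) (brad n))))"
proof -
  have b: "(\<forall>y. isr y \<longrightarrow> inball (rat q) r y \<longrightarrow> memb y Y) \<longleftrightarrow> ballin Y q r" for q r Y
    unfolding ballin_def by (simp add: inball_val cong: imp_cong)
  have "(\<exists>q r. (\<exists>d e. n = pair q (pair d e) \<and> r = qcode (d + 1) 0 e) \<and> ballin Y q r) \<longleftrightarrow>
      ballin Y (pi1 n) (brad n)" for n Y
    using pair_eq_iff pi_pair by (metis pair_pi)
  then show ?thesis unfolding opn_def b by simp
qed

lemma opnI:
  assumes "I1 (\<lambda>n. of_bool (ballin Y (pi1 n) (brad n)) :: num)"
  shows "\<exists>X::t1. \<forall>n. X \<bullet> n \<le> 1 \<and> (X \<bullet> n = 1 \<longleftrightarrow> ballin Y (pi1 n) (brad n))"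
proof -
  obtain X :: t1 where "\<And>n. X \<bullet> n = of_bool (ballin Y (pi1 n) (brad n))" using assms unfolding I1_def by blast
  then show ?thesis by (intro exI[of _ X]) simp
qed

lemmas Ibrad = I1_c3[OF I3_qcode] I2_c3[OF I3_qcode]

text \<open>Membership is a number quantifier over the sequence of \<open>Y \<bullet> x\<close>, so
  \<open>e2\<close> decides it and the characteristic function of the complement belongs to the
  model. It respects equality of reals because membership does.\<close>

lemma e2_complement:
  assumes e2 and Y: "rfun Y"
  shows "\<exists>C. rfun C \<and> (\<forall>x. isr x \<longrightarrow> (memb x C \<longleftrightarrow> \<not> memb x Y))"
proof -
  have "I1 (\<lambda>x. rat (of_bool (\<not> memb x Y)))" unfolding rat_def by (intro Ir e2_memb[OF assms(1)])
  then obtain C :: t11 where C: "\<And>x. C \<bullet> x = rat (of_bool (\<not> memb x Y))" unfolding I1_def by blast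
  have v: "val (C \<bullet> x) = of_bool (\<not> memb x Y)" for x by (simp add: C of_bool_def)
  have r: "rfun C"
  proof (rule rfunI)
    show "isr (C \<bullet> x)" for x by (simp add: C)
    show "val (C \<bullet> x) = val (C \<bullet> y)" if "isr x" "isr y" "val x = val y" for x y
      unfolding v using memb_cong[OF Y that] by simp
  qed
  then show ?thesis using memb_val[OF r] by (intro exI[of _ C]) (simp add: v)
qed

lemma openp_cong: "(\<And>x. isr x \<Longrightarrow> P x \<longleftrightarrow> Q x) \<Longrightarrow> openp P \<longleftrightarrow> openp Q"
  unfolding openp_def by (metis (full_types))

lemma memb_rat_iff: "I1 (\<lambda>u. of_bool (memb (rat u) Y) :: num)" if jmp
  unfolding memb_iff rat_def by (intro Ir R_rules jmp_all[OF that])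

text \<open>With \<open>e2\<close>, a ball lies in Y when its radius is at most the distance of its
  centre from the complement. Without it, Y is continuous along rational points, and a ball lies in
  Y when for each smaller radius Y is bounded below by some \<open>eps K\<close> at the rational
  points within that radius. Both criteria are arithmetical.\<close>

theorem clo_opn: "clo \<Longrightarrow> opn"
  unfolding opn_iff
proof (intro allI impI, elim conjE)
  fix Y assume clo: clo and Y: "rfun Y" and op: "openp (\<lambda>x. memb x Y)"
  note jmp = clo_jmp[OF clo]
  show "\<exists>X::t1. \<forall>n. X \<bullet> n \<le> 1 \<and> (X \<bullet> n = 1 \<longleftrightarrow> ballin Y (pi1 n) (brad n))"
  proof (cases e2)
    case True
    obtain C where C: "rfun C" "\<And>x. isr x \<Longrightarrow> memb x C \<longleftrightarrow> \<not> memb x Y" using e2_complement[OF True Y] by blast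
    show ?thesis
    proof (cases "\<exists>x. isr x \<and> memb x C")
      \<comment> \<open>An empty complement has no distance function, but then every ball lies in
        Y.\<close>
      case False
      then have "ballin Y q r" for q r using C(2) unfolding ballin_def by blast
      then show ?thesis by (intro opnI) (simp add: I1_const)
    next
      case True
      have "openp (\<lambda>x. \<not> memb x C)" using op openp_cong[of "\<lambda>x. \<not> memb x C" "\<lambda>x. memb x Y"] C(2) by blast
      moreover obtain x0 where "isr x0" "memb x0 C" using True by (elim exE conjE)
      ultimately obtain D where D: "rfun D" "\<And>x. isr x \<Longrightarrow> dist_of (D \<bullet> x) x C"
        using clo_ex[OF clo C(1), of x0] by blast
      have isD: "isr (D \<bullet> rat q)" for q using rfunD(1)[OF D(1)] by simp
      have "ballin Y q r \<longleftrightarrow> kq (rv r) \<le> val (D \<bullet> rat q)" for q r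
      proof
        assume b: "ballin Y q r"
        have "val (rat r) \<le> \<bar>val (rat q) - val y\<bar>" if "isr y" "memb y C" for y
          using b that C(2) unfolding ballin_def by (force simp: not_less)
        then have "val (rat r) \<le> val (D \<bullet> rat q)"
          using D(2)[OF isr_rat[of q]] isr_rat[of r]
          unfolding dist_of_val[OF C(1) isD isr_rat] by blast
        then show "kq (rv r) \<le> val (D \<bullet> rat q)" by simp
      next
        assume *: "kq (rv r) \<le> val (D \<bullet> rat q)"
        show "ballin Y q r"
          unfolding ballin_def
        proof (intro allI impI, rule ccontr)
          fix y assume y: "isr y" "\<bar>kq (rv q) - val y\<bar> < kq (rv r)" "\<not> memb y Y"
          then have "val (D \<bullet> rat q) \<le> \<bar>val (rat q) - val y\<bar>"
            using D(2)[OF isr_rat[of q]] C(2) unfolding dist_of_val[OF C(1) isD isr_rat] by blast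
          then show False using * y(2) by simp
        qed
      qed
      then show ?thesis
        by (intro opnI, simp only: ge_val_rat[OF isD])
          (unfold rat_def, intro jmp_all[OF jmp] Ir R_rules Ibrad)
    qed
  next
    case False
    note cont = rational_continuity[OF False Y]
    have isY: "isr (Y \<bullet> rat u)" for u using rfunD(1)[OF Y] by simp
    define A where "A K u \<longleftrightarrow> kq (eps K) \<le> val (Y \<bullet> rat u)" for K u
    have IA: "I2 (\<lambda>K u. of_bool (A K u) :: num)"
      unfolding A_def ge_val_rat[OF isY] unfolding rat_def by (intro jmp_all[OF jmp] Ir R_rules)
    have Amono: "A K' u" if "A K u" "K \<le> K'" for K K' u
      using that keps_mono[OF that(2)] unfolding A_def by linarith
    \<comment> \<open>Compactness by bisection: without a common bound, rational points with ever
      smaller values accumulate at some z in the open ball, where Y is positive and continuous along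
      rational points.\<close>
    have key: "\<exists>K. \<forall>u. \<bar>rv q - rv u\<bar> \<le> s \<longrightarrow> A K u" if b: "ballin Y q r" and s: "s < rv r" for q r s
    proof (rule ccontr)
      assume no: "\<not> ?thesis"
      define a w where "a = rv q - s" and "w = s + s"
      let ?B = "\<lambda>n j. \<forall>K. \<exists>u. a + w * (ofn j * eps n) \<le> rv u \<and> rv u \<le> a + w * ((ofn j + 1) * eps n) \<and>
        \<bar>rv q - rv u\<bar> \<le> s \<and> \<not> A K u"
      have IB: "I2 (\<lambda>n j. of_bool (?B n j) :: num)"
        by (intro Ir R_rules jmp_all[OF jmp] jmp_I3[OF jmp] I4_c2[OF IA])
      have B0: "?B 0 0"
      proof
        fix K
        obtain u where "\<bar>rv q - rv u\<bar> \<le> s" "\<not> A K u" using no by blast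
        then show "\<exists>u. a + w * (ofn 0 * eps 0) \<le> rv u \<and> rv u \<le> a + w * ((ofn 0 + 1) * eps 0) \<and>
            \<bar>rv q - rv u\<bar> \<le> s \<and> \<not> A K u"
          by (intro exI[of _ u]) (auto simp: a_def w_def eps_0 abs_le_iff algebra_simps)
      qed
      have st: "?B (n + 1) (j + j) \<or> ?B (n + 1) (j + j + 1)" if B: "?B n j" for n j
      proof (rule ccontr)
        assume "\<not> ?thesis"
        then obtain k1 k2 where
          1: "\<And>u. \<not> (a + w * (ofn (j + j) * eps (n + 1)) \<le> rv u \<and> rv u \<le> a + w * ((ofn (j + j) + 1) * eps (n + 1)) \<and>
            \<bar>rv q - rv u\<bar> \<le> s \<and> \<not> A k1 u)" and
          2: "\<And>u. \<not> (a + w * (ofn (j + j + 1) * eps (n + 1)) \<le> rv u \<and> rv u \<le> a + w * ((ofn (j + j + 1) + 1) * eps (n + 1)) \<and>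
            \<bar>rv q - rv u\<bar> \<le> s \<and> \<not> A k2 u)" by blast
        obtain u where u: "a + w * (ofn j * eps n) \<le> rv u" "rv u \<le> a + w * ((ofn j + 1) * eps n)"
          "\<bar>rv q - rv u\<bar> \<le> s" "\<not> A (max k1 k2) u" using B by blast
        have S: "\<not> A k1 u" "\<not> A k2 u" using Amono[of k1 u "max k1 k2"] Amono[of k2 u "max k1 k2"] u(4) by auto
        have j: "ofn (j + j) * eps (n + 1) = ofn j * eps n" "(ofn (j + j) + 1) * eps (n + 1) = ofn (j + j + 1) * eps (n + 1)"
          "(ofn (j + j + 1) + 1) * eps (n + 1) = (ofn j + 1) * eps n"
          unfolding eps_Suc[of n] ofn_simps by (simp_all add: algebra_simps)
        show False using 1[of u] 2[of u] S u(1-3) unfolding j by linarith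
      qed
      obtain z where z: "isr z"
        "\<And>n. \<exists>j. ?B n j \<and> \<bar>val z - kq (a + w * (ofn j * eps n))\<bar> \<le> kq (\<bar>w\<bar> * eps n)"
        using bisection[OF IB B0 st, of a w] by blast
      have near: "\<exists>u. \<bar>val z - kq (rv u)\<bar> \<le> 2 * kq (\<bar>w\<bar> * eps n) \<and> \<bar>rv q - rv u\<bar> \<le> s \<and> \<not> A K u" for n K
      proof -
        obtain j where j: "?B n j" "\<bar>val z - kq (a + w * (ofn j * eps n))\<bar> \<le> kq (\<bar>w\<bar> * eps n)" using z(2) by blast
        then obtain u where u: "a + w * (ofn j * eps n) \<le> rv u" "rv u \<le> a + w * ((ofn j + 1) * eps n)"
          "\<bar>rv q - rv u\<bar> \<le> s" "\<not> A K u" by blast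
        have "w * eps n \<le> \<bar>w\<bar> * eps n" by (intro mult_right_mono) (simp_all add: eps_ge0)
        then have "\<bar>(a + w * (ofn j * eps n)) - rv u\<bar> \<le> \<bar>w\<bar> * eps n"
          using u(1,2) unfolding distrib_right distrib_left mult_1 by linarith
        then have "kq \<bar>(a + w * (ofn j * eps n)) - rv u\<bar> \<le> kq (\<bar>w\<bar> * eps n)" unfolding kq_le .
        then have "\<bar>val z - kq (rv u)\<bar> \<le> 2 * kq (\<bar>w\<bar> * eps n)"
          using j(2) unfolding kq_abs kq_diff by linarith
        then show ?thesis using u(3,4) by blast
      qed
      have "\<bar>kq (rv q) - val z\<bar> \<le> kq s"
      proof (rule ccontr)
        assume "\<not> ?thesis"
        then obtain n where n: "kq (2 * \<bar>w\<bar> * eps n) < \<bar>kq (rv q) - val z\<bar> - kq s"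
          using scaled_eps[of "\<bar>kq (rv q) - val z\<bar> - kq s" "2 * \<bar>w\<bar>"] by (auto simp: not_le)
        obtain u where u: "\<bar>val z - kq (rv u)\<bar> \<le> 2 * kq (\<bar>w\<bar> * eps n)" "\<bar>rv q - rv u\<bar> \<le> s" using near by blast
        have "kq (2 * \<bar>w\<bar> * eps n) = 2 * kq (\<bar>w\<bar> * eps n)" by (simp add: mult.assoc)
        moreover have "\<bar>kq (rv q) - kq (rv u)\<bar> \<le> kq s" using u(2) unfolding kq_diff[symmetric] kq_abs[symmetric] kq_le .
        ultimately show False using n u(1) by linarith
      qed
      also have "kq s < kq (rv r)" using s by simp
      finally have "memb z Y" using b z(1) unfolding ballin_def by blast
      then have "0 < val (Y \<bullet> z)" using memb_val[OF Y z(1)] by simp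
      then obtain k where k: "4 * kq (eps k) < val (Y \<bullet> z)" using keps_arch4 by blast
      obtain m where m: "\<And>u. \<bar>val z - kq (rv u)\<bar> < kq (eps m) \<Longrightarrow> \<bar>val (Y \<bullet> rat u) - val (Y \<bullet> z)\<bar> < kq (eps k)"
        using cont[OF z(1), of k] by blast
      obtain n where n: "kq (2 * \<bar>w\<bar> * eps n) < kq (eps m)" using scaled_eps[OF keps_pos[of m]] by blast
      obtain u where u: "\<bar>val z - kq (rv u)\<bar> \<le> 2 * kq (\<bar>w\<bar> * eps n)" "\<not> A k u" using near by blast
      have "kq (2 * \<bar>w\<bar> * eps n) = 2 * kq (\<bar>w\<bar> * eps n)" by (simp add: mult.assoc)
      then have "\<bar>val z - kq (rv u)\<bar> < kq (eps m)" using n u(1) by linarith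
      from m[OF this] show False using u(2) k keps_pos[of k] unfolding A_def by linarith
    qed
    \<comment> \<open>A point of the ball has rational approximations within a slightly smaller
      radius, and continuity carries the lower bound over to the point.\<close>
    have conv: "ballin Y q r" if *: "\<And>s. rv s < rv r \<Longrightarrow> \<exists>K. \<forall>u. \<bar>rv q - rv u\<bar> \<le> rv s \<longrightarrow> A K u" for q r
      unfolding ballin_def
    proof (intro allI impI)
      fix y assume y: "isr y" "\<bar>kq (rv q) - val y\<bar> < kq (rv r)"
      then obtain d where d: "d > 0" "kq d < kq (rv r) - \<bar>kq (rv q) - val y\<bar>"
        using kq_between[of "kq (rv r) - \<bar>kq (rv q) - val y\<bar>"] by auto
      obtain e where e: "2 * eps e < d"
        using eps_arch[of "d / 2"] d(1) by (auto simp: field_simps)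
      have e': "2 * kq (eps e) < kq d" using kq_less[of "2 * eps e" d] e by simp
      obtain s where s: "rv s = rv r - eps e" using rv_surj by blast
      obtain K where K: "\<And>u. \<bar>rv q - rv u\<bar> \<le> rv s \<Longrightarrow> A K u" using *[of s] eps_pos[of e] by (auto simp: s)
      obtain m where m: "\<And>u. \<bar>val y - kq (rv u)\<bar> < kq (eps m) \<Longrightarrow> \<bar>val (Y \<bullet> rat u) - val (Y \<bullet> y)\<bar> < kq (eps K)"
        using cont[OF y(1), of K] by blast
      let ?n = "m + e + 1" let ?u = "y \<bullet> ?n"
      have ee: "kq (eps (m + e)) \<le> kq (eps m)" "kq (eps (m + e)) \<le> kq (eps e)" by (intro keps_mono; simp)+
      have yu: "\<bar>val y - kq (rv ?u)\<bar> \<le> kq (eps ?n)" by (rule approx[OF y(1)])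
      have "\<bar>val y - kq (rv ?u)\<bar> < kq (eps m)" using yu ee(1) keps_Suc[of "m + e"] keps_pos[of ?n] by linarith
      from m[OF this] have 1: "\<bar>val (Y \<bullet> rat ?u) - val (Y \<bullet> y)\<bar> < kq (eps K)" .
      have "kq \<bar>rv q - rv ?u\<bar> \<le> kq (rv s)"
        unfolding s kq_abs kq_diff using yu ee(2) d(2) e' keps_Suc[of "m + e"] keps_pos[of ?n] by linarith
      then have "A K ?u" unfolding kq_le by (rule K)
      then have "0 < val (Y \<bullet> y)" using 1 unfolding A_def by linarith
      then show "memb y Y" using memb_val[OF Y y(1)] by simp
    qed
    have "ballin Y q r \<longleftrightarrow> (\<forall>s. rv s < rv r \<longrightarrow> (\<exists>K. \<forall>u. \<bar>rv q - rv u\<bar> \<le> rv s \<longrightarrow> A K u))" for q r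
      using key conv by blast
    moreover have "I2 (\<lambda>q r. of_bool (\<forall>s. rv s < rv r \<longrightarrow> (\<exists>K. \<forall>u. \<bar>rv q - rv u\<bar> \<le> rv s \<longrightarrow> A K u)) :: num)"
    proof -
      have "I3 (\<lambda>q s K. of_bool (\<forall>u. \<bar>rv q - rv u\<bar> \<le> rv s \<longrightarrow> A K u) :: num)"
        by (intro jmp_all[OF jmp] Ir R_rules I4_c2[OF IA])
      then have I: "I2 (\<lambda>q s. of_bool (\<exists>K. \<forall>u. \<bar>rv q - rv u\<bar> \<le> rv s \<longrightarrow> A K u) :: num)"
        by (rule jmp_I2[OF jmp])
      show ?thesis by (intro jmp_all[OF jmp] Ir R_rules I3_c2[OF I])
    qed
    ultimately have "I2 (\<lambda>q r. of_bool (ballin Y q r) :: num)" by (simp only:)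
    then show ?thesis by (intro opnI) (erule I1_c2; intro Ir Ibrad)
  qed
qed

section \<open>Distance functions from enumerated balls\<close>

text \<open>Without \<open>\<exists>\<^sup>2\<close> a closed set is open as well, and a change of membership between two rationals
  could be traced by bisection to a single point.\<close>

lemma clopen_total:
  assumes jmp: jmp and ne: "\<not> e2" and C: "rfun C" and op: "openp (\<lambda>x. \<not> memb x C)"
    and x0: "isr x0" "memb x0 C" and y0: "isr y0"
  shows "memb y0 C"
proof (rule ccontr)
  assume y0C: "\<not> memb y0 C"
  \<comment> \<open>Here the failure of \<open>e2\<close> enters: positivity of
    \<open>C \<bullet> x\<close> persists at nearby rational points by continuity.\<close>
  have inner: "\<exists>m. \<forall>u. \<bar>val x - kq (rv u)\<bar> < kq (eps m) \<longrightarrow> memb (rat u) C" if x: "isr x" "memb x C" for x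
  proof -
    have "0 < val (C \<bullet> x)" using memb_val[OF C x(1)] x(2) by simp
    then obtain k where k: "kq (eps k) < val (C \<bullet> x)" using keps_arch by blast
    obtain m where m: "\<And>u. \<bar>val x - kq (rv u)\<bar> < kq (eps m) \<Longrightarrow> \<bar>val (C \<bullet> rat u) - val (C \<bullet> x)\<bar> < kq (eps k)"
      using rational_continuity[OF ne C x(1), of k] by blast
    have "memb (rat u) C" if "\<bar>val x - kq (rv u)\<bar> < kq (eps m)" for u
      using m[OF that] k memb_val[OF C isr_rat[of u]] by linarith
    then show ?thesis by blast
  qed
  have outer: "\<exists>r>0. \<forall>u. \<bar>val x - kq (rv u)\<bar> < kq r \<longrightarrow> \<not> memb (rat u) C" if x: "isr x" "\<not> memb x C" for x
  proof -
    obtain r where r: "r > 0" "\<And>y. isr y \<Longrightarrow> \<bar>val x - val y\<bar> < kq r \<Longrightarrow> \<not> memb y C"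
      using op x unfolding openp_val by blast
    then have "\<not> memb (rat u) C" if "\<bar>val x - kq (rv u)\<bar> < kq r" for u using that r(2)[of "rat u"] by simp
    then show ?thesis using r(1) by blast
  qed
  have close: "\<exists>u. \<bar>val x - kq (rv u)\<bar> < kq r" if x: "isr x" and r: "0 < r" for x r
  proof -
    obtain n where "eps n < r" using eps_arch[OF r] by blast
    then have "kq (eps n) < kq r" by (simp only: kq_less)
    then show ?thesis using approx[OF x, of n] by (meson le_less_trans)
  qed
  obtain p where p: "memb (rat p) C" using inner[OF x0] close[OF x0(1) eps_pos] by blast
  obtain p' where p': "\<not> memb (rat p') C" using outer[OF y0 y0C] close[OF y0] by blast
  define a w where "a = rv p" and "w = rv p' - rv p"
  have "R2 (\<lambda>n j. a + w * (ofn j * eps n))" by (intro R_rules Ir)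
  then obtain pt where pt: "I2 pt" "\<And>n j. rv (pt n j) = a + w * (ofn j * eps n)" unfolding R2_def by blast
  have mc: "memb (rat u) C \<longleftrightarrow> memb (rat u') C" if "rv u = rv u'" for u u'
    using memb_cong[OF C isr_rat[of u] isr_rat[of u']] that by simp
  \<comment> \<open>A grid interval with its first end in C and its second end outside. One half
    inherits this, which one depends on the midpoint.\<close>
  let ?B = "\<lambda>n j. memb (rat (pt n j)) C \<and> \<not> memb (rat (pt n (j + 1))) C"
  have IB: "I2 (\<lambda>n j. of_bool (?B n j) :: num)"
    by (intro Ir I2_c1[OF memb_rat_iff[OF jmp]] I2_c2[OF pt(1)])
  have B0: "?B 0 0"
    using p p' mc[of "pt 0 0" p] mc[of "pt 0 (0 + 1)" p'] by (simp add: pt a_def w_def eps_0)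
  have st: "?B (n + 1) (j + j) \<or> ?B (n + 1) (j + j + 1)" if "?B n j" for n j
  proof -
    have "rv (pt (n + 1) (j + j)) = rv (pt n j)" "rv (pt (n + 1) (j + j + 1 + 1)) = rv (pt n (j + 1))"
      unfolding pt eps_Suc[of n] ofn_simps by (simp_all add: algebra_simps)
    from mc[OF this(1)] mc[OF this(2)] show ?thesis using that by blast
  qed
  obtain z where z: "isr z" "\<And>n. \<exists>j. ?B n j \<and> \<bar>val z - kq (a + w * (ofn j * eps n))\<bar> \<le> kq (\<bar>w\<bar> * eps n)"
    using bisection[OF IB B0 st, of a w] by blast
  \<comment> \<open>Both ends of the intervals converge to z, whereas membership is constant at the
    rational points near z, whether z lies in C or not.\<close>
  show False
  proof (cases "memb z C")
    case True
    obtain m where m: "\<And>u. \<bar>val z - kq (rv u)\<bar> < kq (eps m) \<Longrightarrow> memb (rat u) C" using inner[OF z(1) True] by blast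
    obtain n where n: "kq (2 * \<bar>w\<bar> * eps n) < kq (eps m)" using scaled_eps[OF keps_pos[of m]] by blast
    have n2: "kq (2 * \<bar>w\<bar> * eps n) = 2 * kq (\<bar>w\<bar> * eps n)" by (simp add: mult.assoc)
    obtain j where j: "?B n j" "\<bar>val z - kq (a + w * (ofn j * eps n))\<bar> \<le> kq (\<bar>w\<bar> * eps n)" using z(2) by blast
    have "\<bar>rv (pt n (j + 1)) - (a + w * (ofn j * eps n))\<bar> = \<bar>w\<bar> * eps n"
      unfolding pt ofn_simps using eps_ge0[of n] by (simp add: algebra_simps abs_mult)
    then have "kq \<bar>rv (pt n (j + 1)) - (a + w * (ofn j * eps n))\<bar> = kq (\<bar>w\<bar> * eps n)" by (simp only:)
    then have "\<bar>val z - kq (rv (pt n (j + 1)))\<bar> < kq (eps m)"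
      using j(2) n unfolding n2 kq_abs kq_diff by linarith
    then show False using m j(1) by blast
  next
    case False
    obtain r where r: "r > 0" "\<And>u. \<bar>val z - kq (rv u)\<bar> < kq r \<Longrightarrow> \<not> memb (rat u) C" using outer[OF z(1) False] by blast
    have "0 < kq r" using r(1) kq_less[of 0 r] by simp
    then obtain n where n: "kq (\<bar>w\<bar> * eps n) < kq r" using scaled_eps by blast
    obtain j where j: "?B n j" "\<bar>val z - kq (a + w * (ofn j * eps n))\<bar> \<le> kq (\<bar>w\<bar> * eps n)" using z(2) by blast
    then have "\<bar>val z - kq (rv (pt n j))\<bar> < kq r" unfolding pt using n by linarith
    then show False using r(2) j(1) by blast
  qed
qed

text \<open>With \<open>e2\<close>, the enumerated balls inside the complement tell which positive
  rationals bound the distance from below. Without it, a nonempty closed set contains every real by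
  \<open>clopen_total\<close>, and its distance function is 0.\<close>

theorem jmp_opn_clo: "jmp \<Longrightarrow> opn \<Longrightarrow> clo"
  unfolding clo_def
proof (intro allI impI, elim conjE exE)
  fix C x0 assume jmp: jmp and opn: opn and C: "rfun C" and op: "openp (\<lambda>x. \<not> memb x C)" and x0: "isr x0" "memb x0 C"
  show "\<exists>D. rfun D \<and> contf D \<and> (\<forall>x. isr x \<longrightarrow> dist_of (D \<bullet> x) x C)"
  proof (cases e2)
    case True
    obtain Y where Y: "rfun Y" "\<And>x. isr x \<Longrightarrow> memb x Y \<longleftrightarrow> \<not> memb x C" using e2_complement[OF True C] by blast
    have "openp (\<lambda>x. memb x Y)" using op openp_cong[of "\<lambda>x. \<not> memb x C" "\<lambda>x. memb x Y"] Y(2) by blast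
    then obtain X :: t1 where X: "\<And>n. X \<bullet> n = 1 \<longleftrightarrow> ballin Y (pi1 n) (brad n)"
      using opn Y(1) unfolding opn_iff by blast
    \<comment> \<open>Search for the index of the ball described by m. Radii are compared by value,
      since the enumeration uses codes of a special form; if the radius is not positive, any index
      will do.\<close>
    let ?P = "\<lambda>m n. 0 < rv (pi2 m) \<longrightarrow> pi1 n = pi1 m \<and> rv (brad n) = rv (pi2 m)"
    have IP: "I2 (\<lambda>m n. of_bool (?P m n) :: num)" by (intro Ir R_rules Ibrad)
    have "\<exists>n. ?P m n" for m
    proof (cases "0 < rv (pi2 m)")
      case True
      let ?w = "pi2 m"
      have "pi1 (pi2 ?w) < pi1 ?w" using True ofn_ge0[of "pi2 (pi2 ?w)"] unfolding rv_def
        by (auto simp: zero_less_divide_iff simp del: tv_code)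
      then have "pi1 ?w = pi1 (pi2 ?w) + (pi1 ?w - pi1 (pi2 ?w))" "pi1 ?w - pi1 (pi2 ?w) \<noteq> 0"
        by (simp_all add: le_add_diff_inverse num_le_diff0)
      then obtain k where k: "pi1 ?w = pi1 (pi2 ?w) + (k + 1)" using num_cases[of "pi1 ?w - pi1 (pi2 ?w)"] by metis
      have "rv (qcode (k + 1) 0 (pi2 (pi2 ?w))) = rv ?w"
        unfolding rv_qcode unfolding rv_def k by simp
      then show ?thesis by (intro exI[of _ "pair (pi1 m) (pair k (pi2 (pi2 ?w)))"]) (simp add: pi_pair)
    qed simp
    then obtain g where g: "I1 g" "\<And>m. ?P m (g m)" using choice00[OF IP] by blast
    \<comment> \<open>A number that is not positive is always a lower bound, so the balls are
      consulted for positive radii only.\<close>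
    let ?L = "\<lambda>q w. rv w \<le> 0 \<or> X \<bullet> g (pair q w) = 1"
    show ?thesis
    proof (rule rat_dist[OF C x0, of ?L])
      show "I2 (\<lambda>q w. of_bool (?L q w) :: num)" by (intro Ir R_rules I2_c1[OF g(1)])
      fix q w
      show "?L q w \<longleftrightarrow> (\<forall>y. isr y \<longrightarrow> memb y C \<longrightarrow> kq (rv w) \<le> \<bar>kq (rv q) - val y\<bar>)"
      proof (cases "0 < rv w")
        case True
        then have "pi1 (g (pair q w)) = q" "rv (brad (g (pair q w))) = rv w"
          using g(2)[of "pair q w"] by (simp_all add: pi_pair)
        then have "?L q w \<longleftrightarrow> (\<forall>y. isr y \<longrightarrow> \<bar>kq (rv q) - val y\<bar> < kq (rv w) \<longrightarrow> memb y Y)"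
          using True unfolding X ballin_def by simp
        also have "\<dots> \<longleftrightarrow> (\<forall>y. isr y \<longrightarrow> memb y C \<longrightarrow> kq (rv w) \<le> \<bar>kq (rv q) - val y\<bar>)"
          using Y(2) by (meson not_less)
        finally show ?thesis .
      next
        case False
        then have "kq (rv w) \<le> 0" using kq_le[of "rv w" 0] by (simp add: not_less)
        then show ?thesis using False by (auto simp: not_less intro: order_trans)
      qed
    qed
  next
    case False
    let ?L = "\<lambda>(q::num) w. rv w \<le> 0"
    show ?thesis
    proof (rule rat_dist[OF C x0, of ?L])
      show "I2 (\<lambda>q w. of_bool (?L q w) :: num)" by (intro Ir R_rules)
      fix q w
      have m: "memb (rat q) C" by (rule clopen_total[OF jmp False C op x0]) simp
      have "rv w \<le> 0 \<longleftrightarrow> kq (rv w) \<le> 0" using kq_le[of "rv w" 0] by simp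
      also have "\<dots> \<longleftrightarrow> (\<forall>y. isr y \<longrightarrow> memb y C \<longrightarrow> kq (rv w) \<le> \<bar>kq (rv q) - val y\<bar>)"
        using m by (auto intro: order_trans dest: spec[of _ "rat q"])
      finally show "?L q w \<longleftrightarrow> (\<forall>y. isr y \<longrightarrow> memb y C \<longrightarrow> kq (rv w) \<le> \<bar>kq (rv q) - val y\<bar>)" .
    qed
  qed
qed

end

section \<open>Arithmetical comprehension\<close>

text \<open>The subterms of an arithmetical formula may have any type, so that here, unlike in \<open>I1\<close>, types
  must be arguments of the definition.\<close>

definition internal :: "ty \<Rightarrow> (num \<Rightarrow> tm) \<Rightarrow> bool" where
  "internal \<tau> F \<longleftrightarrow> (\<exists>f \<in> carr M0 (Nt \<rightarrow> \<tau>). \<forall>s. ap M0 f (rp s) = F s)"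

lemma ap_M0: "f \<in> carr M0 (\<sigma> \<rightarrow> \<tau>) \<Longrightarrow> a \<in> carr M0 \<sigma> \<Longrightarrow> ap M0 f a \<in> carr M0 \<tau>"
  using normal_M0 unfolding normal_def by blast

lemma ct_M0: "type_of t = Some \<tau> \<Longrightarrow> fvt t = {} \<Longrightarrow> (\<And>r s. t \<noteq> r \<cdot> s) \<Longrightarrow> ct M0 t \<in> carr M0 \<tau>"
  using normal_M0 unfolding normal_def by blast

lemma internal_Nt: "internal Nt F \<longleftrightarrow> (\<exists>h :: num \<Rightarrow> num. I1 h \<and> (\<forall>s. F s = rp (h s)))"
proof
  assume "internal Nt F"
  then obtain f where f: "f \<in> carr M0 T1" "\<And>s. ap M0 f (rp s) = F s" unfolding internal_def by blast
  have "rp (ab f :: t1) = f" using f(1) by (simp add: rp_ab)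
  then have "F s = rp ((ab f :: t1) \<bullet> s)" for s using f(2)[of s] ap_rp[of "ab f :: t1" s] by simp
  then show "\<exists>h :: num \<Rightarrow> num. I1 h \<and> (\<forall>s. F s = rp (h s))"
    unfolding I1_def by (intro exI[of _ "\<lambda>s. (ab f :: t1) \<bullet> s"]) blast
next
  assume "\<exists>h :: num \<Rightarrow> num. I1 h \<and> (\<forall>s. F s = rp (h s))"
  then obtain g :: t1 where g: "\<And>s. F s = rp (g \<bullet> s)" unfolding I1_def by metis
  then show "internal Nt F"
    unfolding internal_def using rp_mem[of g] by (intro bexI[of _ "rp g"]) simp_all
qed

context counterexample
begin

lemma K_M0: "x \<in> carr M0 \<sigma> \<Longrightarrow> y \<in> carr M0 \<tau> \<Longrightarrow> ap M0 (ap M0 (ct M0 (Kc \<sigma> \<tau>)) x) y = x"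
proof -
  assume x: "x \<in> carr M0 \<sigma>" and y: "y \<in> carr M0 \<tau>"
  have "wff (K_axiom \<sigma> \<tau> 0)" by (simp add: K_axiom_def wff_eq_at)
  moreover have "K_axiom \<sigma> \<tau> 0 \<in> RCA0\<omega>" unfolding RCA0\<omega>_def by blast
  ultimately have "sat M0 e0 (K_axiom \<sigma> \<tau> 0)" by (intro model_M0[OF refuted]) simp_all
  then have "sim M0 \<sigma> (ap M0 (ap M0 (ct M0 (Kc \<sigma> \<tau>)) x) y) x" using x y by (simp add: K_axiom_def)
  moreover have "ap M0 (ap M0 (ct M0 (Kc \<sigma> \<tau>)) x) y \<in> carr M0 \<sigma>"
    by (rule ap_M0[OF ap_M0[OF ct_M0 x] y]) simp_all
  ultimately show ?thesis using x by (simp add: sim_rp)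
qed

lemma S_M0: "f \<in> carr M0 (\<rho> \<rightarrow> \<sigma> \<rightarrow> \<tau>) \<Longrightarrow> g \<in> carr M0 (\<rho> \<rightarrow> \<sigma>) \<Longrightarrow> z \<in> carr M0 \<rho> \<Longrightarrow>
    ap M0 (ap M0 (ap M0 (ct M0 (Sc \<rho> \<sigma> \<tau>)) f) g) z = ap M0 (ap M0 f z) (ap M0 g z)"
proof -
  assume f: "f \<in> carr M0 (\<rho> \<rightarrow> \<sigma> \<rightarrow> \<tau>)" and g: "g \<in> carr M0 (\<rho> \<rightarrow> \<sigma>)" and z: "z \<in> carr M0 \<rho>"
  have "wff (S_axiom \<rho> \<sigma> \<tau> 0)" by (simp add: S_axiom_def wff_eq_at)
  moreover have "S_axiom \<rho> \<sigma> \<tau> 0 \<in> RCA0\<omega>" unfolding RCA0\<omega>_def by blast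
  ultimately have "sat M0 e0 (S_axiom \<rho> \<sigma> \<tau> 0)" by (intro model_M0[OF refuted]) simp_all
  then have "sim M0 \<tau> (ap M0 (ap M0 (ap M0 (ct M0 (Sc \<rho> \<sigma> \<tau>)) f) g) z) (ap M0 (ap M0 f z) (ap M0 g z))"
    using f g z by (simp add: S_axiom_def)
  moreover have "ap M0 (ap M0 (ap M0 (ct M0 (Sc \<rho> \<sigma> \<tau>)) f) g) z \<in> carr M0 \<tau>"
    by (rule ap_M0[OF ap_M0[OF ap_M0[OF ct_M0 f] g] z]) simp_all
  moreover have "ap M0 (ap M0 f z) (ap M0 g z) \<in> carr M0 \<tau>"
    by (rule ap_M0[OF ap_M0[OF f z] ap_M0[OF g z]])
  ultimately show ?thesis by (simp add: sim_rp)
qed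

lemma rp_num_carr: "rp (s :: num) \<in> carr M0 Nt" using rp_mem[of s] by simp

lemma internal_const: "c \<in> carr M0 \<tau> \<Longrightarrow> internal \<tau> (\<lambda>s. c)"
  unfolding internal_def
  by (rule bexI[of _ "ap M0 (ct M0 (Kc \<tau> Nt)) c"]) (simp add: K_M0 rp_num_carr, rule ap_M0[OF ct_M0], simp_all)

lemma internal_ap: "internal (\<sigma> \<rightarrow> \<tau>) F \<Longrightarrow> internal \<sigma> G \<Longrightarrow> internal \<tau> (\<lambda>s. ap M0 (F s) (G s))"
proof -
  assume "internal (\<sigma> \<rightarrow> \<tau>) F" "internal \<sigma> G"
  then obtain f g where f: "f \<in> carr M0 (Nt \<rightarrow> \<sigma> \<rightarrow> \<tau>)" "\<And>s. ap M0 f (rp s) = F s"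
    and g: "g \<in> carr M0 (Nt \<rightarrow> \<sigma>)" "\<And>s. ap M0 g (rp s) = G s"
    unfolding internal_def by blast
  show ?thesis
    unfolding internal_def
  proof (rule bexI[of _ "ap M0 (ap M0 (ct M0 (Sc Nt \<sigma> \<tau>)) f) g"])
    show "\<forall>s. ap M0 (ap M0 (ap M0 (ct M0 (Sc Nt \<sigma> \<tau>)) f) g) (rp s) = ap M0 (F s) (G s)"
      by (simp add: S_M0[OF f(1) g(1) rp_num_carr] f(2) g(2))
    show "ap M0 (ap M0 (ct M0 (Sc Nt \<sigma> \<tau>)) f) g \<in> carr M0 (Nt \<rightarrow> \<tau>)"
      by (rule ap_M0[OF ap_M0[OF ct_M0 f(1)] g(1)]) simp_all
  qed
qed

lemma internal_comp:
  assumes "internal \<tau> F" "I1 (h :: num \<Rightarrow> num)" shows "internal \<tau> (\<lambda>s. F (h s))"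
proof -
  obtain f where f: "f \<in> carr M0 (Nt \<rightarrow> \<tau>)" "\<And>s. ap M0 f (rp s) = F s"
    using assms(1) unfolding internal_def by blast
  have "internal Nt (\<lambda>s. rp (h s))" using assms(2) internal_Nt by blast
  from internal_ap[OF internal_const[OF f(1)] this] show ?thesis by (simp add: f(2))
qed

lemma internal_eval:
  "type_of t = Some \<tau> \<Longrightarrow> (\<And>x. x \<in> fvt t \<Longrightarrow> internal (snd x) (\<lambda>s. E s x)) \<Longrightarrow>
    internal \<tau> (\<lambda>s. eval M0 (E s) t)"
proof (induction t arbitrary: \<tau>)
  case (Var i \<sigma>)
  then show ?case using Var.prems(2)[of "(i, \<sigma>)"] by simp
next
  case (App r t)
  from App.prems(1) obtain \<sigma> where t: "type_of r = Some (\<sigma> \<rightarrow> \<tau>)" "type_of t = Some \<sigma>"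
    unfolding type_of_App by blast
  show ?case unfolding eval.simps
    by (rule internal_ap[OF App.IH(1)[OF t(1)] App.IH(2)[OF t(2)]]) (simp_all add: App.prems(2))
qed (simp_all del: rp_consts, (rule internal_const[OF ct_M0]; simp)+)

text \<open>A number quantifier is treated by packing the parameter and the quantified number into
  one number, applying the induction hypothesis and closing under \<open>jmp\<close>. Atomic
  formulas are covered by combinatory completeness at all types.\<close>

lemma internal_sat:
  assumes jmp
  shows "wff A \<Longrightarrow> number_quantifiers A \<Longrightarrow> (\<And>x. x \<in> fv A \<Longrightarrow> internal (snd x) (\<lambda>s. E s x)) \<Longrightarrow>
    I1 (\<lambda>s. of_bool (sat M0 (E s) A) :: num)"
proof (induction A arbitrary: E)
  case (Eq r t)
  obtain f g :: "num \<Rightarrow> num" where "I1 f" "\<And>s. eval M0 (E s) r = rp (f s)" "I1 g" "\<And>s. eval M0 (E s) t = rp (g s)"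
    using internal_eval[of r Nt E] internal_eval[of t Nt E] Eq.prems unfolding internal_Nt by auto
  then show ?case by (simp, intro I_rules)
next
  case (Less r t)
  obtain f g :: "num \<Rightarrow> num" where "I1 f" "\<And>s. eval M0 (E s) r = rp (f s)" "I1 g" "\<And>s. eval M0 (E s) t = rp (g s)"
    using internal_eval[of r Nt E] internal_eval[of t Nt E] Less.prems unfolding internal_Nt by auto
  then show ?case by (simp add: rp_arith, intro I_rules)
next
  case Fls
  show ?case by (simp add: I1_const)
next
  case (Imp A B)
  have "I1 (\<lambda>s. of_bool (sat M0 (E s) A) :: num)" "I1 (\<lambda>s. of_bool (sat M0 (E s) B) :: num)"
    by (rule Imp.IH; use Imp.prems in simp)+
  then show ?case unfolding sat.simps by (intro I_rules)
next
  case (FAll x A)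
  let ?E = "\<lambda>s. (E (pi1 s))(x := rp (pi2 s))"
  have x: "snd x = Nt" using FAll.prems(2) by simp
  have "I1 (\<lambda>s. of_bool (sat M0 (?E s) A) :: num)"
  proof (rule FAll.IH)
    show "wff A" "number_quantifiers A" using FAll.prems by simp_all
    fix y assume y: "y \<in> fv A"
    show "internal (snd y) (\<lambda>s. ?E s y)"
    proof (cases "y = x")
      case True
      then show ?thesis using I1_pi2 by (auto simp: x internal_Nt)
    next
      case False
      then have "internal (snd y) (\<lambda>s. E s y)" using FAll.prems(3) y by simp
      from internal_comp[OF this I1_pi1] show ?thesis using False by simp
    qed
  qed
  from I2_c1[OF this I2_pair]
  have "I2 (\<lambda>s (a::num). of_bool (sat M0 ((E s)(x := rp a)) A) :: num)" by (simp add: pi_pair)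
  from jmp_all(1)[OF assms this] show ?case by (simp add: x)
qed

lemma jmp_comprehension:
  assumes jmp "wff A" "arithmetical A" "(k, T1) \<notin> fv A" "penv M0 e"
  shows "sat M0 e (comprehension_axiom i k A)"
proof -
  have "I1 (\<lambda>s::num. of_bool (sat M0 (e((i, Nt) := rp s)) A) :: num)"
  proof (rule internal_sat[OF assms(1,2)])
    show "number_quantifiers A" using assms(3) by (simp add: arithmetical_def)
    fix x assume "x \<in> fv A"
    show "internal (snd x) (\<lambda>s. (e((i, Nt) := rp s)) x)"
    proof (cases "x = (i, Nt)")
      case True
      then show ?thesis using I1_var by (auto simp: internal_Nt)
    next
      case False
      then show ?thesis using penvD[OF assms(5), of "fst x" "snd x"] by (simp add: internal_const)
    qed
  qed
  then obtain X :: t1 where X: "\<And>s. X \<bullet> s = of_bool (sat M0 (e((i, Nt) := rp s)) A)" unfolding I1_def by blast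
  have "sat M0 (e((k, T1) := rp X, (i, Nt) := rp s)) A \<longleftrightarrow> X \<bullet> s = 1" for s :: num
  proof -
    have "sat M0 (e((k, T1) := rp X, (i, Nt) := rp s)) A \<longleftrightarrow> sat M0 (e((i, Nt) := rp s)) A"
      using assms(4) by (intro sat_cong) auto
    then show ?thesis by (simp add: X)
  qed
  moreover have "X \<bullet> s \<le> 1" for s by (simp add: X)
  ultimately show ?thesis
    unfolding comprehension_axiom_def by (simp add: rp_arith sat_le) (rule exI[of _ X], simp)
qed

text \<open>The predicate is handed to the comprehension formula as a function of coded pairs, so
  that its only parameter has type 1.\<close>

lemma ACA_jmp:
  assumes "model M0 ACA" shows jmp
  unfolding jmp_def
proof (intro allI impI)
  fix P :: "num \<Rightarrow> num \<Rightarrow> bool" assume "I2 (\<lambda>s a. of_bool (P s a) :: num)"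
  from I1_c2[OF this I1_pi1 I1_pi2]
  obtain f :: t1 where f: "\<And>u. f \<bullet> u = of_bool (P (pi1 u) (pi2 u))" unfolding I1_def by blast
  \<comment> \<open>Index 0 serves for the number and for the function, which are different
    variables because their types differ. Starting at depth 1 keeps the quantified variables apart
    from both.\<close>
  define A where "A = (Exists Nt (\<lambda>a. Exists Nt (\<lambda>p. pair_code p (Var 0 Nt) a \<^bold>\<and> Var 0 T1 \<cdot> p \<^bold>= One))) 1"
  have fvA: "fv A = {(0, Nt), (0, T1)}" "wff A" "number_quantifiers A"
    by (auto simp: A_def Exists_def FEx_def Neg_def s_conj_def Conj_def pair_code_def s_eq_def)
  have "arithmetical A" "(1, T1) \<notin> fv A" by (simp_all add: arithmetical_def fvA)
  then have "comprehension_axiom 0 1 A \<in> ACA"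
    unfolding ACA_def using fvA(2) by blast
  moreover have "wff (comprehension_axiom 0 1 A)"
    using fvA by (simp add: comprehension_axiom_def FEx_def Neg_def Conj_def Iff_def s_le_def)
  ultimately have "sat M0 (e0((0, T1) := rp f)) (comprehension_axiom 0 1 A)"
    using assms by (simp add: model_def)
  then have "\<exists>X::t1. \<forall>n. X \<bullet> n \<le> 1 \<and>
      (X \<bullet> n = 1 \<longleftrightarrow> sat M0 (e0((0, T1) := rp f, (1, T1) := rp X, (0, Nt) := rp n)) A)"
    by (simp add: comprehension_axiom_def rp_arith sat_le)
  then obtain X :: t1 where X: "\<And>n. X \<bullet> n \<le> 1"
    "\<And>n. X \<bullet> n = 1 \<longleftrightarrow> sat M0 (e0((0, T1) := rp f, (1, T1) := rp X, (0, Nt) := rp n)) A"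
    by blast
  have sA: "sat M0 (e0((0, T1) := rp f, (1, T1) := rp X, (0, Nt) := rp n)) A \<longleftrightarrow> (\<exists>a. P n a)" for n
    by (simp add: A_def sat_pair_code rp_arith f pi_pair)
  have "X \<bullet> n = of_bool (\<exists>a. P n a)" for n
    using X(1)[of n] X(2)[of n] less_one_num[of "X \<bullet> n"] unfolding sA
    by (auto simp: order_le_less)
  then show "I1 (\<lambda>s. of_bool (\<exists>a. P s a) :: num)" unfolding I1_def by blast
qed

end

section \<open>The theorem\<close>

lemma not_refuted: "\<not> refuted"
proof
  assume refuted: refuted
  then interpret counterexample by unfold_locales
  from countermodel_M0[OF refuted] obtain e where e: "penv M0 e"
    and "sat M0 e E3 \<and> \<not> sat M0 e CLO \<or> sat M0 e CLO \<and> \<not> sat M0 e HBC \<or>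
     (\<exists>A \<in> ACA \<union> {OPEN}. wff A \<and> sat M0 e CLO \<and> \<not> sat M0 e A) \<or>
     model M0 ACA \<and> sat M0 e OPEN \<and> \<not> sat M0 e CLO"
    unfolding countermodel_def by blast
  then consider "e3" "\<not> clo" | "clo" "\<not> hbc" | "clo" "\<not> opn"
    | A where "clo" "A \<in> ACA" "\<not> sat M0 e A" | "model M0 ACA" "opn" "\<not> clo"
    unfolding sat_E3 sat_CLO sat_HBC
    using sat_OPEN[of e] by blast
  then show False
  proof cases
    case 4
    then obtain i k B where "A = comprehension_axiom i k B" "wff B" "arithmetical B" "(k, T1) \<notin> fv B"
      unfolding ACA_def by blast
    then show False using jmp_comprehension[OF clo_jmp[OF 4(1)] _ _ _ e] 4(3) by blast
  qed (use e3_clo clo_hbc clo_opn jmp_opn_clo[OF ACA_jmp] in blast)+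
qed

section \<open>Well-formedness of the sentences\<close>

lemma wff_with_rat:
  "type_of q = Some Nt \<Longrightarrow> wff (with_rat q F n) =
    wff (F (Var n Nt, Var (Suc n) Nt, Var (Suc (Suc n)) Nt \<oplus> One) (Suc (Suc (Suc n))))"
  by (simp add: with_rat_def rat_code_def pair_code_def)

lemma wff_q_rels:
  assumes "type_of p = Some Nt" "type_of n = Some Nt" "type_of d = Some Nt"
    "type_of p' = Some Nt" "type_of n' = Some Nt" "type_of d' = Some Nt"
  shows "wff (q_less (p, n, d) (p', n', d') k)" "wff (q_le (p, n, d) (p', n', d') k)"
    "wff (q_eq (p, n, d) (p', n', d') k)" "wff (q_abs_less (p, n, d) (p', n', d') k)"
    "wff (q_abs_le (p, n, d) (p', n', d') k)" "wff (q_is_abs (p, n, d) (p', n', d') k)"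
  using assms by (simp_all add: q_le_def q_eq_def q_abs_less_def q_abs_le_def q_is_abs_def q_zero_def)

lemma wff_reals [simp]:
  "type_of x = Some T1 \<Longrightarrow> wff (is_real x n)"
  "type_of x = Some T1 \<Longrightarrow> type_of y = Some T1 \<Longrightarrow> wff (r_eq x y n)"
  "type_of x = Some T1 \<Longrightarrow> type_of y = Some T1 \<Longrightarrow> wff (r_le x y n)"
  "type_of x = Some T1 \<Longrightarrow> type_of y = Some T1 \<Longrightarrow> type_of z = Some T1 \<Longrightarrow> wff (r_is_dist z x y n)"
  "type_of r = Some Nt \<Longrightarrow> wff (pos_rat r n)"
  by (simp_all add: is_real_def r_eq_def r_le_def r_is_dist_def pos_rat_def wff_with_rat wff_q_rels
      q_diff_def q_eps_def q_eps2_def two_pow_def q_zero_def)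

lemma wff_real_preds [simp]:
  "wff (ForallR F n) = wff (F (Var n T1) (Suc n))" "wff (ExistsR F n) = wff (F (Var n T1) (Suc n))"
  "type_of x = Some T1 \<Longrightarrow> type_of y = Some T1 \<Longrightarrow> wff (r_less x y n)"
  "type_of q = Some Nt \<Longrightarrow> type_of (r_of_rat q) = Some T1"
  by (simp_all add: ForallR_def ExistsR_def r_less_def r_of_rat_def)

lemma wff_sentences: "wff E3" "wff CLO" "wff OPEN" "wff HBC"
  by (simp_all add: E3_def CLO_def OPEN_def HBC_def s_le_def closed_set_def open_set_def open_pred_def
      real_function_def continuous_function_def mem_def is_distance_def with_dist_def in_ball_def
      ball_enum_def pair_code_def rat_code_def)

lemma wff_ACA: "A \<in> ACA \<Longrightarrow> wff A"
  by (auto simp: ACA_def comprehension_axiom_def FEx_def Neg_def Conj_def Iff_def s_le_def)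

theorem theorem4p12:
  shows "(RCA0\<omega> \<turnstile> Imp E3 CLO \<and> RCA0\<omega> \<turnstile> Imp CLO HBC) \<and>
    ((\<forall>A \<in> ACA \<union> {OPEN}. RCA0\<omega> \<turnstile> Imp CLO A) \<and> RCA0\<omega> \<union> ACA \<turnstile> Imp OPEN CLO)"
proof -
  have no: "\<not> countermodel M" for M using not_refuted by (auto simp: refuted_def)
  have eq: "equality_axioms \<subseteq> RCA0\<omega>" by (auto simp: RCA0\<omega>_def)
  have ext: "extensionality_axiom \<rho> \<tau> 0 \<in> RCA0\<omega>" for \<rho> \<tau> unfolding RCA0\<omega>_def by blast
  have pr: "RCA0\<omega> \<turnstile> Imp A B"
    if "wff A" "wff B" "\<And>M e. normal M \<Longrightarrow> model M RCA0\<omega> \<Longrightarrow> penv M e \<Longrightarrow> sat M e A \<Longrightarrow> sat M e B" for A B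
    by (rule completeness[OF eq ext]) (use that in simp_all)
  have 1: "RCA0\<omega> \<turnstile> Imp E3 CLO" "RCA0\<omega> \<turnstile> Imp CLO HBC"
    by (rule pr; use no wff_sentences in \<open>unfold countermodel_def, blast\<close>)+
  have 2: "RCA0\<omega> \<turnstile> Imp CLO A" if A: "A \<in> ACA \<union> {OPEN}" for A
  proof (rule pr)
    show w: "wff A" "wff CLO" using A wff_ACA wff_sentences by auto
    fix M e assume "normal M" "model M RCA0\<omega>" "penv M e" "sat M e CLO"
    then show "sat M e A" using no[of M] w A unfolding countermodel_def by blast
  qed
  \<comment> \<open>Comprehension is a schema and cannot be a premise of a single implication, so
    completeness is applied to the enlarged theory.\<close>
  have 3: "RCA0\<omega> \<union> ACA \<turnstile> Imp OPEN CLO"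
  proof (rule completeness)
    show "equality_axioms \<subseteq> RCA0\<omega> \<union> ACA" using eq by blast
    show "extensionality_axiom \<rho> \<tau> 0 \<in> RCA0\<omega> \<union> ACA" for \<rho> \<tau> using ext by blast
    show "wff (Imp OPEN CLO)" using wff_sentences by simp
    fix M e assume M: "normal M" "model M (RCA0\<omega> \<union> ACA)" "penv M e"
    then have "model M RCA0\<omega>" "model M ACA" by (auto simp: model_def)
    then have "\<not> (sat M e OPEN \<and> \<not> sat M e CLO)" using no[of M] M(1,3) unfolding countermodel_def by blast
    then show "sat M e (Imp OPEN CLO)" by simp
  qed
  show ?thesis using 1 2 3 by blast
qed

end
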